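(* The cut problem for Recursive Petri Nets is EXPSPACE-complete: given a marked RPN $(\mathcal N,s_0)$, deciding whether there exists a finite firing sequence $s_0\xrightarrow{\sigma}\emptyset$ is EXPSPACE-complete (with respect to the size of the encoding of $(\mathcal N,s_0)$).
   Context: A Recursive Petri Net (RPN) is a tuple $\mathcal N=\langle P,T,W^+,W^-,\Omega\rangle$ where $P$ is a finite set of places, $T=T_{el}\uplus T_{ab}\uplus T_{\tau}$ is a finite set of transitions disjoint from $P$ (elementary, abstract and cut transitions), $W^-\in\mathbb N^{P\times T}$, $W^+\in\mathbb N^{P\times(T_{el}\uplus T_{ab})}$, and $\Omega:T_{ab}\to\mathbb N^P$. Write $W^{\pm}(t)\in\mathbb N^P$ for the column of $t$; markings are compared componentwise. A (concrete) state is either the empty tree $\emptyset$ or a finite rooted tree whose vertices (threads) are taken from a fixed countably infinite set $\mathcal V$, each vertex $v$ labelled by a marking $M_s(v)\in\mathbb N^P$ and each edge labelled by a vector in $\{W^+(t):t\in T_{ab}\}$. Firing rule: a thread $v$ of a state $s\neq\emptyset$ can fire $t$ if $W^-(t)\le M_s(v)$, giving $s\xrightarrow{(v,t)}s'$ where: if $t\in T_{el}$, the marking of $v$ becomes $M_s(v)-W^-(t)+W^+(t)$; if $t\in T_{ab}$, the marking of $v$ becomes $M_s(v)-W^-(t)$ and a new child $w$ of $v$ (a vertex never used before) is created with marking $\Omega(t)$ and edge $v\to w$ labelled $W^+(t)$; if $t\in T_\tau$, the subtree rooted at $v$ is deleted, and if $v$ is the root the result is $\emptyset$, otherwise the marking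 of the parent $u$ of $v$ is increased by the label of the edge $u\to v$. A marked RPN $(\mathcal N,s_0)$ is an RPN with an initial state. *)

theory Defs
  imports Main
begin

section \<open>Recursive Petri nets\<close>

text \<open>
  Places and transitions share the type of nodes, so that their disjointness is an explicit
  condition. The vectors attached to a transition \<open>t\<close> are the columns \<open>W\<^sup>-(t)\<close> and \<open>W\<^sup>+(t)\<close>;
  \<open>Wplus\<close> is meaningful only on elementary and abstract transitions, \<open>Omega\<close> only on
  abstract ones.
\<close>

record 'a rpn =
  places :: "'a set"
  elem_trans :: "'a set"
  abs_trans :: "'a set"
  cut_trans :: "'a set"
  Wminus :: "'a \<Rightarrow> 'a \<Rightarrow> nat"
  Wplus :: "'a \<Rightarrow> 'a \<Rightarrow> nat"
  Omega :: "'a \<Rightarrow> 'a \<Rightarrow> nat"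

definition transitions :: "'a rpn \<Rightarrow> 'a set" where
  "transitions N = elem_trans N \<union> abs_trans N \<union> cut_trans N"

text \<open>\<open>\<nat>\<^sup>P\<close>, as functions vanishing outside \<open>P\<close>; the componentwise order is then \<open>\<le>\<close> on functions.\<close>

definition vectors :: "'a set \<Rightarrow> ('a \<Rightarrow> nat) set" where
  "vectors P = {m. \<forall>p. p \<notin> P \<longrightarrow> m p = 0}"

definition is_rpn :: "'a rpn \<Rightarrow> bool" where
  "is_rpn N \<longleftrightarrow>
     finite (places N) \<and> finite (transitions N) \<and>
     places N \<inter> transitions N = {} \<and>
     elem_trans N \<inter> abs_trans N = {} \<and>
     elem_trans N \<inter> cut_trans N = {} \<and>
     abs_trans N \<inter> cut_trans N = {} \<and>
     (\<forall>t\<in>transitions N. Wminus N t \<in> vectors (places N)) \<and>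
     (\<forall>t\<in>elem_trans N \<union> abs_trans N. Wplus N t \<in> vectors (places N)) \<and>
     (\<forall>t\<in>abs_trans N. Omega N t \<in> vectors (places N))"

text \<open>
  A state is a tree whose vertices are the domain of \<open>mark\<close> and whose (parent, child) edges
  are the domain of \<open>label\<close>.
\<close>

record ('a, 'v) state =
  mark :: "'v \<Rightarrow> ('a \<Rightarrow> nat) option"
  label :: "'v \<times> 'v \<Rightarrow> ('a \<Rightarrow> nat) option"

definition verts :: "('a, 'v) state \<Rightarrow> 'v set" where
  "verts s = dom (mark s)"

definition edges :: "('a, 'v) state \<Rightarrow> ('v \<times> 'v) set" where
  "edges s = dom (label s)"

definition empty_state :: "('a, 'v) state" where
  "empty_state = \<lparr>mark = Map.empty, label = Map.empty\<rparr>"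

definition rooted_tree :: "'v set \<Rightarrow> ('v \<times> 'v) set \<Rightarrow> 'v \<Rightarrow> bool" where
  "rooted_tree V E r \<longleftrightarrow>
     r \<in> V \<and> E \<subseteq> V \<times> V \<and>
     (\<forall>u. (u, r) \<notin> E) \<and>
     (\<forall>v\<in>V - {r}. \<exists>!u. (u, v) \<in> E) \<and>
     (\<forall>v\<in>V. (r, v) \<in> E\<^sup>*)"

definition is_state :: "'a rpn \<Rightarrow> ('a, 'v) state \<Rightarrow> bool" where
  "is_state N s \<longleftrightarrow>
     s = empty_state \<or>
     finite (verts s) \<and> (\<exists>r. rooted_tree (verts s) (edges s) r) \<and>
     ran (mark s) \<subseteq> vectors (places N) \<and>
     ran (label s) \<subseteq> Wplus N ` abs_trans N"

definition is_root :: "('a, 'v) state \<Rightarrow> 'v \<Rightarrow> bool" where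
  "is_root s v \<longleftrightarrow> v \<in> verts s \<and> (\<forall>u. (u, v) \<notin> edges s)"

definition subtree :: "('a, 'v) state \<Rightarrow> 'v \<Rightarrow> 'v set" where
  "subtree s v = {x. (v, x) \<in> (edges s)\<^sup>*}"

text \<open>\<open>U\<close> is the set of all vertices used so far, from which a new thread must be distinct.\<close>

inductive fire :: "'a rpn \<Rightarrow> 'v set \<Rightarrow> ('a, 'v) state \<Rightarrow> 'v \<times> 'a \<Rightarrow> ('a, 'v) state \<Rightarrow> bool"
  for N U s where
  elementary:
    "\<lbrakk>t \<in> elem_trans N; mark s v = Some m; Wminus N t \<le> m;
      s' = s\<lparr>mark := (mark s)(v \<mapsto> (\<lambda>p. m p - Wminus N t p + Wplus N t p))\<rparr>\<rbrakk>
     \<Longrightarrow> fire N U s (v, t) s'"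
| abstract:
    "\<lbrakk>t \<in> abs_trans N; mark s v = Some m; Wminus N t \<le> m; w \<notin> U;
      s' = \<lparr>mark = (mark s)(v \<mapsto> (\<lambda>p. m p - Wminus N t p), w \<mapsto> Omega N t),
            label = (label s)((v, w) \<mapsto> Wplus N t)\<rparr>\<rbrakk>
     \<Longrightarrow> fire N U s (v, t) s'"
| cut_root:
    "\<lbrakk>t \<in> cut_trans N; mark s v = Some m; Wminus N t \<le> m; is_root s v\<rbrakk>
     \<Longrightarrow> fire N U s (v, t) empty_state"
| cut_nonroot:
    "\<lbrakk>t \<in> cut_trans N; mark s v = Some m; Wminus N t \<le> m;
      label s (u, v) = Some l; mark s u = Some k;
      s' = \<lparr>mark = ((mark s)(u \<mapsto> (\<lambda>p. k p + l p))) |` (- subtree s v),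
            label = (label s) |` ((- subtree s v) \<times> (- subtree s v))\<rparr>\<rbrakk>
     \<Longrightarrow> fire N U s (v, t) s'"

inductive fire_seq ::
  "'a rpn \<Rightarrow> 'v set \<Rightarrow> ('a, 'v) state \<Rightarrow> ('v \<times> 'a) list \<Rightarrow> ('a, 'v) state \<Rightarrow> bool"
  for N where
  Nil: "fire_seq N U s [] s"
| Cons: "\<lbrakk>fire N U s a s'; fire_seq N (U \<union> verts s') s' \<sigma> s''\<rbrakk> \<Longrightarrow> fire_seq N U s (a # \<sigma>) s''"

definition firing_sequence ::
  "'a rpn \<Rightarrow> ('a, 'v) state \<Rightarrow> ('v \<times> 'a) list \<Rightarrow> ('a, 'v) state \<Rightarrow> bool" where
  "firing_sequence N s \<sigma> s' \<longleftrightarrow> fire_seq N (verts s) s \<sigma> s'"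


section \<open>The cut problem as a language\<close>

text \<open>
  Instances are marked nets whose places, transitions and threads are named by natural numbers.
  They are written as words over two letters, with all numbers in binary (least significant bit
  first) and every component self-delimiting, so that the encoding determines the instance.
\<close>

fun bits :: "nat \<Rightarrow> bool list" where
  "bits n = (if n = 0 then [] else odd n # bits (n div 2))"

declare bits.simps [simp del]

definition enc_nat :: "nat \<Rightarrow> bool list" where
  "enc_nat n = concat (map (\<lambda>b. [True, b]) (bits n)) @ [False]"

definition enc_list :: "('b \<Rightarrow> bool list) \<Rightarrow> 'b list \<Rightarrow> bool list" where
  "enc_list f xs = enc_nat (length xs) @ concat (map f xs)"

definition enc_set :: "(nat \<Rightarrow> bool list) \<Rightarrow> nat set \<Rightarrow> bool list" where
  "enc_set f A = enc_list (\<lambda>x. enc_nat x @ f x) (sorted_list_of_set A)"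

definition enc_vector :: "nat set \<Rightarrow> (nat \<Rightarrow> nat) \<Rightarrow> bool list" where
  "enc_vector P m = enc_list (\<lambda>p. enc_nat (m p)) (sorted_list_of_set P)"

definition enc_rpn :: "nat rpn \<Rightarrow> bool list" where
  "enc_rpn N = (let vec = enc_vector (places N) in
     enc_set (\<lambda>p. []) (places N) @
     enc_set (\<lambda>t. vec (Wminus N t) @ vec (Wplus N t)) (elem_trans N) @
     enc_set (\<lambda>t. vec (Wminus N t) @ vec (Wplus N t) @ vec (Omega N t)) (abs_trans N) @
     enc_set (\<lambda>t. vec (Wminus N t)) (cut_trans N))"

definition enc_state :: "nat set \<Rightarrow> (nat, nat) state \<Rightarrow> bool list" where
  "enc_state P s =
     enc_set (\<lambda>v. enc_vector P (the (mark s v)) @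
                  enc_set (\<lambda>w. enc_vector P (the (label s (v, w)))) {w. (v, w) \<in> edges s})
       (verts s)"

definition enc_marked_rpn :: "nat rpn \<Rightarrow> (nat, nat) state \<Rightarrow> bool list" where
  "enc_marked_rpn N s = enc_rpn N @ enc_state (places N) s"

definition cut_problem :: "bool list set" where
  "cut_problem = {enc_marked_rpn N s0 | N s0.
     is_rpn N \<and> is_state N s0 \<and> (\<exists>\<sigma>. firing_sequence N s0 \<sigma> empty_state)}"


section \<open>Turing machines\<close>

text \<open>
  Deterministic multi-tape machines with two-way infinite tapes. The states are the numbers
  below \<open>tm_states\<close> and the tape symbols those below \<open>tm_symbols\<close>; the symbol 0 is the blank,
  and 1 and 2 stand for the letters \<open>False\<close> and \<open>True\<close>. The first tape holds the input; for
  machines computing functions, the last one (possibly the same) holds the output.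
\<close>

datatype dir = Go_Left | Stay | Go_Right

record tm =
  tm_tapes :: nat
  tm_symbols :: nat
  tm_states :: nat
  tm_start :: nat
  tm_accept :: nat
  tm_reject :: nat
  tm_delta :: "nat \<Rightarrow> nat list \<Rightarrow> nat \<times> (nat \<times> dir) list"

definition is_tm :: "tm \<Rightarrow> bool" where
  "is_tm M \<longleftrightarrow>
     1 \<le> tm_tapes M \<and> 3 \<le> tm_symbols M \<and>
     tm_start M < tm_states M \<and> tm_accept M < tm_states M \<and> tm_reject M < tm_states M \<and>
     tm_accept M \<noteq> tm_reject M \<and>
     (\<forall>q as. q < tm_states M \<and> length as = tm_tapes M \<and> set as \<subseteq> {..<tm_symbols M} \<longrightarrow>
        (case tm_delta M q as of (q', acts) \<Rightarrow>
           q' < tm_states M \<and> length acts = tm_tapes M \<and> fst ` set acts \<subseteq> {..<tm_symbols M}))"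

type_synonym tape = "(int \<Rightarrow> nat) \<times> int"  \<comment> \<open>contents and head position\<close>
type_synonym config = "nat \<times> tape list"

fun move :: "dir \<Rightarrow> int \<Rightarrow> int" where
  "move Go_Left h = h - 1"
| "move Stay h = h"
| "move Go_Right h = h + 1"

fun act :: "tape \<Rightarrow> nat \<times> dir \<Rightarrow> tape" where
  "act (f, h) (a, d) = (f(h := a), move d h)"

definition halted :: "tm \<Rightarrow> config \<Rightarrow> bool" where
  "halted M c \<longleftrightarrow> fst c \<in> {tm_accept M, tm_reject M}"

definition step :: "tm \<Rightarrow> config \<Rightarrow> config" where
  "step M c =
     (if halted M c then c
      else case tm_delta M (fst c) (map (\<lambda>(f, h). f h) (snd c)) of
        (q', acts) \<Rightarrow> (q', map2 act (snd c) acts))"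

definition word_tape :: "bool list \<Rightarrow> int \<Rightarrow> nat" where
  "word_tape w i =
     (if 0 \<le> i \<and> i < int (length w) then (if w ! nat i then 2 else 1) else 0)"

definition init_config :: "tm \<Rightarrow> bool list \<Rightarrow> config" where
  "init_config M w =
     (tm_start M, (word_tape w, 0) # replicate (tm_tapes M - 1) (word_tape [], 0))"

definition run :: "tm \<Rightarrow> bool list \<Rightarrow> nat \<Rightarrow> config" where
  "run M w n = (step M ^^ n) (init_config M w)"

definition halts :: "tm \<Rightarrow> bool list \<Rightarrow> bool" where
  "halts M w \<longleftrightarrow> (\<exists>n. halted M (run M w n))"

definition accepts :: "tm \<Rightarrow> bool list \<Rightarrow> bool" where
  "accepts M w \<longleftrightarrow> (\<exists>n. fst (run M w n) = tm_accept M)"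

text \<open>The pairs (tape, cell) scanned during the computation; the input tape is included.\<close>

definition visited :: "tm \<Rightarrow> bool list \<Rightarrow> (nat \<times> int) set" where
  "visited M w = {(i, snd (snd (run M w n) ! i)) | i n. i < tm_tapes M}"


section \<open>Completeness for exponential space\<close>

definition decides_in_space :: "tm \<Rightarrow> bool list set \<Rightarrow> (nat \<Rightarrow> nat) \<Rightarrow> bool" where
  "decides_in_space M L f \<longleftrightarrow>
     (\<forall>w. halts M w \<and> (accepts M w \<longleftrightarrow> w \<in> L) \<and>
          finite (visited M w) \<and> card (visited M w) \<le> f (length w))"

definition DSPACE :: "(nat \<Rightarrow> nat) \<Rightarrow> bool list set set" where
  "DSPACE f = {L. \<exists>M c. is_tm M \<and> decides_in_space M L (\<lambda>n. c * f n)}"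

definition EXPSPACE :: "bool list set set" where
  "EXPSPACE = (\<Union>k. DSPACE (\<lambda>n. 2 ^ (n ^ k)))"

definition computes_in_time ::
  "tm \<Rightarrow> (bool list \<Rightarrow> bool list) \<Rightarrow> (nat \<Rightarrow> nat) \<Rightarrow> bool" where
  "computes_in_time M g f \<longleftrightarrow>
     (\<forall>w. \<exists>n \<le> f (length w). halted M (run M w n) \<and>
            fst (last (snd (run M w n))) = word_tape (g w))"

definition polytime_computable :: "(bool list \<Rightarrow> bool list) \<Rightarrow> bool" where
  "polytime_computable g \<longleftrightarrow>
     (\<exists>M c k. is_tm M \<and> computes_in_time M g (\<lambda>n. c * n ^ k + c))"

definition polytime_reducible :: "bool list set \<Rightarrow> bool list set \<Rightarrow> bool" where
  "polytime_reducible L L' \<longleftrightarrow>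
     (\<exists>g. polytime_computable g \<and> (\<forall>w. w \<in> L \<longleftrightarrow> g w \<in> L'))"

definition EXPSPACE_complete :: "bool list set \<Rightarrow> bool" where
  "EXPSPACE_complete L \<longleftrightarrow>
     L \<in> EXPSPACE \<and> (\<forall>L'\<in>EXPSPACE. polytime_reducible L' L)"

end

(* Membership: a thread can be closed iff its marking covers the input of a cut transition in the Petri net in which
  those abstract transitions whose threads can be closed act as elementary ones. The closable items (abstract
  transitions and threads) are therefore obtained by ranks. By Rackoff, covering only needs paths through markings
  with doubly exponential entries, which Savitch's algorithm finds in exponential space.
  Hardness: a machine working in exponential space is a counter program with doubly exponential registers. Lipton's
  Petri net of polynomial size simulates it, zero tests being double loops executed exactly 2^2^k times, and a cut
  transition enabled at acceptance closes the root. *)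
theory Submission
 imports Defs "HOL-Library.Nat_Bijection" "HOL-Library.FuncSet"
begin

text \<open>Space is never measured directly. \<open>LS\<close> collects the functions on numbers
  that counter programs compute in time polynomial in the values of their arguments. A value 2^2^p
  needs about 2^p tape cells, so an \<open>LSP\<close> predicate evaluated at arguments 2^2^p(n) is
  an exponential-space computation, and membership amounts to writing \<open>decide\<close> with
  such numbers as parameters. Search below a parameter is then free. Hence the input is not parsed:
  all tables and ranks of an instance are guessed as the digits of one number, and the encoding of
  the guess is compared with the input. A set of markings, however, would have a triply exponential
  code, so reachability needs Savitch's recursion with a stack kept in one number. The same programs
  serve hardness. One step of a fixed machine is an \<open>LS\<close> function of the coded
  configuration, so the simulating program keeps its registers polynomial in codes of doubly
  exponential size, which Lipton's counters can hold. In the reduction itself all weights are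
  polynomially bounded except the code of the word, which is copied from the input letter by
  letter.\<close>

section \<open>Counter programs with a stack of commands\<close>

datatype cnd = Zero nat | Sym nat

datatype cmd = Skip | Inc nat | Dec nat | Out bool | Adv | Rewind
 | Sq cmd cmd | Ite cnd cmd cmd | Until cnd cmd

type_synonym cstate = "(nat => nat) \<times> nat \<times> bool list"

fun holds :: "bool list => cnd => cstate => bool" where
 "holds w (Zero r) (rg, k, u) = (rg r = 0)"
| "holds w (Sym s) (rg, k, u) = (word_tape w (int k) = s)"

text \<open>The first component is the stack of commands still to be run; compound commands are
  unfolded on it, which costs a step of its own. \<open>Adv\<close> stops behind the last letter, so
  that a reading head never leaves the word by more than one blank.\<close>

fun cstep :: "bool list => cmd list \<times> cstate => cmd list \<times> cstate" where
 "cstep w ([], s) = ([], s)"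
| "cstep w (Skip # ks, s) = (ks, s)"
| "cstep w (Inc r # ks, (rg, k, u)) = (ks, (rg(r := Suc (rg r)), k, u))"
| "cstep w (Dec r # ks, (rg, k, u)) = (ks, (rg(r := rg r - 1), k, u))"
| "cstep w (Out b # ks, (rg, k, u)) = (ks, (rg, k, u @ [b]))"
| "cstep w (Adv # ks, (rg, k, u)) = (ks, (rg, if k < length w then Suc k else k, u))"
| "cstep w (Rewind # ks, (rg, k, u)) = (ks, (rg, 0, u))"
| "cstep w (Sq a b # ks, s) = (a # b # ks, s)"
| "cstep w (Ite c a b # ks, s) = ((if holds w c s then a else b) # ks, s)"
| "cstep w (Until c a # ks, s) = (if holds w c s then ks else a # Until c a # ks, s)"

fun succs :: "cmd => cmd list => cmd list set" where
 "succs (Sq a b) ks = {a # b # ks}"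
| "succs (Ite c a b) ks = {a # ks, b # ks}"
| "succs (Until c a) ks = {ks, a # Until c a # ks}"
| "succs _ ks = {ks}"

text \<open>All stacks that can arise while the given command runs on top of \<open>ks\<close>.
  There are finitely many of them, because \<open>Until\<close> puts back a copy of itself instead
  of growing the stack; they become the states of a Turing machine and the instruction numbers of a
  flat program.\<close>

fun ctrls :: "cmd => cmd list => cmd list set" where
 "ctrls (Sq a b) ks = insert (Sq a b # ks) (ctrls a (b # ks) Un ctrls b ks)"
| "ctrls (Ite c a b) ks = insert (Ite c a b # ks) (ctrls a ks Un ctrls b ks)"
| "ctrls (Until c a) ks = insert (Until c a # ks) (ctrls a (Until c a # ks))"
| "ctrls c ks = {c # ks}"

lemma finite_ctrls: "finite (ctrls c ks)"
 by (induction c arbitrary: ks) auto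

lemma Cons_in_ctrls: "c # ks : ctrls c ks"
 by (cases c) auto

lemma succs_ctrls: "a # l : ctrls c ks ==> succs a l <= insert ks (ctrls c ks)"
proof (induction c arbitrary: ks)
 case (Sq c1 c2)
 then show ?case using Cons_in_ctrls[of c1 "c2 # ks"] Cons_in_ctrls[of c2 ks]
  by (auto dest!: Sq.IH)
next
 case (Ite x c1 c2)
 then show ?case using Cons_in_ctrls[of c1 ks] Cons_in_ctrls[of c2 ks] by (auto dest!: Ite.IH)
next
 case (Until x c)
 then show ?case using Cons_in_ctrls[of c "Until x c # ks"] by (auto dest!: Until.IH)
qed auto

fun cregs :: "cmd => nat set" where
 "cregs (Inc r) = {r}"
| "cregs (Dec r) = {r}"
| "cregs (Sq a b) = cregs a Un cregs b"
| "cregs (Ite c a b) = (case c of Zero r => {r} | Sym s => {}) Un cregs a Un cregs b"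
| "cregs (Until c a) = (case c of Zero r => {r} | Sym s => {}) Un cregs a"
| "cregs _ = {}"

lemma finite_cregs: "finite (cregs c)"
 by (induction c) (auto split: cnd.split)

lemma cregs_ctrls: "a # l : ctrls c ks ==> cregs a <= cregs c"
 by (induction c arbitrary: ks) (fastforce split: cnd.split)+

subsection \<open>Bijective binary numbers\<close>

text \<open>The digits have the values 1 (\<open>False\<close>) and 2 (\<open>True\<close>), least
  significant first. Every list is then the numeral of exactly one number: no leading zeros have to
  be trimmed, and zero is the empty tape.\<close>

fun binc :: "bool list => bool list" where
 "binc [] = [False]"
| "binc (False # xs) = True # xs"
| "binc (True # xs) = False # binc xs"

fun bdec :: "bool list => bool list" where
 "bdec [] = []"
| "bdec (True # xs) = False # xs"
| "bdec (False # xs) = (if xs = [] then [] else True # bdec xs)"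

fun bnum :: "bool list => nat" where
 "bnum [] = 0"
| "bnum (b # xs) = 2 * bnum xs + (if b then 2 else 1)"

definition dig :: "nat => bool list" where
 "dig v = (binc ^^ v) []"

lemma binc_ne [simp]: "binc xs ~= []"
 by (induction xs rule: binc.induct) auto

lemma bdec_binc [simp]: "bdec (binc xs) = xs"
 by (induction xs rule: binc.induct) auto

lemma bnum_binc: "bnum (binc xs) = Suc (bnum xs)"
 by (induction xs rule: binc.induct) auto

lemma dig_0 [simp]: "dig 0 = []"
 by (simp add: dig_def)

lemma dig_Suc: "dig (Suc v) = binc (dig v)"
 by (simp add: dig_def)

lemma dig_pred: "dig (v - 1) = bdec (dig v)"
 by (cases v) (simp_all add: dig_Suc)

lemma dig_eq_Nil [simp]: "dig v = [] \<longleftrightarrow> v = 0"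
 by (cases v) (simp_all add: dig_Suc)

lemma bnum_dig: "bnum (dig v) = v"
 by (induction v) (simp_all add: dig_Suc bnum_binc)

text \<open>The smallest numeral of a given length has all digits 1.\<close>

lemma length_bnum: "2 ^ length xs <= bnum xs + 1"
 by (induction xs) auto

lemma length_dig: "2 ^ length (dig v) <= v + 1"
 using length_bnum[of "dig v"] by (simp add: bnum_dig)

lemma length_dig_le: "v + 1 < 2 ^ Suc L ==> length (dig v) <= L"
 using length_dig[of v] by (meson le_less_trans less_Suc_eq_le nat_power_less_imp_less zero_less_numeral)

subsection \<open>Compilation to Turing machines\<close>

definition sym :: "bool => nat" where
 "sym b = (if b then 2 else 1)"

lemma word_tape_upd: "(word_tape (ys @ x # xs))(int (length ys) := sym b) = word_tape (ys @ b # xs)"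
 by (rule ext) (auto simp: word_tape_def sym_def nth_append nth_Cons split: nat.splits)

lemma word_tape_append: "(word_tape ys)(int (length ys) := sym b) = word_tape (ys @ [b])"
 by (rule ext) (auto simp: word_tape_def sym_def nth_append)

lemma word_tape_erase: "(word_tape (ys @ [b]))(int (length ys) := 0) = word_tape ys"
 by (rule ext) (auto simp: word_tape_def nth_append)

lemma word_tape_at: "word_tape (ys @ x # xs) (int (length ys)) = sym x"
 by (auto simp: word_tape_def sym_def)

lemma word_tape_end: "word_tape ys (int (length ys)) = 0"
 by (auto simp: word_tape_def)

lemma word_tape_neg: "h < 0 ==> word_tape ys h = 0"
 by (auto simp: word_tape_def)

lemma word_tape_in: "k < length ys ==> word_tape ys (int k) = sym (ys ! k)"
 by (auto simp: word_tape_def sym_def)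

lemma word_tape_eq0: "word_tape ys (int k) = 0 \<longleftrightarrow> length ys <= k"
 by (auto simp: word_tape_def)

lemma sym_simps [simp]: "sym b ~= 0" "sym True = 2" "sym False = 1" "sym b = 2 \<longleftrightarrow> b" "sym b = 1 \<longleftrightarrow> ~ b"
 "0 < sym b" "sym b < 3" "sym b = Suc 0 \<longleftrightarrow> ~ b"
 by (auto simp: sym_def)

definition keep :: "nat list => (nat \<times> dir) list" where
 "keep as = map (%a. (a, Stay)) as"

definition upd1 :: "nat list => nat => nat => dir => (nat \<times> dir) list" where
 "upd1 as j a d = (keep as)[j := (a, d)]"

text \<open>Phases: 0 normal and carry propagation of \<open>Inc\<close>, 1 return of the head to cell 0,
  2 borrow propagation of \<open>Dec\<close>, 3 removal of the most significant digit.\<close>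

fun tdelta :: "nat => cmd list \<times> nat => nat list => (cmd list \<times> nat) \<times> (nat \<times> dir) list" where
 "tdelta R ([], ph) as = (([], 0), keep as)"
| "tdelta R (Inc r # ks, ph) as = (let j = Suc r; a = as ! j in
   if ph = 0 then
    (if a = 2 then ((Inc r # ks, 0), upd1 as j 1 Go_Right)
    else ((Inc r # ks, 1), upd1 as j (if a = 1 then 2 else 1) Go_Left))
   else (if a = 0 then ((ks, 0), upd1 as j 0 Go_Right)
      else ((Inc r # ks, 1), upd1 as j a Go_Left)))"
| "tdelta R (Dec r # ks, ph) as = (let j = Suc r; a = as ! j in
   if ph = 0 & a = 0 then ((ks, 0), keep as)
   else if ph = 0 | ph = 2 then
    (if a = 2 then ((Dec r # ks, 1), upd1 as j 1 Go_Left)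
    else if a = 1 then ((Dec r # ks, 2), upd1 as j 2 Go_Right)
    else ((Dec r # ks, 3), upd1 as j 0 Go_Left))
   else if ph = 3 then ((Dec r # ks, 1), upd1 as j 0 Go_Left)
   else (if a = 0 then ((ks, 0), upd1 as j 0 Go_Right)
      else ((Dec r # ks, 1), upd1 as j a Go_Left)))"
| "tdelta R (Out b # ks, ph) as = ((ks, 0), upd1 as (Suc R) (sym b) Go_Right)"
| "tdelta R (Adv # ks, ph) as = ((ks, 0), if as ! 0 = 0 then keep as else upd1 as 0 (as ! 0) Go_Right)"
| "tdelta R (Rewind # ks, ph) as =
   (if ph = 0 then ((Rewind # ks, 1), upd1 as 0 (as ! 0) Go_Left)
   else if as ! 0 = 0 then ((ks, 0), upd1 as 0 0 Go_Right)
   else ((Rewind # ks, 1), upd1 as 0 (as ! 0) Go_Left))"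
| "tdelta R (Skip # ks, ph) as = ((ks, 0), keep as)"
| "tdelta R (Sq a b # ks, ph) as = ((a # b # ks, 0), keep as)"
| "tdelta R (Ite c a b # ks, ph) as =
   (((if (case c of Zero r => as ! Suc r = 0 | Sym s => as ! 0 = s) then a else b) # ks, 0), keep as)"
| "tdelta R (Until c a # ks, ph) as =
   ((if (case c of Zero r => as ! Suc r = 0 | Sym s => as ! 0 = s) then ks else a # Until c a # ks, 0), keep as)"

definition cset :: "cmd => cmd list set" where
 "cset c = insert [] (ctrls c [])"

abbreviation cstates :: "cmd => (cmd list \<times> nat) set" where
 "cstates c == cset c \<times> {..<4}"

definition tnum :: "cmd => cmd list \<times> nat => nat" where
 "tnum c = (SOME h. bij_betw h (cstates c) {0..<card (cstates c)})"

definition tst :: "cmd => cmd list \<times> nat => nat" where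
 "tst c q = tnum c q + 2"

text \<open>States 0 and 1 are acceptance and rejection, hence the shift by 2 in \<open>tst\<close>.
  When no command is left, the machine accepts iff cell 0 of tape 1 is not blank, that is, iff
  register 0 is positive.\<close>

definition ctm :: "cmd => nat => tm" where
 "ctm c R = (|tm_tapes = R + 2, tm_symbols = 3, tm_states = card (cstates c) + 2,
   tm_start = tst c ([c], 0), tm_accept = 0, tm_reject = 1,
   tm_delta = (%n as. if n < 2 then (n, keep as) else
    let q = inv_into (cstates c) (tst c) n in
    if fst q = [] then (if as ! 1 = 0 then 1 else 0, keep as)
    else let (q', acts) = tdelta R q as in (tst c q', acts))|)"

lemma ctm_simps [simp]: "tm_tapes (ctm c R) = R + 2" "tm_symbols (ctm c R) = 3"
 "tm_accept (ctm c R) = 0" "tm_reject (ctm c R) = 1" "tm_start (ctm c R) = tst c ([c], 0)"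
 by (simp_all add: ctm_def)

lemma finite_cset: "finite (cset c)"
 by (simp add: cset_def finite_ctrls)

lemma tnum_bij: "bij_betw (tnum c) (cstates c) {0..<card (cstates c)}"
 unfolding tnum_def
 by (rule someI_ex[OF ex_bij_betw_finite_nat]) (simp add: finite_cset)

lemma inj_tst: "inj_on (tst c) (cstates c)"
 using tnum_bij[of c] by (auto simp: inj_on_def tst_def bij_betw_def)

lemma tst_ge: "2 <= tst c q"
 by (simp add: tst_def)

lemma tst_less: "q : cstates c ==> tst c q < tm_states (ctm c R)"
 using bij_betwE[OF tnum_bij[of c]] by (auto simp: ctm_def tst_def)

lemma tst_surj: "2 <= n ==> n < tm_states (ctm c R) ==> EX q : cstates c. n = tst c q"
proof -
 assume n: "2 <= n" "n < tm_states (ctm c R)"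
 then have "n - 2 : tnum c ` (cstates c)"
  using bij_betw_imp_surj_on[OF tnum_bij[of c]] by (auto simp: ctm_def)
 then obtain q where "q : cstates c" "n - 2 = tnum c q" by blast
 then show ?thesis using n by (intro bexI[of _ q]) (auto simp: tst_def)
qed

lemma cset_succs: "a # l : cset c ==> succs a l <= cset c"
 using succs_ctrls[of a l c "[]"] by (auto simp: cset_def)

lemma tdelta_closed:
 assumes "q : cstates c"
 shows "fst (tdelta R q as) : cstates c"
proof -
 obtain l ph where q: "q = (l, ph)" by force
 show ?thesis
 proof (cases l)
  case Nil
  then show ?thesis using assms q by auto
 next
  case (Cons a ks)
  then show ?thesis using assms q cset_succs[of a ks c]
   by (cases a) (auto simp: Let_def)
 qed
qed

lemma length_upd1 [simp]: "length (upd1 as j a d) = length as" "length (keep as) = length as"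
 by (simp_all add: upd1_def keep_def)

lemma keep_sub: "set as <= {..<3} ==> fst ` set (keep as) <= {..<3}"
 by (auto simp: keep_def)

lemma upd1_sub: "set as <= {..<3} ==> a < 3 ==> fst ` set (upd1 as j a d) <= {..<3}"
 using set_update_subset_insert[of "keep as" j "(a, d)"] keep_sub[of as]
 unfolding upd1_def by fastforce

lemma tdelta_acts:
 assumes "set as <= {..<3}" "length as = R + 2" "fst q = [] | cregs (hd (fst q)) <= {..<R}"
 shows "length (snd (tdelta R q as)) = R + 2 & fst ` set (snd (tdelta R q as)) <= {..<3}"
proof -
 have nth: "as ! i < 3" if "i < R + 2" for i using that assms by (metis lessThan_iff nth_mem subsetD)
 obtain l ph where q: "q = (l, ph)" by force
 show ?thesis
 proof (cases l)
  case Nil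
  then show ?thesis using assms q keep_sub by auto
 next
  case (Cons a ks)
  then show ?thesis using assms(2,3) q nth[of 0] nth[of "Suc _"] keep_sub[OF assms(1)] upd1_sub[OF assms(1)]
   by (cases a) (simp_all add: Let_def)
 qed
qed

lemma cset_cregs: "a # l : cset c ==> cregs a <= cregs c"
 using cregs_ctrls by (auto simp: cset_def)

lemma start_in: "([c], 0) : cstates c"
 using Cons_in_ctrls[of c "[]"] by (auto simp: cset_def)

lemma is_tm_ctm:
 assumes "cregs c <= {..<R}"
 shows "is_tm (ctm c R)"
proof -
 have "case tm_delta (ctm c R) q as of (q', acts) =>
   q' < tm_states (ctm c R) & length acts = R + 2 & fst ` set acts <= {..<3}"
  if "q < tm_states (ctm c R)" "length as = R + 2" "set as <= {..<3}" for q as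
 proof (cases "q < 2")
  case True
  then show ?thesis using that keep_sub by (auto simp: ctm_def)
 next
  case False
  then have "EX p : cstates c. q = tst c p" using that(1) by (intro tst_surj) simp_all
  then obtain p where p: "p : cstates c" "q = tst c p" by blast
  then have inv: "inv_into (cstates c) (tst c) q = p" using inj_tst inv_into_f_f by metis
  have "fst p = [] | cregs (hd (fst p)) <= {..<R}"
  proof (cases "fst p")
   case (Cons a l)
   then have "a # l : cset c" using p(1) by (metis mem_Times_iff)
   from cset_cregs[OF this] show ?thesis using assms Cons by simp
  qed simp
  note acts = tdelta_acts[OF that(3,2) this]
  show ?thesis
   using False inv that keep_sub[OF that(3)] acts tst_less[OF tdelta_closed[OF p(1), of R as], of R]
   by (auto simp: ctm_def Let_def case_prod_beta)
 qed
 then show ?thesis using tst_less[OF start_in, of c R]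
  by (auto simp: is_tm_def ctm_def)
qed


section \<open>Runs of the compiled machine on a single tape\<close>

text \<open>The cells scanned in the last configuration are left out, so that runs compose by adding
  their lengths; they are accounted for where the machine halts.\<close>

definition sr :: "tm => (nat \<times> int) set => nat => config => config => bool" where
 "sr M S t x y \<longleftrightarrow> (step M ^^ t) x = y &
   (ALL t' < t. ALL j < tm_tapes M. (j, snd (snd ((step M ^^ t') x) ! j)) : S)"

lemma sr_0: "sr M S 0 x x"
 unfolding sr_def by simp

lemma sr_trans:
 assumes "sr M S t x y" "sr M S t' y z"
 shows "sr M S (t + t') x z"
proof -
 have *: "(step M ^^ (k + t)) x = (step M ^^ k) y" for k
  using assms(1) by (simp add: sr_def funpow_add)
 have "(j, snd (snd ((step M ^^ i) x) ! j)) : S" if "i < t + t'" "j < tm_tapes M" for i j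
 proof (cases "i < t")
  case True
  then show ?thesis using assms(1) that(2) by (simp add: sr_def)
 next
  case False
  then have k: "i = (i - t) + t" "i - t < t'" using that(1) by auto
  then show ?thesis using assms(2) that(2) by (subst k(1), subst *) (use k(2) in "simp add: sr_def")
 qed
 moreover have "(step M ^^ (t + t')) x = z"
  using assms(2) *[of t'] by (simp add: sr_def add.commute)
 ultimately show ?thesis unfolding sr_def by blast
qed

lemma sr_step:
 assumes "step M x = y" "ALL j < tm_tapes M. (j, snd (snd x ! j)) : S"
 shows "sr M S 1 x y"
 using assms by (simp add: sr_def)

lemma map2_keep: "map2 act ts (keep (map (%(f, h). f h) ts)) = ts"
 by (rule nth_equalityI) (auto simp: keep_def split: prod.splits)

lemma map2_upd1:
 "map2 act ts (upd1 (map (%(f, h). f h) ts) j a d) = ts[j := act (ts ! j) (a, d)]"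
 by (cases "j < length ts")
  (auto intro!: nth_equalityI simp: keep_def upd1_def nth_list_update list_update_beyond split: prod.splits)

lemma ctm_step:
 assumes "(b # ks, ph) : cstates c"
 shows "step (ctm c R) (tst c (b # ks, ph), ts) =
   (case tdelta R (b # ks, ph) (map (%(f, h). f h) ts) of (q, acts) => (tst c q, map2 act ts acts))"
proof -
 have "inv_into (cstates c) (tst c) (tst c (b # ks, ph)) = (b # ks, ph)"
  using inv_into_f_f[OF inj_tst assms] .
 then show ?thesis using tst_ge[of c "(b # ks, ph)"]
  by (auto simp: step_def halted_def ctm_def Let_def split: prod.splits)
qed

text \<open>During one command only the head of tape \<open>j\<close> moves. Cell -1 belongs to the
  permitted range because a returning head recognizes the beginning of the tape by running into the
  blank there.\<close>

context
 fixes c :: cmd and R :: nat and S :: "(nat \<times> int) set" and ts :: "tape list" and j L :: nat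
 assumes len: "length ts = R + 2" and j: "j < R + 2"
  and heads: "ALL i < R + 2. i ~= j --> (i, snd (ts ! i)) : S"
  and range: "ALL h. -1 <= h & h <= int L --> (j, h) : S"
begin

abbreviation goes :: "nat => cmd list \<times> nat => bool list => int => cmd list \<times> nat => bool list => int => bool" where
 "goes t q xs h q' ys h' == sr (ctm c R) S t (tst c q, ts[j := (word_tape xs, h)]) (tst c q', ts[j := (word_tape ys, h')])"

lemma tape_step:
 assumes "(b # ks, ph) : cstates c" "-1 <= h" "h <= int L"
  and "tdelta R (b # ks, ph) (map (%(f, h). f h) (ts[j := (f, h)])) =
     (q, upd1 (map (%(f, h). f h) (ts[j := (f, h)])) j a d)"
 shows "sr (ctm c R) S 1 (tst c (b # ks, ph), ts[j := (f, h)]) (tst c q, ts[j := (f(h := a), move d h)])"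
proof (rule sr_step)
 show "step (ctm c R) (tst c (b # ks, ph), ts[j := (f, h)]) = (tst c q, ts[j := (f(h := a), move d h)])"
  using len j by (simp only: ctm_step[OF assms(1)] assms(4)) (simp add: map2_upd1)
 show "ALL i<tm_tapes (ctm c R). (i, snd (snd (tst c (b # ks, ph), ts[j := (f, h)]) ! i)) : S"
  using heads range assms(2,3) len j by (auto simp: nth_list_update)
qed

lemma read_tape: "map (%(f, h). f h) (ts[j := (f, h)]) ! j = f h"
 using len j by (simp add: nth_list_update)

text \<open>A head at \<open>k - 1\<close> passes \<open>k\<close> digits before it meets the blank
  in cell -1, from which it steps right to cell 0.\<close>

lemma ret_tape:
 assumes "(b # ks, 1) : cstates c" "k <= length zs" "length zs <= L"
  and 1: "!!as. as ! j = 0 ==> tdelta R (b # ks, 1) as = ((ks, 0), upd1 as j 0 Go_Right)"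
  and 2: "!!as. as ! j ~= 0 ==> tdelta R (b # ks, 1) as = ((b # ks, 1), upd1 as j (as ! j) Go_Left)"
 shows "goes (k + 1) (b # ks, 1) zs (int k - 1) (ks, 0) zs 0"
 using assms(2)
proof (induction k)
 case 0
 show ?case
  using tape_step[OF assms(1), of "-1" "word_tape zs" "(ks, 0)" 0 Go_Right] 1 read_tape
  by (simp add: word_tape_neg fun_upd_idem)
next
 case (Suc k)
 have "goes 1 (b # ks, 1) zs (int k) (b # ks, 1) zs (int k - 1)"
  using tape_step[OF assms(1), of "int k" "word_tape zs" "(b # ks, 1)" "word_tape zs (int k)" Go_Left]
   Suc.prems assms(3) 2 read_tape word_tape_eq0[of zs k]
  by simp
 from sr_trans[OF this Suc.IH] Suc.prems show ?case by simp
qed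

text \<open>Here \<open>ys\<close> are the digits already rewritten by the carry. The digit that
  stops it lies in cell \<open>p\<close>, and the return starts one cell further left, at
  \<open>p - 1\<close>.\<close>

lemma inc_tape_aux:
 assumes "j = Suc r" "(Inc r # ks, 0) : cstates c" "length ys + length xs <= L"
 shows "EX t <= length xs + 1. EX p <= length ys + length xs.
   goes t (Inc r # ks, 0) (ys @ xs) (int (length ys)) (Inc r # ks, 1) (ys @ binc xs) (int p - 1)"
 using assms(3)
proof (induction xs arbitrary: ys)
 case Nil
 show ?case
  using tape_step[OF assms(2), of "int (length ys)" "word_tape ys" "(Inc r # ks, 1)" 1 Go_Left]
   Nil assms(1) read_tape word_tape_append[of ys False]
  by (intro exI[of _ 1] conjI exI[of _ "length ys"]) (simp_all add: word_tape_end Let_def)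
next
 case (Cons x xs)
 show ?case
 proof (cases x)
  case False
  then show ?thesis
   using tape_step[OF assms(2), of "int (length ys)" "word_tape (ys @ x # xs)" "(Inc r # ks, 1)" 2 Go_Left]
    Cons.prems assms(1) read_tape word_tape_upd[of ys x xs True]
   by (intro exI[of _ 1] conjI exI[of _ "length ys"]) (simp_all add: word_tape_at Let_def)
 next
  case True
  have 1: "goes 1 (Inc r # ks, 0) (ys @ x # xs) (int (length ys)) (Inc r # ks, 0) ((ys @ [False]) @ xs) (int (length (ys @ [False])))"
   using tape_step[OF assms(2), of "int (length ys)" "word_tape (ys @ x # xs)" "(Inc r # ks, 0)" 1 Go_Right]
    Cons.prems assms(1) read_tape word_tape_upd[of ys x xs False] True
   by (simp add: word_tape_at Let_def add.commute)
  obtain t p where t: "t <= length xs + 1" "p <= length (ys @ [False]) + length xs"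
   and "goes t (Inc r # ks, 0) ((ys @ [False]) @ xs) (int (length (ys @ [False]))) (Inc r # ks, 1) ((ys @ [False]) @ binc xs) (int p - 1)"
   using Cons.IH[of "ys @ [False]"] Cons.prems by auto
  from sr_trans[OF 1 this(3)] show ?thesis
   using t True by (intro exI[of _ "1 + t"] conjI exI[of _ p]) simp_all
 qed
qed

lemma length_binc: "length xs <= length (binc xs)" "length (binc xs) <= Suc (length xs)"
 by (induction xs rule: binc.induct) auto

lemma inc_tape:
 assumes "j = Suc r" "Inc r # ks : cset c" "length xs < L"
 shows "EX t <= 2 * length xs + 2. goes t (Inc r # ks, 0) xs 0 (ks, 0) (binc xs) 0"
proof -
 obtain t p where t: "t <= length xs + 1" "p <= length xs"
  and 1: "goes t (Inc r # ks, 0) xs 0 (Inc r # ks, 1) (binc xs) (int p - 1)"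
  using inc_tape_aux[OF assms(1), of ks "[]" xs] assms by auto
 have "goes (p + 1) (Inc r # ks, 1) (binc xs) (int p - 1) (ks, 0) (binc xs) 0"
  by (rule ret_tape) (use assms t length_binc[of xs] in "auto simp: Let_def")
 from sr_trans[OF 1 this] show ?thesis using t by (intro exI[of _ "t + (p + 1)"]) simp
qed

text \<open>A digit 1 becomes 2 and borrows from the next one. If the borrow runs past the end, all
  digits were 1 and the numeral becomes shorter: its last digit, just rewritten, is erased, whence
  \<open>butlast\<close>.\<close>

lemma dec_tape_aux:
 assumes "j = Suc r" "Dec r # ks : cset c" "length ys + length xs <= L" "ph = 0 & xs ~= [] | ph = 2 & ys @ xs ~= []"
 shows "EX t <= length xs + 2. EX p <= length ys + length xs. EX zs. p <= length zs & length zs <= L &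
   zs = (if xs = [] then butlast ys else ys @ bdec xs) &
   goes t (Dec r # ks, ph) (ys @ xs) (int (length ys)) (Dec r # ks, 1) zs (int p - 1)"
 using assms(3,4)
proof (induction xs arbitrary: ys ph)
 case Nil
 have c: "(Dec r # ks, 2) : cstates c" "(Dec r # ks, 3) : cstates c" using assms by auto
 obtain zs x where ys: "ys = zs @ [x]" using Nil by (metis append_Nil2 rev_exhaust)
 have "goes 1 (Dec r # ks, ph) ys (int (length ys)) (Dec r # ks, 3) ys (int (length zs))"
  using tape_step[OF c(1), of "int (length ys)" "word_tape ys" "(Dec r # ks, 3)" 0 Go_Left]
   Nil assms(1) read_tape ys word_tape_end[of ys]
  by (simp add: Let_def fun_upd_idem)
 moreover have "goes 1 (Dec r # ks, 3) ys (int (length zs)) (Dec r # ks, 1) zs (int (length zs) - 1)"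
  using tape_step[OF c(2), of "int (length zs)" "word_tape ys" "(Dec r # ks, 1)" 0 Go_Left]
   Nil assms(1) read_tape ys word_tape_erase[of zs x]
  by (simp add: Let_def)
 ultimately have "goes (1 + 1) (Dec r # ks, ph) ys (int (length ys)) (Dec r # ks, 1) zs (int (length zs) - 1)" by (rule sr_trans)
 then show ?case using ys Nil
  by (intro exI[of _ "1 + 1"] conjI exI[of _ "length zs"] exI[of _ zs]) simp_all
next
 case (Cons x xs)
 have c: "(Dec r # ks, ph) : cstates c" using assms Cons.prems by auto
 show ?case
 proof (cases x)
  case True
  then show ?thesis
   using tape_step[OF c, of "int (length ys)" "word_tape (ys @ x # xs)" "(Dec r # ks, 1)" 1 Go_Left]
    Cons.prems assms(1) read_tape word_tape_upd[of ys x xs False]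
   by (intro exI[of _ 1] conjI exI[of _ "length ys"] exI[of _ "ys @ False # xs"])
    (auto simp: word_tape_at Let_def)
 next
  case False
  have 1: "goes 1 (Dec r # ks, ph) (ys @ x # xs) (int (length ys)) (Dec r # ks, 2) ((ys @ [True]) @ xs) (int (length (ys @ [True])))"
   using tape_step[OF c, of "int (length ys)" "word_tape (ys @ x # xs)" "(Dec r # ks, 2)" 2 Go_Right]
    Cons.prems assms(1) read_tape word_tape_upd[of ys x xs True] False
   by (auto simp: word_tape_at Let_def add.commute)
  obtain t p zs where t: "t <= length xs + 2" "p <= length (ys @ [True]) + length xs" "p <= length zs" "length zs <= L"
   "zs = (if xs = [] then butlast (ys @ [True]) else (ys @ [True]) @ bdec xs)"
   and "goes t (Dec r # ks, 2) ((ys @ [True]) @ xs) (int (length (ys @ [True]))) (Dec r # ks, 1) zs (int p - 1)"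
   using Cons.IH[of "ys @ [True]" 2] Cons.prems by auto
  from sr_trans[OF 1 this(6)] show ?thesis
   using t False by (intro exI[of _ "1 + t"] conjI exI[of _ p] exI[of _ zs]) (simp_all split: if_splits)
 qed
qed

lemma dec_tape:
 assumes "j = Suc r" "Dec r # ks : cset c" "length xs <= L" "xs ~= []"
 shows "EX t <= 2 * length xs + 3. goes t (Dec r # ks, 0) xs 0 (ks, 0) (bdec xs) 0"
proof -
 obtain t p where t: "t <= length xs + 2" "p <= length xs" "p <= length (bdec xs)" "length (bdec xs) <= L"
  and 1: "goes t (Dec r # ks, 0) xs 0 (Dec r # ks, 1) (bdec xs) (int p - 1)"
  using dec_tape_aux[OF assms(1,2), of "[]" xs 0] assms by auto
 have "goes (p + 1) (Dec r # ks, 1) (bdec xs) (int p - 1) (ks, 0) (bdec xs) 0"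
  by (rule ret_tape) (use assms t in "auto simp: Let_def")
 from sr_trans[OF 1 this] show ?thesis using t by (intro exI[of _ "t + (p + 1)"]) simp
qed

lemma rewind_tape:
 assumes "j = 0" "Rewind # ks : cset c" "k <= length xs" "length xs <= L"
 shows "EX t <= length xs + 2. goes t (Rewind # ks, 0) xs (int k) (ks, 0) xs 0"
proof -
 have 1: "goes 1 (Rewind # ks, 0) xs (int k) (Rewind # ks, 1) xs (int k - 1)"
  using tape_step[of "Rewind" ks 0 "int k" "word_tape xs" "(Rewind # ks, 1)" "word_tape xs (int k)" Go_Left]
   assms read_tape by simp
 have "goes (k + 1) (Rewind # ks, 1) xs (int k - 1) (ks, 0) xs 0"
  by (rule ret_tape) (use assms in "auto simp: Let_def")
 from sr_trans[OF 1 this] show ?thesis using assms by (intro exI[of _ "1 + (k + 1)"]) simp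
qed

end


section \<open>Simulation of whole programs and the cells it uses\<close>

definition regs_tapes :: "nat => (nat => nat) => tape list" where
 "regs_tapes R rg = map (%r. (word_tape (dig (rg r)), 0)) [0..<R]"

fun cfg :: "cmd => nat => bool list => cmd list \<times> cstate => config" where
 "cfg c R w (ks, (rg, k, u)) = (tst c (ks, 0),
   (word_tape w, int k) # regs_tapes R rg @ [(word_tape u, int (length u))])"

definition cells :: "nat => nat => nat => nat => (nat \<times> int) set" where
 "cells R n L U = {0} \<times> {-1..int n} Un {1..R} \<times> {-1..int L} Un {Suc R} \<times> {0..int U}"

lemma card_cells: "card (cells R n L U) <= n + 2 + R * (L + 2) + (U + 1)"
by (auto simp: cells_def nat_add_distrib intro!: order_trans[OF card_Un_le])

lemma finite_cells: "finite (cells R n L U)"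
 by (simp add: cells_def)

lemma ex_le_trans: "EX t <= (a::nat). P t ==> a <= b ==> EX t <= b. P t"
 by (meson order_trans)

text \<open>A command costs at most one pass over a register and back (\<open>Inc\<close>,
  \<open>Dec\<close>) or one over the input (\<open>Rewind\<close>), whence the bound. The strict
  bound by \<open>L\<close> leaves room for the digit that \<open>Inc\<close> may add.\<close>

lemma ctm_sim_step:
 assumes b: "b # ks : cset c" and R: "cregs c <= {..<R}" and k: "k <= length w"
  and L: "!!r. length (dig (rg r)) < L" and U: "length u <= U"
 shows "EX t <= 2 * L + length w + 4.
   sr (ctm c R) (cells R (length w) L U) t (cfg c R w (b # ks, (rg, k, u))) (cfg c R w (cstep w (b # ks, (rg, k, u))))"
proof -
 let ?S = "cells R (length w) L U"
 define ts where "ts = (word_tape w, int k) # regs_tapes R rg @ [(word_tape u, int (length u))]"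
 have len: "length ts = R + 2" by (simp add: ts_def regs_tapes_def)
 have nth: "ts ! 0 = (word_tape w, int k)" "!!r. r < R ==> ts ! Suc r = (word_tape (dig (rg r)), 0)"
  "ts ! Suc R = (word_tape u, int (length u))"
  by (simp_all add: ts_def regs_tapes_def nth_append)
 have heads: "(i, snd (ts ! i)) : ?S" if "i < R + 2" for i
 proof -
  consider "i = 0" | r where "i = Suc r" "r < R" | "i = Suc R" using \<open>i < R + 2\<close> by (cases i) force+
  then show ?thesis using k U by cases (auto simp: nth cells_def)
 qed
 have upd: "ts[Suc r := (word_tape (dig v), 0)] =
   (word_tape w, int k) # regs_tapes R (rg(r := v)) @ [(word_tape u, int (length u))]" if "r < R" for r v
  using that by (auto intro!: nth_equalityI simp: ts_def regs_tapes_def nth_append nth_Cons nth_list_update split: nat.splits)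
 have self: "ts[i := ts ! i] = ts" for i by simp
 have in4: "(b # ks, 0) : cstates c" using b by simp
 have read: "map (%(f, h). f h) ts ! i = (case ts ! i of (f, h) => f h)" if "i < R + 2" for i
  using that len by simp
 have quiet: ?thesis if "tdelta R (b # ks, 0) (map (%(f, h). f h) ts) = ((ks', 0), keep (map (%(f, h). f h) ts))"
  "cstep w (b # ks, (rg, k, u)) = (ks', (rg, k, u))" for ks'
 proof -
  have "step (ctm c R) (tst c (b # ks, 0), ts) = (tst c (ks', 0), ts)"
   by (simp only: ctm_step[OF in4] that(1)) (simp add: map2_keep)
  then show ?thesis using heads that(2)
   by (intro exI[of _ 1] conjI sr_step) (auto simp: ts_def)
 qed
 have rR: "r < R" if "r : cregs b" for r using cset_cregs[OF b] R that by auto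
 have readR: "map (%(f, h). f h) ts ! Suc r = 0 \<longleftrightarrow> rg r = 0" if "r : cregs b" for r
  using rR[OF that] word_tape_eq0[of "dig (rg r)" 0] by (simp add: read nth)
 show ?thesis
 proof (cases b)
  case Skip
  then show ?thesis by (intro quiet[of ks]) auto
 next
  case (Sq x y)
  then show ?thesis by (intro quiet[of "x # y # ks"]) auto
 next
  case (Ite cn x y)
  have "(case cn of Zero r => map (%(f, h). f h) ts ! Suc r = 0 | Sym s => map (%(f, h). f h) ts ! 0 = s)
   \<longleftrightarrow> holds w cn (rg, k, u)"
   using readR Ite by (cases cn) (auto simp: read nth)
  then show ?thesis using Ite by (intro quiet[of "(if holds w cn (rg, k, u) then x else y) # ks"]) auto
 next
  case (Until cn x)
  have "(case cn of Zero r => map (%(f, h). f h) ts ! Suc r = 0 | Sym s => map (%(f, h). f h) ts ! 0 = s)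
   \<longleftrightarrow> holds w cn (rg, k, u)"
   using readR Until by (cases cn) (auto simp: read nth)
  then show ?thesis using Until
   by (intro quiet[of "if holds w cn (rg, k, u) then ks else x # Until cn x # ks"]) auto
 next
  case (Inc r)
  then have r: "r < R" using rR by simp
  have "EX t<=2 * length (dig (rg r)) + 2. sr (ctm c R) ?S t
    (tst c (Inc r # ks, 0), ts[Suc r := (word_tape (dig (rg r)), 0)])
    (tst c (ks, 0), ts[Suc r := (word_tape (binc (dig (rg r))), 0)])"
   using len r heads L b Inc by (intro inc_tape) (auto simp: cells_def)
  moreover have "ts[Suc r := (word_tape (dig (rg r)), 0)] = ts" using nth(2)[OF r] self by metis
  ultimately show ?thesis using L[of r] upd[OF r, of "Suc (rg r)"]
   by - (rule ex_le_trans[of "2 * length (dig (rg r)) + 2"], auto simp: Inc dig_Suc ts_def[symmetric])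
 next
  case (Dec r)
  then have r: "r < R" using rR by simp
  show ?thesis
  proof (cases "rg r = 0")
   case True
   then show ?thesis using Dec read[of "Suc r"] r nth(2)[OF r]
    by (intro quiet[of ks]) (auto simp: word_tape_def)
  next
   case False
   have "EX t<=2 * length (dig (rg r)) + 3. sr (ctm c R) ?S t
     (tst c (Dec r # ks, 0), ts[Suc r := (word_tape (dig (rg r)), 0)])
     (tst c (ks, 0), ts[Suc r := (word_tape (bdec (dig (rg r))), 0)])"
    using len r heads L b Dec False by (intro dec_tape) (auto simp: cells_def less_imp_le)
   moreover have "ts[Suc r := (word_tape (dig (rg r)), 0)] = ts" using nth(2)[OF r] self by metis
   ultimately show ?thesis using L[of r] upd[OF r, of "rg r - 1"] dig_pred[of "rg r"]
    by - (rule ex_le_trans[of "2 * length (dig (rg r)) + 3"], auto simp: Dec ts_def[symmetric])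
  qed
 next
  case (Out x)
  have "step (ctm c R) (tst c (b # ks, 0), ts) = (tst c (ks, 0), ts[Suc R := (word_tape (u @ [x]), int (length u) + 1)])"
   by (simp only: ctm_step[OF in4]) (simp add: Out map2_upd1 nth word_tape_append)
  moreover have "ts[Suc R := (word_tape (u @ [x]), int (length u) + 1)] =
    (word_tape w, int k) # regs_tapes R rg @ [(word_tape (u @ [x]), int (length u) + 1)]"
   using list_update_append1
   by (simp add: ts_def list_update_append regs_tapes_def)
  ultimately show ?thesis using heads
   by (intro exI[of _ 1] conjI sr_step) (auto simp: ts_def Out add.commute)
 next
  case Adv
  show ?thesis
  proof (cases "k < length w")
   case True
   then have "step (ctm c R) (tst c (b # ks, 0), ts) = (tst c (ks, 0), ts[0 := (word_tape w, int k + 1)])"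
    by (simp only: ctm_step[OF in4]) (simp add: Adv map2_upd1 nth read word_tape_eq0 fun_upd_idem)
   moreover have "ts[0 := (word_tape w, int k + 1)] =
     (word_tape w, int k + 1) # regs_tapes R rg @ [(word_tape u, int (length u))]"
    by (simp add: ts_def)
   ultimately show ?thesis using heads True
    by (intro exI[of _ 1] conjI sr_step) (auto simp: ts_def Adv add.commute)
  next
   case False
   then show ?thesis using Adv read[of 0] nth(1) word_tape_eq0[of w k]
    by (intro quiet[of ks]) auto
  qed
 next
  case Rewind
  have "EX t<=length w + 2. sr (ctm c R) ?S t
    (tst c (Rewind # ks, 0), ts[0 := (word_tape w, int k)]) (tst c (ks, 0), ts[0 := (word_tape w, 0)])"
   using len heads b Rewind k by (intro rewind_tape[where L = "length w"]) (auto simp: cells_def)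
  moreover have "ts[0 := (word_tape w, int k)] = ts" using nth(1) self by metis
  moreover have "ts[0 := (word_tape w, 0)] =
     (word_tape w, 0) # regs_tapes R rg @ [(word_tape u, int (length u))]"
   by (simp add: ts_def)
  ultimately show ?thesis
   by - (rule ex_le_trans[of "length w + 2"], auto simp: Rewind ts_def[symmetric])
 qed
qed

definition crun :: "bool list => cmd => nat => cmd list \<times> cstate" where
 "crun w c i = (cstep w ^^ i) ([c], (%_. 0), 0, [])"

lemma cstep_cset: "fst C : cset c ==> fst (cstep w C) : cset c"
proof -
 assume C: "fst C : cset c"
 obtain ks rg k u where CC: "C = (ks, rg, k, u)" by (metis prod_cases4)
 show ?thesis
 proof (cases ks)
  case (Cons b l)
  then show ?thesis using C CC cset_succs[of b l c] by (cases b) auto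
 qed (use C CC in auto)
qed

lemma cstep_bounds:
 "case C of (ks, rg, k, u) => case cstep w C of (ks', rg', k', u') =>
   (ALL r. rg' r <= Suc (rg r)) & (k <= length w --> k' <= length w) & length u' <= Suc (length u)"
proof -
 obtain ks rg k u where CC: "C = (ks, rg, k, u)" by (metis prod_cases4)
 show ?thesis
 proof (cases ks)
  case (Cons b l)
  show ?thesis unfolding CC Cons by (cases b) auto
 qed (use CC in auto)
qed

lemma crun_inv:
 "case crun w c i of (ks, rg, k, u) => ks : cset c & (ALL r. rg r <= i) & k <= length w & length u <= i"
proof (induction i)
 case 0
 then show ?case using start_in[of c] by (auto simp: crun_def)
next
 case (Suc i)
 obtain ks rg k u where C: "crun w c i = (ks, rg, k, u)" by (metis prod_cases4)
 obtain ks' rg' k' u' where C': "cstep w (ks, rg, k, u) = (ks', rg', k', u')" by (metis prod_cases4)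
 have S: "crun w c (Suc i) = (ks', rg', k', u')" using C C' by (simp add: crun_def)
 have "ks' : cset c" using Suc C C' cstep_cset[where C = "(ks, rg, k, u)" and w = w and c = c] by simp
 moreover have "rg' r <= Suc i" for r
  using Suc C C' cstep_bounds[where C = "(ks, rg, k, u)" and w = w] by (auto intro: le_trans)
 ultimately show ?case
  using Suc C C' cstep_bounds[where C = "(ks, rg, k, u)" and w = w] unfolding S by auto
qed

text \<open>Time bounds space: a register gains at most 1 per command, so after fewer than 2^L
  commands its numeral still has fewer than \<open>L\<close> digits.\<close>

lemma ctm_sim:
 assumes R: "cregs c <= {..<R}" and L: "T < 2 ^ L" "L > 0"
  and U: "!!i. i <= T ==> length (snd (snd (snd (crun w c i)))) <= U"
  and "i <= T"
 shows "EX t <= i * (2 * L + length w + 4). sr (ctm c R) (cells R (length w) L U) t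
   (init_config (ctm c R) w) (cfg c R w (crun w c i))"
 using \<open>i <= T\<close>
proof (induction i)
 case 0
 have "regs_tapes R (%_. 0) = replicate R (word_tape [], 0)"
  by (rule nth_equalityI) (auto simp: regs_tapes_def)
 then have "init_config (ctm c R) w = cfg c R w (crun w c 0)"
  by (simp add: init_config_def crun_def replicate_append_same)
 then show ?case using sr_0 by auto
next
 case (Suc i)
 then obtain t where t: "t <= i * (2 * L + length w + 4)"
  and 1: "sr (ctm c R) (cells R (length w) L U) t (init_config (ctm c R) w) (cfg c R w (crun w c i))" by auto
 obtain ks rg k u where C: "crun w c i = (ks, rg, k, u)" by (metis prod_cases4)
 have next_run: "crun w c (Suc i) = cstep w (crun w c i)" by (simp add: crun_def)
 have inv: "ks : cset c" "!!r. rg r <= i" "k <= length w" using crun_inv[where w = w and c = c and i = i] C by auto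
 show ?case
 proof (cases ks)
  case Nil
  then show ?thesis using 1 t next_run C by (intro exI[of _ t]) auto
 next
  case (Cons b l)
  have dl: "length (dig (rg r)) < L" for r
  proof -
   have "rg r + 1 < 2 ^ Suc (L - 1)" using inv(2)[of r] Suc.prems L by simp
   from length_dig_le[OF this] show ?thesis using L(2) by simp
  qed
  obtain t' where "t' <= 2 * L + length w + 4"
   "sr (ctm c R) (cells R (length w) L U) t' (cfg c R w (crun w c i)) (cfg c R w (crun w c (Suc i)))"
   using ctm_sim_step[of b l c R k w rg L u U] inv dl R U[of i] Suc.prems Cons C next_run by auto
  then show ?thesis using sr_trans[OF 1] t by (intro exI[of _ "t + t'"]) auto
 qed
qed

lemma ctm_halt:
 assumes "fst C = tst c ([], 0)" "length (snd C) = R + 2"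
 shows "step (ctm c R) C = (if (case snd C ! 1 of (f, h) => f h) = 0 then 1 else 0, snd C)"
proof -
 have "([], 0) : cstates c" by (simp add: cset_def)
 from inv_into_f_f[OF inj_tst this] show ?thesis
  using tst_ge[of c "([], 0)"] assms
  by (auto simp: step_def halted_def ctm_def Let_def map2_keep)
qed

lemma run_Suc: "run M w (Suc n) = step M (run M w n)"
 by (simp add: run_def)

theorem ctm_correct:
 assumes R: "cregs c <= {..<R}" "0 < R" and L: "T < 2 ^ L" "L > 0"
  and U: "!!i. i <= T ==> length (snd (snd (snd (crun w c i)))) <= U"
  and fin: "crun w c T = ([], rg, k, u)"
 shows "EX t <= T * (2 * L + length w + 4) + 1.
   run (ctm c R) w t = (if rg 0 = 0 then 1 else 0, snd (cfg c R w ([], rg, k, u)))"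
  and "visited (ctm c R) w <= cells R (length w) L U"
proof -
 let ?M = "ctm c R"
 obtain t where t: "t <= T * (2 * L + length w + 4)"
  and 1: "sr ?M (cells R (length w) L U) t (init_config ?M w) (cfg c R w ([], rg, k, u))"
 proof -
  have "EX t <= T * (2 * L + length w + 4). sr ?M (cells R (length w) L U) t
    (init_config ?M w) (cfg c R w (crun w c T))"
   by (rule ctm_sim[OF R(1) L]) (use U in simp_all)
  then show thesis using that unfolding fin by blast
 qed
 have rt: "run ?M w t = cfg c R w ([], rg, k, u)" using 1 unfolding run_def sr_def by blast
 have "word_tape (dig (rg 0)) 0 = 0 \<longleftrightarrow> rg 0 = 0" using word_tape_eq0[of "dig (rg 0)" 0] by simp
 then have S: "run ?M w (Suc t) = (if rg 0 = 0 then 1 else 0, snd (cfg c R w ([], rg, k, u)))"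
  using ctm_halt[of "run ?M w t" c R] rt R(2) unfolding run_Suc
  by (simp add: regs_tapes_def nth_append)
 then show "EX t <= T * (2 * L + length w + 4) + 1.
   run ?M w t = (if rg 0 = 0 then 1 else 0, snd (cfg c R w ([], rg, k, u)))"
  using t by (intro exI[of _ "Suc t"]) auto
 have hl: "halted ?M (run ?M w (Suc t))" unfolding S by (simp add: halted_def)
 have stay: "run ?M w (Suc t + m) = run ?M w (Suc t)" for m
 proof (induction m)
  case (Suc m)
  have "run ?M w (Suc t + Suc m) = step ?M (run ?M w (Suc t + m))" by (simp only: run_Suc add_Suc_right)
  also have "... = run ?M w (Suc t)" unfolding Suc using hl by (simp only: step_def if_True)
  finally show ?case .
 qed simp
 have "k <= length w" "length u <= U" using crun_inv[where w = w and c = c and i = T] fin U[of T] by auto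
 then have fh: "(j, snd (snd (cfg c R w ([], rg, k, u)) ! j)) : cells R (length w) L U" if "j < R + 2" for j
 proof (cases j)
  case (Suc r)
  then show ?thesis using that \<open>length u <= U\<close> by (cases "r < R") (auto simp: cells_def regs_tapes_def nth_append)
 qed (use \<open>k <= length w\<close> in "auto simp: cells_def")
 show "visited ?M w <= cells R (length w) L U"
 proof
  fix x assume "x : visited ?M w"
  then obtain j n where x: "x = (j, snd (snd (run ?M w n) ! j))" "j < R + 2" by (auto simp: visited_def)
  consider "n < t" | "n = t" | "n > t" by linarith
  then show "x : cells R (length w) L U"
  proof cases
   case 1
   then show ?thesis using \<open>sr _ _ _ _ _\<close> x by (auto simp: sr_def run_def)
  next
   case 2
   then show ?thesis using x rt fh by simp
  next
   case 3
   then have "n = Suc t + (n - Suc t)" by simp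
   then have "snd (run ?M w n) = snd (cfg c R w ([], rg, k, u))" using stay S by (metis snd_conv)
   then show ?thesis using x fh by simp
  qed
 qed
qed

subsection \<open>Executions of counter programs\<close>

text \<open>The quantifier over the rest \<open>ks\<close> of the stack makes executions compose:
  the command is run in front of any continuation and leaves exactly that continuation.\<close>

definition rn :: "bool list => cmd => cstate => nat => cstate => bool" where
 "rn w c s K s' \<longleftrightarrow> (EX t <= K. ALL ks. (cstep w ^^ t) (c # ks, s) = (ks, s'))"

lemma rn_mono: "rn w c s K s' ==> K <= K' ==> rn w c s K' s'"
 unfolding rn_def by (meson order_trans)

lemma rn_1:
 assumes "!!ks. cstep w (c # ks, s) = (ks, s')" "1 <= K"
 shows "rn w c s K s'"
 unfolding rn_def using assms by (intro exI[of _ 1]) simp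

lemma rn_pre:
 assumes "!!ks. cstep w (c # ks, s) = (c' # ks, s)" "rn w c' s K s'" "K < K'"
 shows "rn w c s K' s'"
proof -
 from assms(2) obtain t where t: "t <= K" "!!ks. (cstep w ^^ t) (c' # ks, s) = (ks, s')"
  unfolding rn_def by blast
 have "(cstep w ^^ Suc t) (c # ks, s) = (ks, s')" for ks
  using t(2) assms(1) by (simp only: funpow_Suc_right o_apply)
 then show ?thesis unfolding rn_def using t(1) assms(3) by (intro exI[of _ "Suc t"]) auto
qed

lemma rn_pre2:
 assumes "!!ks. cstep w (c # ks, s) = (a # b # ks, s)" "rn w a s K s1" "rn w b s1 K' s'" "K + K' < K''"
 shows "rn w c s K'' s'"
proof -
 from assms(2) obtain t where t: "t <= K" "!!ks. (cstep w ^^ t) (a # ks, s) = (ks, s1)"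
  unfolding rn_def by blast
 from assms(3) obtain t' where t': "t' <= K'" "!!ks. (cstep w ^^ t') (b # ks, s1) = (ks, s')"
  unfolding rn_def by blast
 have "(cstep w ^^ (t' + Suc t)) (c # ks, s) = (ks, s')" for ks
  using t(2)[of "b # ks"] t'(2) assms(1) by (simp only: funpow_add funpow_Suc_right o_apply)
 then show ?thesis unfolding rn_def using t(1) t'(1) assms(4) by (intro exI[of _ "t' + Suc t"]) auto
qed

lemma rn_Sq: "rn w a s K s1 ==> rn w b s1 K' s' ==> K + K' < K'' ==> rn w (Sq a b) s K'' s'"
 by (rule rn_pre2[of w _ s a b]) auto

lemma rn_Ite: "rn w (if holds w c s then a else b) s K s' ==> K < K' ==> rn w (Ite c a b) s K' s'"
 by (rule rn_pre[of w _ s "if holds w c s then a else b"]) auto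

lemma rn_Until_stop: "holds w c s ==> 1 <= K ==> rn w (Until c a) s K s"
 by (rule rn_1) auto

lemma rn_Until_step:
 "~ holds w c s ==> rn w a s K s1 ==> rn w (Until c a) s1 K' s' ==> K + K' < K'' ==> rn w (Until c a) s K'' s'"
 by (rule rn_pre2[of w _ s a "Until c a"]) auto

lemma rn_loop:
 assumes "!!i. i < n ==> ~ holds w c (sg i)" "!!i. i < n ==> rn w a (sg i) K (sg (Suc i))"
  "holds w c (sg n)" "n * (K + 1) + 1 <= K'"
 shows "rn w (Until c a) (sg 0) K' (sg n)"
proof -
 have "rn w (Until c a) (sg (n - i)) (i * (K + 1) + 1) (sg n)" if "i <= n" for i
  using that
 proof (induction i)
  case 0
  then show ?case using assms(3) by (simp add: rn_Until_stop)
 next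
  case (Suc i)
  then have "Suc (n - Suc i) = n - i" by simp
  then show ?case using assms(1,2)[of "n - Suc i"] Suc
   by - (rule rn_Until_step[of w c _ a K "sg (n - i)" "i * (K + 1) + 1"], auto)
 qed
 from this[of n] show ?thesis using assms(4) rn_mono by simp
qed

lemma rn_Skip: "1 <= K ==> rn w Skip s K s"
 by (rule rn_1) (cases s; simp)+

lemma rn_Inc: "1 <= K ==> rn w (Inc r) (rg, z) K (rg(r := Suc (rg r)), z)"
 by (rule rn_1) (cases z; simp)+

lemma rn_Dec: "1 <= K ==> rn w (Dec r) (rg, z) K (rg(r := rg r - 1), z)"
 by (rule rn_1) (cases z; simp)+

lemma cstep_value: "fst (snd ((cstep w ^^ t) C)) r <= fst (snd C) r + t"
proof (induction t)
 case (Suc t)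
 obtain ks rg1 k u where C: "(cstep w ^^ t) C = (ks, rg1, k, u)" by (metis prod_cases4)
 obtain ks' rg' k' u' where C': "cstep w (ks, rg1, k, u) = (ks', rg', k', u')" by (metis prod_cases4)
 have "rg' r <= Suc (rg1 r)" using cstep_bounds[where C = "(ks, rg1, k, u)" and w = w] C' by simp
 then show ?case using Suc C C' by simp
qed simp

text \<open>Programs that touch registers only. Their effect is the same for every word and every
  output, and they are the programs that can be turned into a net.\<close>

fun pure :: "cmd => bool" where
 "pure (Sq a b) = (pure a & pure b)"
| "pure (Ite c a b) = ((EX r. c = Zero r) & pure a & pure b)"
| "pure (Until c a) = ((EX r. c = Zero r) & pure a)"
| "pure Skip = True"
| "pure (Inc r) = True"
| "pure (Dec r) = True"
| "pure _ = False"

definition ex :: "cmd => (nat => nat) => nat => (nat => nat) => bool" where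
 "ex c rg K rg' \<longleftrightarrow> (ALL w z. rn w c (rg, z) K (rg', z))"

lemma ex_rn: "ex c rg K rg' ==> rn w c (rg, z) K (rg', z)"
 unfolding ex_def by blast

lemma ex_mono: "ex c rg K rg' ==> K <= K' ==> ex c rg K' rg'"
 unfolding ex_def by (blast intro: rn_mono)

lemma ex_Sq: "ex a rg K rg1 ==> ex b rg1 K' rg' ==> K + K' < K'' ==> ex (Sq a b) rg K'' rg'"
 unfolding ex_def by (blast intro: rn_Sq)

lemma ex_Sq1: "ex a rg K rg1 ==> ex b rg1 K' rg' ==> ex (Sq a b) rg (K + K' + 1) rg'"
 by (rule ex_Sq) auto

lemma ex_loop:
 assumes "!!i. i < n ==> sg i r ~= 0" "!!i. i < n ==> ex a (sg i) K (sg (Suc i))"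
  "sg n r = 0" "n * (K + 1) + 1 <= K'"
 shows "ex (Until (Zero r) a) (sg 0) K' (sg n)"
 unfolding ex_def
proof (intro allI)
 fix w and z :: "nat \<times> bool list"
 show "rn w (Until (Zero r) a) (sg 0, z) K' (sg n, z)"
  using assms by (intro rn_loop[where sg = "%i. (sg i, z)" and n = n and K = K]) (cases z; auto simp: ex_def)+
qed

lemma ex_Inc: "1 <= K ==> ex (Inc r) rg K (rg(r := Suc (rg r)))"
 unfolding ex_def by (intro allI rn_Inc)

lemma ex_Dec: "1 <= K ==> ex (Dec r) rg K (rg(r := rg r - 1))"
 unfolding ex_def by (intro allI rn_Dec)

lemma ex_Skip: "1 <= K ==> ex Skip rg K rg"
 unfolding ex_def by (intro allI rn_Skip)

definition clear :: "nat => cmd" where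
 "clear r = Until (Zero r) (Dec r)"

lemma pure_clear [simp]: "pure (clear r)"
 by (simp add: clear_def)

lemma ex_clear: assumes "2 * rg r + 1 <= K" shows "ex (clear r) rg K (rg(r := 0))"
proof -
 define sg where "sg i = rg(r := rg r - i)" for i
 have "ex (Dec r) (sg i) 1 (sg (Suc i))" for i
  using ex_Dec[of 1 r "sg i"] by (simp add: sg_def)
 then have "ex (clear r) (sg 0) K (sg (rg r))"
  unfolding clear_def using assms
  by - (rule ex_loop[where K = 1]; (assumption | simp add: sg_def))
 then show ?thesis by (simp add: sg_def)
qed

definition transfer :: "nat => nat => cmd" where
 "transfer r s = Until (Zero r) (Sq (Dec r) (Inc s))"

lemma pure_transfer [simp]: "pure (transfer r s)"
 by (simp add: transfer_def)

lemma ex_transfer: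
 assumes "r ~= s" "4 * rg r + 1 <= K"
 shows "ex (transfer r s) rg K (rg(r := 0, s := rg s + rg r))"
proof -
 define sg where "sg i = rg(r := rg r - i, s := rg s + i)" for i
 have "ex (Sq (Dec r) (Inc s)) (sg i) 3 (sg (Suc i))" for i
 proof (rule ex_Sq)
  show "ex (Dec r) (sg i) 1 ((sg i)(r := sg i r - 1))" by (rule ex_Dec) simp
  have "sg (Suc i) = ((sg i)(r := sg i r - 1))(s := Suc (((sg i)(r := sg i r - 1)) s))"
   using assms(1) by (auto simp: sg_def fun_eq_iff)
  then show "ex (Inc s) ((sg i)(r := sg i r - 1)) 1 (sg (Suc i))" by (simp only:) (rule ex_Inc, simp)
 qed simp
 then have "ex (transfer r s) (sg 0) K (sg (rg r))"
  unfolding transfer_def using assms(2)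
  by - (rule ex_loop[where K = 3]; (assumption | simp add: sg_def assms(1)))
 then show ?thesis by (simp add: sg_def fun_upd_idem)
qed

text \<open>Reading a register empties it, so a second copy is made in \<open>t\<close>, from which
  \<open>j\<close> is restored.\<close>

definition copy :: "nat => nat => nat => cmd" where
 "copy j s t = Sq (Until (Zero j) (Sq (Dec j) (Sq (Inc s) (Inc t)))) (transfer t j)"

lemma pure_copy [simp]: "pure (copy j s t)"
 by (simp add: copy_def)

lemma ex_copy:
 assumes "j ~= s" "j ~= t" "s ~= t" "rg t = 0" "10 * rg j + 4 <= K"
 shows "ex (copy j s t) rg K (rg(s := rg s + rg j))"
proof -
 define sg where "sg i = rg(j := rg j - i, s := rg s + i, t := i)" for i
 have 1: "ex (Sq (Dec j) (Sq (Inc s) (Inc t))) (sg i) 5 (sg (Suc i))" for i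
 proof -
  let ?a = "(sg i)(j := sg i j - 1)" let ?b = "?a(s := Suc (?a s))"
  have "sg (Suc i) = ?b(t := Suc (?b t))" using assms(1-3) by (auto simp: sg_def fun_eq_iff)
  then show ?thesis
   by (simp only:) (rule ex_Sq[OF ex_Dec[of 1] ex_Sq[OF ex_Inc[of 1] ex_Inc[of 1], of 3]], simp_all)
 qed
 have "ex (Until (Zero j) (Sq (Dec j) (Sq (Inc s) (Inc t)))) (sg 0) (6 * rg j + 1) (sg (rg j))"
  by (rule ex_loop[where K = 5]; (rule 1 | simp add: sg_def assms))
 moreover have "sg 0 = rg" using assms by (auto simp: sg_def)
 moreover have "ex (transfer t j) (sg (rg j)) (4 * rg j + 1) ((sg (rg j))(t := 0, j := sg (rg j) j + sg (rg j) t))"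
  using assms by (intro ex_transfer) (auto simp: sg_def)
 moreover have "(sg (rg j))(t := 0, j := sg (rg j) j + sg (rg j) t) = rg(s := rg s + rg j)"
  using assms by (auto simp: sg_def fun_eq_iff)
 ultimately show ?thesis unfolding copy_def using assms(5) by (auto intro: ex_Sq)
qed

subsection \<open>Polynomially bounded functions\<close>

text \<open>The base is at least 2, so that constants and coefficients can be absorbed into the
  exponent and the class is closed under sums, products and composition.\<close>

definition pb :: "(nat list => nat) => bool" where
 "pb T \<longleftrightarrow> (EX q. ALL e. T e <= (sum_list e + 2) ^ q)"

lemma pb_le: "pb T ==> (!!e. T' e <= T e) ==> pb T'"
 unfolding pb_def by (meson order_trans)

lemma less_two_power: "n < (2::nat) ^ n"
 by (rule less_exp)

lemma pb_const: "pb (%e. k)"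
 unfolding pb_def
proof (intro exI allI)
 fix e :: "nat list"
 have "k <= 2 ^ k" using less_two_power[of k] by simp
 also have "... <= (sum_list e + 2) ^ k" by (rule power_mono) auto
 finally show "k <= (sum_list e + 2) ^ k" .
qed

lemma pb_sum: "pb sum_list"
 unfolding pb_def by (intro exI[of _ 1]) simp

lemma pb_mult: assumes "pb f" "pb g" shows "pb (%e. f e * g e)"
proof -
 obtain q q' where "!!e. f e <= (sum_list e + 2) ^ q" "!!e. g e <= (sum_list e + 2) ^ q'"
  using assms unfolding pb_def by blast
 then show ?thesis unfolding pb_def
  by (intro exI[of _ "q + q'"]) (simp add: power_add mult_le_mono)
qed

lemma pb_add: assumes "pb f" "pb g" shows "pb (%e. f e + g e)"
proof -
 have "pb (%e. 2 * ((f e + 1) * (g e + 1)))" if "pb (%e. f e + 1)" "pb (%e. g e + 1)"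
  by (intro pb_mult pb_const that)
 moreover have "pb (%e. h e + 1)" if h: "pb h" for h
 proof -
  obtain q where q: "!!e. h e <= (sum_list e + 2) ^ q" using h unfolding pb_def by blast
  have "h e + 1 <= (sum_list e + 2) ^ Suc q" for e
  proof -
   have "(1::nat) <= (sum_list e + 2) ^ q" by simp
   moreover have "2 * (sum_list e + 2) ^ q <= (sum_list e + 2) ^ Suc q" by simp
   ultimately show ?thesis using q[of e] by linarith
  qed
  then show ?thesis unfolding pb_def by blast
 qed
 ultimately have "pb (%e. 2 * ((f e + 1) * (g e + 1)))" using assms by blast
 then show ?thesis by (rule pb_le) (simp add: algebra_simps)
qed

lemma pb_comp:
 assumes "pb T" "pb g" "!!e. sum_list (G e) <= g e"
 shows "pb (%e. T (G e))"
proof -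
 obtain q where q: "!!e. T e <= (sum_list e + 2) ^ q" using assms(1) unfolding pb_def by blast
 have "pb (%e. g e + 2)" by (intro pb_add pb_const assms)
 then obtain q' where q': "!!e. g e + 2 <= (sum_list e + 2) ^ q'" unfolding pb_def by blast
 have "T (G e) <= (sum_list e + 2) ^ (q' * q)" for e
 proof -
  have "T (G e) <= (sum_list (G e) + 2) ^ q" by (rule q)
  also have "... <= (g e + 2) ^ q" by (intro power_mono) (use assms(3)[of e] in auto)
  also have "... <= ((sum_list e + 2) ^ q') ^ q" by (intro power_mono q') auto
  finally show ?thesis by (simp add: power_mult)
 qed
 then show ?thesis unfolding pb_def by blast
qed

lemma pb_power: "pb f ==> pb (%e. f e ^ q)"
 by (induction q) (simp_all add: pb_const pb_mult)

lemmas pb_intros = pb_const pb_sum pb_add pb_mult pb_power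

subsection \<open>Functions computable by pure programs in polynomial time\<close>

text \<open>The registers from \<open>s\<close> on form a stack. They are empty before the call and,
  except for the result in \<open>s\<close>, empty again afterwards; a program with a result in
  \<open>s\<close> may therefore call another one that starts at a larger number.\<close>

definition computes :: "cmd => nat list => nat => (nat list => nat) => (nat list => nat) => bool" where
 "computes c js s f T \<longleftrightarrow> pure c & pb T &
   (ALL rg. (ALL i>=s. rg i = 0) --> ex c rg (T (map rg js)) (rg(s := f (map rg js))))"

text \<open>Time is measured in the values and not in the lengths of the arguments, so a loop that
  runs up to an argument is allowed. The value itself must be polynomially bounded too, as it
  becomes an argument of further functions.\<close>

definition LS :: "(nat list => nat) => bool" where
 "LS f \<longleftrightarrow> pb f & (ALL js s. (ALL j : set js. j < s) --> (EX c T. computes c js s f T))"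

lemma LS_D:
 assumes "LS f" "ALL j : set js. j < s"
 obtains c T where "pure c" "pb T" "!!rg. ALL i>=s. rg i = 0 ==> ex c rg (T (map rg js)) (rg(s := f (map rg js)))"
 using assms unfolding LS_def computes_def by blast

lemma LS_I: "pb f ==> (!!js s. ALL j : set js. j < s ==> EX c T. computes c js s f T) ==> LS f"
 unfolding LS_def by blast

lemma computes_I: "pure c ==> pb T ==>
  (!!rg. ALL i>=s. rg i = 0 ==> ex c rg (T (map rg js)) (rg(s := f (map rg js)))) ==> EX c T. computes c js s f T"
 unfolding computes_def by blast

lemma LS_pb: "LS f ==> pb f"
 by (simp add: LS_def)

lemma LS_Suc: assumes "LS a" shows "LS (%e. Suc (a e))"
proof (rule LS_I, goal_cases)
 case 1
 show ?case using pb_add[OF LS_pb[OF assms] pb_const[of 1]] by simp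
next
 case (2 js s)
 obtain c T where c: "pure c" "pb T"
  "!!rg. ALL i>=s. rg i = 0 ==> ex c rg (T (map rg js)) (rg(s := a (map rg js)))"
  using LS_D[OF assms 2] by blast
 show ?case
  by (rule computes_I[of "Sq c (Inc s)" "%e. T e + 2"]) (use c ex_Sq[OF c(3) ex_Inc[of 1 s]] pb_add[OF c(2) pb_const[of 2]] in simp_all)
qed

lemma LS_const: "LS (%e. k)"
proof (induction k)
 case 0
 show ?case
  by (rule LS_I[OF pb_const], rule computes_I[of Skip "%_. 1"]) (simp_all add: pb_const ex_Skip fun_upd_idem)
qed (rule LS_Suc)

lemma pb_hd: "pb hd"
 by (rule pb_le[OF pb_add[OF pb_const[of "hd []"] pb_sum]]) (case_tac e; simp)

lemma LS_hd: "LS hd"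
proof (rule LS_I[OF pb_hd])
 fix js :: "nat list" and s
 assume js: "ALL j : set js. j < s"
 show "EX c T. computes c js s hd T"
 proof (cases js)
  case Nil
  obtain c T where "computes c js s (%_. hd []) T" using LS_const[of "hd []"] js unfolding LS_def by blast
  then show ?thesis unfolding computes_def Nil by auto
 next
  case (Cons j l)
  show ?thesis
  proof (rule computes_I[of "copy j s (Suc s)" "%e. 10 * sum_list e + 4"])
   show "ex (copy j s (Suc s)) rg (10 * sum_list (map rg js) + 4) (rg(s := hd (map rg js)))" if "ALL i>=s. rg i = 0" for rg
    using ex_copy[of j s "Suc s" rg "10 * sum_list (map rg js) + 4"] that js Cons by simp
  qed (simp_all add: pb_intros)
 qed
qed

lemma sum_list_tl: "sum_list (tl e) <= sum_list (e :: nat list)"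
 by (cases e) auto

lemma LS_tl: assumes "LS f" shows "LS (%e. f (tl e))"
proof (rule LS_I[OF pb_comp[OF LS_pb[OF assms] pb_sum sum_list_tl]])
 fix js :: "nat list" and s
 assume "ALL j : set js. j < s"
 then have "ALL j : set (tl js). j < s" by (cases js) auto
 from LS_D[OF assms this] obtain c T where c: "pure c" "pb T"
  "!!rg. ALL i>=s. rg i = 0 ==> ex c rg (T (map rg (tl js))) (rg(s := f (map rg (tl js))))" by blast
 then show "EX c T. computes c js s (%e. f (tl e)) T"
  using pb_comp[OF c(2) pb_sum sum_list_tl] by (intro computes_I[of c "%e. T (tl e)"]) (simp_all add: map_tl)
qed

text \<open>Environments are lists with de Bruijn indices: the value of \<open>a\<close> is pushed
  in front and is \<open>hd e\<close> for the body. On the registers the value sits in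
  \<open>s\<close> while the body runs from \<open>Suc s\<close> on; then its result is moved
  down.\<close>

lemma LS_let:
 assumes "LS a" "LS (%e. F (hd e) (tl e))"
 shows "LS (%e. F (a e) e)"
proof -
 have pbG: "pb (%e. G (a e # e))" if "pb G" for G
  using pb_comp[OF that pb_add[OF LS_pb[OF assms(1)] pb_sum], of "%e. a e # e"] by simp
 have pbF: "pb (%e. F (a e) e)" using pbG[OF LS_pb[OF assms(2)]] by simp
 show ?thesis
 proof (rule LS_I[OF pbF])
 fix js :: "nat list" and s
 assume js: "ALL j : set js. j < s"
 obtain c T where c: "pure c" "pb T"
  "!!rg. ALL i>=s. rg i = 0 ==> ex c rg (T (map rg js)) (rg(s := a (map rg js)))"
  using LS_D[OF assms(1) js] by blast
 have "ALL j : set (s # js). j < Suc s" using js by auto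
 from LS_D[OF assms(2) this] obtain c' T' where c': "pure c'" "pb T'"
  "!!rg. ALL i>=Suc s. rg i = 0 ==> ex c' rg (T' (map rg (s # js))) (rg(Suc s := F (rg s) (map rg js)))"
  by auto
 let ?c = "Sq c (Sq c' (Sq (clear s) (transfer (Suc s) s)))"
 let ?T = "%e. T e + (T' (a e # e) + ((2 * a e + 1) + (4 * F (a e) e + 1) + 1) + 1) + 1"
 have "ex ?c rg (?T (map rg js)) (rg(s := F (a (map rg js)) (map rg js)))" if z: "ALL i>=s. rg i = 0" for rg
 proof -
  let ?e = "map rg js"
  have m: "map (rg(s := v)) js = ?e" for v using js by auto
  have 2: "ex c' (rg(s := a ?e)) (T' (a ?e # ?e)) (rg(s := a ?e, Suc s := F (a ?e) ?e))"
   using c'(3)[of "rg(s := a ?e)"] z m by simp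
  have 3: "ex (clear s) (rg(s := a ?e, Suc s := F (a ?e) ?e)) (2 * a ?e + 1) (rg(s := 0, Suc s := F (a ?e) ?e))"
   using ex_clear[of "rg(s := a ?e, Suc s := F (a ?e) ?e)" s "2 * a ?e + 1"] by (simp add: fun_upd_twist)
  have "(rg(s := 0, Suc s := F (a ?e) ?e))(Suc s := 0, s := F (a ?e) ?e) = rg(s := F (a ?e) ?e)"
   using z by (auto simp: fun_eq_iff)
  then have 4: "ex (transfer (Suc s) s) (rg(s := 0, Suc s := F (a ?e) ?e)) (4 * F (a ?e) ?e + 1) (rg(s := F (a ?e) ?e))"
   using ex_transfer[of "Suc s" s "rg(s := 0, Suc s := F (a ?e) ?e)" "4 * F (a ?e) ?e + 1"] by simp
  show ?thesis
   by (rule ex_mono[OF ex_Sq1[OF c(3)[OF z] ex_Sq1[OF 2 ex_Sq1[OF 3 4]]]]) simp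
 qed
 moreover have "pb ?T" by (intro pb_intros c pbG c' LS_pb[OF assms(1)] pbF)
 ultimately show "EX c T. computes c js s (%e. F (a e) e) T"
  using c(1) c'(1) by (intro computes_I[of ?c ?T]) simp_all
 qed
qed

text \<open>Limited recursion: the bound \<open>B\<close> on all intermediate values keeps the total
  time polynomial. Register \<open>s\<close> holds the accumulator, \<open>s + 1\<close> the index,
  \<open>s + 2\<close> the number of passes left, and the step function delivers into
  \<open>s + 3\<close>. The step sees the accumulator and the index as the two front entries of its
  environment.\<close>

lemma LS_rec:
 assumes "LS n" "LS a" "LS (%e. h (hd e) (hd (tl e)) (tl (tl e)))" "pb B"
  and B: "!!e i. i <= n e ==> rec_nat (a e) (%i r. h r i e) i <= B e"
 shows "LS (%e. rec_nat (a e) (%i r. h r i e) (n e))"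
proof (rule LS_I)
 show "pb (%e. rec_nat (a e) (%i r. h r i e) (n e))" using pb_le[OF assms(4)] B by simp
 fix js :: "nat list" and s
 assume js: "ALL j : set js. j < s"
 obtain c T where c: "pure c" "pb T"
  "!!rg. ALL i>=s. rg i = 0 ==> ex c rg (T (map rg js)) (rg(s := a (map rg js)))"
  using LS_D[OF assms(2) js] by blast
 have "ALL j : set js. j < s + 2" using js by auto
 from LS_D[OF assms(1) this] obtain cn Tn where cn: "pure cn" "pb Tn"
  "!!rg. ALL i>=s+2. rg i = 0 ==> ex cn rg (Tn (map rg js)) (rg(s + 2 := n (map rg js)))"
  by blast
 have "ALL j : set (s # (s + 1) # js). j < s + 3" using js by auto
 from LS_D[OF assms(3) this] obtain ch Th where ch: "pure ch" "pb Th"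
  "!!rg. ALL i>=s+3. rg i = 0 ==> ex ch rg (Th (rg s # rg (s + 1) # map rg js)) (rg(s + 3 := h (rg s) (rg (s + 1)) (map rg js)))"
  by auto
 obtain q where q: "!!e. Th e <= (sum_list e + 2) ^ q" using ch(2) unfolding pb_def by blast
 \<comment> \<open>One pass: the step function on bounded arguments, clearing the old accumulator
   (twice its value) and moving the new one down (four times its value).\<close>
 define K where "K e = (B e + n e + sum_list e + 2) ^ q + 6 * B e + 10" for e
 have pbK: "pb K" unfolding K_def by (intro pb_intros assms(4) LS_pb[OF assms(1)])
 let ?body = "Sq (Dec (s + 2)) (Sq ch (Sq (clear s) (Sq (transfer (s + 3) s) (Inc (s + 1)))))"
 let ?c = "Sq c (Sq cn (Sq (Until (Zero (s + 2)) ?body) (clear (s + 1))))"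
 let ?T = "%e. T e + (Tn e + ((n e * (K e + 1) + 1) + (2 * n e + 1) + 1) + 1) + 1"
 have "ex ?c rg (?T (map rg js))
   (rg(s := rec_nat (a (map rg js)) (%i r. h r i (map rg js)) (n (map rg js))))" if z: "ALL i>=s. rg i = 0" for rg
 proof -
  define e where "e = map rg js"
  define r where "r = rec_nat (a e) (%i r. h r i e)"
  define sg where "sg i = rg(s := r i, s + 1 := i, s + 2 := n e - i)" for i
  have m: "map (sg i) js = e" "map ((sg i)(s + 2 := v)) js = e" for i v
   using js by (auto simp: sg_def e_def)
  have rB: "r i <= B e" if "i <= n e" for i using B[OF that] by (simp add: r_def)
  have 1: "ex ?body (sg i) (K e) (sg (Suc i))" if i: "i < n e" for i
  proof -
   let ?r1 = "(sg i)(s + 2 := n e - Suc i)"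
   have 1: "ex (Dec (s + 2)) (sg i) 1 ?r1"
    using ex_Dec[of 1 "s + 2" "sg i"] by (simp add: sg_def)
   have "ex ch ?r1 (Th (?r1 s # ?r1 (s + 1) # map ?r1 js)) (?r1(s + 3 := h (?r1 s) (?r1 (s + 1)) (map ?r1 js)))"
    by (rule ch(3)) (use z in "auto simp: sg_def")
   moreover have "?r1 s = r i" "?r1 (s + 1) = i" by (simp_all add: sg_def)
   ultimately have 2: "ex ch ?r1 (Th (r i # i # e)) (?r1(s + 3 := r (Suc i)))"
    by (simp only: m(2)) (simp add: r_def)
   have 3: "ex (clear s) (?r1(s + 3 := r (Suc i))) (2 * r i + 1) (?r1(s + 3 := r (Suc i), s := 0))"
    by (rule ex_clear) (simp add: sg_def)
   have 4: "ex (transfer (s + 3) s) (?r1(s + 3 := r (Suc i), s := 0)) (4 * r (Suc i) + 1)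
     (?r1(s + 3 := 0, s := r (Suc i)))"
    using ex_transfer[of "s + 3" s "?r1(s + 3 := r (Suc i), s := 0)" "4 * r (Suc i) + 1"]
    by (simp add: fun_upd_twist)
   have "?r1(s + 3 := 0, s := r (Suc i), s + 1 := Suc i) = sg (Suc i)"
    using z by (auto simp: sg_def fun_eq_iff)
   then have 5: "ex (Inc (s + 1)) (?r1(s + 3 := 0, s := r (Suc i))) 1 (sg (Suc i))"
    using ex_Inc[of 1 "s + 1" "?r1(s + 3 := 0, s := r (Suc i))"] by (simp add: sg_def)
   have "Th (r i # i # e) <= (sum_list (r i # i # e) + 2) ^ q" by (rule q)
   also have "... <= (B e + n e + sum_list e + 2) ^ q"
    using rB[of i] i by (intro power_mono) auto
   finally have "1 + (Th (r i # i # e) + ((2 * r i + 1) + ((4 * r (Suc i) + 1) + 1 + 1) + 1) + 1) < K e"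
    using rB[of i] rB[of "Suc i"] i by (simp add: K_def)
   then show ?thesis
    by - (rule ex_mono[OF ex_Sq1[OF 1 ex_Sq1[OF 2 ex_Sq1[OF 3 ex_Sq1[OF 4 5]]]]], simp)
  qed
  have s0: "rg(s := a e, s + 2 := n e) = sg 0" using z by (auto simp: sg_def r_def fun_eq_iff)
  have "map (rg(s := a e)) js = e" using js by (auto simp: e_def)
  then have 2: "ex cn (rg(s := a e)) (Tn e) (sg 0)"
   using cn(3)[of "rg(s := a e)"] z s0 by simp
  have 3: "ex (Until (Zero (s + 2)) ?body) (sg 0) (n e * (K e + 1) + 1) (sg (n e))"
   by (rule ex_loop[where K = "K e"]; (rule 1, assumption | simp add: sg_def))
  have "(sg (n e))(s + 1 := 0) = rg(s := r (n e))" using z by (auto simp: sg_def fun_eq_iff)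
  then have 4: "ex (clear (s + 1)) (sg (n e)) (2 * n e + 1) (rg(s := r (n e)))"
   using ex_clear[of "sg (n e)" "s + 1" "2 * n e + 1"] by (simp add: sg_def)
  have "ex c rg (T e) (rg(s := a e))" using c(3)[OF z] by (simp add: e_def)
  from ex_Sq1[OF this ex_Sq1[OF 2 ex_Sq1[OF 3 4]]] show ?thesis unfolding e_def[symmetric] r_def[symmetric] .
 qed
 moreover have "pb ?T" by (intro pb_intros c cn pbK LS_pb[OF assms(1)])
 ultimately show "EX c T. computes c js s (%e. rec_nat (a e) (%i r. h r i e) (n e)) T"
  using c(1) cn(1) ch(1) by (intro computes_I[of ?c ?T]) simp_all
qed

subsection \<open>Closure properties\<close>

text \<open>The tested number is the length of a recursion whose step ignores the accumulator; such
  a recursion returns its base value only if it has length 0.\<close>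

lemma LS_if:
 assumes "LS p" "LS f" "LS g"
 shows "LS (%e. if p e = 0 then g e else f e)"
proof -
 have r: "rec_nat y (%i r. x) n = (if n = 0 then y else x)" for x y n :: nat by (cases n) auto
 have "LS (%e. rec_nat (g e) (%i r. f e) (p e))"
  by (rule LS_rec[where h = "%r i. f" and B = "%e. f e + g e"])
   (use assms LS_tl[OF LS_tl[OF assms(2)]] in "simp_all add: r pb_add LS_pb")
 then show ?thesis by (simp only: r)
qed

named_theorems LS_intro

text \<open>The first twelve de Bruijn variables, deep enough for the nested quantifiers and sums
  that occur later.\<close>

lemmas LS_var1 = LS_hd LS_hd[THEN LS_tl] LS_hd[THEN LS_tl, THEN LS_tl] LS_hd[THEN LS_tl, THEN LS_tl, THEN LS_tl]
lemmas LS_var2 = LS_var1[THEN LS_tl, THEN LS_tl, THEN LS_tl, THEN LS_tl]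
lemmas LS_var3 = LS_var2[THEN LS_tl, THEN LS_tl, THEN LS_tl, THEN LS_tl]

declare LS_var1 [LS_intro] LS_var2 [LS_intro] LS_var3 [LS_intro] LS_const [LS_intro] LS_Suc [LS_intro]

lemma LS_tl2: "LS f ==> LS (%e. f (tl (tl e)))"
 by (rule LS_tl[OF LS_tl, of f])

lemma LS_subst1: "LS (%e. F (hd e)) ==> LS a ==> LS (%e. F (a e))"
 by (rule LS_let[where F = "%x e. F x"])

text \<open>The variables of the core function are listed in reverse, since the arguments are pushed one by one.\<close>

lemma LS_subst3:
 assumes F: "LS (%e. F (hd (tl (tl e))) (hd (tl e)) (hd e))" and "LS a" "LS b" "LS c"
 shows "LS (%e. F (a e) (b e) (c e))"
proof -
 have "LS (%e. F (hd (tl e)) (hd e) (c (tl (tl e))))"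
  using LS_let[OF LS_tl2[OF assms(4)], where F = "%y e. F (hd (tl e)) (hd e) y"] F by simp
 then have "LS (%e. F (hd e) (b (tl e)) (c (tl e)))"
  using LS_let[OF LS_tl[OF assms(3)], where F = "%y e. F (hd e) y (c (tl e))"] by simp
 then show ?thesis using LS_let[OF assms(2), where F = "%x e. F x (b e) (c e)"] by simp
qed

lemma LS_pred: assumes "LS a" shows "LS (%e. a e - Suc 0)"
proof -
 have "LS (%e. rec_nat 0 (%i r. i) (a e))"
 proof (rule LS_rec[where h = "%r i e. i" and a = "%e. 0" and B = a])
  fix e i assume "i <= a e"
  then show "rec_nat 0 (%i r. i) i <= a e" by (cases i) auto
 qed (use assms LS_pb in "auto intro: LS_intro")
 moreover have "rec_nat 0 (%i r. i) n = n - Suc 0" for n by (cases n) auto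
 ultimately show ?thesis by simp
qed

lemma LS_sub [LS_intro]: assumes "LS a" "LS b" shows "LS (%e. a e - b e)"
proof -
 have r: "rec_nat x (%i r. r - Suc 0) n = x - n" for x n by (induction n) auto
 have "LS (%e. rec_nat (a e) (%i r. r - Suc 0) (b e))"
  by (rule LS_rec[where h = "%r i e. r - Suc 0" and B = a])
   (use assms LS_pb r in "auto intro: LS_intro LS_pred")
 then show ?thesis by (simp add: r)
qed

lemma LS_add [LS_intro]: assumes "LS a" "LS b" shows "LS (%e. a e + b e)"
proof -
 have r: "rec_nat x (%i r. Suc r) n = x + n" for x n by (induction n) auto
 have "LS (%e. rec_nat (a e) (%i r. Suc r) (b e))"
  by (rule LS_rec[where h = "%r i e. Suc r" and B = "%e. a e + b e"])
   (use assms LS_pb r in "auto intro: LS_intro pb_add")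
 then show ?thesis by (simp add: r)
qed

lemma LS_mult [LS_intro]: assumes "LS a" "LS b" shows "LS (%e. a e * b e)"
proof -
 have r: "rec_nat 0 (%i r. r + x) n = x * n" for x n :: nat by (induction n) auto
 have "LS (%e. rec_nat 0 (%i r. r + a e) (b e))"
  by (rule LS_rec[where h = "%r i e. r + a e" and a = "%e. 0" and B = "%e. a e * b e"])
   (use assms LS_pb r LS_tl2[OF assms(1)] in "auto intro: LS_intro pb_mult")
 then show ?thesis by (simp add: r)
qed

lemma LS_power [LS_intro]: "LS a ==> LS (%e. a e ^ k)"
 by (induction k) (auto intro: LS_intro)

definition LSP :: "(nat list => bool) => bool" where
 "LSP P \<longleftrightarrow> LS (%e. if P e then 1 else 0)"

lemma LS_If [LS_intro]:
 assumes "LSP P" "LS f" "LS g"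
 shows "LS (%e. if P e then f e else g e)"
proof -
 have "(%e. if P e then f e else g e) = (%e. if (if P e then 1 else 0::nat) = 0 then g e else f e)" by auto
 then show ?thesis using LS_if[OF assms(1)[unfolded LSP_def] assms(2,3)] by simp
qed

lemma LSP_I: assumes "LS f" "!!e. P e \<longleftrightarrow> f e ~= 0" shows "LSP P"
proof -
 have "LS (%e. if f e = 0 then 0 else 1)" by (intro LS_if assms LS_const)
 moreover have "(%e. if f e = 0 then 0 else 1::nat) = (%e. if P e then 1 else 0)" using assms(2) by auto
 ultimately show ?thesis unfolding LSP_def by simp
qed

lemma LSP_less [LS_intro]: "LS a ==> LS b ==> LSP (%e. a e < b e)"
 by (rule LSP_I[of "%e. b e - a e"], intro LS_intro, auto)

lemma LSP_le [LS_intro]: "LS a ==> LS b ==> LSP (%e. a e <= b e)"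
 by (rule LSP_I[of "%e. Suc (b e) - a e"], intro LS_intro, auto)

lemma LSP_tl: "LSP P ==> LSP (%e. P (tl e))"
 unfolding LSP_def by (rule LS_tl)

lemma LSP_not [LS_intro]: "LSP P ==> LSP (%e. ~ P e)"
 by (rule LSP_I[of "%e. if P e then 0 else 1"], intro LS_intro, auto)

lemma LSP_conj [LS_intro]: "LSP P ==> LSP Q ==> LSP (%e. P e & Q e)"
 by (rule LSP_I[of "%e. if P e then (if Q e then 1 else 0) else 0"], intro LS_intro, auto)

lemma LSP_disj [LS_intro]: "LSP P ==> LSP Q ==> LSP (%e. P e | Q e)"
 by (rule LSP_I[of "%e. if P e then 1 else (if Q e then 1 else 0)"], intro LS_intro, auto)

lemma LSP_imp [LS_intro]: "LSP P ==> LSP Q ==> LSP (%e. P e --> Q e)"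
 by (rule LSP_I[of "%e. if P e then (if Q e then 1 else 0) else 1"], intro LS_intro, auto)

lemma LSP_eq [LS_intro]: "LS a ==> LS b ==> LSP (%e. a e = b e)"
 by (simp only: eq_iff[of "_ :: nat"]) (intro LS_intro)

lemma LSP_const [LS_intro]: "LSP (%e. b)"
 unfolding LSP_def by (rule LS_const)

lemma LSP_if [LS_intro]: "LSP P ==> LSP Q ==> LSP R ==> LSP (%e. if P e then Q e else R e)"
 by (rule LSP_I[of "%e. if P e then (if Q e then 1 else 0) else (if R e then 1 else 0)"], intro LS_intro, auto)

lemma LSP_ex [LS_intro]:
 assumes "LS n" "LSP (%e. P (hd e) (tl e))"
 shows "LSP (%e. EX x < n e. P x e)"
proof -
 have r: "rec_nat 0 (%i r. if P i e then 1 else r) m = (if EX x<m. P x e then 1 else 0::nat)" for m e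
  by (induction m) (auto simp: less_Suc_eq)
 have "LS (%e. rec_nat 0 (%i r. if P i e then 1 else r) (n e))"
  by (rule LS_rec[where h = "%r i e. if P i e then 1 else r" and a = "%e. 0" and B = "%e. 1"])
   (use assms(1) LSP_tl[OF assms(2)] r in "auto intro: LS_intro pb_const")
 then show ?thesis by (simp add: r LSP_def)
qed

lemma LSP_all [LS_intro]:
 assumes "LS n" "LSP (%e. P (hd e) (tl e))"
 shows "LSP (%e. ALL x < n e. P x e)"
proof -
 have "LSP (%e. ~ (EX x < n e. ~ P x e))" by (intro LS_intro assms)
 then show ?thesis by simp
qed

lemma LS_sum [LS_intro]:
 assumes "LS n" "LS (%e. f (hd e) (tl e))"
 shows "LS (%e. SUM x<n e. f x e)"
proof -
 have r: "rec_nat 0 (%i r. r + f i e) m = (SUM x<m. f x e)" for m e by (induction m) auto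
 obtain q where q: "!!e. f (hd e) (tl e) <= (sum_list e + 2) ^ q"
  using LS_pb[OF assms(2)] unfolding pb_def by blast
 have f: "f x e <= (n e + sum_list e + 2) ^ q" if "x < n e" for x e
 proof -
  have "f x e <= (x + sum_list e + 2) ^ q" using q[of "x # e"] by simp
  also have "... <= (n e + sum_list e + 2) ^ q" using that by (intro power_mono) auto
  finally show ?thesis .
 qed
 have B: "(SUM x<m. f x e) <= n e * (n e + sum_list e + 2) ^ q" if "m <= n e" for m e
 proof -
  have "(SUM x<m. f x e) <= of_nat (card {..<m}) * (n e + sum_list e + 2) ^ q"
   using f that by (intro sum_bounded_above) auto
  also have "... <= n e * (n e + sum_list e + 2) ^ q" using that by simp
  finally show ?thesis .
 qed
 have pbB: "pb (%e. n e * (n e + sum_list e + 2) ^ q)" by (intro pb_intros LS_pb assms)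
 have "LS (%e. rec_nat 0 (%i r. r + f i e) (n e))"
  by (rule LS_rec[where h = "%r i e. r + f i e" and a = "%e. 0"
     and B = "%e. n e * (n e + sum_list e + 2) ^ q"])
   (use assms LS_tl[OF assms(2)] r B in "auto intro: LS_intro pbB[simplified]")
 then show ?thesis by (simp add: r)
qed

text \<open>The quotient counts the positive multiples of the divisor up to the dividend. For
  divisor 0 the guard makes the count 0, in accordance with HOL.\<close>

lemma LS_div [LS_intro]: assumes "LS a" "LS b" shows "LS (%e. a e div b e)"
proof -
 have r: "(SUM x<m. if 0 < y & Suc x * y <= n then 1 else 0) = min m (n div y)" if "0 < y" for m n y :: nat
 proof (induction m)
  case (Suc m)
  have "Suc m * y <= n \<longleftrightarrow> Suc m <= n div y" using that by (simp add: less_eq_div_iff_mult_less_eq)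
  then show ?case using Suc that by (auto simp: min_def)
 qed simp
 have "x div y = (SUM z<x. if 0 < y & Suc z * y <= x then 1 else 0)" for x y :: nat
  using r[of y x x] div_le_dividend[of x y] by (cases "y = 0") (auto simp: min_def)
 then show ?thesis using assms by (auto intro!: LS_intro LS_tl)
qed

lemma LS_mod [LS_intro]: "LS a ==> LS b ==> LS (%e. a e mod b e)"
 unfolding modulo_nat_def by (intro LS_intro)

lemma LS_max [LS_intro]: "LS a ==> LS b ==> LS (%e. max (a e) (b e))"
 unfolding max_def by (intro LS_intro)

section \<open>Digits and pairs\<close>

definition dg :: "nat => nat => nat => nat" where
 "dg b z i = z div b ^ i mod b"

text \<open>The power \<open>b ^ i\<close> is not polynomially bounded, so the digit is reached by
  \<open>i\<close> successive divisions, whose results never exceed \<open>z\<close>.\<close>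

lemma LS_dg [LS_intro]:
 assumes "LS b" "LS z" "LS i"
 shows "LS (%e. dg (b e) (z e) (i e))"
proof -
 have r: "rec_nat z (%i r. r div b) i = z div b ^ i" for z b i :: nat
  by (induction i) (simp_all add: div_mult2_eq[symmetric] mult.commute)
 have "LS (%e. rec_nat (z e) (%i r. r div b e) (i e))"
  by (rule LS_rec[where h = "%r i e. r div b e" and B = z])
   (use assms LS_tl2[OF assms(1)] r LS_pb[OF assms(2)] in "auto intro: LS_intro")
 from LS_mod[OF this assms(1)] show ?thesis by (simp add: dg_def r)
qed

lemma LS_prod_encode [LS_intro]: "LS a ==> LS b ==> LS (%e. prod_encode (a e, b e))"
 by (simp add: prod_encode_def triangle_def) (intro LS_intro)

text \<open>Both components are at most the code, so decoding is a bounded search; each sum has at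
  most one nonzero term.\<close>

lemma prod_decode_sum:
 "fst (prod_decode z) = (SUM x<Suc z. if EX y<Suc z. prod_encode (x, y) = z then x else 0)"
 "snd (prod_decode z) = (SUM y<Suc z. if EX x<Suc z. prod_encode (x, y) = z then y else 0)"
proof -
 obtain x y where d: "prod_decode z = (x, y)" by force
 then have z: "z = prod_encode (x, y)" by (metis prod_decode_inverse)
 have xy: "x < Suc z" "y < Suc z" using le_prod_encode_1[of x y] le_prod_encode_2[of y x] by (auto simp: z)
 have "(EX y'<Suc z. prod_encode (x', y') = z) \<longleftrightarrow> x' = x" for x' using xy by (auto simp: z)
 then show "fst (prod_decode z) = (SUM x<Suc z. if EX y<Suc z. prod_encode (x, y) = z then x else 0)"
  using xy by (simp add: d)
 have "(EX x'<Suc z. prod_encode (x', y') = z) \<longleftrightarrow> y' = y" for y' using xy by (auto simp: z)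
 then show "snd (prod_decode z) = (SUM y<Suc z. if EX x<Suc z. prod_encode (x, y) = z then y else 0)"
  using xy by (simp add: d)
qed

lemma LS_fst_decode [LS_intro]: assumes "LS a" shows "LS (%e. fst (prod_decode (a e)))"
proof (rule LS_subst1[of "%z. fst (prod_decode z)"])
 show "LS (%e. fst (prod_decode (hd e)))" unfolding prod_decode_sum by (intro LS_intro)
qed fact

lemma LS_snd_decode [LS_intro]: assumes "LS a" shows "LS (%e. snd (prod_decode (a e)))"
proof (rule LS_subst1[of "%z. snd (prod_decode z)"])
 show "LS (%e. snd (prod_decode (hd e)))" unfolding prod_decode_sum by (intro LS_intro)
qed fact

subsection \<open>Space bounded deciders\<close>

text \<open>The leading 1 keeps words of different lengths apart. The first letter is the most
  significant, so the code can be built by doubling while the word is read from left to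
  right.\<close>

definition wcode :: "bool list => nat" where
 "wcode w = foldl (%x b. 2 * x + of_bool b) 1 w"

lemma wcode_snoc: "wcode (w @ [b]) = 2 * wcode w + of_bool b"
 by (simp add: wcode_def)

lemma wcode_bounds: "2 ^ length w <= wcode w & wcode w < 2 ^ Suc (length w)"
 by (induction w rule: rev_induct) (auto simp: wcode_snoc, simp_all add: wcode_def)

text \<open>The target \<open>r\<close> may itself be an argument: the result is computed above all
  arguments first and moved afterwards. The old value of \<open>r\<close> enters the time bound
  because it has to be counted down to 0.\<close>

lemma ex_assign:
 assumes "LS f" "ALL j : set js. j < s" "r < s"
 shows "EX c T. pure c & pb T & (ALL rg. (ALL i>=s. rg i = 0) -->
  ex c rg (T (rg r # map rg js)) (rg(r := f (map rg js))))"
proof -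
 obtain c T where c: "pure c" "pb T"
  "!!rg. ALL i>=s. rg i = 0 ==> ex c rg (T (map rg js)) (rg(s := f (map rg js)))"
  using LS_D[OF assms(1,2)] by blast
 let ?c = "Sq c (Sq (clear r) (transfer s r))"
 let ?T = "%l. T (tl l) + ((2 * hd l + 1) + (4 * f (tl l) + 1) + 1) + 1"
 have "ex ?c rg (?T (rg r # map rg js)) (rg(r := f (map rg js)))" if z: "ALL i>=s. rg i = 0" for rg
 proof -
  let ?v = "f (map rg js)"
  have 2: "ex (clear r) (rg(s := ?v)) (2 * rg r + 1) (rg(s := ?v, r := 0))"
   using assms(3) by (intro ex_clear) simp
  have "rg(s := ?v, r := 0, s := 0, r := ?v) = rg(r := ?v)" using z assms(3) by (auto simp: fun_eq_iff)
  then have 3: "ex (transfer s r) (rg(s := ?v, r := 0)) (4 * ?v + 1) (rg(r := ?v))"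
   using ex_transfer[of s r "rg(s := ?v, r := 0)" "4 * ?v + 1"] assms(3) by simp
  show ?thesis unfolding list.sel by (rule ex_Sq1[OF c(3)[OF z] ex_Sq1[OF 2 3]])
 qed
 moreover have "pb ?T"
  by (intro pb_intros pb_hd pb_comp[OF c(2) pb_sum sum_list_tl] pb_comp[OF LS_pb[OF assms(1)] pb_sum sum_list_tl])
 ultimately show ?thesis using c(1) by (intro exI[of _ ?c] exI[of _ ?T]) simp
qed

text \<open>This is no \<open>LS\<close> function, its value being too large. Starting from 2 and
  squaring \<open>m\<close> times takes time polynomial in the result, which is why the result is
  the first argument of the time bound.\<close>

lemma ex_double_exp:
 assumes "LS m" "ALL j : set js. j < s"
 shows "EX c T. pure c & pb T & (ALL rg. (ALL i>=s. rg i = 0) -->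
  ex c rg (T (2 ^ 2 ^ m (map rg js) # map rg js)) (rg(s := 2 ^ 2 ^ m (map rg js))))"
proof -
 have "ALL j : set js. j < s + 1" using assms(2) by auto
 from LS_D[OF assms(1) this] obtain c T where c: "pure c" "pb T"
  "!!rg. ALL i>=s+1. rg i = 0 ==> ex c rg (T (map rg js)) (rg(s+1 := m (map rg js)))" by blast
 have "LS (%e. hd e * hd e)" by (intro LS_intro)
 from ex_assign[OF this, of "[s]" "s+2" s] obtain c' T' where c': "pure c'" "pb T'"
  "!!rg. ALL i>=s+2. rg i = 0 ==> ex c' rg (T' [rg s, rg s]) (rg(s := rg s * rg s))" by auto
 obtain q where q: "!!e. T' e <= (sum_list e + 2) ^ q" using c'(2) unfolding pb_def by blast
 let ?body = "Sq (Dec (s+1)) c'"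
 let ?c = "Sq c (Sq (Sq (Inc s) (Inc s)) (Until (Zero (s+1)) ?body))"
 define K where "K d = (2 * d + 2) ^ q + 2" for d :: nat
 let ?T = "%l. T (tl l) + (5 + (m (tl l) * (K (hd l) + 1) + 1) + 1) + 1"
 have "ex ?c rg (?T (2 ^ 2 ^ m (map rg js) # map rg js)) (rg(s := 2 ^ 2 ^ m (map rg js)))" if z: "ALL i>=s. rg i = 0" for rg
 proof -
  let ?m = "m (map rg js)" let ?D = "2 ^ 2 ^ ?m :: nat"
  define sg where "sg i = rg(s := 2 ^ 2 ^ i, s + 1 := ?m - i)" for i
  have body: "ex ?body (sg i) (K ?D) (sg (Suc i))" if "i < ?m" for i
  proof -
   let ?r = "(sg i)(s+1 := ?m - Suc i)"
   have 1: "ex (Dec (s+1)) (sg i) 1 ?r"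
    using ex_Dec[of 1 "s+1" "sg i"] by (simp add: sg_def)
   have e: "(2::nat) ^ 2 ^ i * 2 ^ 2 ^ i = 2 ^ 2 ^ Suc i" by (simp add: power_add[symmetric])
   have "ex c' ?r (T' [?r s, ?r s]) (?r(s := ?r s * ?r s))"
    by (rule c'(3)) (use z in "auto simp: sg_def")
   moreover have "?r(s := ?r s * ?r s) = sg (Suc i)"
    by (auto simp: sg_def fun_eq_iff power_add[symmetric])
   moreover have "?r s = 2 ^ 2 ^ i" by (simp add: sg_def)
   ultimately have 2: "ex c' ?r (T' [2 ^ 2 ^ i, 2 ^ 2 ^ i]) (sg (Suc i))" by simp
   have D: "(2::nat) ^ 2 ^ i <= ?D" using that by (intro power_increasing) auto
   have "T' [2 ^ 2 ^ i, 2 ^ 2 ^ i] <= (2 * 2 ^ 2 ^ i + 2) ^ q"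
    using q[of "[2 ^ 2 ^ i, 2 ^ 2 ^ i]"] by (simp add: mult_2)
   also have "... <= (2 * ?D + 2) ^ q" using D by (intro power_mono) auto
   finally have "T' [2 ^ 2 ^ i, 2 ^ 2 ^ i] <= (2 * ?D + 2) ^ q" .
   then show ?thesis by (intro ex_mono[OF ex_Sq1[OF 1 2]]) (simp add: K_def)
  qed
  have 1: "ex c rg (T (map rg js)) (rg(s+1 := ?m))" using c(3) z by simp
  have "(rg(s+1 := ?m))(s := (rg(s+1 := ?m)) s + 2) = sg 0" using z by (auto simp: sg_def fun_eq_iff)
  then have 2: "ex (Sq (Inc s) (Inc s)) (rg(s+1 := ?m)) 5 (sg 0)"
   using ex_Sq1[OF ex_Inc[of 1 s "rg(s+1 := ?m)"] ex_Inc[of 3 s]] by simp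
  have "ex (Until (Zero (s+1)) ?body) (sg 0) (?m * (K ?D + 1) + 1) (sg ?m)"
   by (rule ex_loop[where K = "K ?D"]; (rule body, assumption | simp add: sg_def))
  moreover have "sg ?m = rg(s := 2 ^ 2 ^ ?m)" using z by (auto simp: sg_def fun_eq_iff)
  ultimately have 3: "ex (Until (Zero (s+1)) ?body) (sg 0) (?m * (K ?D + 1) + 1) (rg(s := 2 ^ 2 ^ ?m))" by simp
  show ?thesis unfolding list.sel by (rule ex_Sq1[OF 1 ex_Sq1[OF 2 3]])
 qed
 moreover have "pb ?T" unfolding K_def
  by (intro pb_intros pb_hd pb_comp[OF c(2) pb_sum sum_list_tl] pb_comp[OF LS_pb[OF assms(1)] pb_sum sum_list_tl])
 ultimately show ?thesis using c(1) c'(1) by (intro exI[of _ ?c] exI[of _ ?T]) simp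
qed

lemma rn_crun: "rn w c ((%_. 0), 0, []) K s ==> EX t <= K. crun w c t = ([], s)"
 unfolding rn_def crun_def by blast

lemma cstep_out_mono: "length (snd (snd (snd C))) <= length (snd (snd (snd (cstep w C))))"
proof -
 obtain ks rg k u where CC: "C = (ks, rg, k, u)" by (metis prod_cases4)
 show ?thesis
 proof (cases ks)
  case (Cons b l)
  show ?thesis unfolding CC Cons by (cases b) auto
 qed (use CC in auto)
qed

lemma crun_out_mono: "i <= j ==> length (snd (snd (snd (crun w c i)))) <= length (snd (snd (snd (crun w c j))))"
proof (induction j rule: dec_induct)
 case (step n)
 have "crun w c (Suc n) = cstep w (crun w c n)" by (simp add: crun_def)
 then show ?case using step.IH cstep_out_mono[where C = "crun w c n" and w = w] by simp
qed simp

lemma rn_scan_aux: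
 assumes "!!k. k < length w ==> rn w c (sg k, k, u) K (sg (Suc k), k, u)"
 shows "rn w (Until (Sym 0) (Sq c Adv)) (sg 0, 0, u) (length w * (K + 3) + 1) (sg (length w), length w, u)"
proof (rule rn_loop[where sg = "%k. (sg k, k, u)" and K = "K + 2"])
 fix k assume k: "k < length w"
 then show "~ holds w (Sym 0) (sg k, k, u)" by (simp add: word_tape_eq0)
 have "rn w Adv (sg (Suc k), k, u) 1 (sg (Suc k), Suc k, u)" by (rule rn_1) (use k in auto)
 from rn_Sq[OF assms[OF k] this] show "rn w (Sq c Adv) (sg k, k, u) (K + 2) (sg (Suc k), Suc k, u)" by simp
qed (auto simp: word_tape_eq0 algebra_simps)

lemma rn_Rewind: "1 <= K ==> rn w Rewind (rg, k, u) K (rg, 0, u)"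
 by (rule rn_1) auto

text \<open>The code of \<open>w\<close> is exponential in its length, and so is the time for
  building it; this is affordable where only space matters.\<close>

lemma ex_load:
 "EX c q. ALL w. rn w c ((%_. 0), 0, []) ((wcode w + length w + 2) ^ q) ((%_. 0)(1 := wcode w, 2 := length w), 0, [])"
proof -
 have LS2: "LS (%e. 2 * hd e + of_bool b)" for b by (intro LS_intro)
 obtain c0 T0 where c0: "pb T0"
  "!!rg. ALL i>=3. rg i = 0 ==> ex c0 rg (T0 [rg 1, rg 1]) (rg(1 := 2 * rg 1))"
  using ex_assign[OF LS2[of False], of "[1]" 3 1] by auto
 obtain c1 T1 where c1: "pb T1"
  "!!rg. ALL i>=3. rg i = 0 ==> ex c1 rg (T1 [rg 1, rg 1]) (rg(1 := 2 * rg 1 + 1))"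
  using ex_assign[OF LS2[of True], of "[1]" 3 1] by auto
 let ?body = "Sq (Ite (Sym 1) c0 c1) (Inc 2)"
 let ?c = "Sq (Inc 1) (Sq (Until (Sym 0) (Sq ?body Adv)) Rewind)"
 obtain q where q: "!!e. T0 e + T1 e + 4 <= (sum_list e + 2) ^ q"
  using pb_add[OF pb_add[OF c0(1) c1(1)] pb_const[of 4]] unfolding pb_def by blast
 have "rn w ?c ((%_. 0), 0, []) ((2 * wcode w + length w + 2) ^ q * length w + 3 * length w + 5)
   ((%_. 0)(1 := wcode w, 2 := length w), 0, [])" for w
 proof -
  define sg :: "nat => nat => nat" where "sg k = (%_. 0)(1 := wcode (take k w), 2 := k)" for k
  define K where "K = (2 * wcode w + length w + 2) ^ q"
  have mono: "wcode (take k w) <= wcode w" for k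
  proof -
   have "wcode xs <= wcode (xs @ ys)" for xs ys
    by (induction ys rule: rev_induct) (auto simp: wcode_snoc append_assoc[symmetric] simp del: append_assoc)
   from this[of "take k w" "drop k w"] show ?thesis by simp
  qed
  have body: "rn w ?body (sg k, k, []) K (sg (Suc k), k, [])" if k: "k < length w" for k
  proof -
   have s: "wcode (take (Suc k) w) = 2 * wcode (take k w) + of_bool (w ! k)"
    using k by (simp add: take_Suc_conv_app_nth wcode_snoc)
   let ?r = "(sg k)(1 := wcode (take (Suc k) w))"
   let ?l = "[wcode (take k w), wcode (take k w)]"
   have c: "rn w (if holds w (Sym 1) (sg k, k, []) then c0 else c1) (sg k, k, []) (T0 ?l + T1 ?l) (?r, k, [])"
   proof (cases "w ! k")
    case True
    then have "ex c1 (sg k) (T1 ?l) ?r" using c1(2)[of "sg k"] s by (simp add: sg_def)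
    then show ?thesis using True k by (auto simp: word_tape_in intro: rn_mono ex_rn)
   next
    case False
    then have "ex c0 (sg k) (T0 ?l) ?r" using c0(2)[of "sg k"] s by (simp add: sg_def)
    then show ?thesis using False k by (auto simp: word_tape_in intro: rn_mono ex_rn)
   qed
   have "?r(2 := Suc (?r 2)) = sg (Suc k)" by (auto simp: sg_def fun_eq_iff)
   then have i: "rn w (Inc 2) (?r, k, []) 1 (sg (Suc k), k, [])"
    using rn_Inc[of 1 w 2 ?r "(k, [])"] by simp
   have "T0 ?l + T1 ?l + 4 <= (sum_list ?l + 2) ^ q" by (rule q)
   also have "... <= K" unfolding K_def using mono[of k] by (intro power_mono) auto
   finally show ?thesis
    by - (rule rn_Sq[OF rn_Ite[OF c lessI] i], simp)
  qed
  have "rn w (Inc 1) ((%_. 0), 0, []) 1 (sg 0, 0, [])"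
   using rn_Inc[of 1 w 1 "%_. 0" "(0, [])"] by (simp add: sg_def wcode_def fun_upd_idem)
  moreover have "rn w (Until (Sym 0) (Sq ?body Adv)) (sg 0, 0, []) (length w * (K + 3) + 1) (sg (length w), length w, [])"
   by (rule rn_scan_aux) (rule body)
  moreover have "rn w Rewind (sg (length w), length w, []) 1 (sg (length w), 0, [])" by (rule rn_Rewind) simp
  ultimately have "rn w ?c ((%_. 0), 0, []) (length w * (K + 3) + 5) (sg (length w), 0, [])"
   by - (rule rn_Sq, assumption, rule rn_Sq, assumption, assumption, rule lessI, simp)
  then show ?thesis by (simp add: sg_def K_def algebra_simps)
 qed
 moreover have "pb (%e. (2 * hd e + hd (tl e) + 2) ^ q * hd (tl e) + 3 * hd (tl e) + 5)"
  by (intro pb_intros pb_hd pb_comp[OF pb_hd pb_sum sum_list_tl])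
 then obtain q' where "!!e :: nat list. (2 * hd e + hd (tl e) + 2) ^ q * hd (tl e) + 3 * hd (tl e) + 5 <= (sum_list e + 2) ^ q'"
  unfolding pb_def by blast
 from this[of "[wcode _, length _]"] have "(2 * wcode w + length w + 2) ^ q * length w + 3 * length w + 5 <= (wcode w + length w + 2) ^ q'" for w
  by simp
 ultimately show ?thesis by (intro exI[of _ ?c] exI[of _ q']) (blast intro: rn_mono)
qed

lemma run_halted: "halted M (run M w n) ==> run M w (n + m) = run M w n"
proof (induction m)
 case (Suc m)
 have "run M w (n + Suc m) = step M (run M w n)"
  using Suc by (simp only: run_Suc add_Suc_right)
 then show ?case using Suc.prems by (simp only: step_def if_True)
qed simp

lemma cregs_bounded: "EX R > 0. cregs c <= {..<R}"
proof -
 obtain m where "ALL r : cregs c. r < m" using finite_cregs[of c] by (metis finite_nat_set_iff_bounded)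
 then have "cregs c <= {..<Suc m}" by force
 then show ?thesis by blast
qed

lemma accepts_iff:
 assumes "halted M (run M w t)"
 shows "accepts M w \<longleftrightarrow> fst (run M w t) = tm_accept M"
proof
 assume "accepts M w"
 then obtain n where n: "fst (run M w n) = tm_accept M" by (auto simp: accepts_def)
 then show "fst (run M w t) = tm_accept M"
  using run_halted[of M w n t] run_halted[OF assms, of n] by (simp add: halted_def add.commute)
qed (auto simp: accepts_def)

text \<open>The double exponentials are computed first and handed to \<open>P\<close> as ordinary
  arguments. The whole run takes time polynomial in them, hence less than 2^l for an exponentially
  large l; as time bounds the registers, l digits per tape suffice.\<close>

theorem EXPSPACE_I:
 assumes P: "LSP P"
  and L: "!!w. w : L \<longleftrightarrow> P [2 ^ 2 ^ (length w ^ k2 + c2), 2 ^ 2 ^ (length w ^ k1 + c1), length w, wcode w]"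
 shows "L : EXPSPACE"
proof -
 obtain c0 q0 where c0: "!!w. rn w c0 ((%_. 0), 0, []) ((wcode w + length w + 2) ^ q0) ((%_. 0)(1 := wcode w, 2 := length w), 0, [])"
  using ex_load by blast
 have LSm: "LS (%e. hd e ^ k + c)" for k c by (intro LS_intro)
 obtain d1 T1 where d1: "pb T1" "!!rg. ALL i>=3. rg i = 0 ==> ex d1 rg (T1 [2 ^ 2 ^ (rg 2 ^ k1 + c1), rg 2]) (rg(3 := 2 ^ 2 ^ (rg 2 ^ k1 + c1)))"
  using ex_double_exp[OF LSm[of k1 c1], of "[2]" 3] by auto
 obtain d2 T2 where d2: "pb T2" "!!rg. ALL i>=4. rg i = 0 ==> ex d2 rg (T2 [2 ^ 2 ^ (rg 2 ^ k2 + c2), rg 2]) (rg(4 := 2 ^ 2 ^ (rg 2 ^ k2 + c2)))"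
  using ex_double_exp[OF LSm[of k2 c2], of "[2]" 4] by auto
 obtain p T where p: "pb T" "!!rg. ALL i>=5. rg i = 0 ==>
   ex p rg (T [rg 0, rg 4, rg 3, rg 2, rg 1]) (rg(0 := if P [rg 4, rg 3, rg 2, rg 1] then 1 else 0))"
  using ex_assign[OF P[unfolded LSP_def], of "[4, 3, 2, 1]" 5 0] by auto
 let ?c = "Sq c0 (Sq d1 (Sq d2 p))"
 obtain q1 q2 q where q1: "!!e. T1 e <= (sum_list e + 2) ^ q1" and q2: "!!e. T2 e <= (sum_list e + 2) ^ q2"
  and q: "!!e. T e <= (sum_list e + 2) ^ q" using d1(1) d2(1) p(1) unfolding pb_def by blast
 define M where "M w = 2 ^ 2 ^ (length w ^ k2 + c2) + 2 ^ 2 ^ (length w ^ k1 + c1) + length w + wcode w + 2" for w :: "bool list"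
 define Q where "Q = q + q1 + q2 + q0 + 3"
 have run: "EX rg. (rg 0 = 0 \<longleftrightarrow> w ~: L) & rn w ?c ((%_. 0), 0, []) (M w ^ Q) (rg, 0, [])" for w
 proof -
  let ?D1 = "2 ^ 2 ^ (length w ^ k1 + c1) :: nat" let ?D2 = "2 ^ 2 ^ (length w ^ k2 + c2) :: nat"
  let ?r0 = "(%_. 0)(1 := wcode w, 2 := length w) :: nat => nat"
  let ?r1 = "?r0(3 := ?D1)" let ?r2 = "?r1(4 := ?D2)" let ?r3 = "?r2(0 := if w : L then 1 else 0)"
  let ?K = "M w ^ (q + q1 + q2 + q0)"
  have M2: "2 <= M w" by (simp add: M_def)
  have mle: "x ^ a <= ?K" if "x <= M w" "a <= q + q1 + q2 + q0" for x a
   using that M2 by (meson le_trans power_increasing power_mono zero_le one_le_numeral)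
  have st: "rn w c (r, 0, []) ?K (r', 0, [])" if "ex c r x r'" "x <= y ^ a" "y <= M w" "a <= q + q1 + q2 + q0" for c r r' x y a
   by (rule rn_mono[OF ex_rn[OF that(1)] order_trans[OF that(2) mle[OF that(3,4)]]])
  have 0: "rn w c0 ((%_. 0), 0, []) ?K (?r0, 0, [])"
   by (rule rn_mono[OF c0 mle]) (auto simp: M_def)
  have 1: "rn w d1 (?r0, 0, []) ?K (?r1, 0, [])"
   by (rule st[OF _ q1[of "[?D1, length w]"]]) (use d1(2)[of ?r0] in "auto simp: M_def")
  have 2: "rn w d2 (?r1, 0, []) ?K (?r2, 0, [])"
   by (rule st[OF _ q2[of "[?D2, length w]"]]) (use d2(2)[of ?r1] in "auto simp: M_def")
  have 3: "rn w p (?r2, 0, []) ?K (?r3, 0, [])"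
   by (rule st[OF _ q[of "[0, ?D2, ?D1, length w, wcode w]"]]) (use p(2)[of ?r2] L[of w] in "auto simp: M_def")
  have "1 <= ?K" using M2 by simp
  then have "?K + (?K + (?K + ?K + 1) + 1) < 2 ^ 3 * ?K" by simp
  also have "... <= M w ^ 3 * ?K" using M2 by (intro mult_right_mono power_mono) auto
  also have "... = M w ^ Q" by (simp add: Q_def power_add mult.commute)
  finally have "rn w ?c ((%_. 0), 0, []) (M w ^ Q) (?r3, 0, [])"
   by - (rule rn_Sq[OF 0 rn_Sq[OF 1 rn_Sq[OF 2 3 lessI] lessI]], simp)
  moreover have "?r3 0 = 0 \<longleftrightarrow> w ~: L" by simp
  ultimately show ?thesis by (intro exI[of _ ?r3] conjI)
 qed
 obtain R where R: "cregs ?c <= {..<R}" "0 < R"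
  using cregs_bounded by blast
 define len where "len n = Q * (2 ^ (n ^ k2 + c2) + 2 ^ (n ^ k1 + c1) + 2 * n + 5) + 1" for n :: nat
 have MQ: "M w ^ Q < 2 ^ len (length w)" for w
 proof -
  let ?a = "2 ^ (length w ^ k2 + c2) :: nat" let ?b = "2 ^ (length w ^ k1 + c1) :: nat"
  let ?s = "?a + ?b + 2 * length w + 2"
  have pw: "(2::nat) ^ x <= 2 ^ ?s" if "x <= ?s" for x using that by (intro power_increasing) auto
  have "M w <= 2 ^ ?a + 2 ^ ?b + 2 ^ length w + 2 ^ Suc (length w) + 2 ^ 1"
   using wcode_bounds[of w] less_two_power[of "length w"] unfolding M_def by linarith
  also have "... <= 2 ^ ?s + 2 ^ ?s + 2 ^ ?s + 2 ^ ?s + 2 ^ ?s" by (intro add_mono pw) auto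
  also have "... <= 2 ^ (?s + 3)" by (simp add: power_add)
  finally have "M w ^ Q <= (2 ^ (?s + 3)) ^ Q" by (intro power_mono) auto
  also have "... = 2 ^ (len (length w) - 1)" by (simp add: len_def power_mult[symmetric] mult.commute)
  also have "... < 2 ^ len (length w)" by (intro power_strict_increasing) (auto simp: len_def)
  finally show ?thesis .
 qed
 have dec: "halts (ctm ?c R) w & (accepts (ctm ?c R) w \<longleftrightarrow> w : L) &
   finite (visited (ctm ?c R) w) & card (visited (ctm ?c R) w) <= length w + 2 + R * (len (length w) + 2) + 1" for w
 proof -
  obtain rg where rg: "rg 0 = 0 \<longleftrightarrow> w ~: L" "rn w ?c ((%_. 0), 0, []) (M w ^ Q) (rg, 0, [])"
   using run[of w] by (elim exE conjE) (rule that)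
  obtain t where t: "t <= M w ^ Q" "crun w ?c t = ([], rg, 0, [])" using rn_crun[OF rg(2)] by blast
  have tl: "t < 2 ^ len (length w)" using t(1) MQ[of w] by simp
  have l0: "0 < len (length w)" by (simp add: len_def)
  have u0: "length (snd (snd (snd (crun w ?c i)))) <= 0" if "i <= t" for i
   using crun_out_mono[OF that, of w ?c] t(2) by simp
  note cc = ctm_correct[OF R tl l0 u0 t(2)]
  obtain t' where t': "run (ctm ?c R) w t' = (if rg 0 = 0 then 1 else 0, snd (cfg ?c R w ([], rg, 0, [])))"
   using cc(1) by blast
  have hl: "halted (ctm ?c R) (run (ctm ?c R) w t')" unfolding t' by (simp add: halted_def)
  moreover have "accepts (ctm ?c R) w \<longleftrightarrow> w : L"
   unfolding accepts_iff[OF hl] t' using rg(1) by simp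
  moreover have "finite (visited (ctm ?c R) w)" using cc(2) finite_cells finite_subset by blast
  moreover have "card (visited (ctm ?c R) w) <= length w + 2 + R * (len (length w) + 2) + 1"
   using card_mono[OF finite_cells cc(2)] card_cells[of R "length w" "len (length w)" 0] by linarith
  ultimately show ?thesis unfolding halts_def by (intro conjI exI)
 qed
 define k where "k = k1 + k2 + 1"
 define C where "C = 4 + R * (Q * (2 ^ c2 * 2 + 2 ^ c1 * 2 + 7) + 3)"
 have "n + 2 + R * (len n + 2) + 1 <= C * 2 ^ (n ^ k)" for n
 proof -
  define E where "E = (2::nat) ^ (n ^ k)"
  have E1: "1 <= E" by (simp add: E_def)
  have e: "(2::nat) ^ (n ^ a + c) <= (2 ^ c * 2) * E" if "a <= k" for a c :: nat
  proof -
   \<comment> \<open>The summand 1 covers \<open>n = 0\<close> with \<open>a = 0\<close>, where the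
     left side is 1 and \<open>n ^ k\<close> is 0.\<close>
   have "n ^ a <= n ^ k + 1" using that power_increasing[of a k n] by (cases "n = 0") (auto simp: power_0_left)
   then have "(2::nat) ^ (n ^ a) <= 2 ^ (n ^ k + 1)" by (intro power_increasing) auto
   then show ?thesis by (simp add: power_add E_def)
  qed
  have e2: "2 ^ (n ^ k2 + c2) <= 2 ^ c2 * 2 * E" and e1: "2 ^ (n ^ k1 + c1) <= 2 ^ c1 * 2 * E"
   by (intro e; simp add: k_def)+
  have "n <= n ^ k" by (cases "n = 0") (auto simp: k_def)
  then have nE: "n <= E" using less_two_power[of "n ^ k"] unfolding E_def by linarith
  have "2 ^ (n ^ k2 + c2) + 2 ^ (n ^ k1 + c1) + 2 * n + 5 <= (2 ^ c2 * 2 + 2 ^ c1 * 2 + 7) * E"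
   using e2 e1 nE E1 unfolding distrib_right by linarith
  from mult_left_mono[OF this, of Q] have "len n + 2 <= (Q * (2 ^ c2 * 2 + 2 ^ c1 * 2 + 7) + 3) * E"
   using E1 unfolding len_def distrib_right mult.assoc by linarith
  from mult_left_mono[OF this, of R] show ?thesis
   using nE E1 unfolding C_def E_def[symmetric] distrib_right mult.assoc by linarith
 qed
 then have "decides_in_space (ctm ?c R) L (%n. C * 2 ^ (n ^ k))"
  using dec unfolding decides_in_space_def by (meson order_trans)
 then show ?thesis using is_tm_ctm[OF R(1)] unfolding EXPSPACE_def DSPACE_def by blast
qed

subsection \<open>Polynomial time word functions\<close>

text \<open>The counterpart of \<open>computes\<close> for output. Head and registers are restored,
  so emitters can be chained and repeated. The word stays on the input tape: its code would be
  exponential and could not be handled in polynomial time.\<close>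

definition emits :: "cmd => nat list => nat => (bool list => nat list => bool list) => (nat list => nat) => bool" where
 "emits c js s F T \<longleftrightarrow> pb T & (ALL w rg u. (ALL i>=s. rg i = 0) -->
   rn w c (rg, 0, u) (T (length w # map rg js)) (rg, 0, u @ F w (map rg js)))"

definition LO :: "(bool list => nat list => bool list) => bool" where
 "LO F \<longleftrightarrow> (ALL js s. (ALL j : set js. j < s) --> (EX c T. emits c js s F T))"

lemma emits_D:
 assumes "emits c js s F T"
 shows "pb T" "ALL i>=s. rg i = 0 ==> rn w c (rg, 0, u) (T (length w # map rg js)) (rg, 0, u @ F w (map rg js))"
 using assms by (simp_all add: emits_def)

lemma LO_D: "LO F ==> ALL j : set js. j < s ==> EX c T. emits c js s F T"
 unfolding LO_def by blast

lemma LO_I: "(!!js s. ALL j : set js. j < s ==> EX c T. emits c js s F T) ==> LO F"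
 unfolding LO_def by blast

lemma emits_I: "pb T ==> (!!w rg u. ALL i>=s. rg i = 0 ==>
  rn w c (rg, 0, u) (T (length w # map rg js)) (rg, 0, u @ F w (map rg js))) ==> EX c T. emits c js s F T"
 unfolding emits_def by blast

named_theorems LO_intro

lemma LO_Nil [LO_intro]: "LO (%w e. [])"
 by (rule LO_I, rule emits_I[where T = "%e. 1" and c = Skip]) (simp_all add: pb_const rn_Skip)

lemma LO_single [LO_intro]: "LO (%w e. [b])"
 by (rule LO_I, rule emits_I[where T = "%e. 1" and c = "Out b"]) (simp_all add: pb_const rn_1)

lemma LO_append [LO_intro]: assumes "LO F" "LO G" shows "LO (%w e. F w e @ G w e)"
proof (rule LO_I)
 fix js s assume js: "ALL j : set js. j < (s::nat)"
 obtain c T where ec: "emits c js s F T" using LO_D[OF assms(1) js] by blast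
 note c = emits_D[OF ec]
 obtain c' T' where ec': "emits c' js s G T'" using LO_D[OF assms(2) js] by blast
 note c' = emits_D[OF ec']
 show "EX c T. emits c js s (%w e. F w e @ G w e) T"
  by (rule emits_I[where T = "%e. T e + T' e + 1" and c = "Sq c c'"]) (use rn_Sq[OF c(2) c'(2)] pb_add[OF pb_add[OF c(1) c'(1)] pb_const[of 1]] in simp_all)
qed

lemma LO_cons [LO_intro]: "LO F ==> LO (%w e. b # F w e)"
 using LO_append[OF LO_single[of b], of F] by simp

lemma LO_for [LO_intro]:
 assumes "LS n" "LO (%w e. F w (hd e) (tl e))"
 shows "LO (%w e. concat (map (%i. F w i e) [0..<n e]))"
proof (rule LO_I)
 fix js s assume js: "ALL j : set js. j < (s::nat)"
 then have js1: "ALL j : set js. j < s + 1" and js2: "ALL j : set (s # js). j < s + 2" by auto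
 obtain c T where c: "pure c" "pb T" "!!rg. ALL i>=s+1. rg i = 0 ==>
   ex c rg (T (map rg js)) (rg(s+1 := n (map rg js)))"
  using LS_D[OF assms(1) js1] by blast
 obtain c' T' where ec': "emits c' (s # js) (s + 2) (%w e. F w (hd e) (tl e)) T'" using LO_D[OF assms(2) js2] by blast
 note c' = emits_D[OF ec', unfolded list.map list.sel]
 obtain q where q: "!!e. T' e <= (sum_list e + 2) ^ q" using c'(1) unfolding pb_def by blast
 define K where "K l = (n (tl l) + sum_list l + 2) ^ q + 4" for l
 let ?body = "Sq (Dec (s+1)) (Sq c' (Inc s))"
 let ?c = "Sq c (Sq (Until (Zero (s+1)) ?body) (clear s))"
 let ?T = "%l. T (tl l) + ((n (tl l) * (K l + 1) + 1) + (2 * n (tl l) + 1) + 1) + 1"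
 have "rn w ?c (rg, 0, u) (?T (length w # map rg js)) (rg, 0, u @ concat (map (%i. F w i (map rg js)) [0..<n (map rg js)]))"
  if z: "ALL i>=s. rg i = 0" for w rg u
 proof -
  define e where "e = map rg js"
  let ?l = "length w # e"
  define r where "r i = rg(s := i, s + 1 := n e - i)" for i
  define v where "v i = u @ concat (map (%i. F w i e) [0..<i])" for i
  have body: "rn w ?body (r i, 0, v i) (K ?l) (r (Suc i), 0, v (Suc i))" if i: "i < n e" for i
  proof -
   let ?r = "(r i)(s+1 := n e - Suc i)"
   have 1: "rn w (Dec (s+1)) (r i, 0, v i) 1 (?r, 0, v i)"
    using rn_Dec[of 1 w "s+1" "r i" "(0, v i)"] by (simp add: r_def)
   have m: "map ?r js = e" using js by (auto simp: r_def e_def)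
   have "rn w c' (?r, 0, v i) (T' (length w # ?r s # map ?r js)) (?r, 0, v i @ F w (?r s) (map ?r js))"
    by (rule c'(2)) (use z in "auto simp: r_def")
   moreover have "v (Suc i) = v i @ F w (?r s) (map ?r js)" unfolding m by (simp add: v_def r_def)
   moreover have "?r s = i" by (simp add: r_def)
   ultimately have 2: "rn w c' (?r, 0, v i) (T' (length w # i # e)) (?r, 0, v (Suc i))"
    unfolding m by simp
   have "?r(s := Suc (?r s)) = r (Suc i)" by (auto simp: r_def fun_eq_iff)
   then have 3: "rn w (Inc s) (?r, 0, v (Suc i)) 1 (r (Suc i), 0, v (Suc i))"
    using rn_Inc[of 1 w s ?r "(0, v (Suc i))"] by simp
   have "T' (length w # i # e) <= (length w + (i + sum_list e) + 2) ^ q" using q[of "length w # i # e"] by simp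
   also have "... <= (n e + sum_list ?l + 2) ^ q" using i by (intro power_mono) auto
   finally show ?thesis
    by - (rule rn_Sq[OF 1 rn_Sq[OF 2 3 lessI]], simp add: K_def)
  qed
  have "map rg js = e" by (simp add: e_def)
  have "rg(s+1 := n e) = r 0" using z by (auto simp: r_def fun_eq_iff)
  then have 1: "rn w c (rg, 0, u) (T e) (r 0, 0, v 0)"
   using ex_rn[OF c(3), of rg w "(0, u)"] z by (simp add: e_def v_def)
  have 2: "rn w (Until (Zero (s+1)) ?body) (r 0, 0, v 0) (n e * (K ?l + 1) + 1) (r (n e), 0, v (n e))"
   by (rule rn_loop[where sg = "%i. (r i, 0, v i)" and K = "K ?l"]; (rule body, assumption | simp add: r_def))
  have "(r (n e))(s := 0) = rg" using z by (auto simp: r_def fun_eq_iff)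
  then have 3: "rn w (clear s) (r (n e), 0, v (n e)) (2 * n e + 1) (rg, 0, v (n e))"
   using ex_rn[OF ex_clear[of "r (n e)" s "2 * n e + 1"], of w "(0, v (n e))"] by (simp add: r_def)
  show ?thesis unfolding list.sel \<open>map rg js = e\<close> v_def[symmetric]
   by (rule rn_Sq[OF 1 rn_Sq[OF 2 3 lessI]]) simp
 qed
 moreover have "pb ?T" unfolding K_def
  by (intro pb_intros pb_comp[OF c(2) pb_sum sum_list_tl] pb_comp[OF LS_pb[OF assms(1)] pb_sum sum_list_tl])
 ultimately show "EX c T. emits c js s (%w e. concat (map (%i. F w i e) [0..<n e])) T"
  by (intro emits_I[where T = ?T and c = ?c]) simp_all
qed

lemma LO_tl: assumes "LO F" shows "LO (%w e. F w (tl e))"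
proof (rule LO_I)
 fix js s assume "ALL j : set js. j < (s::nat)"
 then have "ALL j : set (tl js). j < s" by (cases js) auto
 then obtain c T where c: "emits c (tl js) s F T" using LO_D[OF assms] by blast
 have "pb (%e. T (hd e # tl (tl e)))"
  by (rule pb_comp[OF emits_D(1)[OF c] pb_add[OF pb_hd pb_sum]]) (case_tac e; case_tac "tl e"; simp)
 then show "EX c T. emits c js s (%w e. F w (tl e)) T"
  using emits_D(2)[OF c] by (intro emits_I[where T = "%e. T (hd e # tl (tl e))" and c = c]) (simp_all add: map_tl)
qed

text \<open>A conditional is a pair of loops, one of length 1 and the other of length 0.\<close>

lemma LO_if [LO_intro]:
 assumes "LSP P" "LO F" "LO G" shows "LO (%w e. if P e then F w e else G w e)"
proof -
 have "LO (%w e. concat (map (%i. F w e) [0..<if P e then 1 else 0]) @ concat (map (%i. G w e) [0..<if P e then 0 else 1]))"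
  by (intro LO_append LO_for LS_intro LO_tl assms)
 moreover have "concat (map (%i. u) [0..<if b then 1 else 0]) @ concat (map (%i. v) [0..<if b then 0 else 1]) = (if b then u else v)"
  for b and u v :: "bool list" by simp
 ultimately show ?thesis by (simp only:)
qed

text \<open>Up to the tail \<open>[True, True, False]\<close> this is the encoding of the
  exponentially large number \<open>wn w\<close> (see \<open>enc_nat_wn\<close>), which thus is
  written without ever being computed.\<close>

lemma LO_word [LO_intro]: "LO (%w e. concat (map (%b. [True, b]) w))"
proof (rule LO_I)
 fix js :: "nat list" and s
 let ?body = "Sq (Ite (Sym 1) (Sq (Out True) (Out False)) (Sq (Out True) (Out True))) Adv"
 let ?c = "Sq (Until (Sym 0) ?body) Rewind"
 have out: "rn w (Out b) (rg, k, u) 1 (rg, k, u @ [b])" for w b rg k u by (rule rn_1) auto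
 have "rn w ?c (rg, 0, u) (7 * length w + 3) (rg, 0, u @ concat (map (%b. [True, b]) w))" for w rg u
 proof -
  define v where "v k = u @ concat (map (%b. [True, b]) (take k w))" for k
  have body: "rn w ?body (rg, k, v k) 6 (rg, Suc k, v (Suc k))" if k: "k < length w" for k
  proof -
   have v: "v (Suc k) = (v k @ [True]) @ [w ! k]" using k by (simp add: v_def take_Suc_conv_app_nth)
   have "rn w (Sq (Out True) (Out (w ! k))) (rg, k, v k) 3 (rg, k, v (Suc k))"
    unfolding v by (rule rn_Sq[OF out out]) simp
   then have "rn w (if holds w (Sym 1) (rg, k, v k) then Sq (Out True) (Out False) else Sq (Out True) (Out True))
     (rg, k, v k) 3 (rg, k, v (Suc k))"
    using k by (cases "w ! k") (auto simp: word_tape_in)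
   from rn_Ite[OF this lessI]
   have 1: "rn w (Ite (Sym 1) (Sq (Out True) (Out False)) (Sq (Out True) (Out True))) (rg, k, v k) 4
     (rg, k, v (Suc k))" by simp
   have "rn w Adv (rg, k, v (Suc k)) 1 (rg, Suc k, v (Suc k))" by (rule rn_1) (use k in auto)
   from rn_Sq[OF 1 this] show ?thesis by simp
  qed
  have 1: "rn w (Until (Sym 0) ?body) (rg, 0, v 0) (7 * length w + 1) (rg, length w, v (length w))"
   by (rule rn_loop[where sg = "%k. (rg, k, v k)" and K = 6]; (rule body, assumption | simp add: word_tape_eq0))
  from rn_Sq[OF 1 rn_Rewind[of 1]] show ?thesis by (simp add: v_def)
 qed
 then show "EX c T. emits c js s (%w e. concat (map (%b. [True, b]) w)) T"
  by (intro emits_I[where T = "%e. 7 * hd e + 3" and c = ?c]) (simp_all add: pb_intros pb_hd)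
qed

lemma bits_nth: "i < length (bits x) ==> bits x ! i = odd (x div 2 ^ i)"
proof (induction x arbitrary: i rule: bits.induct)
 case (1 x)
 show ?case
 proof (cases "x = 0")
  case True
  then show ?thesis using 1(2) by (simp add: bits.simps)
 next
  case False
  then show ?thesis using 1 by (cases i) (auto simp: bits.simps[of x] div_mult2_eq)
 qed
qed

lemma length_bits: "length (bits x) = (SUM i<x. if x div 2 ^ i = 0 then 0 else 1)"
proof -
 have *: "x div 2 ^ i = 0 \<longleftrightarrow> length (bits x) <= i" for i
 proof (induction x arbitrary: i rule: bits.induct)
  case (1 x)
  then show ?case
   by (cases "x = 0"; cases i) (auto simp: bits.simps[of x] bits.simps[of 0] div_mult2_eq)
 qed
 have "length (bits x) <= x"
  using *[of x] less_two_power[of x] by simp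
 then have "{..<x} Int {i. ~ length (bits x) <= i} = {..<length (bits x)}" by auto
 then show ?thesis unfolding * by (simp add: sum.If_cases Collect_neg_eq[symmetric])
qed

lemma LS_div_pow [LS_intro]:
 assumes "LS z" "LS i" shows "LS (%e. z e div k ^ i e)"
proof -
 have r: "rec_nat z (%i r. r div b) i = z div b ^ i" for z b i :: nat
  by (induction i) (simp_all add: div_mult2_eq[symmetric] mult.commute)
 have "LS (%e. rec_nat (z e) (%i r. r div k) (i e))"
  by (rule LS_rec[where h = "%r i e. r div k" and B = z])
   (use assms r LS_pb[OF assms(1)] in "auto intro: LS_intro")
 then show ?thesis by (simp add: r)
qed

lemma enc_nat_for: "enc_nat x = concat (map (%i. if x div 2 ^ i mod 2 = 1 then [True, True] else [True, False])
  [0..<SUM i<x. if x div 2 ^ i = 0 then 0 else 1]) @ [False]"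
proof -
 have "map (%b. [True, b]) (bits x) =
   map (%i. if x div 2 ^ i mod 2 = 1 then [True, True] else [True, False]) [0..<length (bits x)]"
  by (rule nth_equalityI) (auto simp: bits_nth odd_iff_mod_2_eq_one)
 then show ?thesis by (simp add: enc_nat_def length_bits)
qed

lemma LO_enc_nat [LO_intro]: assumes "LS f" shows "LO (%w e. enc_nat (f e))"
 unfolding enc_nat_for by (intro LO_intro LS_intro assms LS_tl[OF assms])

lemma concat_enc_vector: "enc_vector {a..<b} m = enc_nat (b - a) @ concat (map (%i. enc_nat (m (a + i))) [0..<b - a])"
proof -
 have "[a..<b] = map (%i. a + i) [0..<b - a]" by (rule nth_equalityI) auto
 then show ?thesis by (simp add: enc_vector_def enc_list_def o_def)
qed

theorem polytime_I:
 assumes "LO F" shows "polytime_computable (%w. F w [length w])"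
proof -
 obtain c T where ec: "emits c [0] 1 F T" using LO_D[OF assms, of "[0]" 1] by auto
 note c = emits_D[OF ec]
 let ?c = "Sq (Until (Sym 0) (Sq (Inc 0) Adv)) (Sq Rewind c)"
 obtain q where q: "!!e. T e <= (sum_list e + 2) ^ q" using c(1) unfolding pb_def by blast
 define K where "K n = (2 * n + 2) ^ q + 4 * n + 6" for n :: nat
 have run: "rn w ?c ((%_. 0), 0, []) (K (length w)) ((%_. 0)(0 := length w), 0, F w [length w])" for w
 proof -
  define r :: "nat => nat => nat" where "r k = (%_. 0)(0 := k)" for k
  have 1: "rn w (Until (Sym 0) (Sq (Inc 0) Adv)) (r 0, 0, []) (length w * (1 + 3) + 1) (r (length w), length w, [])"
  proof (rule rn_scan_aux)
   fix k
   show "rn w (Inc 0) (r k, k, []) 1 (r (Suc k), k, [])"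
    using rn_Inc[of 1 w 0 "r k" "(k, [])"] by (simp add: r_def)
  qed
  have 3: "rn w c (r (length w), 0, []) (T [length w, length w]) (r (length w), 0, F w [length w])"
   using c(2)[where rg = "r (length w)" and w = w and u = "[]"] by (simp add: r_def)
  have "T [length w, length w] <= (2 * length w + 2) ^ q"
   using q[of "[length w, length w]"] by (simp add: mult_2)
  then have "rn w ?c (r 0, 0, []) (K (length w)) (r (length w), 0, F w [length w])"
   by - (rule rn_Sq[OF 1 rn_Sq[OF rn_Rewind[of 1] 3 lessI]], simp_all add: K_def)
  moreover have "r 0 = (%_. 0)" by (auto simp: r_def)
  ultimately show ?thesis by (simp add: r_def)
 qed
 obtain R where R: "cregs ?c <= {..<R}" "0 < R" using cregs_bounded by blast
 have "EX t <= K (length w) * (2 * (K (length w) + 1) + length w + 4) + 1.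
   halted (ctm ?c R) (run (ctm ?c R) w t) & fst (last (snd (run (ctm ?c R) w t))) = word_tape (F w [length w])" for w
 proof -
  obtain r0 t where t: "t <= K (length w)" "crun w ?c t = ([], r0, 0, F w [length w])"
   using rn_crun[OF run] by blast
  \<comment> \<open>A crude number of digits: allowing numerals as long as the running time still
    gives a polynomial bound.\<close>
  have tl: "t < 2 ^ (K (length w) + 1)" using t(1) less_two_power[of "K (length w) + 1"] by linarith
  have l0: "0 < K (length w) + 1" by simp
  have u: "length (snd (snd (snd (crun w ?c i)))) <= t" if "i <= t" for i
   using crun_inv[where w = w and c = ?c and i = i] that by (auto split: prod.splits)
  obtain t' where t': "t' <= t * (2 * (K (length w) + 1) + length w + 4) + 1"
   "run (ctm ?c R) w t' = (if r0 0 = 0 then 1 else 0, snd (cfg ?c R w ([], r0, 0, F w [length w])))"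
  using ctm_correct(1)[OF R tl l0 u t(2)] by blast
  have "t' <= K (length w) * (2 * (K (length w) + 1) + length w + 4) + 1"
   using t'(1) mult_right_mono[OF t(1), of "2 * (K (length w) + 1) + length w + 4"] by linarith
  moreover have "halted (ctm ?c R) (run (ctm ?c R) w t')" unfolding t'(2) by (simp add: halted_def)
  moreover have "fst (last (snd (run (ctm ?c R) w t'))) = word_tape (F w [length w])" unfolding t'(2) by simp
  ultimately show ?thesis by blast
 qed
 moreover have "pb (%e. K (hd e) * (2 * (K (hd e) + 1) + hd e + 4) + 1)" unfolding K_def
  by (intro pb_intros pb_hd)
 then obtain d where d: "!!e::nat list. K (hd e) * (2 * (K (hd e) + 1) + hd e + 4) + 1 <= (sum_list e + 2) ^ d"
  unfolding pb_def by blast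
 \<comment> \<open>The power \<open>(n + 2) ^ d\<close> is at most \<open>(3 * n) ^ d\<close> for
   positive \<open>n\<close> and \<open>2 ^ d\<close> for \<open>n = 0\<close>.\<close>
 have "K n * (2 * (K n + 1) + n + 4) + 1 <= 3 ^ d * n ^ d + 3 ^ d" for n
 proof -
  have "K n * (2 * (K n + 1) + n + 4) + 1 <= (n + 2) ^ d" using d[of "[n]"] by simp
  also have "... <= 3 ^ d * n ^ d + 3 ^ d"
   using power_mono[of "n + 2" "3 * n" d] power_mono[of 2 "3::nat" d] by (cases "n = 0") (auto simp: power_mult_distrib numeral_2_eq_2)
  finally show ?thesis .
 qed
 ultimately have "computes_in_time (ctm ?c R) (%w. F w [length w]) (%n. 3 ^ d * n ^ d + 3 ^ d)"
  unfolding computes_in_time_def by (meson order_trans)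
 then show ?thesis using is_tm_ctm[OF R(1)] unfolding polytime_computable_def by blast
qed

section \<open>Recursive Petri nets\<close>

subsection \<open>Rooted trees\<close>

text \<open>Parents are unique, so a cycle through a vertex also passes through its parent; followed
  up to the root, it would contradict that the root has no parent.\<close>

lemma rooted_tree_acyclic:
 assumes "rooted_tree V E r" "v : V"
 shows "(v, v) ~: E^+"
proof -
 have E: "E <= V \<times> V" "!!u. (u, r) ~: E" "!!v x y. (x, v) : E ==> (y, v) : E ==> x = y"
  using assms(1) unfolding rooted_tree_def by (blast, blast, metis DiffI mem_Sigma_iff singletonD subsetD)
 have "(r, v) : E^*" using assms unfolding rooted_tree_def by blast
 then show ?thesis
 proof (induction rule: rtrancl_induct)
  case base
  show ?case using E(2) by (meson tranclD2)
 next
  case (step y z)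
  show ?case
  proof
   assume "(z, z) : E^+"
   then obtain x where "(z, x) : E^*" "(x, z) : E" by (meson tranclD2)
   then have "(z, y) : E^*" using E(3) step(2) by blast
   then show False using step(2,3) by (meson rtrancl_into_trancl2)
  qed
 qed
qed

lemma rooted_tree_add:
 assumes "rooted_tree V E r" "v : V" "w ~: V"
 shows "rooted_tree (insert w V) (insert (v, w) E) r"
proof -
 have E: "r : V" "E <= V \<times> V" "!!u. (u, r) ~: E" "!!v. v : V - {r} ==> EX! u. (u, v) : E" "!!v. v : V ==> (r, v) : E^*"
  using assms(1) unfolding rooted_tree_def by blast+
 have mono: "E^* <= (insert (v, w) E)^*" by (rule rtrancl_mono) blast
 have "EX! u. (u, x) : insert (v, w) E" if "x : insert w V - {r}" for x
 proof (cases "x = w")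
  case True
  then show ?thesis using E(2) assms(3) by blast
 next
  case False
  then have "EX! u. (u, x) : E" using E(4) that by blast
  then show ?thesis using False by simp
 qed
 moreover have "(r, x) : (insert (v, w) E)^*" if "x : insert w V" for x
  using that E(5) mono assms(2) by (metis insertE insertI1 rtrancl.rtrancl_into_rtrancl subsetD)
 moreover have "(u, r) ~: insert (v, w) E" for u using E(1,3) assms(3) by auto
 moreover have "insert (v, w) E <= insert w V \<times> insert w V" using E(2) assms(2) by auto
 ultimately show ?thesis using E(1) unfolding rooted_tree_def by simp
qed

lemma rooted_tree_cut:
 assumes "rooted_tree V E r" "v ~= r" and D: "D = {x. (v, x) : E^*}"
 shows "rooted_tree (V - D) (E Int (- D) \<times> (- D)) r"
proof -
 have E: "r : V" "E <= V \<times> V" "!!u. (u, r) ~: E" "!!v. v : V - {r} ==> EX! u. (u, v) : E" "!!v. v : V ==> (r, v) : E^*"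
  using assms(1) unfolding rooted_tree_def by blast+
 have cl: "(x, y) : E ==> x : D ==> y : D" for x y unfolding D by (auto intro: rtrancl_into_rtrancl)
 have r: "r ~: D" unfolding D using E(3) assms(2) by (metis mem_Collect_eq rtranclE)
 have "EX! u. (u, x) : E Int (- D) \<times> (- D)" if "x : V - D - {r}" for x
 proof -
  obtain u where "(u, x) : E" "!!u'. (u', x) : E ==> u' = u" using E(4)[of x] \<open>x : V - D - {r}\<close> by blast
  then show ?thesis using cl that by blast
 qed
 moreover have "x ~: D --> (r, x) : (E Int (- D) \<times> (- D))^*" if "(r, x) : E^*" for x
  using that
 proof (induction rule: rtrancl_induct)
  case (step y z)
  then show ?case using cl[OF step(2)] by (auto intro: rtrancl_into_rtrancl)
 qed auto
 ultimately show ?thesis using E(1-3,5) r unfolding rooted_tree_def by blast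
qed

subsection \<open>Closable threads\<close>

inductive clo :: "'a rpn => ('a => nat) => bool" for N where
 clo_cut: "t : cut_trans N ==> Wminus N t <= m ==> clo N m"
| clo_elem: "t : elem_trans N ==> Wminus N t <= m ==>
  clo N (%p. m p - Wminus N t p + Wplus N t p) ==> clo N m"
| clo_abs: "t : abs_trans N ==> Wminus N t <= m ==> clo N (Omega N t) ==>
  clo N (%p. m p - Wminus N t p + Wplus N t p) ==> clo N m"

lemma clo_mono: "clo N m ==> m <= m' ==> clo N m'"
proof (induction arbitrary: m' rule: clo.induct)
 case (clo_cut t m)
 then show ?case by (meson clo.clo_cut order_trans)
next
 case (clo_elem t m)
 have "(%p. m p - Wminus N t p + Wplus N t p) <= (%p. m' p - Wminus N t p + Wplus N t p)"
  using clo_elem.prems by (simp add: le_fun_def diff_le_mono)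
 show ?case by (rule clo.clo_elem[OF clo_elem(1) order_trans[OF clo_elem(2,5)] clo_elem(4)]) fact
next
 case (clo_abs t m)
 have "(%p. m p - Wminus N t p + Wplus N t p) <= (%p. m' p - Wminus N t p + Wplus N t p)"
  using clo_abs.prems by (simp add: le_fun_def diff_le_mono)
 show ?case by (rule clo.clo_abs[OF clo_abs(1) order_trans[OF clo_abs(2,7)] clo_abs(3,6)]) fact
qed

text \<open>The children in \<open>X\<close> are closed first and pay their labels; the other
  children of the thread are swept away by its cut. With \<open>X\<close> empty this is
  \<open>clo\<close> of the marking.\<close>

inductive cl :: "'a rpn => ('a, 'v) state => 'v => bool" for N s where
 "mark s v = Some m ==> finite X ==> (!!w. w : X ==> (v, w) : edges s & cl N s w) ==>
  clo N (%p. m p + (SUM w:X. the (label s (v, w)) p)) ==> cl N s v"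

lemma cl_leaf: "mark s v = Some m ==> clo N m ==> cl N s v"
 by (rule cl.intros[of s v m "{}"]) auto

definition wfs :: "('a, 'v) state => bool" where
 "wfs s \<longleftrightarrow> s = empty_state | finite (verts s) & (EX r. rooted_tree (verts s) (edges s) r)"

definition good :: "'a rpn => ('a, 'v) state => bool" where
 "good N s \<longleftrightarrow> s = empty_state | (EX r. is_root s r & cl N s r)"

lemma state_dom: "mark s v = Some m ==> v : verts s" "label s e = Some l ==> e : edges s"
 by (auto simp: verts_def edges_def)

lemma verts_empty [simp]: "verts empty_state = {}" "edges empty_state = {}"
 by (auto simp: verts_def edges_def empty_state_def)

lemma wfs_finite: "wfs s ==> finite (verts s)"
 by (auto simp: wfs_def)

lemma wfs_edges: "wfs s ==> edges s <= verts s \<times> verts s"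
 by (auto simp: wfs_def rooted_tree_def)

lemma wfs_edge_tree: "wfs s ==> e : edges s ==> EX r. rooted_tree (verts s) (edges s) r"
 by (auto simp: wfs_def)

lemma wfs_tree: "wfs s ==> mark s v = Some m ==> EX r. rooted_tree (verts s) (edges s) r"
 by (auto simp: wfs_def empty_state_def)

lemma fire_wfs: "fire N U s a s' ==> wfs s ==> verts s <= U ==> wfs s'"
proof (induction rule: fire.induct)
 case (elementary t v m s')
 then have "verts s' = verts s" "edges s' = edges s" by (auto simp: verts_def edges_def)
 then show ?case using elementary by (auto simp: wfs_def empty_state_def)
next
 case (abstract t v m w s')
 obtain r where r: "rooted_tree (verts s) (edges s) r" using wfs_tree[OF abstract(6,2)] by blast
 have "verts s' = insert w (verts s)" "edges s' = insert (v, w) (edges s)"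
  using abstract by (auto simp: verts_def edges_def)
 moreover have "rooted_tree (insert w (verts s)) (insert (v, w) (edges s)) r"
  by (rule rooted_tree_add[OF r state_dom(1)[OF abstract(2)]]) (use abstract(4,7) in auto)
 moreover have "finite (verts s)" by (rule wfs_finite) fact
 ultimately show ?case by (auto simp: wfs_def)
next
 case (cut_nonroot t v m u l k s')
 obtain r where r: "rooted_tree (verts s) (edges s) r" using wfs_tree[OF cut_nonroot(7,2)] by blast
 have uv: "(u, v) : edges s" by (rule state_dom) fact
 then have "v ~= r" using r by (auto simp: rooted_tree_def)
 have "verts s' = verts s - subtree s v" "edges s' = edges s Int (- subtree s v) \<times> (- subtree s v)"
  using cut_nonroot by (auto simp: verts_def edges_def restrict_map_def split: if_splits)
 moreover have "rooted_tree (verts s - subtree s v) (edges s Int (- subtree s v) \<times> (- subtree s v)) r"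
  by (rule rooted_tree_cut[OF r \<open>v ~= r\<close>]) (simp add: subtree_def)
 moreover have "finite (verts s)" by (rule wfs_finite) fact
 ultimately show ?case unfolding wfs_def by auto
qed (simp add: wfs_def)

lemma not_in_subtree:
 assumes "wfs s" "(u, v) : edges s" shows "u ~: subtree s v"
proof
 assume "u : subtree s v"
 then have "(u, u) : (edges s)^+"
  using assms(2) unfolding subtree_def by (meson mem_Collect_eq rtrancl_into_trancl2)
 moreover have "u : verts s" using wfs_edges[OF assms(1)] assms(2) by blast
 moreover obtain r where "rooted_tree (verts s) (edges s) r" using wfs_edge_tree[OF assms] by blast
 ultimately show False using rooted_tree_acyclic[of "verts s" "edges s" r u] by simp
qed

lemma wfs_parent:
 assumes "wfs s" "(u, v) : edges s" "(u', v) : edges s" shows "u = u'"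
proof -
 obtain r where r: "rooted_tree (verts s) (edges s) r" using wfs_edge_tree[OF assms(1,2)] by blast
 then have "v : verts s - {r}" using assms unfolding rooted_tree_def by blast
 then have "EX! u. (u, v) : edges s" using r unfolding rooted_tree_def by simp
 then show ?thesis using assms by blast
qed

text \<open>Goodness is carried backwards, starting from the empty state. A firing inside a thread
  becomes one more rule of \<open>clo\<close> for it; a thread that was cut becomes a closable child
  of its parent; a thread that was created has no children yet, so in the new state it can only be
  closed through \<open>Omega\<close>.\<close>

lemma fire_good:
 assumes "fire N U s a s'" "wfs s" "verts s <= U" "good N s'"
 shows "good N s"
 using assms
proof (cases rule: fire.cases)
 case (elementary t v m)
 let ?m = "%p. m p - Wminus N t p + Wplus N t p"
 have e: "edges s' = edges s" "verts s' = verts s" "label s' = label s"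
  using elementary by (auto simp: edges_def verts_def)
 have "cl N s x" if "cl N s' x" for x
  using that
 proof (induction rule: cl.induct)
  case (1 x k X)
  show ?case
  proof (cases "x = v")
   case True
   then have k: "k = ?m" using 1 elementary by simp
   have "clo N (%p. m p + (SUM w:X. the (label s (v, w)) p))"
   proof (rule clo_elem)
    show "Wminus N t <= (%p. m p + (SUM w:X. the (label s (v, w)) p))"
     using elementary by (simp add: le_fun_def trans_le_add1)
    have "(%p. m p + (SUM w:X. the (label s (v, w)) p) - Wminus N t p + Wplus N t p) =
     (%p. k p + (SUM w:X. the (label s' (x, w)) p))"
    proof
     fix p
     show "m p + (SUM w:X. the (label s (v, w)) p) - Wminus N t p + Wplus N t p = k p + (SUM w:X. the (label s' (x, w)) p)"
      using le_funD[OF elementary(4), of p] by (simp add: k True e)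
    qed
    then show "clo N (%p. m p + (SUM w:X. the (label s (v, w)) p) - Wminus N t p + Wplus N t p)" using 1 by simp
   qed (use elementary in simp)
   then show ?thesis using 1 True elementary e by (intro cl.intros[of s x m X]) auto
  next
   case False
   then show ?thesis using 1 elementary e by (intro cl.intros[of s x k X]) auto
  qed
 qed
 moreover have "s' ~= empty_state" using e elementary state_dom by (force simp: empty_state_def verts_def)
 ultimately show ?thesis using assms(4) e by (auto simp: good_def is_root_def)
next
 case (abstract t v m w)
 let ?m = "%p. m p - Wminus N t p"
 have w: "w ~: verts s" "v ~= w" using abstract assms(3) state_dom by fast+
 have e: "edges s' = insert (v, w) (edges s)" "verts s' = insert w (verts s)"
  using abstract by (auto simp: edges_def verts_def)
 have lab: "label s' (x, y) = label s (x, y)" if "y ~= w" for x y using abstract that by auto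
 have ew: "(x, w) ~: edges s" "(w, x) ~: edges s" for x using wfs_edges[OF assms(2)] w by auto
 have cw: "clo N (Omega N t)" if "cl N s' w"
  using that
 proof (cases rule: cl.cases)
  case (1 k X)
  then have "X = {}" using e ew w by auto
  then show ?thesis using 1 abstract by simp
 qed
 have "x = w | cl N s x" if "cl N s' x" for x
  using that
 proof (induction rule: cl.induct)
  case (1 x k X)
  show ?case
  proof (cases "x = v")
   case True
   then have k: "k = ?m" using 1 abstract w by simp
   let ?X = "X - {w}"
   let ?S = "%p. SUM w:?X. the (label s (v, w)) p"
   have S: "(SUM w:?X. the (label s' (x, w)) p) = ?S p" for p
    using lab True by (intro sum.cong) auto
   have "clo N (%p. m p + ?S p)"
   proof (cases "w : X")
    case True
    have wS: "(SUM w:X. the (label s' (x, w)) p) = Wplus N t p + ?S p" for p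
     using sum.remove[OF 1(2) True, of "%w. the (label s' (x, w)) p"] S[of p] abstract \<open>x = v\<close> by simp
    have "(%p. m p + ?S p - Wminus N t p + Wplus N t p) = (%p. k p + (SUM w:X. the (label s' (x, w)) p))"
    proof (intro ext)
     fix p
     show "m p + ?S p - Wminus N t p + Wplus N t p = k p + (SUM w:X. the (label s' (x, w)) p)"
      using le_funD[OF abstract(4), of p] by (simp add: k wS)
    qed
    then have "clo N (%p. m p + ?S p - Wminus N t p + Wplus N t p)" using 1 by simp
    moreover have "Wminus N t <= (%p. m p + ?S p)"
     using abstract by (simp add: le_fun_def trans_le_add1)
    ultimately show ?thesis using abstract cw 1 True by (blast intro: clo_abs)
   next
    case False
    then have "clo N (%p. k p + ?S p)" using 1 S by simp
    then show ?thesis by (rule clo_mono) (simp add: k le_fun_def)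
   qed
   then show ?thesis using 1 True abstract e by (auto intro!: cl.intros[of s v m ?X])
  next
   case False
   show ?thesis
   proof (cases "x = w")
    case False
    have "w ~: X" using 1 \<open>x ~= v\<close> e ew by auto
    then have "(SUM w:X. the (label s' (x, w)) p) = (SUM w:X. the (label s (x, w)) p)" for p
     by (intro sum.cong refl, subst lab) auto
    moreover have "mark s x = Some k" using 1 abstract \<open>x ~= v\<close> False by simp
    ultimately show ?thesis using 1 \<open>w ~: X\<close> e \<open>x ~= v\<close> by (auto intro!: cl.intros[of s x k X])
   qed simp
  qed
 qed
 moreover have "r ~= w & is_root s r" if "is_root s' r" for r using that e by (auto simp: is_root_def)
 moreover have "s' ~= empty_state" using e by (auto simp: empty_state_def verts_def)
 ultimately show ?thesis using assms(4) unfolding good_def by blast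
next
 case (cut_root t v m)
 then have "cl N s v" using cl_leaf[of s v m N] clo_cut[of t N m] by simp
 with cut_root show ?thesis using cut_root by (auto simp: good_def)
next
 case (cut_nonroot t v m u l k)
 have uv: "(u, v) : edges s" by (rule state_dom) fact
 have u: "u ~: subtree s v" by (rule not_in_subtree[OF assms(2) uv])
 have v: "v : subtree s v" by (simp add: subtree_def)
 have clv: "cl N s v" by (rule cl_leaf[OF cut_nonroot(3) clo_cut[OF cut_nonroot(2,4)]])
 have e: "edges s' = edges s Int (- subtree s v) \<times> (- subtree s v)" "verts s' = verts s - subtree s v"
  using cut_nonroot by (auto simp: verts_def edges_def restrict_map_def split: if_splits)
 have mk: "mark s' y = (if y : subtree s v then None else if y = u then Some (%p. k p + l p) else mark s y)" for y
  by (simp add: cut_nonroot(7) restrict_map_def)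
 have lab: "label s' (x, y) = label s (x, y)" if "(x, y) : edges s'" for x y
  using cut_nonroot that e by auto
 have "cl N s x" if "cl N s' x" for x
  using that
 proof (induction rule: cl.induct)
  case (1 x k' X)
  have x: "x ~: subtree s v" using state_dom(1)[OF 1(1)] e by blast
  have S: "(SUM w:X. the (label s' (x, w)) p) = (SUM w:X. the (label s (x, w)) p)" for p
   using lab 1 by (intro sum.cong) auto
  show ?case
  proof (cases "x = u")
   case True
   then have k': "k' = (%p. k p + l p)" using 1(1) x by (simp add: mk)
   \<comment> \<open>Before the firing \<open>v\<close> was closable by this very cut, so it joins
     the children used for \<open>u\<close> and contributes the label that the firing has
     paid.\<close>
   have "v ~: X" using 1 e v by auto
   then have "(%p. k p + (SUM w:insert v X. the (label s (u, w)) p)) = (%p. k' p + (SUM w:X. the (label s' (x, w)) p))"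
    using S 1(2) True cut_nonroot by (auto simp: k')
   then show ?thesis using 1 True cut_nonroot e clv uv by (auto intro!: cl.intros[of s u k "insert v X"])
  next
   case False
   then have "mark s x = Some k'" using 1(1) x by (simp add: mk)
   then show ?thesis using 1 S e by (auto intro!: cl.intros[of s x k' X])
  qed
 qed
 moreover have "is_root s x" if "is_root s' x" for x
  using that e unfolding is_root_def subtree_def by (auto intro: rtrancl_into_rtrancl)
 moreover have "u : verts s'" using e u state_dom(1)[OF cut_nonroot(6)] by blast
 then have "s' ~= empty_state" by (auto simp: empty_state_def verts_def)
 ultimately show ?thesis using assms(4) by (auto simp: good_def)
qed

lemma fire_seq_good:
 "fire_seq N U s sg s' ==> s' = empty_state ==> wfs s ==> verts s <= U ==> good N s"
proof (induction rule: fire_seq.induct)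
 case (Cons U s a s' sg s'')
 then show ?case using fire_wfs[OF Cons(1)] fire_good[OF Cons(1)] by simp
qed (simp add: good_def)

section \<open>Closing the threads one after another\<close>

text \<open>The set of used vertices grows along a run, so the statement is made for every finite
  such set; an infinite supply of threads then always leaves a fresh one.\<close>

definition can :: "'a rpn => ('a, 'v) state => bool" where
 "can N s \<longleftrightarrow> (ALL U. finite U & verts s <= U --> (EX sg. fire_seq N U s sg empty_state))"

lemma can_empty: "can N empty_state"
 unfolding can_def by (blast intro: fire_seq.Nil)

lemma can_step:
 assumes "!!U. finite U ==> verts s <= U ==> EX a s'. fire N U s a s' & can N s' & finite (verts s')"
 shows "can N s"
 unfolding can_def
proof (intro allI impI)
 fix U assume U: "finite U & verts s <= U"
 then obtain a s' where a: "fire N U s a s'" "can N s'" "finite (verts s')" using assms by blast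
 then have "EX sg. fire_seq N (U Un verts s') s' sg empty_state" using U unfolding can_def by simp
 then show "EX sg. fire_seq N U s sg empty_state" using a(1) by (blast intro: fire_seq.Cons)
qed

text \<open>The outcome of closing \<open>v\<close>. It does not depend on the marking of
  \<open>v\<close>, so firings inside the thread leave it unchanged (\<open>cutres_upd\<close>), and
  it can serve as the goal of a thread before its cut is known.\<close>

definition cutres :: "('a, 'v) state => 'v => ('a, 'v) state" where
 "cutres s v = (if is_root s v then empty_state else let u = THE u. (u, v) : edges s in
   (|mark = ((mark s)(u |-> (%p. the (mark s u) p + the (label s (u, v)) p))) |` (- subtree s v),
   label = label s |` ((- subtree s v) \<times> (- subtree s v))|))"

lemma parent_ex: "mark s v = Some m ==> ~ is_root s v ==> EX u. (u, v) : edges s"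
 unfolding is_root_def using state_dom by fast

lemma the_parent: "wfs s ==> (u, v) : edges s ==> (THE u. (u, v) : edges s) = u"
 by (rule the_equality) (auto dest: wfs_parent)

lemma wfs_cutres: "wfs s ==> mark s v = Some m ==> wfs (cutres s v)"
proof -
 assume s: "wfs s" and m: "mark s v = Some m"
 show ?thesis
 proof (cases "is_root s v")
  case True
  then show ?thesis by (simp add: cutres_def wfs_def)
 next
  case False
  then obtain u where u: "(u, v) : edges s" using parent_ex[OF m] by blast
  then have "u : verts s" using wfs_edges[OF s] by blast
  \<comment> \<open>In a net where every name is a cut transition without precondition, removing
    \<open>v\<close> is a firing, so \<open>fire_wfs\<close> applies.\<close>
  define N :: "'a rpn" where "N = (|places = {}, elem_trans = {}, abs_trans = {}, cut_trans = UNIV, Wminus = (%_ _. 0), Wplus = (%_ _. 0), Omega = (%_ _. 0)|)"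
  have "fire N (verts s) s (v, undefined) (cutres s v)"
   using \<open>u : verts s\<close> u False the_parent[OF s u] m
   by (intro fire.cut_nonroot[of undefined N s v m u "the (label s (u, v))" "the (mark s u)"])
    (auto simp: N_def le_fun_def cutres_def edges_def verts_def Let_def)
  from fire_wfs[OF this s] show ?thesis by simp
 qed
qed

lemma fire_cutres:
 assumes "wfs s" "t : cut_trans N" "mark s v = Some m" "Wminus N t <= m"
 shows "fire N U s (v, t) (cutres s v)"
proof (cases "is_root s v")
 case True
 then show ?thesis using fire.cut_root[OF assms(2-4)] by (simp add: cutres_def)
next
 case False
 then obtain u where u: "(u, v) : edges s" using parent_ex[OF assms(3)] by blast
 then have "u : verts s" using wfs_edges[OF assms(1)] by blast
 then show ?thesis using u False the_parent[OF assms(1) u] assms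
  by (intro fire.cut_nonroot[of t N s v m u "the (label s (u, v))" "the (mark s u)"])
   (auto simp: cutres_def edges_def verts_def Let_def)
qed

lemma cutres_upd:
 assumes "wfs s" "mark s v = Some m"
 shows "cutres (s(|mark := (mark s)(v |-> m')|)) v = cutres s v"
proof -
 let ?s = "s(|mark := (mark s)(v |-> m')|)"
 have e: "edges ?s = edges s" "verts ?s = verts s" "subtree ?s v = subtree s v" "is_root ?s v = is_root s v"
  using assms by (auto simp: edges_def verts_def subtree_def is_root_def)
 show ?thesis
 proof (cases "is_root s v")
  case True
  then show ?thesis using e by (simp add: cutres_def)
 next
  case False
  then obtain u where u: "(u, v) : edges s" using parent_ex[OF assms(2)] by blast
  have "u ~= v" using not_in_subtree[OF assms(1) u] by (auto simp: subtree_def)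
  moreover have "v : subtree s v" by (simp add: subtree_def)
  ultimately show ?thesis using False e the_parent[OF assms(1) u]
   by (auto simp: cutres_def Let_def restrict_map_def fun_eq_iff)
 qed
qed

text \<open>Creating a child and closing it amounts to the effect of an elementary transition on the
  parent.\<close>

lemma cutres_child:
 assumes "wfs s" "mark s v = Some m" "w ~: verts s"
 shows "cutres (|mark = (mark s)(v |-> m1, w |-> m2), label = (label s)((v, w) |-> l)|) w =
   s(|mark := (mark s)(v |-> (%p. m1 p + l p))|)"
proof -
 let ?s = "(|mark = (mark s)(v |-> m1, w |-> m2), label = (label s)((v, w) |-> l)|)"
 have vw: "v ~= w" using assms state_dom by fast
 have e: "edges ?s = insert (v, w) (edges s)" by (auto simp: edges_def)
 have ew: "(x, w) ~: edges s" "(w, x) ~: edges s" for x using wfs_edges[OF assms(1)] assms(3) by auto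
 have wx: "(w, x) : (edges ?s)^* \<longleftrightarrow> x = w" for x
  using ew vw e by (auto elim: converse_rtranclE)
 have st: "subtree ?s w = {w}" unfolding subtree_def using wx by auto
 have nr: "~ is_root ?s w" using e by (auto simp: is_root_def)
 have p: "(THE u. (u, w) : edges ?s) = v" using e ew by auto
 have lw: "label s (x, w) = None" "label s (w, x) = None" "mark s w = None" for x
  using ew assms(3) unfolding edges_def verts_def domIff by blast+
 have "(label s)((v, w) |-> l) |` ((- {w}) \<times> (- {w})) = label s"
 proof (rule ext)
  fix e show "((label s)((v, w) |-> l) |` ((- {w}) \<times> (- {w}))) e = label s e"
   using lw by (cases e) (auto simp: restrict_map_def)
 qed
 moreover have "((mark s)(v |-> m1, w |-> m2, v |-> (%p. m1 p + l p))) |` (- {w}) = (mark s)(v |-> (%p. m1 p + l p))"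
  using lw vw by (auto simp: restrict_map_def fun_eq_iff)
 ultimately show ?thesis using nr p st vw by (simp add: cutres_def Let_def)
qed

text \<open>The premise on \<open>cutres s v\<close> is a continuation: what is left to do once
  \<open>v\<close> has been closed. In the abstract case the induction hypothesis of the child is
  applied with the rest of the run of its parent as continuation.\<close>

lemma clo_can:
 assumes "infinite (UNIV :: 'v set)"
 shows "clo N m ==> wfs s ==> mark s (v::'v) = Some m ==> can N (cutres s v) ==> can N s"
proof (induction arbitrary: s v rule: clo.induct)
 case (clo_cut t m)
 show ?case
 proof (rule can_step)
  fix U
  have "fire N U s (v, t) (cutres s v)" by (rule fire_cutres[OF clo_cut(3,1,4,2)])
  then show "EX a s'. fire N U s a s' & can N s' & finite (verts s')"
   using clo_cut wfs_finite[OF wfs_cutres[OF clo_cut(3,4)]] by blast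
 qed
next
 case (clo_elem t m)
 let ?m = "%p. m p - Wminus N t p + Wplus N t p"
 let ?s = "s(|mark := (mark s)(v |-> ?m)|)"
 have f: "fire N U s (v, t) ?s" for U by (rule fire.elementary[OF clo_elem(1,6,2)]) simp
 have w: "wfs ?s" using fire_wfs[OF f clo_elem(5) order_refl] .
 have "can N ?s" by (rule clo_elem(4)[OF w, of v]) (use cutres_upd[OF clo_elem(5,6)] clo_elem(7) in auto)
 then show ?case using f wfs_finite[OF w] by (intro can_step) blast
next
 case (clo_abs t m)
 show ?case
 proof (rule can_step)
  fix U :: "'v set" assume U: "finite U" "verts s <= U"
  obtain w where w: "w ~: U" using assms U(1) ex_new_if_finite by blast
  have wv: "w ~: verts s" using w U by blast
  let ?s = "(|mark = (mark s)(v |-> (%p. m p - Wminus N t p), w |-> Omega N t),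
      label = (label s)((v, w) |-> Wplus N t)|)"
  let ?s2 = "s(|mark := (mark s)(v |-> (%p. m p - Wminus N t p + Wplus N t p))|)"
  have f: "fire N U s (v, t) ?s" by (rule fire.abstract[OF clo_abs(1,8,2) w]) simp
  have ws: "wfs ?s" using fire_wfs[OF f clo_abs(7) U(2)] .
  have c: "cutres ?s w = ?s2" by (rule cutres_child[OF clo_abs(7,8) wv])
  have "wfs ?s2" using wfs_cutres[OF ws, of w "Omega N t"] c by simp
  then have "can N ?s2" by (rule clo_abs(6)[of _ v]) (use cutres_upd[OF clo_abs(7,8)] clo_abs(9) in auto)
  then have "can N ?s" by (intro clo_abs(5)[OF ws, of w]) (simp_all add: c)
  then show "EX a s'. fire N U s a s' & can N s' & finite (verts s')" using f wfs_finite[OF ws] by blast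
 qed
qed

text \<open>Descending along used children ends at a thread that needs none of its own.\<close>

lemma cl_leaf_ex: "cl N s v ==> EX v' m. mark s v' = Some m & clo N m & (v, v') : (edges s)^*"
proof (induction rule: cl.induct)
 case (1 v m X)
 show ?case
 proof (cases "X = {}")
  case True
  then show ?thesis using 1 by auto
 next
  case False
  then show ?thesis using 1(4) by (meson all_not_in_conv converse_rtrancl_into_rtrancl)
 qed
qed

text \<open>The parent of \<open>v\<close> has the label for good and drops \<open>v\<close> from
  its set \<open>X\<close>. For any other thread outside the subtree of \<open>v\<close>, the
  children it uses lie outside as well.\<close>

lemma cl_cutres:
 assumes "wfs s" "mark s v = Some m" "~ is_root s v"
 shows "cl N s x ==> x ~: subtree s v ==> cl N (cutres s v) x"
proof (induction rule: cl.induct)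
 case (1 x k X)
 obtain u where u: "(u, v) : edges s" using parent_ex[OF assms(2,3)] by blast
 let ?s = "cutres s v"
 have mk: "mark ?s y = (if y : subtree s v then None else if y = u then Some (%p. the (mark s u) p + the (label s (u, v)) p) else mark s y)" for y
  using assms(3) the_parent[OF assms(1) u] by (simp add: cutres_def Let_def restrict_map_def)
 have e: "edges ?s = edges s Int (- subtree s v) \<times> (- subtree s v)"
  using assms(3) by (auto simp: cutres_def Let_def edges_def restrict_map_def split: if_splits)
 have lab: "label ?s (y, z) = label s (y, z)" if "(y, z) : edges ?s" for y z
  using assms(3) that e by (auto simp: cutres_def Let_def)
 have D: "w ~: subtree s v" if w: "w : X" "w ~= v" for w
 proof
  assume "w : subtree s v"
  then obtain y where "(v, y) : (edges s)^*" "(y, w) : edges s"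
   using w(2) unfolding subtree_def by (metis mem_Collect_eq rtranclE)
  moreover have "y = x" using wfs_parent[OF assms(1)] 1(4)[OF w(1)] calculation by blast
  ultimately show False using 1(5) by (simp add: subtree_def)
 qed
 have S: "(SUM w:X - {v}. the (label ?s (x, w)) p) = (SUM w:X - {v}. the (label s (x, w)) p)" for p
 proof (rule sum.cong[OF refl])
  fix w assume "w : X - {v}"
  then have "(x, w) : edges ?s" using e D 1(4,5) by auto
  then show "the (label ?s (x, w)) p = the (label s (x, w)) p" by (simp add: lab)
 qed
 obtain k' where k': "mark ?s x = Some k'" "!!p. k p + (SUM w:X. the (label s (x, w)) p) <= k' p + (SUM w:X - {v}. the (label s (x, w)) p)"
 proof (cases "x = u")
  case True
  have "(SUM w:X. the (label s (x, w)) p) <= the (label s (u, v)) p + (SUM w:X - {v}. the (label s (x, w)) p)" for p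
   using sum.remove[OF 1(2), of v "%w. the (label s (x, w)) p"] True by (cases "v : X") auto
  then show thesis using that mk[of x] True 1(1,5) by (simp add: add.assoc)
 next
  case False
  have "v ~: X" using wfs_parent[OF assms(1) u] 1(4) False by blast
  then show thesis using that[of k] mk[of x] False 1(1,5) by simp
 qed
 show ?case
 proof (rule cl.intros[OF k'(1), of "X - {v}"])
  show "clo N (%p. k' p + (SUM w:X - {v}. the (label ?s (x, w)) p))"
   by (rule clo_mono[OF 1(3)]) (simp add: le_fun_def S k'(2))
  show "(x, w) : edges ?s & cl N ?s w" if "w : X - {v}" for w
   using that e D 1(4,5) by auto
 qed (use 1(2) in simp)
qed

text \<open>A thread that needs no child is closed first. This removes its subtree, keeps the root
  closable by \<open>cl_cutres\<close>, and decreases the number of vertices.\<close>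

lemma cl_can:
 assumes "infinite (UNIV :: 'v set)"
 shows "wfs s ==> is_root s (r::'v) ==> cl N s r ==> can N s"
proof (induction "card (verts s)" arbitrary: s rule: less_induct)
 case less
 obtain v m where v: "mark s v = Some m" "clo N m" "(r, v) : (edges s)^*" using cl_leaf_ex[OF less(4)] by blast
 show ?case
 proof (cases "is_root s v")
  case True
  then have "can N (cutres s v)" using can_empty by (simp add: cutres_def)
  then show ?thesis using clo_can[OF assms v(2) less(2) v(1)] by simp
 next
  case False
  let ?s = "cutres s v"
  have r: "r ~: subtree s v"
  proof
   assume "r : subtree s v"
   moreover have "r ~= v" using False less(3) by blast
   ultimately show False using less(3) unfolding subtree_def is_root_def by (metis mem_Collect_eq rtranclE)
  qed
  have e: "edges ?s <= edges s"
   using False by (auto simp: cutres_def Let_def edges_def restrict_map_def split: if_splits)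
  obtain u where u: "(u, v) : edges s" using parent_ex[OF v(1) False] by blast
  then have "u : verts s" using wfs_edges[OF less(2)] by blast
  then have vs: "verts ?s = verts s - subtree s v"
   using False the_parent[OF less(2) u] by (auto simp: cutres_def Let_def verts_def restrict_map_def split: if_splits)
  have "v : subtree s v" "v : verts s" using v(1) by (auto simp: subtree_def verts_def)
  then have "card (verts ?s) < card (verts s)" using wfs_finite[OF less(2)] vs by (intro psubset_card_mono) auto
  moreover have "wfs ?s" by (rule wfs_cutres[OF less(2) v(1)])
  moreover have "is_root ?s r" using less(3) e vs r by (auto simp: is_root_def)
  moreover have "cl N ?s r" by (rule cl_cutres[OF less(2) v(1) False less(4) r])
  ultimately have "can N ?s" using less(1) by blast
  then show ?thesis using clo_can[OF assms v(2) less(2) v(1)] by simp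
 qed
qed

theorem cut_iff_good:
 assumes "infinite (UNIV :: 'v set)" "is_state N (s :: ('a, 'v) state)"
 shows "(EX sg. firing_sequence N s sg empty_state) \<longleftrightarrow> good N s"
proof
 have w: "wfs s" using assms(2) by (auto simp: is_state_def wfs_def)
 show "good N s" if "EX sg. firing_sequence N s sg empty_state"
  using that fire_seq_good[OF _ refl w] unfolding firing_sequence_def by blast
 assume "good N s"
 then have "can N s" using cl_can[OF assms(1) w] can_empty by (auto simp: good_def)
 then show "EX sg. firing_sequence N s sg empty_state"
  using wfs_finite[OF w] unfolding can_def firing_sequence_def by blast
qed

subsection \<open>Rackoff's bound\<close>

definition actives :: "'a rpn => 'a set" where
 "actives N = elem_trans N Un {t : abs_trans N. clo N (Omega N t)}"

definition shift :: "'a rpn => 'a => ('a => nat) => 'a => nat" where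
 "shift N t m = (%p. m p - Wminus N t p + Wplus N t p)"

text \<open>Covering in at most \<open>n\<close> steps when only the places of \<open>I\<close> are taken into account.\<close>

fun covn :: "'a rpn => nat => 'a set => ('a => nat) => bool" where
 "covn N 0 I m \<longleftrightarrow> (EX t : cut_trans N. ALL p : I. Wminus N t p <= m p)"
| "covn N (Suc n) I m \<longleftrightarrow> covn N 0 I m |
   (EX t : actives N. (ALL p : I. Wminus N t p <= m p) & covn N n I (shift N t m))"

lemma covn_0: "covn N 0 I m ==> covn N n I m"
 by (cases n) auto

lemma covn_Suc: "covn N n I m ==> covn N (Suc n) I m"
proof (induction n arbitrary: m)
 case (Suc n)
 show ?case
 proof (cases "covn N 0 I m")
  case False
  then obtain t where "t : actives N" "ALL p : I. Wminus N t p <= m p" "covn N n I (shift N t m)"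
   using Suc.prems unfolding covn.simps(2) by blast
  then show ?thesis using Suc.IH unfolding covn.simps(2)[of N "Suc n"] by blast
 qed (rule covn_0)
qed simp

lemma covn_mono: "n <= n' ==> covn N n I m ==> covn N n' I m"
 by (induction n' rule: dec_induct) (auto simp del: covn.simps intro: covn_Suc)

lemma covn_proj: "(!!p. p : I ==> m p = m' p) ==> covn N n I m \<longleftrightarrow> covn N n I m'"
proof (induction n arbitrary: m m')
 case (Suc n)
 have "covn N n I (shift N t m) \<longleftrightarrow> covn N n I (shift N t m')" for t
  using Suc.prems by (intro Suc.IH) (simp add: shift_def)
 then show ?case using Suc.prems by simp
qed simp

lemma clo_covn: "clo N m ==> EX n. covn N n UNIV m"
proof (induction rule: clo.induct)
 case (clo_cut t m)
 then show ?case by (intro exI[of _ 0]) (auto simp: le_fun_def)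
next
 case (clo_elem t m)
 then obtain n where "covn N n UNIV (shift N t m)" by (auto simp: shift_def)
 moreover have "t : actives N" using clo_elem by (simp add: actives_def)
 ultimately have "covn N (Suc n) UNIV m" using clo_elem(2) unfolding covn.simps(2) by (auto simp: le_fun_def)
 then show ?case ..
next
 case (clo_abs t m)
 then obtain n where "covn N n UNIV (shift N t m)" by (auto simp: shift_def)
 moreover have "t : actives N" using clo_abs by (simp add: actives_def)
 ultimately have "covn N (Suc n) UNIV m" using clo_abs(2) unfolding covn.simps(2) by (auto simp: le_fun_def)
 then show ?case ..
qed

lemma covn_subset: "J <= I ==> covn N n I m ==> covn N n J m"
 by (induction n arbitrary: m) (auto, (meson subsetD)+)

definition boxed :: "'a set => nat => ('a => nat) set" where
 "boxed I c = {m. (ALL p : I. m p < c) & (ALL p. p ~: I --> m p = 0)}"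

lemma boxed_card: assumes "finite I" shows "finite (boxed I c)" "card (boxed I c) <= c ^ card I"
proof -
 have inj: "inj_on (%m. restrict m I) (boxed I c)"
 proof (rule inj_onI)
  fix m m' assume m: "m : boxed I c" "m' : boxed I c" "restrict m I = restrict m' I"
  show "m = m'"
  proof
   fix p
   have "restrict m I p = restrict m' I p" by (simp only: m(3))
   then show "m p = m' p" using m(1,2) by (cases "p : I") (auto simp: boxed_def)
  qed
 qed
 have sub: "(%m. restrict m I) ` boxed I c <= (I \<rightarrow>\<^sub>E {..<c})" by (auto simp: boxed_def)
 have fin: "finite (I \<rightarrow>\<^sub>E {..<c})" using assms by (intro finite_PiE) auto
 show "finite (boxed I c)" using inj sub fin by (rule inj_on_finite)
 show "card (boxed I c) <= c ^ card I"
  using card_inj_on_le[OF inj sub fin] by (simp add: card_funcsetE[OF assms])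
qed

text \<open>The recurrence behind \<open>rackoff_bound\<close>. With l the bound for one place less,
  a path may stay below B = w * l + w for as many steps as there are edges inside that box; a step
  may overshoot it by \<open>w\<close>, so edges are pairs of vectors with entries below B + w + 1,
  whence the exponent 2 * Suc i.\<close>

fun rackoff :: "nat => nat => nat" where
 "rackoff w 0 = 0"
| "rackoff w (Suc i) = (w * rackoff w i + 2 * w + 1) ^ (2 * Suc i) + rackoff w i"

context
 fixes N :: "'a rpn" and w :: nat
 assumes wm: "!!t p. t : cut_trans N Un actives N ==> Wminus N t p <= w"
  and wp: "!!t p. t : actives N ==> Wplus N t p <= w"
begin

text \<open>Each of the \<open>l\<close> steps and the final test takes at most \<open>w\<close>
  tokens from \<open>q\<close>, so a place with that many tokens cannot run dry and may be
  ignored.\<close>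

lemma covn_large:
 "covn N l (I - {q}) m ==> w * l + w <= m q ==> covn N l I m"
proof (induction l arbitrary: m)
 case 0
 have "Wminus N t q <= m q" if "t : cut_trans N" for t using wm[of t q] 0(2) that by simp
 then show ?case using 0(1) by (auto; metis DiffI singletonD)
next
 case (Suc l)
 have c: "covn N 0 I m" if "covn N 0 (I - {q}) m"
 proof -
  have "Wminus N t q <= m q" if "t : cut_trans N" for t using wm[of t q] Suc(3) that by simp
  then show ?thesis using that by (auto; metis DiffI singletonD)
 qed
 show ?case
 proof (cases "covn N 0 (I - {q}) m")
  case True
  then show ?thesis using c covn_0 by blast
 next
  case False
  then obtain t where t: "t : actives N" "ALL p : I - {q}. Wminus N t p <= m p" "covn N l (I - {q}) (shift N t m)"
   using Suc(2) by auto
  have wt: "Wminus N t q <= w" using wm t(1) by blast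
  then have "covn N l I (shift N t m)" using Suc(3) t(3) by (intro Suc.IH) (auto simp: shift_def)
  moreover have "ALL p : I. Wminus N t p <= m p" using t(2) wt Suc(3) by force
  ultimately show ?thesis using t(1) unfolding covn.simps(2) by blast
 qed
qed

text \<open>The path is followed until it covers or some place reaches \<open>B\<close>. Up to that
  point it can be shortened to at most as many steps as there are edges in the box; afterwards the
  large place is ignored, the induction hypothesis applies to the remaining ones, and
  \<open>covn_large\<close> puts the place back.\<close>

theorem rackoff_bound:
 assumes "finite I"
 shows "covn N n I m ==> covn N (rackoff w (card I)) I m"
 using assms
proof (induction "card I" arbitrary: I n m)
 case 0
 then have "I = {}" by simp
 have "covn N n {} m ==> cut_trans N ~= {}" for n m by (induction n arbitrary: m) auto
 then show ?case using 0 \<open>I = {}\<close> by auto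
next
 case (Suc i)
 let ?l = "rackoff w i"
 define B where "B = w * ?l + w"
 \<comment> \<open>Entries outside \<open>I\<close> are irrelevant for \<open>covn\<close> over
   \<open>I\<close>; setting them to 0 makes the box finite.\<close>
 define pr where "pr m = (%p. if p : I then m p else 0)" for m :: "'a => nat"
 define R where "R = {(x, y). x : boxed I B & (EX t : actives N. (ALL p : I. Wminus N t p <= x p) & y = pr (shift N t x))}"
 have cpr: "covn N n I (pr x) \<longleftrightarrow> covn N n I x" for n x by (rule covn_proj) (simp add: pr_def)
 have path: "EX y. (x, y) : R^* & (covn N 0 I y | (EX p : I. B <= y p) & (EX n. covn N n I y))"
  if "covn N n I x" "ALL p. p ~: I --> x p = 0" for n x
  using that
 proof (induction n arbitrary: x)
  case 0
  then show ?case by blast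
 next
  case (Suc n)
  show ?case
  proof (cases "covn N 0 I x | (EX p : I. B <= x p)")
   case True
   then show ?thesis using Suc.prems(1) by blast
  next
   case False
   then obtain t where t: "t : actives N" "ALL p : I. Wminus N t p <= x p" "covn N n I (shift N t x)"
    using Suc.prems(1) by auto
   have "x : boxed I B" using False Suc.prems(2) by (auto simp: boxed_def not_le)
   then have "(x, pr (shift N t x)) : R" using t unfolding R_def by blast
   moreover have "EX y. (pr (shift N t x), y) : R^* & (covn N 0 I y | (EX p : I. B <= y p) & (EX n. covn N n I y))"
    using t(3) by (intro Suc.IH) (simp_all add: cpr, simp add: pr_def)
   ultimately show ?thesis by (meson converse_rtrancl_into_rtrancl)
  qed
 qed
 have prefix: "covn N (k + j) I x" if "(x, y) : R ^^ k" "covn N j I y" for k j x y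
  using that
 proof (induction k arbitrary: x)
  case (Suc k)
  then obtain x1 where x1: "(x, x1) : R" "(x1, y) : R ^^ k" by (meson relpow_Suc_D2)
  then obtain t where t: "t : actives N" "ALL p : I. Wminus N t p <= x p" "x1 = pr (shift N t x)" unfolding R_def by blast
  have "covn N (k + j) I (shift N t x)" using Suc.IH[OF x1(2) Suc.prems(2)] cpr t(3) by simp
  then show ?case using t by auto
 qed simp
 have Rsub: "R <= boxed I (B + w + 1) \<times> boxed I (B + w + 1)"
 proof
  fix z assume "z : R"
  then obtain x t where z: "z = (x, pr (shift N t x))" "x : boxed I B" "t : actives N" unfolding R_def by blast
  have "shift N t x p < B + w + 1" if "p : I" for p
  proof -
   have "x p < B" using z(2) that by (simp add: boxed_def)
   then show ?thesis using wp[OF z(3), of p] by (simp add: shift_def)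
  qed
  then show "z : boxed I (B + w + 1) \<times> boxed I (B + w + 1)"
   using z(1,2) by (auto simp: boxed_def pr_def intro: less_trans)
 qed
 note bc = boxed_card[OF Suc.prems(2), of "B + w + 1"]
 have finR: "finite R" using Rsub bc(1) finite_subset by blast
 have "card R <= card (boxed I (B + w + 1)) * card (boxed I (B + w + 1))"
  using card_mono[OF _ Rsub] bc(1) by (simp add: card_cartesian_product)
 also have "... <= (B + w + 1) ^ card I * (B + w + 1) ^ card I" by (intro mult_mono bc(2)) auto
 also have "... = (w * ?l + 2 * w + 1) ^ (2 * Suc i)"
  using Suc.hyps(2) unfolding B_def by (simp add: power_add[symmetric] mult_2 add.assoc)
 finally have cR: "card R <= (w * ?l + 2 * w + 1) ^ (2 * Suc i)" .
 have "covn N n I (pr m)" using Suc.prems cpr by simp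
 from path[OF this] obtain y where y: "(pr m, y) : R^*"
  "covn N 0 I y | (EX p : I. B <= y p) & (EX n. covn N n I y)" by (auto simp: pr_def)
 have "covn N ?l I y"
 proof (cases "covn N 0 I y")
  case True
  then show ?thesis by (rule covn_0)
 next
  case False
  then obtain q n' where q: "q : I" "B <= y q" "covn N n' I y" using y(2) by blast
  have "covn N n' (I - {q}) y" using covn_subset[OF _ q(3)] by blast
  moreover have "i = card (I - {q})" using Suc.hyps(2) q(1) Suc.prems(2) by simp
  ultimately have "covn N ?l (I - {q}) y" using Suc.hyps(1) Suc.prems(2) by blast
  then show ?thesis by (rule covn_large) (use q(2) in "simp add: B_def")
 qed
 moreover obtain k where "k <= card R" "(pr m, y) : R ^^ k"
  using y(1) rtrancl_finite_eq_relpow[OF finR] by blast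
 ultimately have "covn N (k + ?l) I (pr m)" using prefix by blast
 then have "covn N (rackoff w (Suc i)) I (pr m)"
  by (rule covn_mono[rotated]) (use \<open>k <= card R\<close> cR in simp)
 then show ?case using cpr Suc.hyps(2) by simp
qed

end

text \<open>One level raises \<open>?c * (?r + 1)\<close> at most to the power
  \<open>2 * P + 1\<close>, which multiplies the exponent of \<open>2 * w + 2\<close> by at most
  \<open>4 * P + 4\<close>.\<close>

lemma rackoff_le: "rackoff w i + 1 <= (2 * w + 2) ^ ((4 * P + 4) ^ i)" if "i <= P"
 using that
proof (induction i)
 case (Suc i)
 let ?c = "2 * w + 2" and ?r = "rackoff w i" and ?E = "(4 * P + 4) ^ i"
 have IH: "?r + 1 <= ?c ^ ?E" using Suc by simp
 have x: "w * ?r + 2 * w + 1 <= ?c * (?r + 1)" by simp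
 let ?x = "?c * (?r + 1)"
 have x2: "2 <= ?x" by simp
 have "(w * ?r + 2 * w + 1) ^ (2 * Suc i) <= ?x ^ (2 * Suc i)" by (intro power_mono x) simp
 also have "... <= ?x ^ (2 * P)" using x2 Suc.prems by (intro power_increasing) auto
 finally have 1: "(w * ?r + 2 * w + 1) ^ (2 * Suc i) <= ?x ^ (2 * P)" .
 have "?x ^ 1 <= ?x ^ (2 * P)" using x2 Suc.prems by (intro power_increasing) auto
 then have "?r + 1 <= ?x ^ (2 * P)" by simp
 then have "rackoff w (Suc i) + 1 <= 2 * ?x ^ (2 * P)" using 1 by simp
 also have "... <= ?x * ?x ^ (2 * P)" using x2 by (intro mult_right_mono) auto
 also have "... = ?x ^ (2 * P + 1)" by simp
 also have "... <= (?c ^ (1 + ?E)) ^ (2 * P + 1)"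
 proof (rule power_mono)
  have "?x <= ?c * ?c ^ ?E" by (rule mult_left_mono[OF IH]) simp
  then show "?x <= ?c ^ (1 + ?E)" by simp
 qed simp
 also have "... = ?c ^ ((1 + ?E) * (2 * P + 1))" by (simp only: power_mult)
 also have "... <= ?c ^ ((4 * P + 4) ^ Suc i)"
 proof (rule power_increasing)
  have "1 <= ?E" by simp
  then have "(1 + ?E) * (2 * P + 1) <= (2 * ?E) * (2 * P + 1)" by (intro mult_right_mono) auto
  also have "... <= (4 * P + 4) * ?E" by (simp add: algebra_simps)
  finally show "(1 + ?E) * (2 * P + 1) <= (4 * P + 4) ^ Suc i" by simp
 qed simp
 finally show ?case .
qed simp

lemma rackoff_double_exp:
 assumes "P <= n" "w < 2 ^ n"
 shows "rackoff w P < 2 ^ 2 ^ ((n + 3) * (n + 3))"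
proof -
 have "rackoff w P + 1 <= (2 * w + 2) ^ ((4 * P + 4) ^ P)" by (rule rackoff_le) simp
 also have "... <= (2 ^ (n + 1)) ^ ((4 * P + 4) ^ P)" using assms(2) by (intro power_mono) auto
 also have "... = 2 ^ ((n + 1) * (4 * P + 4) ^ P)" by (simp only: power_mult)
 also have "... <= 2 ^ 2 ^ ((n + 3) * (n + 3))"
 proof (rule power_increasing)
  have "n + 1 <= 2 ^ n" using less_two_power[of n] by linarith
  then have "4 * P + 4 <= 2 ^ (n + 2)" using assms(1) by simp
  then have "(4 * P + 4) ^ P <= (2 ^ (n + 2)) ^ P" by (rule power_mono) simp
  also have "... <= (2 ^ (n + 2)) ^ n" using assms(1) by (intro power_increasing) auto
  finally have "(n + 1) * (4 * P + 4) ^ P <= 2 ^ n * (2 ^ (n + 2)) ^ n"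
   using \<open>n + 1 <= 2 ^ n\<close> by (intro mult_mono) simp_all
  also have "... = 2 ^ (n + (n + 2) * n)" by (simp only: power_mult[symmetric] power_add[symmetric])
  also have "... <= 2 ^ ((n + 3) * (n + 3))" by (intro power_increasing) (auto simp: algebra_simps)
  finally show "(n + 1) * (4 * P + 4) ^ P <= 2 ^ ((n + 3) * (n + 3))" .
 qed simp
 finally show ?thesis by simp
qed

section \<open>Lipton's net\<close>

subsection \<open>Flat counter programs\<close>

text \<open>\<open>Br\<close> with \<open>d = 1\<close> is a decrement and with \<open>d = 0\<close>
  a mere test, so that only one kind of instruction has to test for zero.\<close>

datatype ins = Goto nat | Incr nat nat | Br nat nat nat nat

inductive fstep :: "(nat => ins) => nat \<times> (nat => nat) => nat \<times> (nat => nat) => bool" for prog where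
 "prog q = Goto q' ==> fstep prog (q, rg) (q', rg)"
| "prog q = Incr r q' ==> fstep prog (q, rg) (q', rg(r := Suc (rg r)))"
| "prog q = Br r d q0 q1 ==> rg r = 0 ==> fstep prog (q, rg) (q0, rg)"
| "prog q = Br r d q0 q1 ==> rg r ~= 0 ==> fstep prog (q, rg) (q1, rg(r := rg r - d))"

text \<open>Places: the counters \<open>Ct l 0..3\<close> of level \<open>l\<close> are \<open>y\<close>, its complement, \<open>z\<close>, its complement;
  \<open>Pt k 0..4\<close> are the control points of the procedure of level \<open>k\<close>, which performs the operation given by
  a mode \<open>Md k m\<close> exactly \<open>2 ^ 2 ^ k\<close> times in a double loop over \<open>y\<close> and \<open>z\<close> of level \<open>k - 1\<close>.
  Modes 0 and 1 test \<open>y\<close> and \<open>z\<close> of level \<open>k\<close> by moving the complement to the counter, mode 2 initializes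
  level \<open>k\<close>; at the top level the modes \<open>3 + 2 q\<close> and \<open>4 + 2 q\<close> test the register of instruction \<open>q\<close> and undo this.\<close>

datatype pl = Ct nat nat | Pt nat nat | Md nat nat | Qp nat | Xp nat | Xb nat

type_synonym arc = "(pl \<times> nat) list"

fun ms :: "arc => pl => nat" where
 "ms [] p = 0"
| "ms ((q, c) # xs) p = (if q = p then c else 0) + ms xs p"

definition NN :: "nat => nat" where
 "NN l = 2 ^ 2 ^ l"

lemma NN_Suc: "NN (Suc l) = NN l * NN l"
 by (simp add: NN_def power_add[symmetric] mult_2)

lemma NN_pos [simp]: "0 < NN l"
 by (simp add: NN_def)

lemma NN_0: "NN 0 = 2"
 by (simp add: NN_def)

inductive cov :: "(arc \<times> arc) set => arc => (pl => nat) => bool" for T F where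
 cov_final: "ms F <= m ==> cov T F m"
| cov_step: "(a, b) : T ==> ms a <= m ==> cov T F (%p. m p - ms a p + ms b p) ==> cov T F m"

locale lipton =
 fixes prog :: "nat => ins" and nq R j K qf :: nat
 assumes j: "0 < j"
begin

text \<open>One operation of mode \<open>d\<close> moves a token from each place of
  \<open>srcl\<close> to each place of \<open>tgtl\<close>. Modes \<open>3 + 2 * q\<close> and
  \<open>4 + 2 * q\<close> both give \<open>q\<close> under \<open>(d - 3) div 2\<close>, and the
  parity separates a test from its undoing.\<close>

fun srcl :: "nat => nat => pl list" where
 "srcl k d = (if k < j then (if d = 0 then [Ct k 1] else if d = 1 then [Ct k 3] else [])
   else if d = 2 then [] else (case prog ((d - 3) div 2) of Br r _ _ _ => if odd d then [Xb r] else [Xp r] | _ => []))"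

fun tgtl :: "nat => nat => pl list" where
 "tgtl k d = (if k < j then (if d = 0 then [Ct k 0] else if d = 1 then [Ct k 2] else [Ct k 0, Ct k 2])
   else if d = 2 then map Xb [0..<R] else (case prog ((d - 3) div 2) of Br r _ _ _ => if odd d then [Xp r] else [Xb r] | _ => []))"

declare srcl.simps [simp del] tgtl.simps [simp del]

definition opt :: "nat => nat => arc \<times> arc" where
 "opt k d = ([(Pt k 1, 1), (Ct (k - 1) 2, 1), (Md k d, 1)] @ map (%p. (p, 1)) (srcl k d),
       [(Pt k 2, 1), (Ct (k - 1) 3, 1), (Md k d, 1)] @ map (%p. (p, 1)) (tgtl k d))"

text \<open>A positive register is witnessed by a token of \<open>Xp r\<close>. For the zero branch
  the top procedure must move \<open>NN j\<close> tokens from \<open>Xb r\<close> to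
  \<open>Xp r\<close>, which succeeds only if the complement is full, that is, the register is 0; a
  second call with the other mode moves them back.\<close>

definition mainl :: "nat => nat => arc \<times> arc" where
 "mainl q v = (case prog q of
   Goto q' => if v = 0 then ([(Qp q, 1)], [(Qp q', 1)]) else ([], [])
  | Incr r q' => if v = 0 then ([(Qp q, 1), (Xb r, 1)], [(Qp q', 1), (Xp r, 1)]) else ([], [])
  | Br r d q0 q1 =>
    if v = 0 then ([(Qp q, 1), (Xp r, 1)], [(Qp q1, 1), (Xp r, 1 - d), (Xb r, d)])
    else if v = 1 then ([(Qp q, 1)], [(Pt j 0, 1), (Md j (3 + 2 * q), 1)])
    else if v = 2 then opt j (3 + 2 * q)
    else if v = 3 then opt j (4 + 2 * q)
    else if v = 4 then ([(Pt j 4, 1), (Md j (3 + 2 * q), 1)], [(Pt j 0, 1), (Md j (4 + 2 * q), 1)])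
    else ([(Pt j 4, 1), (Md j (4 + 2 * q), 1)], [(Qp q0, 1)]))"

text \<open>Combinations of \<open>i\<close> and \<open>u\<close> without meaning yield
  \<open>([], [])\<close>, a transition that changes nothing. The transitions are thus indexed by a
  full rectangle, which makes their numbering in the reduction a matter of division with
  remainder.\<close>

definition tr :: "nat => nat => arc \<times> arc" where
 "tr i u =
  (if u = 0 then if 0 < i then ([(Pt i 0, 1), (Ct (i-1) 0, 1)], [(Pt i 1, 1), (Ct (i-1) 1, 1)]) else ([], [])
   else if u <= 3 then if 0 < i & i < j then opt i (u - 1) else ([], [])
   else if u = 4 then if 0 < i then ([(Pt i 2, 1)], [(Pt i 1, 1)]) else ([], [])
   else if u = 5 then if 0 < i then ([(Pt i 2, 1)], [(Pt (i-1) 0, 1), (Md (i-1) 1, 1)]) else ([], [])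
   else if u = 6 then if 0 < i then ([(Pt i 3, 1)], [(Pt i 0, 1)]) else ([], [])
   else if u = 7 then if 0 < i then ([(Pt i 3, 1)], [(Pt (i-1) 0, 1), (Md (i-1) 0, 1)]) else ([], [])
   else if u = 8 then if 0 < i & i < j then ([(Pt i 4, 1), (Md i 1, 1)], [(Pt (i+1) 3, 1)]) else ([], [])
   else if u = 9 then if 0 < i & i < j then ([(Pt i 4, 1), (Md i 0, 1)], [(Pt (i+1) 4, 1)]) else ([], [])
   else if u = 10 then if 0 < i & i < j then ([(Pt i 4, 1), (Md i 2, 1)], [(Pt (i+1) 0, 1), (Md (i+1) 2, 1)]) else ([], [])
   else if u = 11 then if i = 0 then ([(Pt 0 0, 1), (Md 0 1, 1), (Ct 0 3, 2)], [(Pt 1 3, 1), (Ct 0 2, 2)]) else ([], [])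
   else if u = 12 then if i = 0 then ([(Pt 0 0, 1), (Md 0 0, 1), (Ct 0 1, 2)], [(Pt 1 4, 1), (Ct 0 0, 2)]) else ([], [])
   else if u = 13 then if i = j then opt j 2 else ([], [])
   else if u = 14 then if i = j then ([(Pt j 4, 1), (Md j 2, 1), (Xb 0, K)], [(Qp 0, 1), (Xp 0, K)]) else ([], [])
   else if u = 15 then ([], [])
   else if i = j then mainl ((u - 16) div 6) ((u - 16) mod 6) else ([], []))"

definition TT :: "(arc \<times> arc) set" where
 "TT = {tr i u | i u. i <= j & u < 16 + 6 * nq}"

definition FF :: arc where
 "FF = [(Qp qf, 1), (Xp 0, 1)]"

text \<open>Level 0 has its \<open>NN 0 = 2\<close> tokens from the start, and the run begins by
  initializing level 1.\<close>

definition M0 :: arc where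
 "M0 = [(Pt 1 0, 1), (Md 1 2, 1), (Ct 0 0, 2), (Ct 0 2, 2)]"

definition reach :: "nat => (nat => nat) => bool" where
 "reach q rg \<longleftrightarrow> (fstep prog)^** (0, (%_. 0)(0 := K)) (q, rg)"

lemma reach_step: "reach q rg ==> fstep prog (q, rg) (q', rg') ==> reach q' rg'"
 unfolding reach_def by (rule rtranclp.rtrancl_into_rtrancl)

subsection \<open>Soundness\<close>

definition md :: "nat => nat => (pl => nat) => bool" where
 "md k d m \<longleftrightarrow> (ALL d'. m (Md k d') = (if d' = d then 1 else 0))"

definition cnt :: "nat => nat => nat => nat => nat => (pl => nat) => bool" where
 "cnt k y yb z zb m \<longleftrightarrow> m (Ct k 0) = y & m (Ct k 1) = yb & m (Ct k 2) = z & m (Ct k 3) = zb"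

definition regs :: "nat set => (nat => nat) => (pl => nat) => bool" where
 "regs A rg m \<longleftrightarrow> (ALL r : A. m (Xp r) = rg r & m (Xb r) + rg r = NN j)"

text \<open>\<open>ctx k d m\<close>: the levels from \<open>k\<close> on are consistent with a call of the procedure of level \<open>k\<close> that has
  performed its operation \<open>d\<close> times.\<close>

inductive ctx :: "nat => nat => (pl => nat) => bool" where
 ctxZ: "k < j ==> md k 1 m ==> 0 < a ==> a <= NN k ==> b <= NN k ==> d <= b ==>
   cnt k (NN k - a) a (NN k - b + d) (b - d) m ==> ctx (Suc k) ((a - 1) * NN k + b) m ==> ctx k d m"
| ctxY: "k < j ==> md k 0 m ==> a <= NN k ==> d <= a ==>
   cnt k (NN k - a + d) (a - d) (NN k) 0 m ==> ctx (Suc k) (a * NN k) m ==> ctx k d m"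
| ctxI: "k < j ==> md k 2 m ==> cnt k d 0 d 0 m ==> (!!l d. k < l ==> m (Md l d) = 0) ==>
   (!!l c. k < l ==> m (Ct l c) = 0) ==> (!!r. m (Xp r) = 0) ==> (!!r. m (Xb r) = 0) ==> ctx k d m"
| ctxTI: "md j 2 m ==> (!!r. m (Xp r) = 0) ==> (!!r. r < R ==> m (Xb r) = d) ==> ctx j d m"
| ctxT1: "md j (3 + 2 * q) m ==> reach q rg ==> prog q = Br r dd q0 q1 ==> r < R ==> regs ({..<R} - {r}) rg m ==>
   m (Xp r) = rg r + d ==> m (Xb r) + rg r + d = NN j ==> ctx j d m"
| ctxT2: "md j (4 + 2 * q) m ==> reach q rg ==> prog q = Br r dd q0 q1 ==> r < R ==> regs ({..<R} - {r}) rg m ==>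
   rg r = 0 ==> m (Xp r) + d = NN j ==> m (Xb r) = d ==> ctx j d m"

text \<open>The part of a marking that \<open>ctx k\<close> depends on: the levels from
  \<open>k\<close> on and the registers. Control points and lower levels may change freely.\<close>

definition agree :: "nat => (pl => nat) => (pl => nat) => bool" where
 "agree k m m' \<longleftrightarrow> (ALL l>=k. ALL c. m (Ct l c) = m' (Ct l c) & m (Md l c) = m' (Md l c)) &
   (ALL r. m (Xp r) = m' (Xp r) & m (Xb r) = m' (Xb r))"

lemma agree_Suc: "agree k m m' ==> agree (Suc k) m m'"
 by (simp add: agree_def)

lemma agree_md: "agree k m m' ==> k <= l ==> md l d m ==> md l d m'"
 by (simp add: agree_def md_def)

lemma agree_cnt: "agree k m m' ==> k <= l ==> cnt l y yb z zb m ==> cnt l y yb z zb m'"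
 by (simp add: agree_def cnt_def)

lemma ctx_agree: "ctx k d m ==> agree k m m' ==> ctx k d m'"
proof (induction rule: ctx.induct)
 case (ctxZ k m a b d)
 then show ?case by (intro ctx.ctxZ[of k m' a b d]) (auto intro: agree_md agree_cnt agree_Suc)
next
 case (ctxY k m a d)
 then show ?case by (intro ctx.ctxY[of k m' a d]) (auto intro: agree_md agree_cnt agree_Suc)
next
 case (ctxI k m d)
 then show ?case by (intro ctx.ctxI) (auto simp: agree_def md_def cnt_def)
next
 case (ctxTI m d)
 then show ?case by (intro ctx.ctxTI) (auto simp: agree_def md_def)
next
 case (ctxT1 q m rg r dd q0 q1 d)
 then show ?case by (intro ctx.ctxT1[of q m' rg r]) (auto intro: agree_md simp: agree_def regs_def)
next
 case (ctxT2 q m rg r dd q0 q1 d)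
 then show ?case by (intro ctx.ctxT2[of q m' rg r]) (auto intro: agree_md simp: agree_def regs_def)
qed

definition ctl :: "pl => (pl => nat) => bool" where
 "ctl c m \<longleftrightarrow> (ALL k x. m (Pt k x) = (if c = Pt k x then 1 else 0)) & (ALL q. m (Qp q) = (if c = Qp q then 1 else 0))"

definition low :: "nat => (pl => nat) => bool" where
 "low k m \<longleftrightarrow> (ALL l<k. cnt l (NN l) 0 (NN l) 0 m & (ALL d. m (Md l d) = 0))"

text \<open>The counters of level \<open>l\<close> while the procedure of level \<open>l + 1\<close>
  stands at its point \<open>x\<close>. Their complements count the passes: \<open>a\<close> the
  outer ones, including the current one at the points 1 and 2, and \<open>b\<close> the inner ones.
  At point 4 both zero tests have refilled the counters.\<close>

definition lvl :: "nat => nat => nat => nat => (pl => nat) => bool" where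
 "lvl x a b l m \<longleftrightarrow> a <= NN l & b <= NN l & cnt l (NN l - a) a (NN l - b) b m & (ALL d. m (Md l d) = 0) &
   (x = 0 --> b = 0) & (x = 1 | x = 2 --> 0 < a) & (x = 3 --> b = 0) & (x = 4 --> a = 0 & b = 0)"

text \<open>The number of operations performed so far. Inside an outer pass (points 1 and 2) that
  pass is already counted in \<open>a\<close>, whence \<open>a - 1\<close>.\<close>

definition dn :: "nat => nat => nat => nat => nat" where
 "dn x a b l = (if x = 1 | x = 2 then (a - 1) * NN l + b else if x = 4 then NN l * NN l else a * NN l)"

fun body :: "pl => (pl => nat) => bool" where
 "body (Pt 0 x) m = ctx 0 0 m"
| "body (Pt (Suc l) x) m = (l < j & low l m & (EX a b. lvl x a b l m & ctx (Suc l) (dn x a b l) m))"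
| "body (Qp q) m = (low j m & (ALL d. m (Md j d) = 0) & (EX rg. reach q rg & regs {..<R} rg m))"
| "body _ m = False"

text \<open>The control token is unique: it marks one place among the \<open>Pt\<close> and
  \<open>Qp\<close>, and \<open>body\<close> interprets the rest of the marking according to that
  place.\<close>

definition Inv :: "(pl => nat) => bool" where
 "Inv m \<longleftrightarrow> (EX c. ctl c m & body c m)"

lemma InvD: "Inv m ==> 0 < m (Pt k x) ==> ctl (Pt k x) m & body (Pt k x) m"
 "Inv m ==> 0 < m (Qp q) ==> ctl (Qp q) m & body (Qp q) m"
 unfolding Inv_def ctl_def by (metis less_irrefl)+

lemma InvI: "ctl c m ==> body c m ==> Inv m"
 unfolding Inv_def by blast

lemma InvP: "ctl (Pt (Suc l) x) m ==> l < j ==> low l m ==> lvl x a b l m ==> ctx (Suc l) (dn x a b l) m ==> Inv m"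
 by (rule InvI[of "Pt (Suc l) x"], assumption, unfold body.simps, blast)

lemma InvPD:
 assumes "Inv m" "0 < m (Pt (Suc l) x)"
 obtains a b where "ctl (Pt (Suc l) x) m" "l < j" "low l m" "lvl x a b l m" "ctx (Suc l) (dn x a b l) m"
 using InvD(1)[OF assms] by auto

lemma ms_ones: "distinct ps ==> ms (map (%p. (p, 1)) ps) p = (if p : set ps then 1 else 0)"
 by (induction ps) auto

lemma ms_append: "ms (xs @ ys) p = ms xs p + ms ys p"
 by (induction xs) auto

lemma ctx_op:
 assumes "ctx k d m" "0 < m (Md k dd)" "!!p. p : set (srcl k dd) ==> 0 < m p"
  and Ct: "!!l c. k <= l ==> m' (Ct l c) = m (Ct l c) - (if Ct l c : set (srcl k dd) then 1 else 0) + (if Ct l c : set (tgtl k dd) then 1 else 0)"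
  and Xp: "!!r. m' (Xp r) = m (Xp r) - (if Xp r : set (srcl k dd) then 1 else 0) + (if Xp r : set (tgtl k dd) then 1 else 0)"
  and Xb: "!!r. m' (Xb r) = m (Xb r) - (if Xb r : set (srcl k dd) then 1 else 0) + (if Xb r : set (tgtl k dd) then 1 else 0)"
  and Md: "!!l c. m' (Md l c) = m (Md l c)"
 shows "ctx k (Suc d) m'"
 using assms(1)
proof (cases rule: ctx.cases)
 case (ctxZ a b)
 have [simp]: "dd = 1" using ctxZ(2) assms(2) by (auto simp: md_def split: if_splits)
 have st: "srcl k dd = [Ct k 3]" "tgtl k dd = [Ct k 2]" using ctxZ(1) by (auto simp: srcl.simps tgtl.simps)
 have d: "d < b" using assms(3) ctxZ(7) unfolding st cnt_def by fastforce
 have "agree (Suc k) m m'" using Ct Xp Xb Md unfolding st by (auto simp: agree_def)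
 then show ?thesis using ctxZ d Ct Md unfolding st
  by (intro ctx.ctxZ[of k m' a b]) (auto simp: md_def cnt_def intro: ctx_agree)
next
 case (ctxY a)
 have [simp]: "dd = 0" using ctxY(2) assms(2) by (auto simp: md_def split: if_splits)
 have st: "srcl k dd = [Ct k 1]" "tgtl k dd = [Ct k 0]" using ctxY(1) by (auto simp: srcl.simps tgtl.simps)
 have d: "d < a" using assms(3) ctxY(5) unfolding st cnt_def by fastforce
 have "agree (Suc k) m m'" using Ct Xp Xb Md unfolding st by (auto simp: agree_def)
 then show ?thesis using ctxY d Ct Md unfolding st
  by (intro ctx.ctxY[of k m' a]) (auto simp: md_def cnt_def intro: ctx_agree)
next
 case ctxI
 have [simp]: "dd = 2" using ctxI(2) assms(2) by (auto simp: md_def split: if_splits)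
 have st: "srcl k dd = []" "tgtl k dd = [Ct k 0, Ct k 2]" using ctxI(1) by (auto simp: srcl.simps tgtl.simps)
 show ?thesis using ctxI Ct Xp Xb Md unfolding st
  by (intro ctx.ctxI) (auto simp: md_def cnt_def)
next
 case ctxTI
 have dd: "dd = 2" using ctxTI(1,2) assms(2) by (auto simp: md_def split: if_splits)
 have st: "srcl j 2 = []" "tgtl j 2 = map Xb [0..<R]" by (auto simp: srcl.simps tgtl.simps)
 show ?thesis using ctxTI Xp Xb Md unfolding ctxTI(1) dd st
  by (intro ctx.ctxTI) (auto simp: md_def)
next
 case (ctxT1 q rg r d' q0 q1)
 have dd: "dd = 3 + 2 * q" using ctxT1(1,2) assms(2) by (auto simp: md_def split: if_splits)
 have st: "srcl j (3 + 2 * q) = [Xb r]" "tgtl j (3 + 2 * q) = [Xp r]" using ctxT1 by (auto simp: srcl.simps tgtl.simps)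
 have "0 < m (Xb r)" using assms(3) st unfolding dd ctxT1(1) by simp
 then show ?thesis using ctxT1 Xp Xb Md unfolding ctxT1(1) dd st
  by (intro ctx.ctxT1[of q m' rg r]) (auto simp: md_def regs_def)
next
 case (ctxT2 q rg r d' q0 q1)
 have dd: "dd = 4 + 2 * q" using ctxT2(1,2) assms(2) by (auto simp: md_def split: if_splits)
 have "(4 + 2 * q - 3) div 2 = q" by simp
 then have st: "srcl j (4 + 2 * q) = [Xp r]" "tgtl j (4 + 2 * q) = [Xb r]" using ctxT2 by (auto simp: srcl.simps tgtl.simps)
 have "0 < m (Xp r)" using assms(3) st unfolding dd ctxT2(1) by simp
 then show ?thesis using ctxT2 Xp Xb Md unfolding ctxT2(1) dd st
  by (intro ctx.ctxT2[of q m' rg r]) (auto simp: md_def regs_def)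
qed

definition fr :: "arc => arc => (pl => nat) => pl => nat" where
 "fr a b m = (%p. m p - ms a p + ms b p)"

lemma srcl_tgtl: "distinct (srcl k dd)" "distinct (tgtl k dd)"
 "p : set (srcl k dd) Un set (tgtl k dd) ==> (k < j & (EX c. p = Ct k c)) | (EX r. p = Xp r | p = Xb r)"
 by (auto simp: srcl.simps tgtl.simps distinct_map inj_on_def split: ins.splits if_splits)

lemma Inv_opt:
 assumes "Inv m" "ms (fst (opt k dd)) <= m" "0 < k"
 shows "Inv (fr (fst (opt k dd)) (snd (opt k dd)) m)"
proof -
 obtain l where k: "k = Suc l" using assms(3) by (cases k) auto
 let ?a = "fst (opt k dd)" let ?b = "snd (opt k dd)" let ?m = "fr ?a ?b m"
 have le: "ms ?a p <= m p" for p using assms(2) by (simp add: le_fun_def)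
 note st = srcl_tgtl[where k = k and dd = dd]
 have a: "ms ?a p = ms [(Pt k 1, 1), (Ct l 2, 1), (Md k dd, 1)] p + (if p : set (srcl k dd) then 1 else 0)" for p
  unfolding opt_def fst_conv ms_append ms_ones[OF st(1)] by (simp add: k)
 have b: "ms ?b p = ms [(Pt k 2, 1), (Ct l 3, 1), (Md k dd, 1)] p + (if p : set (tgtl k dd) then 1 else 0)" for p
  unfolding opt_def snd_conv ms_append ms_ones[OF st(2)] by (simp add: k)
 have nst: "Pt x y ~: set (srcl k dd)" "Pt x y ~: set (tgtl k dd)" "Md x y ~: set (srcl k dd)" "Md x y ~: set (tgtl k dd)"
  "Qp x ~: set (srcl k dd)" "Qp x ~: set (tgtl k dd)" "x ~= k ==> Ct x y ~: set (srcl k dd)" "x ~= k ==> Ct x y ~: set (tgtl k dd)" for x y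
  using st(3)[where p = "Pt x y"] st(3)[where p = "Md x y"] st(3)[where p = "Qp x"] st(3)[where p = "Ct x y"] by auto
 note nst = nst[unfolded k]
 have "0 < m (Pt k 1)" using le[of "Pt k 1"] unfolding a by (auto split: if_splits)
 from InvD(1)[OF assms(1) this] obtain x y where c: "ctl (Pt k 1) m" "l < j" "low l m" "lvl 1 x y l m" "ctx k (dn 1 x y l) m"
  unfolding k by auto
 have mode: "0 < m (Md k dd)" using le[of "Md k dd"] unfolding a by (auto split: if_splits)
 have src: "0 < m p" if "p : set (srcl k dd)" for p using le[of p] that unfolding a by (auto split: if_splits)
 have z: "0 < m (Ct l 2)" using le[of "Ct l 2"] unfolding a by (auto split: if_splits)
 \<comment> \<open>The token taken from z shows that the inner loop is not exhausted, so its count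
   may grow by one.\<close>
 have y: "y < NN l" using z c(4) by (auto simp: lvl_def cnt_def)
 have fp: "?m p = m p - ms ?a p + ms ?b p" for p by (simp add: fr_def)
 have "ctl (Pt k 2) ?m" using c(1) unfolding ctl_def fp a b by (auto simp: nst k)
 moreover have "low l ?m" using c(3) unfolding low_def cnt_def fp a b by (auto simp: nst k)
 moreover have "lvl 2 x (Suc y) l ?m" using c(4) y unfolding lvl_def cnt_def fp a b by (auto simp: nst k)
 moreover have "ctx k (Suc (dn 1 x y l)) ?m"
  by (rule ctx_op[OF c(5) mode src], assumption, unfold fp a b) (use mode in "auto simp: nst k")
 moreover have "dn 2 x (Suc y) l = Suc (dn 1 x y l)" by (simp add: dn_def)
 ultimately show ?thesis using c(2) unfolding k by (intro InvP[of l 2 _ x "Suc y"]) simp_all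
qed

lemma low_Suc: "low (Suc l) m \<longleftrightarrow> low l m & lvl 4 0 0 l m"
 by (auto simp: low_def lvl_def less_Suc_eq)

definition keeps :: "arc => arc => bool" where
 "keeps a b \<longleftrightarrow> (ALL m. Inv m --> ms a <= m --> Inv (fr a b m))"

lemma keepsP:
 assumes "!!m x y. ms a <= m ==> ctl (Pt (Suc l) k) m ==> l < j ==> low l m ==> lvl k x y l m ==> ctx (Suc l) (dn k x y l) m ==>
  Inv (fr ((Pt (Suc l) k, 1) # a) b m)"
 shows "keeps ((Pt (Suc l) k, 1) # a) b"
 unfolding keeps_def
proof (intro allI impI)
 fix m assume m: "Inv m" "ms ((Pt (Suc l) k, 1) # a) <= m"
 have le: "ms a p + (if p = Pt (Suc l) k then 1 else 0) <= m p" for p using le_funD[OF m(2), of p] by (simp split: if_splits)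
 have "0 < m (Pt (Suc l) k)" using le[of "Pt (Suc l) k"] by simp
 moreover have "ms a <= m" using le by (auto simp: le_fun_def intro: add_leD1)
 ultimately show "Inv (fr ((Pt (Suc l) k, 1) # a) b m)" using InvPD[OF m(1)] assms by blast
qed

lemma Inv_t0: "keeps [(Pt (Suc l) 0, 1), (Ct l 0, 1)] [(Pt (Suc l) 1, 1), (Ct l 1, 1)]"
proof (rule keepsP, goal_cases)
 case c: (1 m a b)
 have "0 < m (Ct l 0)" using le_funD[OF c(1), of "Ct l 0"] by auto
 moreover have "dn 1 (Suc a) 0 l = dn 0 a b l" by (simp add: dn_def)
 ultimately show ?case using c
  by (intro InvP[of l 1 _ "Suc a" 0]) (auto simp: ctl_def low_def lvl_def cnt_def fr_def agree_def intro: ctx_agree)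
qed

lemma Inv_t2: "keeps [(Pt (Suc l) 2, 1)] [(Pt (Suc l) 1, 1)]"
proof (rule keepsP, goal_cases)
 case c: (1 m a b)
 have "dn 1 a b l = dn 2 a b l" by (simp add: dn_def)
 then show ?case using c
  by (intro InvP[of l 1 _ a b]) (auto simp: ctl_def low_def lvl_def cnt_def fr_def agree_def intro: ctx_agree)
qed

lemma Inv_t4: "keeps [(Pt (Suc l) 3, 1)] [(Pt (Suc l) 0, 1)]"
proof (rule keepsP, goal_cases)
 case c: (1 m a b)
 have "dn 0 a b l = dn 3 a b l" by (simp add: dn_def)
 then show ?case using c
  by (intro InvP[of l 0 _ a b]) (auto simp: ctl_def low_def lvl_def cnt_def fr_def agree_def intro: ctx_agree)
qed

lemma Inv_call:
 assumes "ctl (Pt l 0) m" "ctx l 0 m" "l < j" "low l m"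
 shows "Inv m"
proof (cases l)
 case 0
 then show ?thesis using assms by (intro InvI[of "Pt 0 0"]) auto
next
 case (Suc k)
 then show ?thesis using assms low_Suc by (intro InvP[of k 0 m 0 0]) (auto simp: dn_def lvl_def)
qed

lemma Inv_t3: "keeps [(Pt (Suc l) 2, 1)] [(Pt l 0, 1), (Md l 1, 1)]"
proof (rule keepsP, goal_cases)
 case c: (1 m a b)
 let ?m = "fr [(Pt (Suc l) 2, 1)] [(Pt l 0, 1), (Md l 1, 1)] m"
 have "ctx (Suc l) (dn 2 a b l) ?m" by (rule ctx_agree[OF c(6)]) (auto simp: agree_def fr_def)
 then have "ctx l 0 ?m" using c(3,5)
  by (intro ctxZ[of l ?m a b]) (auto simp: dn_def md_def lvl_def cnt_def fr_def)
 then show ?case using c(2-4) by (intro Inv_call[of l]) (auto simp: ctl_def low_def cnt_def fr_def)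
qed

lemma Inv_t5: "keeps [(Pt (Suc l) 3, 1)] [(Pt l 0, 1), (Md l 0, 1)]"
proof (rule keepsP, goal_cases)
 case c: (1 m a b)
 let ?m = "fr [(Pt (Suc l) 3, 1)] [(Pt l 0, 1), (Md l 0, 1)] m"
 have "ctx (Suc l) (dn 3 a b l) ?m" by (rule ctx_agree[OF c(6)]) (auto simp: agree_def fr_def)
 then have "ctx l 0 ?m" using c(3,5)
  by (intro ctxY[of l ?m a]) (auto simp: dn_def md_def lvl_def cnt_def fr_def)
 then show ?case using c(2-4) by (intro Inv_call[of l]) (auto simp: ctl_def low_def cnt_def fr_def)
qed

lemma keeps4:
 assumes "!!m. ms a <= m ==> ctl (Pt (Suc l) 4) m ==> low (Suc l) m ==> ctx (Suc l) (NN (Suc l)) m ==>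
  Inv (fr ((Pt (Suc l) 4, 1) # a) b m)"
 shows "keeps ((Pt (Suc l) 4, 1) # a) b"
proof (rule keepsP, goal_cases)
 case c: (1 m x y)
 have "x = 0" "y = 0" "dn 4 x y l = NN (Suc l)" using c(5) by (auto simp: lvl_def dn_def NN_Suc)
 then show ?case using assms c low_Suc by simp
qed

lemma ctx_mode1:
 assumes "ctx k d m" "0 < m (Md k 1)" "k < j"
 obtains a b where "md k 1 m" "0 < a" "a <= NN k" "b <= NN k" "d <= b"
   "cnt k (NN k - a) a (NN k - b + d) (b - d) m" "ctx (Suc k) ((a - 1) * NN k + b) m"
 using assms(1)
proof (cases rule: ctx.cases)
 case (ctxZ a b)
 then show ?thesis using that by blast
qed (use assms(2,3) in "auto simp: md_def split: if_splits")

lemma ctx_mode0: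
 assumes "ctx k d m" "0 < m (Md k 0)" "k < j"
 obtains a where "md k 0 m" "a <= NN k" "d <= a"
   "cnt k (NN k - a + d) (a - d) (NN k) 0 m" "ctx (Suc k) (a * NN k) m"
 using assms(1)
proof (cases rule: ctx.cases)
 case (ctxY a)
 then show ?thesis using that by blast
qed (use assms(2,3) in "auto simp: md_def split: if_splits")

lemma Inv_t6: assumes "Suc l < j" shows "keeps [(Pt (Suc l) 4, 1), (Md (Suc l) 1, 1)] [(Pt (Suc l + 1) 3, 1)]"
proof (rule keeps4, goal_cases)
 case c: (1 m)
 let ?m = "fr [(Pt (Suc l) 4, 1), (Md (Suc l) 1, 1)] [(Pt (Suc l + 1) 3, 1)] m"
 have e: "0 < m (Md (Suc l) 1)" using le_funD[OF c(1), of "Md (Suc l) 1"] by auto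
 from ctx_mode1[OF c(4) e assms] obtain a b where d: "md (Suc l) 1 m" "0 < a" "a <= NN (Suc l)" "b <= NN (Suc l)"
  "NN (Suc l) <= b" "cnt (Suc l) (NN (Suc l) - a) a (NN (Suc l) - b + NN (Suc l)) (b - NN (Suc l)) m"
  "ctx (Suc (Suc l)) ((a - 1) * NN (Suc l) + b) m" .
 \<comment> \<open>The callee has performed its operation \<open>NN (Suc l)\<close> times, which is
   possible only if the complement was full. So the tested counter was indeed 0 when the caller
   guessed the end of its loop.\<close>
 have b: "b = NN (Suc l)" using d(4,5) by simp
 have "ctx (Suc (Suc l)) ((a - 1) * NN (Suc l) + b) ?m" by (rule ctx_agree[OF d(7)]) (auto simp: agree_def fr_def)
 moreover have "(a - 1) * NN (Suc l) + b = dn 3 a 0 (Suc l)" using d(2) b by (cases a) (auto simp: dn_def)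
 ultimately show ?case using c(2,3) d(1,3,6) b assms
  by (intro InvP[of "Suc l" 3 ?m a 0]) (auto simp: ctl_def low_def lvl_def cnt_def md_def fr_def)
qed

lemma Inv_t7: assumes "Suc l < j" shows "keeps [(Pt (Suc l) 4, 1), (Md (Suc l) 0, 1)] [(Pt (Suc l + 1) 4, 1)]"
proof (rule keeps4, goal_cases)
 case c: (1 m)
 let ?m = "fr [(Pt (Suc l) 4, 1), (Md (Suc l) 0, 1)] [(Pt (Suc l + 1) 4, 1)] m"
 have e: "0 < m (Md (Suc l) 0)" using le_funD[OF c(1), of "Md (Suc l) 0"] by auto
 from ctx_mode0[OF c(4) e assms] obtain a where d: "md (Suc l) 0 m" "a <= NN (Suc l)" "NN (Suc l) <= a"
  "cnt (Suc l) (NN (Suc l) - a + NN (Suc l)) (a - NN (Suc l)) (NN (Suc l)) 0 m" "ctx (Suc (Suc l)) (a * NN (Suc l)) m" .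
 have a: "a = NN (Suc l)" using d(2,3) by simp
 have "ctx (Suc (Suc l)) (dn 4 0 0 (Suc l)) ?m" by (rule ctx_agree) (use d(5) a in "auto simp: agree_def fr_def dn_def")
 then show ?case using c(2,3) d(1,4) a assms
  by (intro InvP[of "Suc l" 4 ?m 0 0]) (auto simp: ctl_def low_def lvl_def cnt_def md_def fr_def)
qed

lemma Inv_t8: assumes "Suc l < j" shows "keeps [(Pt (Suc l) 4, 1), (Md (Suc l) 2, 1)] [(Pt (Suc l + 1) 0, 1), (Md (Suc l + 1) 2, 1)]"
proof (rule keeps4, goal_cases)
 case c: (1 m)
 let ?m = "fr [(Pt (Suc l) 4, 1), (Md (Suc l) 2, 1)] [(Pt (Suc l + 1) 0, 1), (Md (Suc l + 1) 2, 1)] m"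
 have e: "0 < m (Md (Suc l) 2)" using le_funD[OF c(1), of "Md (Suc l) 2"] by auto
 have d: "md (Suc l) 2 m & cnt (Suc l) (NN (Suc l)) 0 (NN (Suc l)) 0 m & (ALL k d. Suc l < k --> m (Md k d) = 0 & m (Ct k d) = 0)
   & (ALL r. m (Xp r) = 0 & m (Xb r) = 0)"
  using c(4) by (cases rule: ctx.cases) (use e assms in "auto simp: md_def split: if_splits")
 have "ctx (Suc (Suc l)) 0 ?m"
 proof (cases "Suc (Suc l) < j")
  case True
  then show ?thesis using d by (intro ctx.ctxI) (auto simp: md_def cnt_def fr_def)
 next
  case False
  then have j: "Suc (Suc l) = j" using assms by simp
  have "ctx j 0 ?m" by (rule ctx.ctxTI) (use d j in "auto simp: md_def fr_def")
  then show ?thesis using j by simp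
 qed
 then show ?case using c(2,3) d assms
  by (intro InvP[of "Suc l" 0 ?m 0 0]) (auto simp: ctl_def low_def lvl_def cnt_def md_def fr_def dn_def)
qed

end

definition wfp :: "(nat => ins) => nat => nat => bool" where
 "wfp prog nq R \<longleftrightarrow> 0 < R & 0 < nq & (ALL q<nq. case prog q of Goto q' => q' < nq | Incr r q' => r < R & q' < nq
   | Br r d q0 q1 => r < R & d <= 1 & q0 < nq & q1 < nq)"

context lipton
begin

text \<open>At level 0 a zero test is a single transition that takes both tokens of the complement
  at once.\<close>

lemma Inv_t11: "keeps [(Pt 0 0, 1), (Md 0 1, 1), (Ct 0 3, 2)] [(Pt 1 3, 1), (Ct 0 2, 2)]"
 unfolding keeps_def
proof (intro allI impI)
 fix m assume m: "Inv m" "ms [(Pt 0 0, 1), (Md 0 1, 1), (Ct 0 3, 2)] <= m"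
 let ?m = "fr [(Pt 0 0, 1), (Md 0 1, 1), (Ct 0 3, 2)] [(Pt 1 3, 1), (Ct 0 2, 2)] m"
 have e: "0 < m (Pt 0 0)" "0 < m (Md 0 1)" "2 <= m (Ct 0 3)"
  using le_funD[OF m(2), of "Pt 0 0"] le_funD[OF m(2), of "Md 0 1"] le_funD[OF m(2), of "Ct 0 3"] by auto
 from InvD(1)[OF m(1) e(1)] have c: "ctl (Pt 0 0) m" "ctx 0 0 m" by auto
 from ctx_mode1[OF c(2) e(2) j] obtain a b where d: "md 0 1 m" "0 < a" "a <= NN 0" "b <= NN 0"
  "cnt 0 (NN 0 - a) a (NN 0 - b) b m" "ctx 1 ((a - 1) * NN 0 + b) m" by auto
 have b: "b = 2" using d(4,5) e(3) by (auto simp: NN_0 cnt_def)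
 have "ctx 1 ((a - 1) * NN 0 + b) ?m" by (rule ctx_agree[OF d(6)]) (auto simp: agree_def fr_def)
 moreover have "(a - 1) * NN 0 + b = dn 3 a 0 0" using d(2) b by (cases a) (auto simp: dn_def NN_0)
 ultimately show "Inv ?m" using c(1) d(1,3,5) b j
  by (intro InvP[of 0 3 ?m a 0]) (auto simp: ctl_def low_def lvl_def cnt_def md_def fr_def NN_0)
qed

lemma Inv_t12: "keeps [(Pt 0 0, 1), (Md 0 0, 1), (Ct 0 1, 2)] [(Pt 1 4, 1), (Ct 0 0, 2)]"
 unfolding keeps_def
proof (intro allI impI)
 fix m assume m: "Inv m" "ms [(Pt 0 0, 1), (Md 0 0, 1), (Ct 0 1, 2)] <= m"
 let ?m = "fr [(Pt 0 0, 1), (Md 0 0, 1), (Ct 0 1, 2)] [(Pt 1 4, 1), (Ct 0 0, 2)] m"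
 have e: "0 < m (Pt 0 0)" "0 < m (Md 0 0)" "2 <= m (Ct 0 1)"
  using le_funD[OF m(2), of "Pt 0 0"] le_funD[OF m(2), of "Md 0 0"] le_funD[OF m(2), of "Ct 0 1"] by auto
 from InvD(1)[OF m(1) e(1)] have c: "ctl (Pt 0 0) m" "ctx 0 0 m" by auto
 from ctx_mode0[OF c(2) e(2) j] obtain a where d: "md 0 0 m" "a <= NN 0"
  "cnt 0 (NN 0 - a) a (NN 0) 0 m" "ctx 1 (a * NN 0) m" by auto
 have a: "a = 2" using d(2,3) e(3) by (auto simp: NN_0 cnt_def)
 have "ctx 1 (dn 4 0 0 0) ?m" by (rule ctx_agree) (use d(4) a in "auto simp: agree_def fr_def dn_def NN_0")
 then show "Inv ?m" using c(1) d(1,3) a j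
  by (intro InvP[of 0 4 ?m 0 0]) (auto simp: ctl_def low_def lvl_def cnt_def md_def fr_def NN_0)
qed

lemma keeps_top:
 assumes "!!m. ms a <= m ==> ctl (Pt j 4) m ==> low j m ==> ctx j (NN j) m ==> Inv (fr ((Pt j 4, 1) # a) b m)"
 shows "keeps ((Pt j 4, 1) # a) b"
 using keeps4[of a "j - 1" b] assms j by simp

lemma Inv_topcall:
 assumes "ctl (Pt j 0) m" "low j m" "ctx j 0 m" shows "Inv m"
proof -
 obtain l where l: "j = Suc l" using j by (cases j) auto
 have "low l m" "lvl 4 0 0 l m" "l < j" using assms(2) low_Suc[of l m] l by auto
 then show ?thesis using assms(1,3)
  by (intro InvP[of l 0 m 0 0]) (auto simp: l[symmetric] dn_def lvl_def)
qed

lemma Inv_t14: assumes R: "0 < R" shows "keeps [(Pt j 4, 1), (Md j 2, 1), (Xb 0, K)] [(Qp 0, 1), (Xp 0, K)]"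
proof (rule keeps_top, goal_cases)
 case c: (1 m)
 let ?m = "fr [(Pt j 4, 1), (Md j 2, 1), (Xb 0, K)] [(Qp 0, 1), (Xp 0, K)] m"
 have e: "0 < m (Md j 2)" "K <= m (Xb 0)" using le_funD[OF c(1), of "Md j 2"] le_funD[OF c(1), of "Xb 0"] by auto
 have d: "md j 2 m & (ALL r. m (Xp r) = 0) & (ALL r<R. m (Xb r) = NN j)"
  using c(4) by (cases rule: ctx.cases) (use e(1) in "auto simp: md_def split: if_splits")
 have "reach 0 ((%_. 0)(0 := K))" by (simp add: reach_def)
 moreover have "regs {..<R} ((%_. 0)(0 := K)) ?m" using d e(2) R by (auto simp: regs_def fr_def)
 ultimately show ?case using c(2,3) d
  by (intro InvI[of "Qp 0"]) (auto simp: ctl_def low_def cnt_def md_def fr_def)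
qed

lemma InvQ:
 assumes "Inv m" "0 < m (Qp q)"
 obtains rg where "ctl (Qp q) m" "low j m" "ALL d. m (Md j d) = 0" "reach q rg" "regs {..<R} rg m"
 using InvD(2)[OF assms] by auto

lemma keeps_Nil: "keeps [] []"
 by (simp add: keeps_def fr_def)

lemma Inv_main:
 assumes "q < nq" "wfp prog nq R"
 shows "keeps (fst (mainl q v)) (snd (mainl q v))"
 unfolding keeps_def
proof (intro allI impI)
 fix m assume m: "Inv m" "ms (fst (mainl q v)) <= m"
 let ?m = "fr (fst (mainl q v)) (snd (mainl q v)) m"
 have triv: "Inv (fr [] [] m)" using m(1) by (simp add: fr_def)
 have kp: "Inv ?m" if "mainl q v = (a, b)" "keeps a b" for a b using m that by (simp add: keeps_def)
 have Rr: "r < R & d <= 1" if "prog q = Br r d q0 q1" for r d q0 q1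
  using assms that unfolding wfp_def by force
 have Ri: "r < R" if "prog q = Incr r q'" for r q'
  using assms that unfolding wfp_def by force
 have simple: "Inv ?m" if "0 < m (Qp q)" "fr (fst (mainl q v)) (snd (mainl q v)) m = (%p. case p of Qp x => m p - (if x = q then 1 else 0) + (if x = q' then 1 else 0) | Xp r => xp r | Xb r => xb r | _ => m p)"
  "!!rg. regs {..<R} rg m ==> EX rg'. fstep prog (q, rg) (q', rg') & (ALL r<R. xp r = rg' r & xb r + rg' r = NN j)" for xp xb q'
 proof -
  from InvQ[OF m(1) that(1)] obtain rg where c: "ctl (Qp q) m" "low j m" "ALL d. m (Md j d) = 0" "reach q rg" "regs {..<R} rg m" .
  from that(3)[OF c(5)] obtain rg' where r: "fstep prog (q, rg) (q', rg')" "ALL r<R. xp r = rg' r & xb r + rg' r = NN j" by blast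
  show ?thesis unfolding that(2) using c(1-3) r(2) reach_step[OF c(4) r(1)]
   by (intro InvI[of "Qp q'"]) (auto simp: ctl_def low_def cnt_def regs_def)
 qed
 show "Inv ?m"
 proof (cases "prog q")
  case (Goto q')
  show ?thesis
  proof (cases "v = 0")
   case True
   have e: "0 < m (Qp q)" using le_funD[OF m(2), of "Qp q"] Goto True by (auto simp: mainl_def)
   show ?thesis
   proof (rule simple[OF e, of q' "%r. m (Xp r)" "%r. m (Xb r)"])
    fix rg assume "regs {..<R} rg m"
    then show "EX rg'. fstep prog (q, rg) (q', rg') & (ALL x<R. m (Xp x) = rg' x & m (Xb x) + rg' x = NN j)"
     by (intro exI[of _ rg]) (auto simp: regs_def Goto intro: fstep.intros)
   qed (auto simp: mainl_def Goto True fr_def fun_eq_iff split: pl.splits)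
  qed (use triv Goto in "simp add: mainl_def")
 next
  case (Incr r q')
  show ?thesis
  proof (cases "v = 0")
   case True
   have e: "0 < m (Qp q)" "0 < m (Xb r)"
    using le_funD[OF m(2), of "Qp q"] le_funD[OF m(2), of "Xb r"] Incr True by (auto simp: mainl_def)
   show ?thesis
   proof (rule simple[OF e(1), of q' "%x. m (Xp x) + (if x = r then 1 else 0)" "%x. m (Xb x) - (if x = r then 1 else 0)"])
    fix rg assume "regs {..<R} rg m"
    then show "EX rg'. fstep prog (q, rg) (q', rg') & (ALL x<R. m (Xp x) + (if x = r then 1 else 0) = rg' x &
      m (Xb x) - (if x = r then 1 else 0) + rg' x = NN j)"
     using e(2) by (intro exI[of _ "rg(r := Suc (rg r))"]) (auto simp: regs_def Incr intro: fstep.intros)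
   qed (auto simp: mainl_def Incr True fr_def fun_eq_iff split: pl.splits)
  qed (use triv Incr in "simp add: mainl_def")
 next
  case (Br r d q0 q1)
  note r = Rr[OF Br]
  consider "v = 0" | "v = 1" | "v = 2" | "v = 3" | "v = 4" | "v > 4" by linarith
  then show ?thesis
  proof cases
   case 1
   have e: "0 < m (Qp q)" "0 < m (Xp r)"
    using le_funD[OF m(2), of "Qp q"] le_funD[OF m(2), of "Xp r"] Br 1 by (auto simp: mainl_def)
   show ?thesis
   proof (rule simple[OF e(1), of q1 "%x. m (Xp x) - (if x = r then d else 0)" "%x. m (Xb x) + (if x = r then d else 0)"])
    fix rg assume a: "regs {..<R} rg m"
    then have "rg r ~= 0" using e(2) r by (auto simp: regs_def)
    then show "EX rg'. fstep prog (q, rg) (q1, rg') & (ALL x<R. m (Xp x) - (if x = r then d else 0) = rg' x &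
      m (Xb x) + (if x = r then d else 0) + rg' x = NN j)"
     using a r by (intro exI[of _ "rg(r := rg r - d)"]) (auto simp: regs_def Br intro: fstep.intros)
   next
    show "fr (fst (mainl q v)) (snd (mainl q v)) m = (%p. case p of Qp x => m p - (if x = q then 1 else 0) + (if x = q1 then 1 else 0)
     | Xp x => m (Xp x) - (if x = r then d else 0) | Xb x => m (Xb x) + (if x = r then d else 0) | _ => m p)"
     using e(2) r by (auto simp: mainl_def Br 1 fr_def fun_eq_iff split: pl.splits)
   qed
  next
   case 2
   have e: "0 < m (Qp q)" using le_funD[OF m(2), of "Qp q"] Br 2 by (auto simp: mainl_def)
   from InvQ[OF m(1) e] obtain rg where c: "ctl (Qp q) m" "low j m" "ALL d. m (Md j d) = 0" "reach q rg" "regs {..<R} rg m" .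
   have m: "?m = fr [(Qp q, 1)] [(Pt j 0, 1), (Md j (3 + 2 * q), 1)] m" by (simp add: mainl_def Br 2)
   have "ctx j 0 ?m" unfolding m
    by (rule ctx.ctxT1[of q _ rg r d q0 q1]) (use c r Br in "auto simp: md_def fr_def regs_def")
   then show ?thesis using c(1,2) unfolding m
    by (intro Inv_topcall) (auto simp: ctl_def low_def cnt_def fr_def)
  next
   case 3
   then show ?thesis using Inv_opt[OF m(1), of j "3 + 2 * q"] m(2) j Br by (simp add: mainl_def)
  next
   case 4
   then show ?thesis using Inv_opt[OF m(1), of j "4 + 2 * q"] m(2) j Br by (simp add: mainl_def)
  next
   case 5
   have "keeps [(Pt j 4, 1), (Md j (3 + 2 * q), 1)] [(Pt j 0, 1), (Md j (4 + 2 * q), 1)]"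
   proof (rule keeps_top, goal_cases)
    case c: (1 m)
    have e: "0 < m (Md j (3 + 2 * q))" using le_funD[OF c(1), of "Md j (3 + 2 * q)"] by auto
    have "ctx j 0 (fr [(Pt j 4, 1), (Md j (3 + 2 * q), 1)] [(Pt j 0, 1), (Md j (4 + 2 * q), 1)] m)" using c(4)
    proof (cases rule: ctx.cases)
     case (ctxT1 q' rg r' d' q0' q1')
     then have "q' = q" using e by (auto simp: md_def split: if_splits)
     then have "r' = r" using ctxT1 Br by simp
     then show ?thesis using ctxT1 Br \<open>q' = q\<close>
      by (intro ctx.ctxT2[of q _ rg r d q0 q1]) (auto simp: md_def fr_def regs_def)
    next
     case (ctxT2 q' rg r' d' q0' q1')
     \<comment> \<open>The two modes differ in parity, so this context cannot carry the present
       mode.\<close>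
     then show ?thesis using e by (auto simp: md_def split: if_splits) presburger
    qed (use e in "auto simp: md_def split: if_splits")
    then show ?case using c(2,3) by (intro Inv_topcall) (auto simp: ctl_def low_def cnt_def fr_def)
   qed
   then show ?thesis by (intro kp) (simp_all add: mainl_def Br 5)
  next
   case 6
   have "keeps [(Pt j 4, 1), (Md j (4 + 2 * q), 1)] [(Qp q0, 1)]"
   proof (rule keeps_top, goal_cases)
    case c: (1 m)
    have e: "0 < m (Md j (4 + 2 * q))" using le_funD[OF c(1), of "Md j (4 + 2 * q)"] by auto
    show ?case using c(4)
    proof (cases rule: ctx.cases)
     case (ctxT2 q' rg r' d' q0' q1')
     then have "q' = q" using e by (auto simp: md_def split: if_splits)
     then have "r' = r" "q0' = q0" using ctxT2 Br by simp_all
     then have "reach q0 rg" using reach_step[OF ctxT2(2)] fstep.intros(3)[of prog q r d q0 q1 rg] ctxT2 Br \<open>q' = q\<close> by simp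
     then show ?thesis using c(2,3) ctxT2 \<open>q' = q\<close> \<open>r' = r\<close>
      by (intro InvI[of "Qp q0"]) (auto simp: ctl_def low_def cnt_def md_def regs_def fr_def intro!: exI[of _ rg])
    next
     case (ctxT1 q' rg r' d' q0' q1')
     then show ?thesis using e by (auto simp: md_def split: if_splits) presburger
    qed (use e in "auto simp: md_def split: if_splits")
   qed
   then show ?thesis by (rule kp[rotated]) (use 6 in "simp add: mainl_def Br")
  qed
 qed
qed

lemma Inv_tr:
 assumes "(a, b) : TT" "wfp prog nq R"
 shows "keeps a b"
proof -
 from assms(1) obtain i u where ab: "tr i u = (a, b)" "u < 16 + 6 * nq" unfolding TT_def by auto
 have R: "0 < R" "0 < nq" using assms(2) by (simp_all add: wfp_def)
 have opt: "opt k d = (a, b) ==> 0 < k ==> keeps a b" for k d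
  using Inv_opt[where k = k and dd = d] by (simp add: keeps_def)
 have main: "mainl q v = (a, b) ==> q < nq ==> keeps a b" for q v
  using Inv_main[OF _ assms(2), of q v] by simp
 have 16: "16 <= u ==> (u - 16) div 6 < nq" using ab(2) by (simp add: less_mult_imp_div_less)
 note k = Inv_t0 Inv_t2 Inv_t3 Inv_t4 Inv_t5 Inv_t6 Inv_t7 Inv_t8
 show ?thesis
 proof (cases "16 <= u")
  case True
  then show ?thesis using ab(1) main[of "(u - 16) div 6" "(u - 16) mod 6"] 16 keeps_Nil by (auto simp: tr_def split: if_splits)
 next
  case False
  show ?thesis
  proof (cases i)
   case 0
   then show ?thesis using ab(1) False opt Inv_t11 Inv_t12 keeps_Nil j by (auto simp: tr_def split: if_splits)
  next
   case (Suc l)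
   then show ?thesis using ab(1) False opt k[of l] Inv_t14[OF R(1)] main[of 0 0] R(2) keeps_Nil j by (auto simp: tr_def split: if_splits)
  qed
 qed
qed

lemma Inv_init: "Inv (ms M0)"
proof -
 have "ctx 1 0 (ms M0)"
 proof (cases "j = 1")
  case True
  have "ctx j 0 (ms M0)" by (rule ctx.ctxTI) (auto simp: M0_def md_def True)
  then show ?thesis using True by simp
 next
  case False
  then show ?thesis using j by (intro ctx.ctxI) (auto simp: M0_def md_def cnt_def)
 qed
 then show ?thesis using j
  by (intro InvP[of 0 0 _ 0 0]) (auto simp: M0_def ctl_def low_def lvl_def cnt_def dn_def NN_0)
qed

theorem lipton_sound:
 assumes "cov TT FF (ms M0)" "wfp prog nq R"
 shows "EX rg. reach qf rg & 0 < rg 0"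
proof -
 have "Inv m ==> EX rg. reach qf rg & 0 < rg 0" if "cov TT FF m" for m
  using that
 proof (induction rule: cov.induct)
  case (cov_final m)
  have "0 < m (Qp qf)" "0 < m (Xp 0)"
   using le_funD[OF cov_final(1), of "Qp qf"] le_funD[OF cov_final(1), of "Xp 0"] by (auto simp: FF_def)
  from InvQ[OF cov_final(2) this(1)] obtain rg where r: "reach qf rg" "regs {..<R} rg m" .
  have "0 < R" using assms(2) by (simp add: wfp_def)
  then have "0 < rg 0" using r(2) \<open>0 < m (Xp 0)\<close> by (auto simp: regs_def)
  then show ?case using r(1) by blast
 next
  case (cov_step a b m)
  have "Inv (fr a b m)" using Inv_tr[OF cov_step(1) assms(2)] cov_step(2,5) by (simp add: keeps_def)
  then show ?case using cov_step(4) by (simp add: fr_def)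
 qed
 then show ?thesis using assms(1) Inv_init by blast
qed

end

subsection \<open>Completeness\<close>

context lipton
begin

definition mstep :: "(pl => nat) => (pl => nat) => bool" where
 "mstep m m' \<longleftrightarrow> (EX (a, b) : TT. ms a <= m & m' = fr a b m)"

abbreviation msteps :: "(pl => nat) => (pl => nat) => bool" where
 "msteps == mstep^**"

lemma msteps_cov: "msteps m m' ==> ms FF <= m' ==> cov TT FF m"
by (induction rule: converse_rtranclp_induct; (fastforce simp: mstep_def fr_def intro: cov.cov_step cov.cov_final)?)

lemma msI:
 assumes "tr i u = (a, b)" "i <= j" "u < 16 + 6 * nq" "ms a <= m" "fr a b m = m'"
 shows "msteps m m'"
proof -
 have "(a, b) : TT" using assms(1-3) unfolding TT_def by (intro CollectI exI[of _ i] exI[of _ u]) simp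
 then have "mstep m m'" using assms(4,5) unfolding mstep_def by blast
 then show ?thesis by blast
qed

lemma msI2:
 assumes "tr i u = (a, b)" "i <= j" "u < 16 + 6 * nq" "!!p. ms a p <= m p" "!!p. m p - ms a p + ms b p = m' p"
 shows "msteps m m'"
 by (rule msI[OF assms(1-3)]) (use assms(4,5) in "simp_all add: le_fun_def fr_def fun_eq_iff")

lemma ms_trans: "msteps a b ==> msteps b c ==> msteps a c"
 by (rule rtranclp_trans)

text \<open>The marking during a call, relative to the marking \<open>m\<close> of the idle
  counters: \<open>a\<close> and \<open>b\<close> tokens have gone to the complements of y and z,
  and \<open>d\<close> operations have been performed. All additions stand before the truncated
  subtractions.\<close>

definition st :: "nat => nat => (pl => nat) => nat => nat => nat => nat => pl => nat" where
 "st l dd m x a b d p = m p + (if p = Pt (Suc l) x then 1 else 0) + (if p = Ct l 1 then a else 0) + (if p = Ct l 3 then b else 0)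
   + (if p : set (tgtl (Suc l) dd) then d else 0)
   - (if p = Ct l 0 then a else 0) - (if p = Ct l 2 then b else 0) - (if p : set (srcl (Suc l) dd) then d else 0)"

definition full :: "nat => (pl => nat) => bool" where
 "full l m \<longleftrightarrow> m (Ct l 0) = NN l & m (Ct l 1) = 0 & m (Ct l 2) = NN l & m (Ct l 3) = 0"

definition valid :: "nat => nat => bool" where
 "valid k dd \<longleftrightarrow> 0 < k & (EX i<=j. EX u < 16 + 6 * nq. tr i u = opt k dd)"

text \<open>A successful zero test of y (\<open>c = 0\<close>) or z (\<open>c = 2\<close>) of level
  \<open>l\<close>, ending at point 4 or 3 of the caller. The test also refills the counter, which
  readies it for the next loop.\<close>

definition callp :: "nat => bool" where
 "callp l \<longleftrightarrow> (ALL m c. (ALL i<l. full i m) & c : {0, 2} & m (Ct l c) = 0 & m (Ct l (Suc c)) = NN l -->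
   msteps (%p. m p + ms [(Pt l 0, 1), (Md l (c div 2), 1)] p)
    (%p. m p + ms [(Pt (Suc l) (if c = 2 then 3 else 4), 1), (Ct l c, NN l)] p - ms [(Ct l (Suc c), NN l)] p))"

lemma st_places: "p : set (srcl (Suc l) dd) Un set (tgtl (Suc l) dd) ==>
  p ~= Pt x y & p ~= Md x y & p ~= Qp x & (ALL c. p ~= Ct l c)"
 using srcl_tgtl(3)[of p "Suc l" dd] by auto

context
 fixes l dd :: nat and m :: "pl => nat"
 assumes l: "l < j" and v: "valid (Suc l) dd" and f: "!!i. i <= l ==> full i m"
  and mode: "0 < m (Md (Suc l) dd)" and src: "!!p. p : set (srcl (Suc l) dd) ==> NN (Suc l) <= m p"
  and call: "callp l"
begin

lemma notin: "Pt x y ~: set (srcl (Suc l) dd)" "Pt x y ~: set (tgtl (Suc l) dd)"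
 "Md x y ~: set (srcl (Suc l) dd)" "Md x y ~: set (tgtl (Suc l) dd)"
 "Ct l y ~: set (srcl (Suc l) dd)" "Ct l y ~: set (tgtl (Suc l) dd)"
 using st_places by blast+

lemma Ct_l: "m (Ct l 0) = NN l" "m (Ct l 1) = 0" "m (Ct l (Suc 0)) = 0" "m (Ct l 2) = NN l" "m (Ct l 3) = 0"
 using f[of l] by (simp_all add: full_def)

lemma src_ge: "p : set (srcl (Suc l) dd) ==> d <= NN (Suc l) ==> d <= m p"
 using src by (meson order_trans)

lemma s0: "a < NN l ==> msteps (st l dd m 0 a 0 d) (st l dd m 1 (Suc a) 0 d)"
 by (rule msI[of "Suc l" 0]) (use l Ct_l notin in "auto simp: tr_def st_def fr_def le_fun_def fun_eq_iff")

lemma s2: "msteps (st l dd m 2 a b d) (st l dd m 1 a b d)"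
 by (rule msI[of "Suc l" 4]) (use l Ct_l notin in "auto simp: tr_def st_def fr_def le_fun_def fun_eq_iff")

lemma s4: "msteps (st l dd m 3 a b d) (st l dd m 0 a b d)"
 by (rule msI[of "Suc l" 6]) (use l Ct_l notin in "auto simp: tr_def st_def fr_def le_fun_def fun_eq_iff")

lemma s1: assumes "b < NN l" "d < NN (Suc l)"
 shows "msteps (st l dd m 1 a b d) (st l dd m 2 a (Suc b) (Suc d))"
proof -
 obtain i u where iu: "i <= j" "u < 16 + 6 * nq" "tr i u = opt (Suc l) dd" using v unfolding valid_def by blast
 note ss = srcl_tgtl(1,2)[of "Suc l" dd]
 have a: "ms (fst (opt (Suc l) dd)) p = ms [(Pt (Suc l) 1, 1), (Ct l 2, 1), (Md (Suc l) dd, 1)] p + (if p : set (srcl (Suc l) dd) then 1 else 0)" for p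
  unfolding opt_def fst_conv ms_append ms_ones[OF ss(1)] by simp
 have b: "ms (snd (opt (Suc l) dd)) p = ms [(Pt (Suc l) 2, 1), (Ct l 3, 1), (Md (Suc l) dd, 1)] p + (if p : set (tgtl (Suc l) dd) then 1 else 0)" for p
  unfolding opt_def snd_conv ms_append ms_ones[OF ss(2)] by simp
 have sg: "Suc d <= m p" if "p : set (srcl (Suc l) dd)" for p using src_ge[OF that, of "Suc d"] assms(2) by simp
 show ?thesis
 proof (rule msI[of i u "fst (opt (Suc l) dd)" "snd (opt (Suc l) dd)"])
  show "ms (fst (opt (Suc l) dd)) <= st l dd m 1 a b d"
  proof (rule le_funI)
   fix p show "ms (fst (opt (Suc l) dd)) p <= st l dd m 1 a b d p"
    unfolding a using assms mode Ct_l notin sg[of p] by (cases "p : set (srcl (Suc l) dd)") (auto simp: st_def)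
  qed
  show "fr (fst (opt (Suc l) dd)) (snd (opt (Suc l) dd)) (st l dd m 1 a b d) = st l dd m 2 a (Suc b) (Suc d)"
  proof
   fix p show "fr (fst (opt (Suc l) dd)) (snd (opt (Suc l) dd)) (st l dd m 1 a b d) p = st l dd m 2 a (Suc b) (Suc d) p"
    unfolding fr_def a b using assms mode Ct_l notin sg[of p] by (cases "p : set (srcl (Suc l) dd)") (auto simp: st_def)
  qed
 qed (use iu in auto)
qed

lemma full_st: "i < l ==> full i (%p. st l dd m x a b d p - (if p = Pt (Suc l) x then 1 else 0))"
proof -
 assume i: "i < l"
 have n: "Ct i c ~: set (srcl (Suc l) dd)" "Ct i c ~: set (tgtl (Suc l) dd)" for c
  using srcl_tgtl(3)[of "Ct i c" "Suc l" dd] i by auto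
 show ?thesis using f[of i] i by (simp add: full_def st_def n)
qed

lemma s3: "a <= NN l ==> msteps (st l dd m 2 a (NN l) d) (st l dd m 3 a 0 d)"
proof -
 assume a: "a <= NN l"
 let ?m = "%p. st l dd m 2 a (NN l) d p - (if p = Pt (Suc l) 2 then 1 else 0)"
 have 1: "msteps (st l dd m 2 a (NN l) d) (%p. ?m p + ms [(Pt l 0, 1), (Md l (2 div 2), 1)] p)"
  by (rule msI[of "Suc l" 5]) (use l notin in "auto simp: tr_def fr_def st_def le_fun_def fun_eq_iff")
 have c: "?m (Ct l 2) = 0" "?m (Ct l (Suc 2)) = NN l" using Ct_l notin by (auto simp: st_def)
 have 2: "msteps (%p. ?m p + ms [(Pt l 0, 1), (Md l (2 div 2), 1)] p)
    (%p. ?m p + ms [(Pt (Suc l) (if 2 = (2::nat) then 3 else 4), 1), (Ct l 2, NN l)] p - ms [(Ct l (Suc 2), NN l)] p)"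
  by (rule call[unfolded callp_def, rule_format], intro conjI allI impI full_st c) simp_all
 have 3: "(%p. ?m p + ms [(Pt (Suc l) (if 2 = (2::nat) then 3 else 4), 1), (Ct l 2, NN l)] p - ms [(Ct l (Suc 2), NN l)] p) = st l dd m 3 a 0 d"
  by (rule ext) (use notin Ct_l in "auto simp: st_def")
 show ?thesis using ms_trans[OF 1 2] unfolding 3 .
qed

lemma s5: "msteps (st l dd m 3 (NN l) 0 d) (st l dd m 4 0 0 d)"
proof -
 let ?m = "%p. st l dd m 3 (NN l) 0 d p - (if p = Pt (Suc l) 3 then 1 else 0)"
 have 1: "msteps (st l dd m 3 (NN l) 0 d) (%p. ?m p + ms [(Pt l 0, 1), (Md l (0 div 2), 1)] p)"
  by (rule msI[of "Suc l" 7]) (use l notin in "auto simp: tr_def fr_def st_def le_fun_def fun_eq_iff")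
 have c: "?m (Ct l 0) = 0" "?m (Ct l (Suc 0)) = NN l" using Ct_l notin by (auto simp: st_def)
 have 2: "msteps (%p. ?m p + ms [(Pt l 0, 1), (Md l (0 div 2), 1)] p)
    (%p. ?m p + ms [(Pt (Suc l) (if 0 = (2::nat) then 3 else 4), 1), (Ct l 0, NN l)] p - ms [(Ct l (Suc 0), NN l)] p)"
  by (rule call[unfolded callp_def, rule_format], intro conjI allI impI full_st c) simp_all
 have 3: "(%p. ?m p + ms [(Pt (Suc l) (if 0 = (2::nat) then 3 else 4), 1), (Ct l 0, NN l)] p - ms [(Ct l (Suc 0), NN l)] p) = st l dd m 4 0 0 d"
  by (rule ext) (use notin Ct_l in "auto simp: st_def")
 show ?thesis using ms_trans[OF 1 2] unfolding 3 .
qed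

lemma inner: "i < NN l ==> d + NN l <= NN (Suc l) ==> msteps (st l dd m 1 a 0 d) (st l dd m 2 a (Suc i) (d + Suc i))"
proof (induction i)
 case 0
 have "d < NN (Suc l)" using 0 by linarith
 then show ?case using s1[of 0 d a] by simp
next
 case (Suc i)
 have "d + Suc i < NN (Suc l)" using Suc.prems by linarith
 then show ?case using Suc ms_trans[OF ms_trans[OF Suc.IH s2] s1[of "Suc i" "d + Suc i" a]] by simp
qed

lemma outer: "a < NN l ==> msteps (st l dd m 0 0 0 0) (st l dd m 3 (Suc a) 0 (Suc a * NN l))"
proof (induction a)
 case (0)
 have "NN l <= NN (Suc l)" unfolding NN_Suc by (simp add: Suc_le_eq)
 then have i: "msteps (st l dd m 1 (Suc 0) 0 0) (st l dd m 2 (Suc 0) (NN l) (NN l))"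
  using inner[of "NN l - 1" 0 1] by simp
 have "Suc 0 <= NN l" using NN_pos[of l] by linarith
 from ms_trans[OF ms_trans[OF s0[OF NN_pos] i] s3[OF this]]
 have "msteps (st l dd m 0 0 0 0) (st l dd m 3 1 0 (NN l))" by simp
 then show ?case by simp
next
 case (Suc a)
 let ?d = "Suc a * NN l"
 have "Suc (Suc a) * NN l <= NN (Suc l)" unfolding NN_Suc using Suc.prems by (intro mult_right_mono) auto
 then have d: "?d + NN l <= NN (Suc l)" by simp
 have "msteps (st l dd m 1 (Suc (Suc a)) 0 ?d) (st l dd m 2 (Suc (Suc a)) (NN l) (?d + NN l))"
  using inner[OF _ d, of "NN l - 1" "Suc (Suc a)"] by simp
 then have "msteps (st l dd m 0 (Suc a) 0 ?d) (st l dd m 3 (Suc (Suc a)) 0 (?d + NN l))"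
  using ms_trans[OF ms_trans[OF s0[of "Suc a" ?d]] s3[of "Suc (Suc a)" "?d + NN l"]] Suc.prems by simp
 moreover have "msteps (st l dd m 0 0 0 0) (st l dd m 0 (Suc a) 0 ?d)"
  using ms_trans[OF Suc.IH s4] Suc.prems by simp
 ultimately show ?case using ms_trans by (simp add: add.commute)
qed

lemma proc: "msteps (st l dd m 0 0 0 0) (st l dd m 4 0 0 (NN (Suc l)))"
using outer[of "NN l - 1"] ms_trans s5 by (simp add: NN_Suc)

end

lemma valid_low: "0 < k ==> k < j ==> dd < 3 ==> valid k dd"
 unfolding valid_def by (intro conjI exI[of _ k] exI[of _ "Suc dd"]) (auto simp: tr_def)

lemma callp: "l < j ==> callp l"
proof (induction l)
 case 0
 have "msteps (%p. m p + ms [(Pt 0 0, 1), (Md 0 (c div 2), 1)] p)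
    (%p. m p + ms [(Pt 1 (if c = 2 then 3 else 4), 1), (Ct 0 c, NN 0)] p - ms [(Ct 0 (Suc c), NN 0)] p)"
  if "c : {0, 2}" "m (Ct 0 c) = 0" "m (Ct 0 (Suc c)) = NN 0" for m c
  by (rule msI2[of 0 "if c = 2 then 11 else 12" "[(Pt 0 0, 1), (Md 0 (c div 2), 1), (Ct 0 (Suc c), 2)]"
     "[(Pt 1 (if c = 2 then 3 else 4), 1), (Ct 0 c, 2)]"])
   (use that in "auto simp: tr_def NN_0")
 then show ?case unfolding callp_def by simp
next
 case (Suc l)
 have C: "callp l" using Suc by simp
 show ?case unfolding callp_def
 proof (intro allI impI, elim conjE)
  fix m c assume f: "ALL i<Suc l. full i m" and c: "c : {0, 2}" "m (Ct (Suc l) c) = 0" "m (Ct (Suc l) (Suc c)) = NN (Suc l)"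
  define dd where "dd = c div 2"
  have dd: "dd < 3" "dd <= 1" "dd = 1 \<longleftrightarrow> c = 2" "dd = 0 \<longleftrightarrow> c = 0" using c(1) by (auto simp: dd_def)
  let ?m = "%p. m p + ms [(Md (Suc l) dd, 1)] p"
  have lj: "l < j" using Suc.prems by simp
  have sr: "srcl (Suc l) dd = [Ct (Suc l) (Suc c)]" "tgtl (Suc l) dd = [Ct (Suc l) c]"
   using c(1) Suc.prems by (auto simp: srcl.simps tgtl.simps dd_def)
  have ff: "full i ?m" if "i <= l" for i using f that by (auto simp: full_def)
  have v: "valid (Suc l) dd" using Suc.prems dd by (intro valid_low) auto
  have a1: "msteps (st l dd ?m 0 0 0 0) (st l dd ?m 4 0 0 (NN (Suc l)))"
   by (rule proc[OF lj v ff _ _ C]) (use c sr in auto)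
  have a0: "st l dd ?m 0 0 0 0 = (%p. m p + ms [(Pt (Suc l) 0, 1), (Md (Suc l) (c div 2), 1)] p)"
   by (auto simp: st_def fun_eq_iff dd_def)
  have a2: "msteps (st l dd ?m 4 0 0 (NN (Suc l)))
   (%p. m p + ms [(Pt (Suc (Suc l)) (if c = 2 then 3 else 4), 1), (Ct (Suc l) c, NN (Suc l))] p - ms [(Ct (Suc l) (Suc c), NN (Suc l))] p)"
  proof (rule msI2[of "Suc l" "if c = 2 then 8 else 9" "[(Pt (Suc l) 4, 1), (Md (Suc l) dd, 1)]"
     "[(Pt (Suc (Suc l)) (if c = 2 then 3 else 4), 1)]"])
   show "tr (Suc l) (if c = 2 then 8 else 9) = ([(Pt (Suc l) 4, 1), (Md (Suc l) dd, 1)], [(Pt (Suc (Suc l)) (if c = 2 then 3 else 4), 1)])"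
    using c(1) dd Suc.prems by (auto simp: tr_def)
  qed (use c dd sr Suc.prems in "auto simp: st_def")
  show "msteps (%p. m p + ms [(Pt (Suc l) 0, 1), (Md (Suc l) (c div 2), 1)] p)
   (%p. m p + ms [(Pt (Suc (Suc l)) (if c = 2 then 3 else 4), 1), (Ct (Suc l) c, NN (Suc l))] p - ms [(Ct (Suc l) (Suc c), NN (Suc l))] p)"
   using ms_trans[OF a1 a2] unfolding a0 .
 qed
qed

lemma procedure:
 assumes "l < j" "valid (Suc l) dd" "!!i. i <= l ==> full i m" "0 < m (Md (Suc l) dd)"
  "!!p. p : set (srcl (Suc l) dd) ==> NN (Suc l) <= m p"
 shows "msteps (%p. m p + (if p = Pt (Suc l) 0 then 1 else 0)) (%p. m p + (if p = Pt (Suc l) 4 then 1 else 0)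
  + (if p : set (tgtl (Suc l) dd) then NN (Suc l) else 0) - (if p : set (srcl (Suc l) dd) then NN (Suc l) else 0))"
proof -
 have "st l dd m 0 0 0 0 = (%p. m p + (if p = Pt (Suc l) 0 then 1 else 0))" by (auto simp: st_def fun_eq_iff)
 moreover have "st l dd m 4 0 0 (NN (Suc l)) = (%p. m p + (if p = Pt (Suc l) 4 then 1 else 0)
  + (if p : set (tgtl (Suc l) dd) then NN (Suc l) else 0) - (if p : set (srcl (Suc l) dd) then NN (Suc l) else 0))"
  by (auto simp: st_def fun_eq_iff)
 ultimately show ?thesis using proc[OF assms(1-5) callp[OF assms(1)]] by simp
qed

definition stg :: "nat => pl => nat" where
 "stg k p = (case p of Pt x y => if x = k & y = 0 then 1 else 0 | Md x y => if x = k & y = 2 then 1 else 0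
   | Ct l c => if l < k & (c = 0 | c = 2) then NN l else 0 | _ => 0)"

definition mst :: "nat => (nat => nat) => pl => nat" where
 "mst q rg p = (case p of Qp x => if x = q then 1 else 0 | Xp r => if r < R then rg r else 0 | Xb r => if r < R then NN j - rg r else 0
   | Ct l c => if l < j & (c = 0 | c = 2) then NN l else 0 | _ => 0)"

lemma init_stage: "0 < k ==> k <= j ==> msteps (ms M0) (stg k)"
proof (induction k)
 case (Suc l)
 show ?case
 proof (cases "l = 0")
  case True
  have "ms M0 = stg (Suc 0)" by (auto simp: M0_def stg_def fun_eq_iff NN_0 split: pl.splits)
  then show ?thesis using True by simp
 next
  case False
  then obtain i where i: "l = Suc i" by (cases l) auto
  let ?m = "%p. stg l p - (if p = Pt l 0 then 1 else 0)"
  have sr: "srcl l 2 = []" "tgtl l 2 = [Ct l 0, Ct l 2]" using Suc.prems by (auto simp: srcl.simps tgtl.simps)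
  have a1: "msteps (%p. ?m p + (if p = Pt l 0 then 1 else 0)) (%p. ?m p + (if p = Pt l 4 then 1 else 0)
   + (if p : set (tgtl l 2) then NN l else 0) - (if p : set (srcl l 2) then NN l else 0))"
  proof (rule procedure[of i 2 ?m, folded i])
   show "valid l 2" using Suc.prems False by (intro valid_low) auto
   show "full i' ?m" if "i' <= i" for i' using that i by (simp add: full_def stg_def)
   show "i < j" using Suc.prems i by simp
   show "0 < ?m (Md l 2)" by (simp add: stg_def)
  qed (simp add: sr)
  have a0: "(%p. ?m p + (if p = Pt l 0 then 1 else 0)) = stg l" by (auto simp: stg_def fun_eq_iff)
  have a2: "msteps (%p. ?m p + (if p = Pt l 4 then 1 else 0)
   + (if p : set (tgtl l 2) then NN l else 0) - (if p : set (srcl l 2) then NN l else 0)) (stg (Suc l))"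
  proof (rule msI2[of l 10 "[(Pt l 4, 1), (Md l 2, 1)]" "[(Pt (l + 1) 0, 1), (Md (l + 1) 2, 1)]"])
   fix p
   show "ms [(Pt l 4, 1), (Md l 2, 1)] p <= ?m p + (if p = Pt l 4 then 1 else 0)
    + (if p : set (tgtl l 2) then NN l else 0) - (if p : set (srcl l 2) then NN l else 0)"
    by (cases p) (auto simp: stg_def sr)
   show "?m p + (if p = Pt l 4 then 1 else 0)
    + (if p : set (tgtl l 2) then NN l else 0) - (if p : set (srcl l 2) then NN l else 0)
    - ms [(Pt l 4, 1), (Md l 2, 1)] p + ms [(Pt (l + 1) 0, 1), (Md (l + 1) 2, 1)] p = stg (Suc l) p"
    by (cases p) (auto simp: stg_def sr less_Suc_eq)
  qed (use Suc.prems False in "auto simp: tr_def")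
  have "msteps (ms M0) (stg l)" using Suc False by simp
  from ms_trans[OF this ms_trans[OF a1[unfolded a0] a2]] show ?thesis .
 qed
qed simp

lemma stage_main:
 assumes "0 < R" "K <= NN j"
 shows "msteps (stg j) (mst 0 ((%_. 0)(0 := K)))"
proof -
 obtain i where i: "j = Suc i" using j by (cases j) auto
 let ?m = "%p. stg j p - (if p = Pt j 0 then 1 else 0)"
 have sr: "srcl j 2 = []" "tgtl j 2 = map Xb [0..<R]" by (auto simp: srcl.simps tgtl.simps)
 have v: "valid j 2" using j unfolding valid_def by (intro conjI exI[of _ j] exI[of _ 13]) (auto simp: tr_def)
 have a1: "msteps (%p. ?m p + (if p = Pt j 0 then 1 else 0)) (%p. ?m p + (if p = Pt j 4 then 1 else 0)
   + (if p : set (tgtl j 2) then NN j else 0) - (if p : set (srcl j 2) then NN j else 0))"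
 proof (rule procedure[of i 2 ?m, folded i])
  show "full i' ?m" if "i' <= i" for i'
  using that i by (simp add: full_def stg_def)
  show "i < j" using i by simp
  show "0 < ?m (Md j 2)" by (simp add: stg_def)
 qed (simp_all add: sr v)
 have a0: "(%p. ?m p + (if p = Pt j 0 then 1 else 0)) = stg j" by (auto simp: stg_def fun_eq_iff)
 have a2: "msteps (%p. ?m p + (if p = Pt j 4 then 1 else 0)
   + (if p : set (tgtl j 2) then NN j else 0) - (if p : set (srcl j 2) then NN j else 0)) (mst 0 ((%_. 0)(0 := K)))"
 proof (rule msI2[of j 14 "[(Pt j 4, 1), (Md j 2, 1), (Xb 0, K)]" "[(Qp 0, 1), (Xp 0, K)]"])
  fix p
  show "ms [(Pt j 4, 1), (Md j 2, 1), (Xb 0, K)] p <= ?m p + (if p = Pt j 4 then 1 else 0)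
   + (if p : set (tgtl j 2) then NN j else 0) - (if p : set (srcl j 2) then NN j else 0)"
   using assms by (cases p) (auto simp: stg_def sr)
  show "?m p + (if p = Pt j 4 then 1 else 0)
   + (if p : set (tgtl j 2) then NN j else 0) - (if p : set (srcl j 2) then NN j else 0)
   - ms [(Pt j 4, 1), (Md j 2, 1), (Xb 0, K)] p + ms [(Qp 0, 1), (Xp 0, K)] p = mst 0 ((%_. 0)(0 := K)) p"
   using assms by (cases p) (auto simp: stg_def mst_def sr)
 qed (use j in "auto simp: tr_def")
 from ms_trans[OF a1[unfolded a0] a2] show ?thesis .
qed

lemma main_step:
 assumes "fstep prog (q, rg) (q', rg')" "q < nq" "wfp prog nq R" "!!r. rg r <= NN j" "!!r. rg' r <= NN j"
 shows "msteps (mst q rg) (mst q' rg')"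
proof -
 have tr: "tr j (16 + 6 * q + v) = mainl q v" if "v < 6" for v
 using that by (simp add: tr_def)
 have msm: "msteps x y" if "mainl q v = (a, b)" "v < 6" "ms a <= x" "fr a b x = y" for v a b x y
  by (rule msI[of j "16 + 6 * q + v" a b]) (use that tr assms(2) in auto)
 show ?thesis
  using assms(1)
 proof (cases rule: fstep.cases)
  case 1
  then show ?thesis
   by (intro msm[of 0 "[(Qp q, 1)]" "[(Qp q', 1)]"]) (auto simp: mainl_def mst_def fr_def le_fun_def fun_eq_iff split: pl.splits)
 next
  case (2 r)
  have r: "r < R" using 2 assms(2,3) unfolding wfp_def by force
  have "rg r < NN j" using 2 assms(5)[of r] by simp
  then show ?thesis using 2 r
   by (intro msm[of 0 "[(Qp q, 1), (Xb r, 1)]" "[(Qp q', 1), (Xp r, 1)]"])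
    (auto simp: mainl_def mst_def fr_def le_fun_def fun_eq_iff split: pl.splits)
 next
  case (4 r d q0)
  have r: "r < R" "d <= 1" using 4 assms(2,3) unfolding wfp_def by force+
  show ?thesis using 4 r assms(4)[of r]
   by (intro msm[of 0 "[(Qp q, 1), (Xp r, 1)]" "[(Qp q', 1), (Xp r, 1 - d), (Xb r, d)]"])
    (auto simp: mainl_def mst_def fr_def le_fun_def fun_eq_iff split: pl.splits)
 next
  case (3 r d q1)
  have r: "r < R" using 3 assms(2,3) unfolding wfp_def by force
  obtain i where i: "j = Suc i" using j by (cases j) auto
  have v: "valid j (3 + 2 * q)" "valid j (4 + 2 * q)"
  proof -
   have "tr j (16 + 6 * q + 2) = opt j (3 + 2 * q)" "tr j (16 + 6 * q + 3) = opt j (4 + 2 * q)"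
    using tr[of 2] tr[of 3] 3 by (simp_all add: mainl_def)
   moreover have "16 + 6 * q + 2 < 16 + 6 * nq" "16 + 6 * q + 3 < 16 + 6 * nq" using assms(2) by auto
   ultimately show "valid j (3 + 2 * q)" "valid j (4 + 2 * q)" using j unfolding valid_def by blast+
  qed
  have "(4 + 2 * q - 3) div 2 = q" by simp
  then have sr: "srcl j (3 + 2 * q) = [Xb r]" "tgtl j (3 + 2 * q) = [Xp r]" "srcl j (4 + 2 * q) = [Xp r]" "tgtl j (4 + 2 * q) = [Xb r]"
   using 3 by (auto simp: srcl.simps tgtl.simps)
  let ?b = "%p. mst q rg p - (if p = Qp q then 1 else 0)"
  let ?m1 = "%p. ?b p + (if p = Md j (3 + 2 * q) then 1 else 0)"
  let ?m2 = "(%p. ?b p + (if p = Md j (4 + 2 * q) then 1 else 0))(Xp r := NN j, Xb r := 0)"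
  let ?e = "%m dd p. m p + (if p = Pt j 4 then 1 else 0) + (if p : set (tgtl j dd) then NN j else 0) - (if p : set (srcl j dd) then NN j else 0)"
  have a1: "msteps (mst q rg) (%p. ?m1 p + (if p = Pt j 0 then 1 else 0))"
   by (rule msm[of 1 "[(Qp q, 1)]" "[(Pt j 0, 1), (Md j (3 + 2 * q), 1)]"])
    (use 3 in "auto simp: mainl_def mst_def fr_def le_fun_def fun_eq_iff")
  have a2: "msteps (%p. ?m1 p + (if p = Pt j 0 then 1 else 0)) (?e ?m1 (3 + 2 * q))"
  proof (rule procedure[of i "3 + 2 * q" ?m1, folded i])
   show "full i' ?m1" if "i' <= i" for i'
   proof -
    have "i' < j" using that i by simp
    then show ?thesis by (simp add: full_def mst_def)
   qed
   show "i < j" using i by simp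
   show "0 < ?m1 (Md j (3 + 2 * q))" by (simp add: mst_def)
  qed (use v 3 r in "auto simp: sr mst_def")
  have a3: "msteps (?e ?m1 (3 + 2 * q)) (%p. ?m2 p + (if p = Pt j 0 then 1 else 0))"
   by (rule msm[of 4 "[(Pt j 4, 1), (Md j (3 + 2 * q), 1)]" "[(Pt j 0, 1), (Md j (4 + 2 * q), 1)]"])
    (use 3 r sr in "auto simp: mainl_def mst_def fr_def le_fun_def fun_eq_iff")
  have a4: "msteps (%p. ?m2 p + (if p = Pt j 0 then 1 else 0)) (?e ?m2 (4 + 2 * q))"
  proof (rule procedure[of i "4 + 2 * q" ?m2, folded i])
   show "full i' ?m2" if "i' <= i" for i'
   proof -
    have "i' < j" using that i by simp
    then show ?thesis by (simp add: full_def mst_def)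
   qed
   show "i < j" using i by simp
   show "0 < ?m2 (Md j (4 + 2 * q))" by (simp add: mst_def)
  qed (use v 3 r in "auto simp: sr mst_def")
  have a5: "msteps (?e ?m2 (4 + 2 * q)) (mst q' rg')"
   by (rule msm[of 5 "[(Pt j 4, 1), (Md j (4 + 2 * q), 1)]" "[(Qp q', 1)]"])
    (use 3 r sr in "auto simp: mainl_def mst_def fr_def le_fun_def fun_eq_iff split: pl.splits")
  show ?thesis by (rule ms_trans[OF a1 ms_trans[OF a2 ms_trans[OF a3 ms_trans[OF a4 a5]]]])
 qed
qed

text \<open>\<open>C\<close> is a run of the program whose register values stay below the capacity of the counters.\<close>

theorem lipton_complete:
 assumes "wfp prog nq R" and C0: "C 0 = (0, (%_. 0)(0 := K))"
  and steps: "!!i. i < n ==> fstep prog (C i) (C (Suc i))"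
  and bound: "!!i r. i <= n ==> snd (C i) r <= NN j"
  and fin: "fst (C n) = qf" "0 < snd (C n) 0"
 shows "cov TT FF (ms M0)"
proof -
 have R: "0 < R" "0 < nq" using assms(1) by (auto simp: wfp_def)
 have q: "fst (C i) < nq" if "i <= n" for i
  using that
 proof (induction i)
  case (Suc i)
  then have "fst (C i) < nq" by simp
  then show ?case using steps[of i] Suc.prems assms(1) unfolding wfp_def
   by (cases "C i"; cases "C (Suc i)") (force elim: fstep.cases)
 qed (simp add: C0 R)
 have K: "K <= NN j" using bound[of 0 0] by (simp add: C0)
 have "msteps (ms M0) (mst (fst (C i)) (snd (C i)))" if "i <= n" for i
  using that
 proof (induction i)
  case 0
  show ?case unfolding C0 fst_conv snd_conv by (rule ms_trans[OF init_stage[OF j order_refl] stage_main[OF R(1) K]])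
 next
  case (Suc i)
  have "msteps (mst (fst (C i)) (snd (C i))) (mst (fst (C (Suc i))) (snd (C (Suc i))))"
   by (rule main_step) (use steps[of i] q[of i] bound[of i] bound[of "Suc i"] Suc.prems assms(1) in auto)
  then show ?case using Suc by (simp add: rtranclp_trans)
 qed
 then have "msteps (ms M0) (mst (fst (C n)) (snd (C n)))" by simp
 moreover have "ms FF p <= mst (fst (C n)) (snd (C n)) p" for p
  using fin R by (cases p) (auto simp: FF_def mst_def)
 ultimately show ?thesis by (intro msteps_cov le_funI)
qed

end

section \<open>Simulation of Turing machines by counter programs\<close>

lemma LS_listsum: "(!!x. x : set xs ==> LS (f x)) ==> LS (%e. SUM x<-xs. f x e)"
 by (induction xs) (auto intro: LS_intro)

text \<open>A finite table is a fixed sum over all its entries from which one is selected, so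
  \<open>f\<close> may be arbitrary, for instance the transition function of a machine.\<close>

lemma LS_table: assumes "LS a" "LS b"
 shows "LS (%e. if a e < m & b e < n then f (a e) (b e) else 0)"
proof -
 have "LS (%e. SUM x<-[0..<m]. SUM y<-[0..<n]. if a e = x & b e = y then f x y else 0)"
  by (intro LS_listsum LS_intro assms)
 moreover have "(SUM x<-[0..<m]. SUM y<-[0..<n]. if p = x & q = y then f x y else 0) = (if p < m & q < n then f p q else 0)" for p q
 proof -
  have "(SUM x<-[0..<m]. SUM y<-[0..<n]. if p = x & q = y then f x y else 0) = (SUM x<m. SUM y<n. if p = x & q = y then f x y else 0)"
   by (simp add: interv_sum_list_conv_sum_set_nat lessThan_atLeast0)
  also have "... = (SUM x<m. if p = x then (if q < n then f x q else 0) else 0)"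
   by (intro sum.cong) auto
  also have "... = (if p < m & q < n then f p q else 0)" by auto
  finally show ?thesis .
 qed
 ultimately show ?thesis by simp
qed

fun tget :: "nat => nat => nat" where
 "tget 0 c = fst (prod_decode c)"
| "tget (Suc i) c = tget i (snd (prod_decode c))"

fun tcode :: "nat list => nat" where
 "tcode [] = 0"
| "tcode (x # xs) = prod_encode (x, tcode xs)"

lemma tget_tcode: "i < length xs ==> tget i (tcode xs) = xs ! i"
 by (induction xs arbitrary: i) (auto simp: nth_Cons split: nat.splits)

lemma LS_tget: "LS a ==> LS (%e. tget i (a e))"
 by (induction i arbitrary: a) (auto intro: LS_intro)

declare tget.simps [simp del]

lemma LS_tcode: "(!!i. i : set is ==> LS (f i)) ==> LS (%e. tcode (map (%i. f i e) is))"
 by (induction "is") (auto intro: LS_intro)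

subsection \<open>Tapes as pairs of numbers\<close>

lemma dg_step [simp]: "a < b ==> dg b (x * b + a) 0 = a" "a < b ==> dg b (x * b + a) (Suc i) = dg b x i"
 "dg b (x div b) i = dg b x (Suc i)"
 by (simp_all add: dg_def div_mult2_eq)

lemma dg_0: "dg b x 0 = x mod b"
 by (simp add: dg_def)

lemma dg_zero: assumes "2 <= b" "!!i. m <= i ==> dg b z i = 0" shows "z < b ^ m"
proof -
 have *: "(!!i. dg b z i = 0) ==> z = 0" for z
 proof (induction z rule: less_induct)
  case (less z)
  show ?case
  using less.IH[of "z div b"] less.prems[of 0] less.prems assms by (force simp: dg_0)
 qed
 have "dg b (z div b ^ m) i = dg b z (m + i)" for i by (simp add: dg_def div_mult2_eq power_add)
 then have "z div b ^ m = 0" using assms(2) by (intro *[of "z div b ^ m"]) simp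
 then show ?thesis using assms(1) by (simp add: div_eq_0_iff)
qed

text \<open>Two stacks: the lowest digit of \<open>r\<close> is the scanned cell and the lowest
  digit of \<open>l\<close> its left neighbour, so that a move only multiplies or divides by
  \<open>b\<close>.\<close>

definition trep :: "nat => tape => nat => nat => bool" where
 "trep b T l r \<longleftrightarrow> (ALL i. dg b l i = fst T (snd T - 1 - int i)) & (ALL i. dg b r i = fst T (snd T + int i))"

fun dcode :: "dir => nat" where
 "dcode Go_Left = 0"
| "dcode Stay = 1"
| "dcode Go_Right = 2"

definition newl :: "nat => nat => nat => nat => nat => nat" where
 "newl b a d l r = (if d = 0 then l div b else if d = 1 then l else l * b + a)"

definition newr :: "nat => nat => nat => nat => nat => nat" where
 "newr b a d l r = (if d = 0 then (r div b * b + a) * b + l mod b else if d = 1 then r div b * b + a else r div b)"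

lemma trep_act:
 assumes "trep b T l r" "a < b"
 shows "trep b (act T (a, d)) (newl b a (dcode d) l r) (newr b a (dcode d) l r)"
proof -
 obtain f h where T: "T = (f, h)" by force
 have L: "dg b l i = f (h - 1 - int i)" and R: "dg b r i = f (h + int i)" for i
  using assms(1) by (simp_all add: trep_def T)
 have lb: "l mod b < b" using assms(2) by simp
 have L0: "l mod b = f (h - 1)" using L[of 0] by (simp add: dg_0)
 show ?thesis
 proof (cases d)
  case Go_Left
  have "dg b (newl b a 0 l r) i = (f(h := a)) (h - 1 - 1 - int i)" for i using L[of "Suc i"] by (simp add: newl_def algebra_simps)
  moreover have "dg b (newr b a 0 l r) i = (f(h := a)) (h - 1 + int i)" for i
  proof (cases i)
   case (Suc k)
   then have k: "h - 1 + int i = h + int k" by simp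
   show ?thesis unfolding k unfolding Suc using R[of k] assms(2) lb by (cases k) (simp_all add: newr_def)
  qed (use lb L0 in "simp add: newr_def")
  ultimately show ?thesis using Go_Left by (simp add: trep_def T)
 next
  case Stay
  have "dg b (newr b a 1 l r) i = (f(h := a)) (h + int i)" for i
   using R[of i] assms(2) by (cases i) (simp_all add: newr_def)
  then show ?thesis using Stay L by (simp add: trep_def T newl_def)
 next
  case Go_Right
  have "dg b (newl b a 2 l r) i = (f(h := a)) (h + 1 - 1 - int i)" for i
   using L[of "i - 1"] assms(2) by (cases i) (simp_all add: newl_def diff_diff_eq2 diff_diff_add)
  moreover have "dg b (newr b a 2 l r) i = (f(h := a)) (h + 1 + int i)" for i
   using R[of "Suc i"] by (simp add: newr_def algebra_simps)
  ultimately show ?thesis using Go_Right by (simp add: trep_def T)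
 qed
qed

lemma digits_sum: "i < n ==> (!!i. i < n ==> g i < b) ==> (SUM i<-[0..<n]. g i * b ^ i) div b ^ i mod b = g i"
 "(!!i. i < n ==> g i < b) ==> (SUM i<-[0..<n]. g i * b ^ i) < b ^ n" for b :: nat
proof -
 show lt: "(SUM i<-[0..<n]. g i * b ^ i) < b ^ n" if "!!i. i < n ==> g i < b" for n
  using that
 proof (induction n)
  case (Suc n)
  have "(SUM i<-[0..<n]. g i * b ^ i) < b ^ n" using Suc by simp
  moreover have "g n + 1 <= b" using Suc.prems[of n] by simp
  then have "(g n + 1) * b ^ n <= b * b ^ n" by (rule mult_right_mono) simp
  ultimately show ?case by simp
 qed simp
 show "(SUM i<-[0..<n]. g i * b ^ i) div b ^ i mod b = g i" if "i < n" "!!i. i < n ==> g i < b"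
  using that
 proof (induction n)
  case (Suc n)
  have b: "0 < b" using Suc.prems(2)[of n] by simp
  show ?case
  proof (cases "i = n")
   case True
   then show ?thesis using lt[of n] Suc.prems(2) b by (simp add: div_add1_eq)
  next
   case False
   then have "i < n" using Suc.prems by simp
   then obtain k where n: "n = Suc (i + k)" using less_iff_Suc_add by auto
   have "g n * b ^ n = (g n * b ^ k * b) * b ^ i" unfolding n by (simp add: power_add mult_ac)
   then have "((SUM i<-[0..<n]. g i * b ^ i) + g n * b ^ n) div b ^ i = (g n * b ^ k * b) + (SUM i<-[0..<n]. g i * b ^ i) div b ^ i"
    using b div_mult_self1[of "b ^ i" "SUM i<-[0..<n]. g i * b ^ i" "g n * b ^ k * b"] by (metis less_not_refl zero_less_power)
   then show ?thesis using Suc \<open>i < n\<close> by (simp add: mod_add_eq[symmetric])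
  qed
 qed simp
qed

context
 fixes M :: tm
 assumes M: "is_tm M"
begin

lemma sb3: "3 <= tm_symbols M"
 using M by (simp add: is_tm_def)

text \<open>All scanned symbols as one number in the base of the alphabet, which turns the
  transition function into a table with two arguments.\<close>

definition scans :: "nat => nat" where
 "scans c = (SUM i<-[0..<tm_tapes M]. (tget (2 * i + 2) c mod tm_symbols M) * tm_symbols M ^ i)"

definition dl :: "nat => nat => nat \<times> (nat \<times> dir) list" where
 "dl q A = tm_delta M q (map (%i. A div tm_symbols M ^ i mod tm_symbols M) [0..<tm_tapes M])"

definition tab :: "(nat => nat => nat) => nat => nat => nat" where
 "tab f p q = (if p < tm_states M & q < tm_symbols M ^ tm_tapes M then f p q else 0)"

text \<open>Field 0 of a configuration code is the state; fields \<open>2 * k + 1\<close> and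
  \<open>2 * k + 2\<close> are the two stacks of tape \<open>k\<close>.\<close>

definition cfields :: "nat => nat => nat" where
 "cfields c i = (let q = tget 0 c; A = scans c in
   if i = 0 then tab (%q A. fst (dl q A)) q A
   else let k = (i - 1) div 2; l = tget (2 * k + 1) c; r = tget (2 * k + 2) c;
     a = tab (%q A. fst (snd (dl q A) ! k)) q A; d = tab (%q A. dcode (snd (snd (dl q A) ! k))) q A
    in if odd i then newl (tm_symbols M) a d l r else newr (tm_symbols M) a d l r)"

definition cstp :: "nat => nat" where
 "cstp c = tcode (map (cfields c) [0..<2 * tm_tapes M + 1])"

lemma LS_tab: "LS p ==> LS q ==> LS (%e. tab f (p e) (q e))"
 unfolding tab_def by (rule LS_table)

lemma LS_scans: "LS c ==> LS (%e. scans (c e))"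
 unfolding scans_def by (intro LS_listsum LS_intro LS_tget)

lemma LS_cstp: "LS c ==> LS (%e. cstp (c e))"
proof -
 assume c: "LS c"
 have "LS (%e. cfields (c e) i)" for i
 using c by (auto simp: cfields_def Let_def newl_def newr_def intro!: LS_tab LS_scans LS_tget LS_intro)
 then show ?thesis unfolding cstp_def by (intro LS_tcode)
qed

definition crep :: "config => nat => bool" where
 "crep C c \<longleftrightarrow> (EX F. c = tcode (map F [0..<2 * tm_tapes M + 1]) & F 0 = fst C & fst C < tm_states M & length (snd C) = tm_tapes M &
   (ALL i<tm_tapes M. trep (tm_symbols M) (snd C ! i) (F (2 * i + 1)) (F (2 * i + 2)) & (ALL x. fst (snd C ! i) x < tm_symbols M)))"

lemma crep_step:
 assumes "crep C c" "~ halted M C"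
 shows "crep (step M C) (cstp c) & (EX acts. length acts = tm_tapes M & snd (step M C) = map2 act (snd C) acts)"
proof -
 obtain F where F: "c = tcode (map F [0..<2 * tm_tapes M + 1])" "F 0 = fst C" "fst C < tm_states M" "length (snd C) = tm_tapes M"
  and T: "!!i. i < tm_tapes M ==> trep (tm_symbols M) (snd C ! i) (F (2 * i + 1)) (F (2 * i + 2))" "!!i x. i < tm_tapes M ==> fst (snd C ! i) x < tm_symbols M"
  using assms(1) unfolding crep_def by blast
 have get: "tget i c = F i" if "i < 2 * tm_tapes M + 1" for i using that F(1) by (simp add: tget_tcode del: upt_Suc)
 have hd: "F (2 * i + 2) mod tm_symbols M = fst (snd C ! i) (snd (snd C ! i))" if "i < tm_tapes M" for i
  using T(1)[OF that] unfolding trep_def by (metis dg_0 add_0_right of_nat_0)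
 define as where "as = map (%(f, h). f h) (snd C)"
 have sc: "scans c = (SUM i<-[0..<tm_tapes M]. (as ! i) * tm_symbols M ^ i)"
  unfolding scans_def as_def using F(4) by (intro arg_cong[of _ _ sum_list] map_cong) (auto simp: get hd[simplified] split: prod.splits)
 have asb: "as ! i < tm_symbols M" if "i < tm_tapes M" for i using T(2)[OF that] that F(4) by (simp add: as_def split: prod.splits) (metis fst_conv)
 have las: "length as = tm_tapes M" using F(4) by (simp add: as_def)
 have sc2: "scans c < tm_symbols M ^ tm_tapes M" "map (%i. scans c div tm_symbols M ^ i mod tm_symbols M) [0..<tm_tapes M] = as"
  unfolding sc using digits_sum(1)[where g = "%i. as ! i" and b = "tm_symbols M" and n = "tm_tapes M"] digits_sum(2)[where g = "%i. as ! i" and b = "tm_symbols M" and n = "tm_tapes M"] asb las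
  by (auto intro!: nth_equalityI)
 obtain q' acts where d: "tm_delta M (fst C) as = (q', acts)" by force
 have dl: "dl (fst C) (scans c) = (q', acts)" by (simp only: dl_def sc2(2) d)
 have "set as <= {..<tm_symbols M}" using asb las by (auto simp: in_set_conv_nth)
 then have "case tm_delta M (fst C) as of (q', acts) =>
   q' < tm_states M & length acts = tm_tapes M & fst ` set acts <= {..<tm_symbols M}"
  using M[unfolded is_tm_def, THEN conjunct2, THEN conjunct2, THEN conjunct2, THEN conjunct2, THEN conjunct2, THEN conjunct2, rule_format, OF conjI[OF F(3) conjI[OF las]]] by simp
 then have ok: "q' < tm_states M" "length acts = tm_tapes M" "fst ` set acts <= {..<tm_symbols M}" using d by auto
 have st: "step M C = (q', map2 act (snd C) acts)" using assms(2) d by (simp add: step_def as_def)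
 have tb: "tab f (tget 0 c) (scans c) = f (fst C) (scans c)" for f
  using F(2,3) sc2(1) get[of 0] by (simp add: tab_def)
 have f0: "cfields c 0 = q'" by (simp add: cfields_def tb dl)
 have aki: "fst (acts ! i) < tm_symbols M" if "i < tm_tapes M" for i using ok(2,3) that by force
 have fi: "trep (tm_symbols M) (act (snd C ! i) (acts ! i)) (cfields c (2 * i + 1)) (cfields c (2 * i + 2))" if "i < tm_tapes M" for i
 using that get[of "2 * i + 1"] trep_act[OF T(1)[OF that] aki[OF that], of "snd (acts ! i)"] get[of "2 * i + 2"] by (simp add: cfields_def tb dl)
 have "fst (act (snd C ! i) (acts ! i)) x < tm_symbols M" if "i < tm_tapes M" for i x
  using T(2)[OF that] aki[OF that] by (cases "snd C ! i"; cases "acts ! i") simp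
 then have "crep (step M C) (cstp c)" unfolding crep_def cstp_def st
  using fi f0 ok F(4) by (intro exI[of _ "cfields c"]) simp
 then show ?thesis using st ok(2) by auto
qed

end

text \<open>A pair is coded by at most the square of its sum plus one; the factor 2 that arises in
  estimating the sum is absorbed by squaring again, so each further entry multiplies the exponent by
  4.\<close>

lemma tcode_bound: "(!!x. x : set xs ==> x <= B) ==> tcode xs <= (B + 2) ^ (4 ^ length xs)"
proof (induction xs)
 case (Cons x xs)
 define Y where "Y = (B + 2) ^ (4 ^ length xs)"
 have "B + 2 <= Y" unfolding Y_def by (rule self_le_power) auto
 moreover have "tcode xs <= Y" using Cons by (simp add: Y_def)
 moreover have "x <= B" using Cons.prems by simp
 ultimately have le: "x + tcode xs + 1 <= 2 * Y" "2 <= Y" by auto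
 have "prod_encode (x, tcode xs) <= (x + tcode xs + 1) * (x + tcode xs + 1)"
 by (simp add: triangle_def prod_encode_def)
 also have "... <= (2 * Y) * (2 * Y)" using le(1) by (intro mult_le_mono)
 also have "... <= (Y * Y) * (Y * Y)" using le(2) by (intro mult_le_mono) auto
 also have "... = Y ^ 4" by (simp add: numeral_eq_Suc)
 finally show ?case by (simp add: Y_def power_mult[symmetric] mult.commute)
qed simp

text \<open>Unlike in \<open>wcode\<close> the first letter is the least significant bit, which is
  the order of \<open>bits\<close>. The binary encoding of \<open>wn w\<close> therefore contains
  \<open>w\<close> letter by letter.\<close>

definition wn :: "bool list => nat" where
 "wn w = foldr (%b x. 2 * x + of_bool b) w 1"

lemma wn_simps [simp]: "wn [] = 1" "wn (b # w) = 2 * wn w + of_bool b"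
 by (simp_all add: wn_def)

lemma wn_bounds: "2 ^ length w <= wn w" "wn w < 2 ^ Suc (length w)"
proof -
 have "2 ^ length w <= wn w & wn w < 2 ^ Suc (length w)" by (induction w) auto
 then show "2 ^ length w <= wn w" "wn w < 2 ^ Suc (length w)" by auto
qed

lemma bits_wn: "bits (wn w) = w @ [True]"
proof (induction w)
 case Nil
 show ?case by (subst bits.simps, simp, subst bits.simps, simp)
next
 case (Cons b w)
 have "0 < wn w" using wn_bounds(1)[of w] by (metis less_le_trans zero_less_numeral zero_less_power)
 then show ?case using Cons by (subst bits.simps) auto
qed

lemma enc_nat_wn: "enc_nat (wn w) = concat (map (%b. [True, b]) w) @ [True, True, False]"
 by (simp add: enc_nat_def bits_wn)

text \<open>The content of the input tape, from the word given as a number with a leading one.\<close>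

fun inN :: "nat => nat => nat" where
 "inN b N = (if N <= 1 then 0 else inN b (N div 2) * b + (1 + N mod 2))"

declare inN.simps [simp del]

lemma inN_bound: assumes "3 <= b" shows "inN b N <= N ^ b"
proof (induction N rule: less_induct)
 case (less N)
 show ?case
 proof (cases "N <= 1")
  case False
  let ?x = "N div 2"
  have x: "1 <= ?x" "?x < N" using False by auto
  have "inN b N = inN b ?x * b + (1 + N mod 2)" using False by (subst inN.simps) simp
  moreover have "inN b ?x * b <= ?x ^ b * b" using less.IH[OF x(2)] by simp
  moreover have "N mod 2 < 2" by simp
  ultimately have "inN b N <= ?x ^ b * b + 2" by linarith
  also have "... <= ?x ^ b * (b + 2)" using one_le_power[OF x(1), of b] by (simp add: algebra_simps)
  also have "... <= ?x ^ b * 2 ^ b"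
  proof -
   have "b + 2 <= 2 ^ b" using assms by (induction b rule: dec_induct) auto
   then show ?thesis by (rule mult_left_mono) simp
  qed
  also have "... = (?x * 2) ^ b" by (simp add: power_mult_distrib)
  also have "... <= N ^ b" by (rule power_mono) auto
  finally show ?thesis .
 qed (simp add: inN.simps)
qed

text \<open>The recursion of \<open>inN\<close> descends from \<open>N\<close> to
  \<open>N div 2\<close>; it is replaced by one that ascends through the numbers
  \<open>N div 2 ^ (N - k)\<close>, the first of which is 0.\<close>

lemma LS_inN: assumes "3 <= b" "LS a" shows "LS (%e. inN b (a e))"
proof -
 let ?h = "%r i N. let x = N div 2 ^ (N - 1 - i) in if x <= 1 then 0 else r * b + (1 + x mod 2)"
 have r: "rec_nat 0 (%i r. ?h r i N) k = inN b (N div 2 ^ (N - k))" if "k <= N" for k N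
  using that
 proof (induction k)
  case 0
  have "N < 2 ^ N" by (rule less_exp)
  then show ?case by (simp add: inN.simps)
 next
  case (Suc k)
  then have "N - k = Suc (N - 1 - k)" by simp
  then have "N div 2 ^ (N - k) = N div 2 ^ (N - 1 - k) div 2" by (simp only: power_Suc2 div_mult2_eq)
  then show ?case using Suc by (simp add: inN.simps[of b "N div 2 ^ (N - Suc k)"] Let_def)
 qed
 have "LS (%e. rec_nat 0 (%i r. ?h r i (hd e)) (hd e))"
 proof (rule LS_rec[where B = "%e. hd e ^ b"])
  show "LS (%e. ?h (hd e) (hd (tl e)) (hd (tl (tl e))))"
   unfolding Let_def by (intro LS_intro)
  show "rec_nat 0 (%i r. ?h r i (hd e)) i <= hd e ^ b" if "i <= hd e" for e i
   unfolding r[OF that] by (rule order_trans[OF inN_bound[OF assms(1)]]) (rule power_mono, auto)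
 qed (rule LS_hd LS_const pb_power[OF LS_pb[OF LS_hd]])+
 then have "LS (%e. inN b (hd e))" using r by simp
 then show ?thesis using assms(2) by (rule LS_subst1)
qed

lemma dg_0_left [simp]: "dg b 0 i = 0"
 by (simp add: dg_def)

lemma dg_inN: "3 <= b ==> dg b (inN b (wn w)) i = word_tape w (int i)"
proof (induction w arbitrary: i)
 case Nil
 then show ?case by (simp add: inN.simps word_tape_def)
next
 case (Cons x w)
 have "1 <= wn w" using wn_bounds(1)[of w] one_le_power[of "2::nat" "length w"] by linarith
 then have "~ wn (x # w) <= 1" by simp
 then have i: "inN b (wn (x # w)) = inN b (wn w) * b + (1 + of_bool x)" by (subst inN.simps) simp
 have "dg b (inN b (wn w) * b + (1 + of_bool x)) i = word_tape (x # w) (int i)"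
 proof (cases i)
  case 0
  have "1 + of_bool x < b" using Cons.prems by (cases x) auto
  from dg_step(1)[OF this] show ?thesis unfolding 0 by (simp add: word_tape_def)
 next
  case (Suc k)
  have "1 + of_bool x < b" using Cons.prems by (cases x) auto
  moreover have "word_tape (x # w) (int (Suc k)) = word_tape w (int k)" by (auto simp: word_tape_def nat_add_distrib)
  ultimately show ?thesis using Cons by (simp add: Suc del: of_nat_Suc add_Suc)
 qed
 then show ?case unfolding i .
qed

subsection \<open>Bounds on the configurations of a space-bounded machine\<close>

context
 fixes M :: tm
 assumes M: "is_tm M"
begin

definition initc :: "nat => nat" where
 "initc N = tcode (map (%i. if i = 0 then tm_start M else if i = 2 then inN (tm_symbols M) N else 0) [0..<2 * tm_tapes M + 1])"

lemma LS_initc: "LS a ==> LS (%e. initc (a e))"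
proof -
 assume a: "LS a"
 have "LS (%e. if i = 0 then tm_start M else if i = 2 then inN (tm_symbols M) (a e) else 0)" for i :: nat
  by (cases "i = 0"; cases "i = 2") (auto intro: LS_intro LS_inN a sb3[OF M])
 then show ?thesis unfolding initc_def by (rule LS_tcode)
qed

lemma crepE:
 assumes "crep M C c"
 obtains F where "c = tcode (map F [0..<2 * tm_tapes M + 1])" "F 0 = fst C" "fst C < tm_states M" "length (snd C) = tm_tapes M"
  "!!i. i < tm_tapes M ==> trep (tm_symbols M) (snd C ! i) (F (2 * i + 1)) (F (2 * i + 2))"
 using assms unfolding crep_def[OF M] by blast

lemma crep_init: "crep M (init_config M w) (initc (wn w))"
 unfolding crep_def[OF M] initc_def
 using M dg_inN[OF sb3[OF M], of w] sb3[OF M]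
 by (intro exI[of _ "%i. if i = 0 then tm_start M else if i = 2 then inN (tm_symbols M) (wn w) else 0"])
  (auto simp: init_config_def is_tm_def nth_Cons trep_def word_tape_def split: nat.splits)

lemma crep_run: "(!!i. i < t ==> ~ halted M (run M w i)) ==> crep M (run M w t) ((cstp M ^^ t) (initc (wn w)))"
proof (induction t)
 case 0
 show ?case using crep_init by (simp add: run_def)
next
 case (Suc t)
 have "run M w (Suc t) = step M (run M w t)" by (simp add: run_def)
 then show ?case using crep_step[OF M Suc.IH] Suc.prems by simp
qed

lemma run_step_act:
 assumes "i < tm_tapes M" "!!i. i < Suc t ==> ~ halted M (run M w i)"
 shows "EX x. snd (run M w (Suc t)) ! i = act (snd (run M w t) ! i) x"
proof -
 have "run M w (Suc t) = step M (run M w t)" by (simp add: run_def)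
 then obtain acts where a: "length acts = tm_tapes M" "snd (run M w (Suc t)) = map2 act (snd (run M w t)) acts"
  using crep_step[OF M crep_run, of t w] assms(2) by auto
 have "length (snd (run M w t)) = tm_tapes M" using crep_run[of t w] assms(2) unfolding crep_def[OF M] by auto
 then show ?thesis using a assms(1) by (intro exI[of _ "acts ! i"]) simp
qed

lemma move_bounds: "\<bar>move d h - h\<bar> <= 1"
 by (cases d) auto

text \<open>A head moves by at most one cell per step, so it has scanned everything between its
  start and its position. The number of scanned cells therefore bounds its distance from the
  start.\<close>

lemma head_visited:
 assumes "i < tm_tapes M" "!!i. i < t ==> ~ halted M (run M w i)"
 shows "{i} \<times> {min 0 (snd (snd (run M w t) ! i)) .. max 0 (snd (snd (run M w t) ! i))} <= visited M w"
 using assms(2)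
proof (induction t)
 case 0
 have "snd (snd (run M w 0) ! i) = 0" using assms(1) by (cases i) (auto simp: run_def init_config_def)
 moreover have "(i, snd (snd (run M w 0) ! i)) : visited M w" using assms(1) unfolding visited_def by blast
 ultimately show ?case by auto
next
 case (Suc t)
 obtain x where x: "snd (run M w (Suc t)) ! i = act (snd (run M w t) ! i) x"
  using run_step_act[OF assms(1)] Suc.prems by blast
 obtain f h a d where fh: "snd (run M w t) ! i = (f, h)" "x = (a, d)" by force
 define h' where "h' = snd (snd (run M w (Suc t)) ! i)"
 have "h' = move d h" by (simp add: h'_def x fh)
 then have "\<bar>h' - h\<bar> <= 1" using move_bounds by simp
 then have "{min 0 h' .. max 0 h'} <= insert h' {min 0 h .. max 0 h}" by auto
 moreover have "(i, h') : visited M w" using assms(1) unfolding visited_def h'_def by blast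
 ultimately show ?case using Suc.IH Suc.prems unfolding h'_def[symmetric] fh snd_conv by auto
qed

lemma head_bound:
 assumes "i < tm_tapes M" "!!i. i < t ==> ~ halted M (run M w i)" "finite (visited M w)" "card (visited M w) <= S"
 shows "\<bar>snd (snd (run M w t) ! i)\<bar> < int S"
using card_mono[OF assms(3) head_visited[where t = t, OF assms(1,2)]] assms by (simp)

lemma content_bound:
 assumes "i < tm_tapes M" "!!i. i < t ==> ~ halted M (run M w i)" "finite (visited M w)" "card (visited M w) <= S"
  "fst (snd (run M w t) ! i) x ~= 0"
 shows "- int S < x & x < int (S + length w)"
 using assms(2,5)
proof (induction t)
 case 0
 have "0 <= x & x < int (length w)"
  using 0 assms(1) by (cases i) (auto simp: run_def init_config_def word_tape_def split: if_splits)
 moreover have "0 < int S" using head_bound[OF assms(1) _ assms(3,4), of 0] by auto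
 ultimately show ?case by simp
next
 case (Suc t)
 obtain y where y: "snd (run M w (Suc t)) ! i = act (snd (run M w t) ! i) y"
  using run_step_act[OF assms(1)] Suc.prems by blast
 obtain f h a d where fh: "snd (run M w t) ! i = (f, h)" "y = (a, d)" by force
 show ?case
 using head_bound[OF assms(1) _ assms(3,4), of t] Suc.prems(2) Suc.IH Suc.prems(1) by (cases "x = h"; (force simp: fh y)?)
qed

text \<open>Nonzero cells lie less than \<open>2 * S + length w\<close> away from the head on either
  side, so both stacks of a tape are numbers with that many digits; the outer exponent comes from
  coding \<open>2 * tm_tapes M + 1\<close> fields.\<close>

lemma code_bound:
 assumes "!!i. i < t ==> ~ halted M (run M w i)" "finite (visited M w)" "card (visited M w) <= S"
 shows "(cstp M ^^ t) (initc (wn w)) <= (tm_symbols M ^ (2 * S + length w) + tm_states M + 2) ^ (4 ^ (2 * tm_tapes M + 1))"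
proof -
 obtain F where F: "(cstp M ^^ t) (initc (wn w)) = tcode (map F [0..<2 * tm_tapes M + 1])" "F 0 = fst (run M w t)" "fst (run M w t) < tm_states M"
  and T: "!!i. i < tm_tapes M ==> trep (tm_symbols M) (snd (run M w t) ! i) (F (2 * i + 1)) (F (2 * i + 2))"
  by (rule crepE[OF crep_run[where t = t, OF assms(1)]]) auto
 let ?m = "2 * S + length w"
 have lr: "F (2 * i + 1) < tm_symbols M ^ ?m & F (2 * i + 2) < tm_symbols M ^ ?m" if i: "i < tm_tapes M" for i
 proof -
  obtain f h where fh: "snd (run M w t) ! i = (f, h)" by force
  have h: "\<bar>h\<bar> < int S" using head_bound[where t = t, OF i assms] fh by simp
  have c: "f x = 0" if "x <= - int S | int (S + length w) <= x" for x using content_bound[where t = t, OF i assms, of x] fh that by fastforce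
  have "dg (tm_symbols M) (F (2 * i + 1)) y = 0" "dg (tm_symbols M) (F (2 * i + 2)) y = 0" if "?m <= y" for y
   using T[OF i] h that unfolding trep_def fh by (auto intro!: c)
  then show ?thesis using dg_zero[of "tm_symbols M" ?m] sb3[OF M] by auto
 qed
 have "F i <= tm_symbols M ^ ?m + tm_states M" if "i < 2 * tm_tapes M + 1" for i
 proof -
  consider "i = 0" | k where "i = 2 * k + 1" "k < tm_tapes M" | k where "i = 2 * k + 2" "k < tm_tapes M"
  proof (cases "i = 0")
   case False
   then have "i = 2 * ((i - 1) div 2) + 1 | i = 2 * ((i - 1) div 2) + 2" "(i - 1) div 2 < tm_tapes M" using \<open>i < 2 * tm_tapes M + 1\<close> by presburger+
   then show ?thesis using that by blast
  qed
  then show ?thesis using F(2,3) lr by cases (auto intro: less_imp_le trans_le_add1)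
 qed
 then have "tcode (map F [0..<2 * tm_tapes M + 1]) <= (tm_symbols M ^ ?m + tm_states M + 2) ^ (4 ^ length (map F [0..<2 * tm_tapes M + 1]))"
  by (intro tcode_bound) (auto simp del: upt_Suc)
 then show ?thesis by (simp add: F(1) del: upt_Suc)
qed

lemma state_code:
 assumes "!!i. i < t ==> ~ halted M (run M w i)"
 shows "tget 0 ((cstp M ^^ t) (initc (wn w))) = fst (run M w t)"
proof -
 obtain F where F: "(cstp M ^^ t) (initc (wn w)) = tcode (map F [0..<2 * tm_tapes M + 1])" "F 0 = fst (run M w t)"
  by (rule crepE[OF crep_run[where t = t, OF assms]]) auto
 then show ?thesis by (simp add: tget_tcode del: upt_Suc)
qed

end

subsection \<open>Runs with bounded registers\<close>

text \<open>The bound holds at every moment of the run and not only at its end, because the counters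
  of Lipton's net cannot hold more than their capacity at any time.\<close>

definition pth :: "nat => cmd list \<times> cstate => cmd list \<times> cstate => bool" where
 "pth B C C' \<longleftrightarrow> (EX t. (cstep [] ^^ t) C = C' & (ALL i<=t. ALL r. fst (snd ((cstep [] ^^ i) C)) r <= B))"

lemma pth_trans: assumes "pth B C C'" "pth B C' C''" shows "pth B C C''"
proof -
 obtain t where t: "(cstep [] ^^ t) C = C'" "!!i r. i <= t ==> fst (snd ((cstep [] ^^ i) C)) r <= B"
  using assms(1) unfolding pth_def by blast
 obtain t' where t': "(cstep [] ^^ t') C' = C''" "!!i r. i <= t' ==> fst (snd ((cstep [] ^^ i) C')) r <= B"
  using assms(2) unfolding pth_def by blast
 have e: "(cstep [] ^^ (k + t)) C = (cstep [] ^^ k) C'" for k by (simp add: funpow_add t(1))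
 have "fst (snd ((cstep [] ^^ i) C)) r <= B" if "i <= t' + t" for i r
 using e[of "i - t"] t'(2)[of "i - t" r] that t(2) by (cases "i <= t"; (simp)?)
 then show ?thesis unfolding pth_def by (intro exI[of _ "t' + t"]) (simp add: e t')
qed

text \<open>A register gains at most 1 per step, so a time bound also bounds all intermediate
  values.\<close>

lemma pth_ex: assumes "ex c rg K rg'" "!!r. rg r + K <= B" shows "pth B (c # ks, rg, 0, []) (ks, rg', 0, [])"
proof -
 obtain t where t: "t <= K" "(cstep [] ^^ t) (c # ks, rg, 0, []) = (ks, rg', 0, [])"
  using ex_rn[OF assms(1), of "[]" "(0, [])"] unfolding rn_def by blast
 have "fst (snd ((cstep [] ^^ i) (c # ks, rg, 0, []))) r <= B" if "i <= t" for i r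
  using cstep_value[of i "[]" "(c # ks, rg, 0, [])" r] assms(2)[of r] that t(1) by simp
 then show ?thesis using t(2) unfolding pth_def by blast
qed

lemma pth_step: "cstep [] (ks, rg, 0, []) = (ks', rg, 0, []) ==> (!!r. rg r <= B) ==> pth B (ks, rg, 0, []) (ks', rg, 0, [])"
 unfolding pth_def by (rule exI[of _ 1]) (auto simp: le_Suc_eq)

text \<open>Double exponential growth with the constant \<open>A\<close> in the exponent, where sums
  and fixed powers are absorbed. The summand \<open>length w\<close> makes room for the code of the
  word.\<close>

definition eb :: "nat => (bool list => nat) => bool" where
 "eb k V \<longleftrightarrow> (EX A. ALL w. V w <= 2 ^ (A * 2 ^ (length w ^ k + length w)))"

lemma eb_const: "eb k (%w. c)"
 unfolding eb_def
proof (intro exI[of _ c] allI)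
 fix w :: "bool list"
 have "c <= c * 2 ^ (length w ^ k + length w)" by simp
 then have "(2::nat) ^ c <= 2 ^ (c * 2 ^ (length w ^ k + length w))" by (rule power_increasing) simp
 then show "c <= 2 ^ (c * 2 ^ (length w ^ k + length w))" using less_exp[of c] by linarith
qed

lemma eb_add: assumes "eb k V" "eb k W" shows "eb k (%w. V w + W w)"
proof -
 obtain A B where AB: "!!w. V w <= 2 ^ (A * 2 ^ (length w ^ k + length w))" "!!w. W w <= 2 ^ (B * 2 ^ (length w ^ k + length w))"
  using assms unfolding eb_def by blast
 have "V w + W w <= 2 ^ ((A + B + 1) * 2 ^ (length w ^ k + length w))" for w
 proof -
  define E :: nat where "E = 2 ^ (length w ^ k + length w)"
  have E: "1 <= E" by (simp add: E_def)
  have "V w <= 2 ^ ((A + B) * E)" by (rule order_trans[OF AB(1)]) (simp add: E_def)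
  moreover have "W w <= 2 ^ ((A + B) * E)" by (rule order_trans[OF AB(2)]) (simp add: E_def)
  ultimately have "V w + W w <= 2 ^ (Suc ((A + B) * E))" by simp
  also have "... <= 2 ^ ((A + B + 1) * E)" using E by (intro power_increasing) auto
  finally show ?thesis by (simp add: E_def)
 qed
 then show ?thesis unfolding eb_def by blast
qed

lemma eb_power: assumes "eb k V" shows "eb k (%w. V w ^ q)"
proof -
 obtain A where A: "!!w. V w <= 2 ^ (A * 2 ^ (length w ^ k + length w))" using assms unfolding eb_def by blast
 have "V w ^ q <= 2 ^ ((A * q) * 2 ^ (length w ^ k + length w))" for w
  using power_mono[OF A, of w q] by (simp add: power_mult[symmetric] mult_ac)
 then show ?thesis unfolding eb_def by blast
qed

lemma eb_wn: "eb k wn"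
 unfolding eb_def
proof (intro exI[of _ 1] allI)
 fix w :: "bool list"
 have "Suc (length w) <= 2 ^ length w" by (rule Suc_leI[OF less_exp])
 also have "... <= 1 * 2 ^ (length w ^ k + length w)" by (simp add: power_increasing)
 finally have "(2::nat) ^ Suc (length w) <= 2 ^ (1 * 2 ^ (length w ^ k + length w))" by (rule power_increasing) simp
 then show "wn w <= 2 ^ (1 * 2 ^ (length w ^ k + length w))" using wn_bounds(2)[of w] by linarith
qed

lemma eb_space: "eb k (%w. b ^ (2 * (c * 2 ^ (length w ^ k)) + length w))"
 unfolding eb_def
proof (intro exI[of _ "b * (2 * c + 1)"] allI)
 fix w :: "bool list"
 define E :: nat where "E = 2 ^ (length w ^ k + length w)"
 have "length w <= 2 ^ length w" using less_exp[of "length w"] by simp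
 also have "... <= E" by (simp add: E_def power_increasing)
 finally have "length w <= E" .
 moreover have "2 ^ (length w ^ k) <= E" by (simp add: E_def power_increasing)
 then have "2 * (c * 2 ^ (length w ^ k)) <= 2 * (c * E)" by (intro mult_left_mono) auto
 ultimately have le: "2 * (c * 2 ^ (length w ^ k)) + length w <= (2 * c + 1) * E" unfolding add_mult_distrib by linarith
 have "b <= 2 ^ b" using less_exp[of b] by simp
 then have "b ^ (2 * (c * 2 ^ (length w ^ k)) + length w) <= (2 ^ b) ^ (2 * (c * 2 ^ (length w ^ k)) + length w)" by (rule power_mono) simp
 also have "... <= (2 ^ b) ^ ((2 * c + 1) * E)" using le by (rule power_increasing) simp
 also have "... = 2 ^ (b * (2 * c + 1) * E)" by (simp only: power_mult[symmetric] mult.assoc)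
 finally show "b ^ (2 * (c * 2 ^ (length w ^ k)) + length w) <= 2 ^ (b * (2 * c + 1) * 2 ^ (length w ^ k + length w))"
  unfolding E_def .
qed

text \<open>As \<open>A\<close> is at most 2^(A + 1), the factor in the exponent becomes an additive
  constant in the level of the counters.\<close>

lemma eb_NN: "eb k V ==> EX J>0. ALL w. V w <= NN (length w ^ k + length w + J)"
proof -
 assume "eb k V"
 then obtain A where A: "!!w. V w <= 2 ^ (A * 2 ^ (length w ^ k + length w))" unfolding eb_def by blast
 have "V w <= NN (length w ^ k + length w + Suc A)" for w
 proof -
  have "A <= 2 ^ Suc A" using less_exp[of A] unfolding power_Suc by linarith
  then have "A * 2 ^ (length w ^ k + length w) <= 2 ^ Suc A * 2 ^ (length w ^ k + length w)" by (rule mult_right_mono) simp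
  then have "(2::nat) ^ (A * 2 ^ (length w ^ k + length w)) <= 2 ^ (2 ^ Suc A * 2 ^ (length w ^ k + length w))" by (rule power_increasing) simp
  moreover have "2 ^ Suc A * 2 ^ (length w ^ k + length w) = (2::nat) ^ (length w ^ k + length w + Suc A)" by (simp only: power_add mult_ac)
  ultimately show ?thesis using A[of w] unfolding NN_def by (metis order_trans)
 qed
 then show ?thesis by blast
qed

lemma ex_assign_poly:
 assumes "LS f" "ALL j : set js. j < s" "r < s"
 obtains c q where "pure c" "!!rg. ALL i>=s. rg i = 0 ==>
  ex c rg ((rg r + sum_list (map rg js) + 2) ^ q) (rg(r := f (map rg js)))"
proof -
 obtain c T where c: "pure c" "pb T" "!!rg. ALL i>=s. rg i = 0 ==> ex c rg (T (rg r # map rg js)) (rg(r := f (map rg js)))"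
  using ex_assign[OF assms] by blast
 obtain q where q: "!!e. T e <= (sum_list e + 2) ^ q" using c(2) unfolding pb_def by blast
 show thesis
 proof (rule that[OF c(1)])
  fix rg :: "nat => nat" assume "ALL i>=s. rg i = 0"
  from ex_mono[OF c(3)[OF this]] show "ex c rg ((rg r + sum_list (map rg js) + 2) ^ q) (rg(r := f (map rg js)))"
   using q[of "rg r # map rg js"] by simp
 qed
qed

text \<open>Register 0 holds the word and at the end the answer, register 1 the coded configuration,
  register 2 a flag telling that the machine is still running; the registers from 3 on are scratch
  space of the \<open>LS\<close> programs.\<close>

theorem tm_program:
 assumes M: "is_tm M" and dec: "decides_in_space M L (%n. c * 2 ^ (n ^ k))"
 obtains P J where "pure P" "0 < J" "!!w. EX rg. pth (NN (length w ^ k + length w + J)) ([P], (%_. 0)(0 := wn w), 0, []) ([], rg, 0, []) & (0 < rg 0 \<longleftrightarrow> w : L)"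
proof -
 define hf where "hf x = (if tget 0 x = tm_accept M | tget 0 x = tm_reject M then 0 else 1::nat)" for x
 define af where "af x = (if tget 0 x = tm_accept M then 1 else 0::nat)" for x
 have LSs: "LS (%e. initc M (hd e))" "LS (%e. cstp M (hd e))" "LS (%e. hf (hd e))" "LS (%e. af (hd e))"
  unfolding hf_def af_def by (intro LS_initc[OF M] LS_cstp[OF M] LS_intro LS_tget)+
 obtain p1 q1 where p1: "pure p1" "!!rg. ALL i>=3. rg i = 0 ==> ex p1 rg ((rg 1 + rg 0 + 2) ^ q1) (rg(1 := initc M (rg 0)))"
  by (rule ex_assign_poly[OF LSs(1), of "[0]" 3 1]) auto
 obtain p2 q2 where p2: "pure p2" "!!rg. ALL i>=3. rg i = 0 ==> ex p2 rg ((rg 1 + rg 1 + 2) ^ q2) (rg(1 := cstp M (rg 1)))"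
  by (rule ex_assign_poly[OF LSs(2), of "[1]" 3 1]) auto
 obtain p3 q3 where p3: "pure p3" "!!rg. ALL i>=3. rg i = 0 ==> ex p3 rg ((rg 2 + rg 1 + 2) ^ q3) (rg(2 := hf (rg 1)))"
  by (rule ex_assign_poly[OF LSs(3), of "[1]" 3 2]) auto
 obtain p4 q4 where p4: "pure p4" "!!rg. ALL i>=3. rg i = 0 ==> ex p4 rg ((rg 0 + rg 1 + 2) ^ q4) (rg(0 := af (rg 1)))"
  by (rule ex_assign_poly[OF LSs(4), of "[1]" 3 0]) auto
 let ?U = "Until (Zero 2) (Sq p2 p3)"
 define P where "P = Sq p1 (Sq p3 (Sq ?U p4))"
 define X where "X w = (tm_symbols M ^ (2 * (c * 2 ^ (length w ^ k)) + length w) + tm_states M + 2) ^ (4 ^ (2 * tm_tapes M + 1))" for w :: "bool list"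
 \<comment> \<open>\<open>Y\<close> bounds each register between the subprograms as well as the base
   of their time bounds; \<open>V\<close> adds the running times and thus bounds every value that
   occurs inside a subprogram.\<close>
 define Y where "Y w = wn w + wn w + (X w + X w) + 4" for w
 define V where "V w = Y w + (Y w ^ q1 + Y w ^ q2 + Y w ^ q3 + Y w ^ q4)" for w
 have "eb k X" unfolding X_def by (intro eb_power eb_add eb_const eb_space)
 then have "eb k V" unfolding V_def Y_def by (intro eb_power eb_add eb_const eb_wn)
 from eb_NN[OF this] obtain J where J: "0 < J" "!!w. V w <= NN (length w ^ k + length w + J)" by blast
 show thesis
 proof (rule that[of P J])
  show "pure P" using p1 p2 p3 p4 by (simp add: P_def)
  show "0 < J" by fact
  fix w :: "bool list"
  let ?S = "c * 2 ^ (length w ^ k)"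
  define B where "B = NN (length w ^ k + length w + J)"
  have dw: "halts M w" "accepts M w \<longleftrightarrow> w : L" "finite (visited M w)" "card (visited M w) <= ?S"
   using dec unfolding decides_in_space_def by auto
  define H where "H = (LEAST n. halted M (run M w n))"
  have H: "halted M (run M w H)" unfolding H_def using dw(1) unfolding halts_def by (rule LeastI_ex)
  have nH: "~ halted M (run M w i)" if "i < H" for i using not_less_Least[of i "%n. halted M (run M w n)"] that unfolding H_def by blast
  define cd where "cd i = (cstp M ^^ i) (initc M (wn w))" for i
  have cX: "cd i <= X w" if "i <= H" for i
   unfolding cd_def X_def by (rule code_bound[OF M _ dw(3,4)]) (use nH that in auto)
  have st: "tget 0 (cd i) = fst (run M w i)" if "i <= H" for i
   unfolding cd_def by (rule state_code[OF M]) (use nH that in auto)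
  have hf: "hf (cd i) = (if i < H then 1 else 0)" if "i <= H" for i
   using st[OF that] nH[of i] H that unfolding hf_def halted_def by (cases "i < H") (auto simp: le_less)
  have VB: "V w <= B" unfolding B_def by (rule J(2))
  have bnd: "rg r + (a + b + 2) ^ q <= B" if "q : {q1, q2, q3, q4}" "!!r. rg r <= wn w + X w + 1" "a <= wn w + X w + 1" "b <= wn w + X w + 1" for rg :: "nat => nat" and r a b q
  proof -
   have "(a + b + 2) ^ q <= Y w ^ q" by (rule power_mono) (use that(3,4) in "auto simp: Y_def")
   also have "... <= Y w ^ q1 + Y w ^ q2 + Y w ^ q3 + Y w ^ q4" using that(1) by auto
   moreover have "rg r <= Y w" using that(2)[of r] by (simp add: Y_def)
   ultimately show ?thesis using VB by (simp add: V_def)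
  qed
  define sg :: "nat => nat => nat => nat" where "sg x y = (%_. 0)(0 := wn w, 1 := x, 2 := y)" for x y
  have sg: "sg x y r <= wn w + X w + 1" if "x <= X w" "y <= 1" for x y r using that by (simp add: sg_def)
  have sgB: "sg x y r <= B" if "x <= X w" "y <= 1" for x y r
   using sg[OF that, of r] VB by (simp add: V_def Y_def)
  have c1: "pth B (p1 # ks, sg 0 0, 0, []) (ks, sg (cd 0) 0, 0, [])" for ks
  proof (rule pth_ex)
   show "ex p1 (sg 0 0) ((0 + wn w + 2) ^ q1) (sg (cd 0) 0)" using p1(2)[of "sg 0 0"] by (simp add: sg_def cd_def fun_upd_twist)
  qed (rule bnd[OF _ sg], auto)
  have c3: "pth B (p3 # ks, sg (cd i) y, 0, []) (ks, sg (cd i) (hf (cd i)), 0, [])" if "i <= H" "y <= 1" for ks i y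
  proof (rule pth_ex)
   show "ex p3 (sg (cd i) y) ((y + cd i + 2) ^ q3) (sg (cd i) (hf (cd i)))" using p3(2)[of "sg (cd i) y"] by (simp add: sg_def)
  qed (rule bnd[OF _ sg], use cX[OF that(1)] that(2) in auto)
  have c2: "pth B (p2 # ks, sg (cd i) y, 0, []) (ks, sg (cd (Suc i)) y, 0, [])" if "i <= H" "y <= 1" for ks i y
  proof (rule pth_ex)
   show "ex p2 (sg (cd i) y) ((cd i + cd i + 2) ^ q2) (sg (cd (Suc i)) y)" using p2(2)[of "sg (cd i) y"] by (simp add: sg_def cd_def fun_upd_twist)
  qed (rule bnd[OF _ sg], use cX[OF that(1)] that(2) in auto)
  have c4: "pth B ([p4], sg (cd H) 0, 0, []) ([], (sg (cd H) 0)(0 := af (cd H)), 0, [])"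
  proof (rule pth_ex)
   show "ex p4 (sg (cd H) 0) ((wn w + cd H + 2) ^ q4) ((sg (cd H) 0)(0 := af (cd H)))" using p4(2)[of "sg (cd H) 0"] by (simp add: sg_def)
  qed (rule bnd[OF _ sg], use cX[of H] in auto)
  have loop: "pth B ([?U, p4], sg (cd 0) (hf (cd 0)), 0, []) ([?U, p4], sg (cd i) (hf (cd i)), 0, [])" if "i <= H" for i
   using that
  proof (induction i)
   case 0
   show ?case unfolding pth_def using sgB[OF cX[of 0]] hf[of 0] by (intro exI[of _ 0]) auto
  next
   case (Suc i)
   have h1: "hf (cd i) = 1" using hf[of i] Suc.prems by simp
   have b: "sg (cd i) 1 r <= B" for r using sgB[OF cX[of i]] Suc.prems by simp
   have s1: "pth B ([?U, p4], sg (cd i) 1, 0, []) ([Sq p2 p3, ?U, p4], sg (cd i) 1, 0, [])"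
    by (rule pth_step) (use b in "auto simp: sg_def")
   have s2: "pth B ([Sq p2 p3, ?U, p4], sg (cd i) 1, 0, []) ([p2, p3, ?U, p4], sg (cd i) 1, 0, [])"
    by (rule pth_step) (use b in auto)
   have s3: "pth B ([p2, p3, ?U, p4], sg (cd i) 1, 0, []) ([p3, ?U, p4], sg (cd (Suc i)) 1, 0, [])"
    by (rule c2) (use Suc.prems in auto)
   have s4: "pth B ([p3, ?U, p4], sg (cd (Suc i)) 1, 0, []) ([?U, p4], sg (cd (Suc i)) (hf (cd (Suc i))), 0, [])"
    by (rule c3) (use Suc.prems in auto)
   have "pth B ([?U, p4], sg (cd 0) (hf (cd 0)), 0, []) ([?U, p4], sg (cd i) 1, 0, [])" using Suc.IH Suc.prems h1 by simp
   then show ?case by (rule pth_trans[OF _ pth_trans[OF s1 pth_trans[OF s2 pth_trans[OF s3 s4]]]])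
  qed
  have hH: "hf (cd H) = 0" using hf[of H] by simp
  have b0: "sg 0 0 r <= B" "sg (cd 0) 0 r <= B" "sg (cd 0) (hf (cd 0)) r <= B" "sg (cd H) 0 r <= B" for r
   using sgB[of 0 0] sgB[OF cX[of 0]] sgB[OF cX[of H]] hf[of 0] by auto
  have e: "(%_. 0)(0 := wn w) = sg 0 0" by (rule ext) (simp add: sg_def)
  have t1: "pth B ([P], sg 0 0, 0, []) ([p1, Sq p3 (Sq ?U p4)], sg 0 0, 0, [])" unfolding P_def by (rule pth_step) (use b0 in auto)
  have t2: "pth B ([Sq p3 (Sq ?U p4)], sg (cd 0) 0, 0, []) ([p3, Sq ?U p4], sg (cd 0) 0, 0, [])" by (rule pth_step) (use b0 in auto)
  have t3: "pth B ([p3, Sq ?U p4], sg (cd 0) 0, 0, []) ([Sq ?U p4], sg (cd 0) (hf (cd 0)), 0, [])" by (rule c3) auto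
  have t4: "pth B ([Sq ?U p4], sg (cd 0) (hf (cd 0)), 0, []) ([?U, p4], sg (cd 0) (hf (cd 0)), 0, [])" by (rule pth_step) (use b0 in auto)
  have t5: "pth B ([?U, p4], sg (cd 0) (hf (cd 0)), 0, []) ([?U, p4], sg (cd H) 0, 0, [])" using loop[of H] hH by simp
  have t6: "pth B ([?U, p4], sg (cd H) 0, 0, []) ([p4], sg (cd H) 0, 0, [])" by (rule pth_step) (use b0 in "auto simp: sg_def")
  have all: "pth B ([P], sg 0 0, 0, []) ([], (sg (cd H) 0)(0 := af (cd H)), 0, [])"
   by (rule pth_trans[OF t1 pth_trans[OF c1 pth_trans[OF t2 pth_trans[OF t3 pth_trans[OF t4 pth_trans[OF t5 pth_trans[OF t6 c4]]]]]]])
  have "0 < af (cd H) \<longleftrightarrow> fst (run M w H) = tm_accept M" using st[of H] by (simp add: af_def)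
  also have "... \<longleftrightarrow> accepts M w"
  proof
   assume "accepts M w"
   then obtain n where n: "fst (run M w n) = tm_accept M" unfolding accepts_def by blast
   then have hn: "halted M (run M w n)" by (simp add: halted_def)
   then have "H <= n" unfolding H_def by (rule Least_le)
   then have "run M w n = run M w H" using run_halted[OF H, of "n - H"] by simp
   then show "fst (run M w H) = tm_accept M" using n by simp
  qed (auto simp: accepts_def)
  finally have "0 < af (cd H) \<longleftrightarrow> w : L" using dw(2) by simp
  then show "EX rg. pth (NN (length w ^ k + length w + J)) ([P], (%_. 0)(0 := wn w), 0, []) ([], rg, 0, []) & (0 < rg 0 \<longleftrightarrow> w : L)"
   using all unfolding e B_def by (intro exI[of _ "(sg (cd H) 0)(0 := af (cd H))"]) simp
 qed
qed

subsection \<open>Flat programs\<close>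

text \<open>Stacks of commands become instruction numbers. The last equation covers the empty stack,
  which loops to itself, so that every configuration has exactly one successor.\<close>

fun fcom :: "(cmd list => nat) => cmd list => ins" where
 "fcom idx (Skip # l) = Goto (idx l)"
| "fcom idx (Sq a b # l) = Goto (idx (a # b # l))"
| "fcom idx (Inc r # l) = Incr r (idx l)"
| "fcom idx (Dec r # l) = Br r 1 (idx l) (idx l)"
| "fcom idx (Ite (Zero r) a b # l) = Br r 0 (idx (a # l)) (idx (b # l))"
| "fcom idx (Until (Zero r) a # l) = Br r 0 (idx l) (idx (a # Until (Zero r) a # l))"
| "fcom idx _ = Goto (idx [])"

lemma pure_ctrls: "pure c ==> a # l : ctrls c ks ==> pure a"
 by (induction c arbitrary: ks) auto

lemma fstep_iff: "fstep prog (q, rg) y \<longleftrightarrow> y = (case prog q of Goto q' => (q', rg) | Incr r q' => (q', rg(r := Suc (rg r)))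
  | Br r d q0 q1 => if rg r = 0 then (q0, rg) else (q1, rg(r := rg r - d)))"
 by (cases "prog q") (auto elim!: fstep.cases intro: fstep.intros)

lemma fstep_fcom:
 assumes "prog (idx ks) = fcom idx ks" "ks = [] | pure (hd ks)" "cstep [] (ks, rg, 0, []) = (ks', rg', z)"
 shows "fstep prog (idx ks, rg) y \<longleftrightarrow> y = (idx ks', rg')" "z = (0, [])"
proof -
 have "(fstep prog (idx ks, rg) y \<longleftrightarrow> y = (idx ks', rg')) & z = (0, [])"
  using assms
  by (cases "(idx, ks)" rule: fcom.cases) (auto simp: fstep_iff)
 then show "fstep prog (idx ks, rg) y \<longleftrightarrow> y = (idx ks', rg')" "z = (0, [])" by auto
qed

theorem flat_program:
 assumes "pure P"
 obtains prog nq R qf where "wfp prog nq R" "qf < nq"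
  "!!j K rg. 0 < j ==> pth (NN j) ([P], (%_. 0)(0 := K), 0, []) ([], rg, 0, []) ==>
    cov (lipton.TT prog nq R j K) (lipton.FF qf) (ms lipton.M0) \<longleftrightarrow> 0 < rg 0"
proof -
 have "[P] : cset P" using Cons_in_ctrls[of P "[]"] by (simp add: cset_def)
 obtain xs where xs: "set xs = cset P - {[P]}" "distinct xs" using finite_distinct_list finite_cset by (metis finite_Diff)
 \<comment> \<open>The initial stack is listed first, so that its number is 0, where a flat program
   starts.\<close>
 define ys where "ys = [P] # xs"
 have ys: "set ys = cset P" "distinct ys" using xs \<open>[P] : cset P\<close> by (auto simp: ys_def)
 define idx where "idx l = (LEAST i. ys ! i = l)" for l
 have idx: "idx l < length ys & ys ! idx l = l" if "l : cset P" for l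
 proof -
  have "l : set ys" using that ys(1) by simp
  then obtain i where i: "i < length ys" "ys ! i = l" unfolding in_set_conv_nth by (elim exE conjE)
  have "idx l <= i" unfolding idx_def by (rule Least_le[where P = "%i. ys ! i = l", OF i(2)])
  moreover have "ys ! idx l = l" unfolding idx_def by (rule LeastI[where P = "%i. ys ! i = l", OF i(2)])
  ultimately show ?thesis using i(1) by simp
 qed
 have idx0: "idx [P] = 0" unfolding idx_def by (rule Least_equality) (simp_all add: ys_def)
 define prog where "prog q = fcom idx (ys ! q)" for q
 have prog: "prog (idx l) = fcom idx l" if "l : cset P" for l using idx[OF that] by (simp add: prog_def)
 obtain R where R: "R > 0" "cregs P <= {..<R}" using cregs_bounded by blast
 have pur: "ks = [] | pure (hd ks)" if "ks : cset P" for ks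
  using that pure_ctrls[OF assms, of "hd ks" "tl ks" "[]"] by (cases ks) (auto simp: cset_def)
 have nil: "[] : cset P" by (simp add: cset_def)
 have wf: "wfp prog (length ys) R"
  unfolding wfp_def
 proof (intro conjI allI impI)
  fix q assume "q < length ys"
  then have q: "ys ! q : cset P" using ys(1) nth_mem by blast
  show "case prog q of Goto q' => q' < length ys | Incr r q' => r < R & q' < length ys
   | Br r d q0 q1 => r < R & d <= 1 & q0 < length ys & q1 < length ys"
  proof (cases "ys ! q")
   case Nil
   then show ?thesis using idx[OF nil] by (simp add: prog_def)
  next
   case (Cons a l)
   have s: "succs a l <= cset P" using cset_succs q Cons by simp
   have r: "cregs a <= {..<R}" using cset_cregs q Cons R(2) by fastforce
   show ?thesis
    using s r idx nil unfolding prog_def Cons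
    by (cases "(idx, a # l)" rule: fcom.cases) auto
  qed
 qed (use R(1) in "auto simp: ys_def")
 show thesis
 proof (rule that[OF wf])
  show "idx [] < length ys" using idx[OF nil] by simp
  fix j K rg assume j: "0 < (j::nat)" and p: "pth (NN j) ([P], (%_. 0)(0 := K), 0, []) ([], rg, 0, [])"
  interpret lp: lipton prog "length ys" R j K "idx []" by standard (rule j)
  define rg0 :: "nat => nat" where "rg0 = (%_. 0)(0 := K)"
  let ?C0 = "([P], rg0, 0::nat, []::bool list)"
  obtain t where t: "(cstep [] ^^ t) ?C0 = ([], rg, 0, [])" "!!i r. i <= t ==> fst (snd ((cstep [] ^^ i) ?C0)) r <= NN j"
   using p unfolding pth_def rg0_def by blast
  define C where "C i = (cstep [] ^^ i) ?C0" for i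
  have C: "fst (C i) : cset P & snd (snd (C i)) = (0, []) &
   (ALL y. fstep prog (idx (fst (C i)), fst (snd (C i))) y \<longleftrightarrow> y = (idx (fst (C (Suc i))), fst (snd (C (Suc i)))))" for i
  proof (induction i)
   case 0
   obtain ks rg' z where c: "cstep [] ([P], rg0, 0, []) = (ks, rg', z)" by (metis prod_cases3)
   have "C (Suc 0) = (ks, rg', z)" "C 0 = ?C0" using c by (simp_all add: C_def)
   then show ?case using fstep_fcom[where prog = prog and idx = idx, OF prog[OF \<open>[P] : cset P\<close>] pur[OF \<open>[P] : cset P\<close>] c] \<open>[P] : cset P\<close> by simp
  next
   case (Suc i)
   obtain l rg1 where c1: "C i = (l, rg1, 0, [])" "l : cset P" using Suc by (cases "C i") auto
   obtain l2 rg2 z2 where c2: "C (Suc i) = (l2, rg2, z2)" by (metis prod_cases3)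
   have s: "cstep [] (l, rg1, 0, []) = (l2, rg2, z2)" using c1(1) c2 by (simp add: C_def)
   have l2: "l2 : cset P"
   proof (cases l)
    case Nil
    then show ?thesis using s nil by simp
   next
    case (Cons a ks)
    have "fst (cstep [] (a # ks, rg1, 0, [])) : succs a ks" by (cases a) auto
    then show ?thesis using s cset_succs[of a ks P] c1(2) Cons by auto
   qed
   have z2: "z2 = (0, [])" by (rule fstep_fcom(2)[where prog = prog and idx = idx, OF prog[OF c1(2)] pur[OF c1(2)] s])
   obtain l3 rg3 z3 where c3: "C (Suc (Suc i)) = (l3, rg3, z3)" by (metis prod_cases3)
   have s3: "cstep [] (l2, rg2, 0, []) = (l3, rg3, z3)" using c2 c3 z2 by (simp add: C_def)
   show ?case using fstep_fcom(1)[where prog = prog and idx = idx, OF prog[OF l2] pur[OF l2] s3] l2 z2 by (simp add: c2 c3)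
  qed
  define D where "D i = (idx (fst (C i)), fst (snd (C i)))" for i
  have D: "fstep prog (D i) y \<longleftrightarrow> y = D (Suc i)" for i y using C[of i] unfolding D_def by blast
  have D0: "D 0 = (0, (%_. 0)(0 := K))" by (simp add: D_def C_def idx0 rg0_def)
  have Dt: "D t = (idx [], rg)" using t(1) by (simp add: D_def C_def)
  have Ct: "C (t + i) = ([], rg, 0, [])" for i
  by (induction i; (simp add: C_def t(1))?)
  show "cov (lipton.TT prog (length ys) R j K) (lipton.FF (idx [])) (ms lipton.M0) \<longleftrightarrow> 0 < rg 0"
  proof
   assume "cov lp.TT lp.FF (ms lp.M0)"
   from lp.lipton_sound[OF this wf] obtain rg' where r: "lp.reach (idx []) rg'" "0 < rg' 0" by blast
   have *: "EX i. y = D i" if "(fstep prog)^** (D 0) y" for y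
    using that
   proof (induction rule: rtranclp_induct)
    case (step y z)
    then obtain i where "y = D i" by blast
    then show ?case using step.hyps(2) D[of i z] by (intro exI[of _ "Suc i"]) simp
   qed (rule exI[of _ 0], simp)
   have "(fstep prog)^** (D 0) (idx [], rg')" using r(1) unfolding lp.reach_def D0 .
   from *[OF this] obtain i where i: "(idx [], rg') = D i" by (elim exE)
   have inj: "fst (C i) = []" using arg_cong[OF i, of fst] idx[OF nil] idx[of "fst (C i)"] C[of i] unfolding D_def fst_conv by metis
   \<comment> \<open>Nothing changes once the stack is empty, neither after step \<open>i\<close>
     nor after step \<open>t\<close>; hence the registers found at the final instruction are those
     of the given run.\<close>
   have "D (i + t) = D i"
   proof -
    have "C (i + n) = C i" for n
    proof (induction n)
     case (Suc n)
     have "C (i + Suc n) = cstep [] (C (i + n))" by (simp add: C_def)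
     then show ?case using Suc inj by (cases "C i") simp
    qed simp
    then show ?thesis by (simp add: D_def)
   qed
   moreover have "D (i + t) = (idx [], rg)" using Ct[of i] by (simp add: D_def add.commute)
   ultimately have "(idx [], rg') = (idx [], rg)" unfolding i by (rule trans[OF sym])
   then show "0 < rg 0" using r(2) by simp
  next
   assume "0 < rg 0"
   show "cov lp.TT lp.FF (ms lp.M0)"
    by (rule lp.lipton_complete[where C = D and n = t, OF wf D0])
     (use D Dt \<open>0 < rg 0\<close> t(2) in "auto simp: D_def C_def")
  qed
 qed
qed

theorem EXPSPACE_lipton:
 assumes "L : EXPSPACE"
 obtains prog nq R qf k J where "wfp prog nq R" "qf < nq" "0 < J"
  "!!w. cov (lipton.TT prog nq R (length w ^ k + length w + J) (wn w)) (lipton.FF qf) (ms lipton.M0) \<longleftrightarrow> w : L"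
proof -
 obtain k M c where M: "is_tm M" "decides_in_space M L (%n. c * 2 ^ (n ^ k))"
  using assms unfolding EXPSPACE_def DSPACE_def by blast
 obtain P J where P: "pure P" "0 < J" "!!w. EX rg. pth (NN (length w ^ k + length w + J)) ([P], (%_. 0)(0 := wn w), 0, []) ([], rg, 0, []) & (0 < rg 0 \<longleftrightarrow> w : L)"
  by (rule tm_program[OF M]) (rule that; assumption)
 obtain prog nq R qf where F: "wfp prog nq R" "qf < nq" "!!j K rg. 0 < j ==> pth (NN j) ([P], (%_. 0)(0 := K), 0, []) ([], rg, 0, []) ==>
    cov (lipton.TT prog nq R j K) (lipton.FF qf) (ms lipton.M0) \<longleftrightarrow> 0 < rg 0"
  by (rule flat_program[OF P(1)]) (rule that; assumption)
 show thesis
 proof (rule that[OF F(1,2) P(2)])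
  fix w
  obtain rg where r: "pth (NN (length w ^ k + length w + J)) ([P], (%_. 0)(0 := wn w), 0, []) ([], rg, 0, [])" "0 < rg 0 \<longleftrightarrow> w : L"
   using P(3)[of w] by (elim exE conjE) (rule that)
  show "cov (lipton.TT prog nq R (length w ^ k + length w + J) (wn w)) (lipton.FF qf) (ms lipton.M0) \<longleftrightarrow> w : L"
   using F(3)[OF _ r(1)] r(2) P(2) by simp
 qed
qed

section \<open>Hardness\<close>

subsection \<open>Unique readability of the encoding\<close>

lemma bits_inject: "bits a = bits b ==> a = b"
proof (induction a arbitrary: b rule: less_induct)
 case (less a)
 show ?case
 proof (cases "a = 0 | b = 0")
  case True
  then show ?thesis using less.prems by (subst (asm) (1 2) bits.simps) (auto split: if_splits)
 next
  case False
  then have "odd a = odd b" "bits (a div 2) = bits (b div 2)"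
   using less.prems by (subst (asm) (1 2) bits.simps, simp)+
  then have "a div 2 = b div 2" "a mod 2 = b mod 2" using less.IH[of "a div 2" "b div 2"] False by (auto simp: odd_iff_mod_2_eq_one)
  then show ?thesis by (metis div_mult_mod_eq)
 qed
qed

text \<open>\<open>True\<close> announces a further bit and \<open>False\<close> ends the number, so
  no code is a proper prefix of another.\<close>

lemma enc_nat_inject: "enc_nat a @ x = enc_nat b @ y \<longleftrightarrow> a = b & x = y"
proof -
 have "concat (map (%b. [True, b]) xs) @ False # x = concat (map (%b. [True, b]) ys) @ False # y \<longleftrightarrow> xs = ys & x = y" for xs ys
 proof (induction xs arbitrary: ys)
  case Nil
  then show ?case by (cases ys) auto
 next
  case (Cons a xs)
  then show ?case by (cases ys) auto
 qed
 then show ?thesis using bits_inject by (auto simp: enc_nat_def)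
qed

text \<open>There are two encoders because rows of two different nets are compared; equal codes show
  that the rows agree on what is written, which is the role of \<open>Q\<close>.\<close>

lemma enc_list_inject:
 assumes "!!a b x y. a : set xs ==> b : set ys ==> f a @ x = g b @ y ==> Q a b & x = y"
  "enc_list f xs @ x = enc_list g ys @ y"
 shows "list_all2 Q xs ys & x = y"
proof -
 have "length xs = length ys" and c: "concat (map f xs) @ x = concat (map g ys) @ y"
  using assms(2) by (auto simp: enc_list_def enc_nat_inject)
 then show ?thesis using assms(1)
 by (induction xs ys rule: list_induct2; (auto)?)
qed

lemma enc_vector_inject:
 assumes "finite P" "enc_vector P m @ x = enc_vector P m' @ y"
 shows "(ALL p:P. m p = m' p) & x = y"
proof -
 have "list_all2 (%a b. m a = m' b) (sorted_list_of_set P) (sorted_list_of_set P) & x = y"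
  using assms(2) unfolding enc_vector_def by (rule enc_list_inject[rotated]) (auto simp: enc_nat_inject)
 then show ?thesis using assms(1) by (auto simp: list.rel_refl_strong list_all2_same)
qed

lemma enc_set_inject:
 assumes "finite A" "finite B" "enc_set f A @ x = enc_set g B @ y"
  "!!a x y. a : A ==> a : B ==> f a @ x = g a @ y ==> Q a & x = y"
 shows "A = B & (ALL a:A. Q a) & x = y"
proof -
 have "list_all2 (%a b. a = b & Q a) (sorted_list_of_set A) (sorted_list_of_set B) & x = y"
  using assms(3) unfolding enc_set_def
  by (rule enc_list_inject[rotated]) (use assms in "auto simp: enc_nat_inject")
 then have l: "list_all2 (%a b. a = b & Q a) (sorted_list_of_set A) (sorted_list_of_set B)" "x = y" by auto
 have "list_all2 (=) (sorted_list_of_set A) (sorted_list_of_set B)" using l(1) by (rule list_all2_mono) simp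
 then have e: "sorted_list_of_set A = sorted_list_of_set B" by (simp add: list.rel_eq)
 then have "A = B" using assms(1,2) by (metis set_sorted_list_of_set)
 moreover have "ALL a:A. Q a" using l(1) assms(1) unfolding e[symmetric] by (auto simp: list_all2_same)
 ultimately show ?thesis using l(2) by simp
qed

lemma clo_transfer:
 assumes "clo N m" "cut_trans N = cut_trans N'" "elem_trans N = elem_trans N'" "abs_trans N = {}"
  "!!t. t : cut_trans N Un elem_trans N ==> Wminus N t = Wminus N' t" "!!t. t : elem_trans N ==> Wplus N t = Wplus N' t"
 shows "clo N' m"
 using assms(1)
proof (induction rule: clo.induct)
 case (clo_cut t m)
 then show ?case using assms(2) assms(5)[of t] clo.clo_cut[of t N' m] by simp
next
 case (clo_elem t m)
 then show ?case using assms(3) assms(5,6)[of t] clo.clo_elem[of t N' m] by simp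
next
 case (clo_abs t m)
 then show ?case using assms(4) by simp
qed

lemma vectors_eq: "m : vectors P ==> m' : vectors P ==> ALL p:P. m p = m' p ==> m = m'"
by (rule ext; (auto simp: vectors_def)?)

text \<open>The word belongs to the language if some instance with this encoding can be cut, so one
  direction has to decode it. Unique readability gives agreement of the two nets on the written
  entries, and \<open>vectors\<close> forces all remaining entries to be 0.\<close>

lemma single_vertex_cut_problem:
 assumes N: "is_rpn N" "abs_trans N = {}" and m: "m : vectors (places N)"
  and s: "s = (|mark = [0 |-> m], label = Map.empty|)"
 shows "enc_marked_rpn N s : cut_problem \<longleftrightarrow> clo N m"
proof -
 have single: "(EX sg. firing_sequence N' s' sg empty_state) \<longleftrightarrow> clo N' m'"
  if "is_state N' s'" "mark s' = [0 |-> m']" "edges s' = {}" for N' :: "nat rpn" and s' :: "(nat, nat) state" and m'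
 proof -
  have "mark s' 0 ~= None" using that(2) by simp
  then have "s' ~= empty_state" by (auto simp: empty_state_def)
  moreover have "is_root s' r \<longleftrightarrow> r = 0" for r using that(2,3) by (simp add: is_root_def verts_def)
  moreover have "cl N' s' 0 \<longleftrightarrow> clo N' m'"
  proof
   assume "cl N' s' 0"
   then obtain k X where k: "mark s' 0 = Some k" "!!w. w : X ==> (0, w) : edges s'" "clo N' (%p. k p + (SUM w:X. the (label s' (0, w)) p))"
    by (cases rule: cl.cases) blast
   have "X = {}" using k(2) that(3) by auto
   then show "clo N' m'" using k(1,3) that(2) by simp
  qed (rule cl_leaf, simp_all add: that)
  ultimately show ?thesis using cut_iff_good[OF _ that(1)] by (simp add: good_def)
 qed
 have st: "is_state N s" using m unfolding is_state_def s by (auto simp: verts_def edges_def rooted_tree_def)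
 have sN: "(EX sg. firing_sequence N s sg empty_state) \<longleftrightarrow> clo N m"
  by (rule single[OF st]) (simp_all add: s edges_def)
 show ?thesis
 proof
  assume "clo N m"
  then show "enc_marked_rpn N s : cut_problem" using sN N(1) st unfolding cut_problem_def by blast
 next
  assume "enc_marked_rpn N s : cut_problem"
  then obtain N' s' where e: "enc_marked_rpn N s = enc_marked_rpn N' s'" and N': "is_rpn N'" "is_state N' s'"
   and f: "EX sg. firing_sequence N' s' sg empty_state" unfolding cut_problem_def by blast
  have fin: "finite (places N)" "finite (places N')" "finite (elem_trans N)" "finite (elem_trans N')"
   "finite (abs_trans N)" "finite (abs_trans N')" "finite (cut_trans N)" "finite (cut_trans N')"
   using N(1) N'(1) by (auto simp: is_rpn_def transitions_def)
  have vs: "finite (verts s')" using N'(2) by (auto simp: is_state_def)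
  have e1: "places N = places N'" and e2: "enc_set (%t. enc_vector (places N) (Wminus N t) @ enc_vector (places N) (Wplus N t)) (elem_trans N) @
   enc_set (%t. enc_vector (places N) (Wminus N t) @ enc_vector (places N) (Wplus N t) @ enc_vector (places N) (Omega N t)) (abs_trans N) @
   enc_set (%t. enc_vector (places N) (Wminus N t)) (cut_trans N) @ enc_state (places N) s =
   enc_set (%t. enc_vector (places N') (Wminus N' t) @ enc_vector (places N') (Wplus N' t)) (elem_trans N') @
   enc_set (%t. enc_vector (places N') (Wminus N' t) @ enc_vector (places N') (Wplus N' t) @ enc_vector (places N') (Omega N' t)) (abs_trans N') @
   enc_set (%t. enc_vector (places N') (Wminus N' t)) (cut_trans N') @ enc_state (places N') s'"
   using enc_set_inject[OF fin(1,2), of "%_. []" _ "%_. []" _ "%_. True"] e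
   by (simp_all add: enc_marked_rpn_def enc_rpn_def Let_def)
  define P where "P = places N"
  have P: "finite P" "places N = P" "places N' = P" using e1 fin by (auto simp: P_def)
  note i2 = enc_set_inject[OF fin(3,4) e2[unfolded P], where Q = "%t. (ALL p:P. Wminus N t p = Wminus N' t p) & (ALL p:P. Wplus N t p = Wplus N' t p)"]
  have r2: "elem_trans N = elem_trans N' & (ALL t:elem_trans N. (ALL p:P. Wminus N t p = Wminus N' t p) & (ALL p:P. Wplus N t p = Wplus N' t p)) &
   enc_set (%t. enc_vector P (Wminus N t) @ enc_vector P (Wplus N t) @ enc_vector P (Omega N t)) (abs_trans N) @
   enc_set (%t. enc_vector P (Wminus N t)) (cut_trans N) @ enc_state P s =
   enc_set (%t. enc_vector P (Wminus N' t) @ enc_vector P (Wplus N' t) @ enc_vector P (Omega N' t)) (abs_trans N') @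
   enc_set (%t. enc_vector P (Wminus N' t)) (cut_trans N') @ enc_state P s'"
  proof (rule i2)
   fix a x y
   assume "(enc_vector P (Wminus N a) @ enc_vector P (Wplus N a)) @ x = (enc_vector P (Wminus N' a) @ enc_vector P (Wplus N' a)) @ y"
   then show "((ALL p:P. Wminus N a p = Wminus N' a p) & (ALL p:P. Wplus N a p = Wplus N' a p)) & x = y"
    using enc_vector_inject[OF P(1), of "Wminus N a" "enc_vector P (Wplus N a) @ x" "Wminus N' a" "enc_vector P (Wplus N' a) @ y"]
     enc_vector_inject[OF P(1), of "Wplus N a" x "Wplus N' a" y] by simp
  qed
  have "length (sorted_list_of_set (abs_trans N')) = 0"
   using r2 N(2) by (simp add: enc_set_def enc_list_def enc_nat_inject)
  then have ab: "abs_trans N' = {}" using fin by simp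
  have e3: "enc_set (%t. enc_vector P (Wminus N t)) (cut_trans N) @ enc_state P s =
   enc_set (%t. enc_vector P (Wminus N' t)) (cut_trans N') @ enc_state P s'"
   using r2 N(2) ab by (simp add: enc_set_def enc_list_def)
  have r3: "cut_trans N = cut_trans N' & (ALL t:cut_trans N. (ALL p:P. Wminus N t p = Wminus N' t p)) & enc_state P s = enc_state P s'"
   by (rule enc_set_inject[OF fin(7,8) e3]) (rule enc_vector_inject[OF P(1)])
  have vs1: "finite (verts s)" by (simp add: s verts_def)
  have ew: "{w. (v, w) : edges s} = {}" for v by (simp add: s edges_def)
  have es: "edges s' <= verts s' \<times> verts s'" using N'(2) by (auto simp: is_state_def rooted_tree_def)
  have fw: "finite {w. (v, w) : edges s'}" for v by (rule finite_subset[OF _ vs]) (use es in auto)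
  have r4: "verts s = verts s' & (ALL v:verts s. (ALL p:P. the (mark s v) p = the (mark s' v) p) & {w. (v, w) : edges s'} = {}) & [] = ([]::bool list)"
  proof (rule enc_set_inject[OF vs1 vs])
   show "enc_set (%v. enc_vector P (the (mark s v)) @ enc_set (%w. enc_vector P (the (label s (v, w)))) {w. (v, w) : edges s}) (verts s) @ [] =
    enc_set (%v. enc_vector P (the (mark s' v)) @ enc_set (%w. enc_vector P (the (label s' (v, w)))) {w. (v, w) : edges s'}) (verts s') @ []"
    using r3 by (simp add: enc_state_def)
  next
   fix v x y
   assume "(enc_vector P (the (mark s v)) @ enc_set (%w. enc_vector P (the (label s (v, w)))) {w. (v, w) : edges s}) @ x =
    (enc_vector P (the (mark s' v)) @ enc_set (%w. enc_vector P (the (label s' (v, w)))) {w. (v, w) : edges s'}) @ y"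
   then have 1: "ALL p:P. the (mark s v) p = the (mark s' v) p" and
    2: "enc_set (%w. enc_vector P (the (label s (v, w)))) {} @ x = enc_set (%w. enc_vector P (the (label s' (v, w)))) {w. (v, w) : edges s'} @ y"
    using enc_vector_inject[OF P(1), of "the (mark s v)" _ "the (mark s' v)"] unfolding append_assoc ew by blast+
   have "length (sorted_list_of_set {w. (v, w) : edges s'}) = 0"
    using 2 unfolding enc_set_def enc_list_def append_assoc enc_nat_inject by simp
   then have "{w. (v, w) : edges s'} = {}" using fw by simp
   moreover have "x = y" using 2 unfolding \<open>{w. (v, w) : edges s'} = {}\<close> enc_set_def enc_list_def append_assoc enc_nat_inject by simp
   ultimately show "((ALL p:P. the (mark s v) p = the (mark s' v) p) & {w. (v, w) : edges s'} = {}) & x = y" using 1 by blast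
  qed
  have v0: "verts s' = {0}" using r4 by (simp add: s verts_def)
  then obtain m' where m': "mark s' 0 = Some m'" unfolding verts_def by blast
  have mk: "mark s' = [0 |-> m']"
  proof (rule ext)
   fix x show "mark s' x = [0 |-> m'] x"
   proof (cases "x = 0")
    case False
    then have "x ~: verts s'" using v0 by simp
    then show ?thesis using False by (simp add: verts_def domIff)
   qed (simp add: m')
  qed
  have ed: "edges s' = {}" using es v0 r4 by auto
  have nes: "s' ~= empty_state" using m' by (auto simp: empty_state_def)
  have "ran (mark s') <= vectors (places N')" using N'(2) nes by (simp add: is_state_def)
  then have "m' : vectors P" using m' P by (auto simp: ran_def)
  moreover have "ALL p:P. m p = m' p" using r4 m' by (simp add: s verts_def)
  ultimately have "m' = m" using m vectors_eq P(2) by metis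
  then have "clo N' m" using f single[OF N'(2) mk ed] by simp
  then show "clo N m"
  proof (rule clo_transfer)
   have vec: "Wminus N t : vectors P" "Wminus N' t : vectors P" if "t : cut_trans N Un elem_trans N" for t
    using N(1) N'(1) that r2 r3 P by (auto simp: is_rpn_def transitions_def)
   have vec2: "Wplus N t : vectors P" "Wplus N' t : vectors P" if "t : elem_trans N" for t
    using N(1) N'(1) that r2 P by (auto simp: is_rpn_def)
   show "Wminus N' t = Wminus N t" if "t : cut_trans N' Un elem_trans N'" for t
    using vectors_eq[OF vec(2,1), of t] that r2 r3 by auto
   show "Wplus N' t = Wplus N t" if "t : elem_trans N'" for t
    using vectors_eq[OF vec2(2,1), of t] that r2 by auto
  qed (use r2 r3 ab in auto)
 qed
qed

subsection \<open>The net of the reduction\<close>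

context
 fixes prog :: "nat => ins" and nq R qf :: nat
 assumes wf: "wfp prog nq R" and qf: "qf < nq"
begin

text \<open>Per level 4 counters, 5 control points and \<open>3 + 2 * nq\<close> modes, together
  with \<open>nq\<close> instructions and \<open>2 * R\<close> register places. All levels get
  blocks of this size; the numbers for instructions and registers are used in block 0 and belong to
  isolated places elsewhere.\<close>

definition KP :: nat where
 "KP = 12 + 3 * nq + 2 * R"

fun lev :: "pl => nat" where
 "lev (Ct l c) = l" | "lev (Pt l c) = l" | "lev (Md l c) = l" | "lev _ = 0"

fun off :: "pl => nat" where
 "off (Ct l c) = c"
| "off (Pt l x) = 4 + x"
| "off (Md l d) = 9 + d"
| "off (Qp q) = 12 + 2 * nq + q"
| "off (Xp r) = 12 + 3 * nq + r"
| "off (Xb r) = 12 + 3 * nq + R + r"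

definition pc :: "pl => nat" where
 "pc q = lev q * KP + off q"

fun vp :: "nat => pl => bool" where
 "vp j (Ct l c) = (l <= j & c < 4)"
| "vp j (Pt l x) = (l <= j & x < 5)"
| "vp j (Md l d) = (l <= j & d < 3 + 2 * nq)"
| "vp j (Qp q) = (q < nq)"
| "vp j (Xp r) = (r < R)"
| "vp j (Xb r) = (r < R)"

lemma off_less: "vp j q ==> off q < KP"
 by (cases q) (auto simp: KP_def)

lemma pc_inj: assumes "vp j q" "vp j q'" "pc q = pc q'" shows "q = q'"
proof -
 have "pc q div KP = lev q" "pc q mod KP = off q" "pc q' div KP = lev q'" "pc q' mod KP = off q'"
  using off_less[OF assms(1)] off_less[OF assms(2)] by (auto simp: pc_def)
 then have "lev q = lev q'" "off q = off q'" using assms(3) by simp_all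
 then show ?thesis using assms(1,2) by (cases q; cases q') auto
qed

lemma pc_less: "vp j q ==> pc q < KP * (j + 1)"
proof -
 assume v: "vp j q"
 have "lev q <= j" using v by (cases q) auto
 then have "lev q * KP <= j * KP" by (rule mult_right_mono) simp
 moreover have "KP * (j + 1) = j * KP + KP" by simp
 ultimately show ?thesis using off_less[OF v] unfolding pc_def by linarith
qed

definition wt :: "arc => nat => nat" where
 "wt a p = (SUM x<-a. if pc (fst x) = p then snd x else 0)"

lemma wt_simps [simp]: "wt [] p = 0" "wt ((q, c) # a) p = (if pc q = p then c else 0) + wt a p" "wt (a @ b) p = wt a p + wt b p"
 by (simp_all add: wt_def)

lemma wt_ms: "ALL x : set a. vp j (fst x) ==> vp j q ==> wt a (pc q) = ms a q"
 by (induction a) (auto dest: pc_inj)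

lemma ms_0: "ALL x : set a. vp j (fst x) ==> ~ vp j q ==> ms a q = 0"
 by (induction a) auto

lemma wt_nonzero: "wt a p ~= 0 ==> EX x : set a. p = pc (fst x)"
 by (induction a) (auto split: if_splits)

lemma tr_valid:
 assumes "lipton j" "i <= j" "u < 16 + 6 * nq"
 shows "ALL x : set (fst (lipton.tr prog R j K i u)) Un set (snd (lipton.tr prog R j K i u)). vp j (fst x)"
proof -
 have j: "0 < j" using assms(1) by (simp add: lipton_def)
 have R: "0 < R" "0 < nq" using wf by (auto simp: wfp_def)
 have s: "vp j x" if "x : set (lipton.srcl prog j k d) Un set (lipton.tgtl prog R j k d)" "k <= j" "k = j ==> d = 2 | d = 3 + 2 * q | d = 4 + 2 * q" "q < nq" for x k d q
 proof -
  have "case prog q of Goto q' => q' < nq | Incr r q' => r < R & q' < nq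
   | Br r d q0 q1 => r < R & d <= 1 & q0 < nq & q1 < nq" using wf that(4) by (auto simp: wfp_def)
  then show ?thesis using that R
   by (auto simp: lipton.srcl.simps[OF assms(1)] lipton.tgtl.simps[OF assms(1)] split: if_splits ins.splits)
 qed
 have o: "ALL x : set (fst (lipton.opt prog R j k d)) Un set (snd (lipton.opt prog R j k d)). vp j (fst x)"
  if "0 < k" "k <= j" "k < j & d < 3 | k = j & (d = 2 | d = 3 + 2 * q | d = 4 + 2 * q)" "q < nq" for k d q
  using that s[where k = k and d = d and q = q] by (auto simp: lipton.opt_def[OF assms(1)])
 have m: "ALL x : set (fst (lipton.mainl prog R j q v)) Un set (snd (lipton.mainl prog R j q v)). vp j (fst x)" if "q < nq" for q v
 proof -
  have "case prog q of Goto q' => q' < nq | Incr r q' => r < R & q' < nq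
   | Br r d q0 q1 => r < R & d <= 1 & q0 < nq & q1 < nq" using wf that by (auto simp: wfp_def)
  then show ?thesis using that j o[of j "3 + 2 * q" q] o[of j "4 + 2 * q" q]
   by (cases "prog q") (auto simp: lipton.mainl_def[OF assms(1)])
 qed
 have "(u - 16) div 6 < nq" if "16 <= u" using that assms(3) by auto
 note m = this[THEN m]
 note fin = assms(2,3) j R
 define av where "av x \<longleftrightarrow> (ALL y : set (fst x) Un set (snd x). vp j (fst y))" for x :: "arc \<times> arc"
 have av_if: "(b ==> av x) ==> (~ b ==> av y) ==> av (if b then x else y)" for b x y by simp
 have av_pair: "av (x, y) \<longleftrightarrow> (ALL z : set x Un set y. vp j (fst z))" for x y by (simp add: av_def)
 have om: "0 < i ==> i < j ==> u <= 3 ==> u ~= 0 ==> av (lipton.opt prog R j i (u - 1))" "av (lipton.opt prog R j j 2)"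
  "16 <= u ==> av (lipton.mainl prog R j ((u - 16) div 6) ((u - 16) mod 6))"
  using o[of i "u - 1" 0] o[of j 2 0] m fin unfolding av_def by auto
 show ?thesis
  unfolding lipton.tr_def[OF assms(1)] av_def[symmetric]
 proof (intro av_if)
  show "av (lipton.opt prog R j i (u - 1))" if "u ~= 0" "u <= 3" "0 < i & i < j" using om(1) that by simp
  show "av (lipton.opt prog R j j 2)" by (rule om(2))
  show "av (lipton.mainl prog R j ((u - 16) div 6) ((u - 16) mod 6))" if "u ~= 0" "~ u <= 3" "u ~= 4" "u ~= 5" "u ~= 6" "u ~= 7"
   "u ~= 8" "u ~= 9" "u ~= 10" "u ~= 11" "u ~= 12" "u ~= 13" "u ~= 14" "u ~= 15" "i = j"
  proof (rule om(3))
   show "16 <= u" using that(1-15) by presburger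
  qed
 qed (use fin in "auto simp: av_pair")
qed

text \<open>A list of arcs is never built by a program. Only its weight at a given place has to be
  computed, since this is all that an encoding contains.\<close>

definition AL :: "(nat list => arc) => bool" where
 "AL F \<longleftrightarrow> (ALL p. LS p --> LS (%e. wt (F e) (p e)))"

lemma AL_Nil: "AL (%e. [])"
 by (simp add: AL_def LS_const)

lemma AL_append: "AL F ==> AL G ==> AL (%e. F e @ G e)"
 by (simp add: AL_def LS_add)

lemma AL_Cons: "LS (%e. pc (q e)) ==> AL F ==> AL (%e. (q e, c) # F e)"
 unfolding AL_def wt_simps by (auto intro!: LS_intro)

lemma AL_if: assumes "LSP P" "AL F" "AL G" shows "AL (%e. if P e then F e else G e)"
proof -
 have "LS (%e. if P e then wt (F e) (p e) else wt (G e) (p e))" if "LS p" for p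
  using assms that unfolding AL_def by (intro LS_If) auto
 moreover have "wt (if P e then F e else G e) p = (if P e then wt (F e) p else wt (G e) p)" for e p by simp
 ultimately show ?thesis unfolding AL_def by (simp only:) simp
qed

lemma AL_const: "AL (%e. a)"
proof (induction a)
 case (Cons x a)
 then show ?case using AL_Cons[of "%_. fst x" "%_. a" "snd x"] LS_const by simp
qed (rule AL_Nil)

lemma LS_pc: "LS l ==> LS (%e. pc (Ct (l e) c))" "LS l ==> LS (%e. pc (Pt (l e) c))" "LS l ==> LS (%e. pc (Md (l e) c))"
 "LS (%e. pc (Qp c))" "LS (%e. pc (Xp c))" "LS (%e. pc (Xb c))"
 unfolding pc_def lev.simps off.simps by (intro LS_intro | assumption)+

lemmas AL_intro = AL_Cons AL_append AL_if AL_const LS_pc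

lemma AL_opt:
 assumes j: "!!e. lipton (j e)" "LS j" and k: "LS k" "!!e. k e <= j e"
 shows "AL (%e. fst (lipton.opt prog R (j e) (k e) d))" "AL (%e. snd (lipton.opt prog R (j e) (k e) d))"
proof -
 have c: "AL (%e. map (%p. (p, 1)) (if k e < j e then (if d = 0 then [Ct (k e) 1] else if d = 1 then [Ct (k e) 3] else []) else a))"
  "AL (%e. map (%p. (p, 1)) (if k e < j e then (if d = 0 then [Ct (k e) 0] else if d = 1 then [Ct (k e) 2] else [Ct (k e) 0, Ct (k e) 2]) else a))" for a
  unfolding if_distrib[of "map (%p. (p, 1))"] list.map by (intro AL_intro LS_intro j k)+
 show "AL (%e. fst (lipton.opt prog R (j e) (k e) d))" "AL (%e. snd (lipton.opt prog R (j e) (k e) d))"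
  unfolding lipton.opt_def[OF j(1)] fst_conv snd_conv lipton.srcl.simps[OF j(1)] lipton.tgtl.simps[OF j(1)]
  by (intro AL_append c, intro AL_intro LS_intro j k)+
qed

lemma AL_mainl:
 assumes j: "!!e. lipton (j e)" "LS j"
 shows "AL (%e. fst (lipton.mainl prog R (j e) q v))" "AL (%e. snd (lipton.mainl prog R (j e) q v))"
proof -
 show "AL (%e. fst (lipton.mainl prog R (j e) q v))"
 proof (cases "prog q")
  case (Br r d q0 q1)
  show ?thesis unfolding lipton.mainl_def[OF j(1)] Br ins.case if_distrib[of fst] fst_conv
   by (intro AL_if AL_opt(1) j order_refl LSP_const; intro AL_intro j)
 qed (auto simp: lipton.mainl_def[OF j(1)] AL_const)
 show "AL (%e. snd (lipton.mainl prog R (j e) q v))"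
 proof (cases "prog q")
  case (Br r d q0 q1)
  show ?thesis unfolding lipton.mainl_def[OF j(1)] Br ins.case if_distrib[of snd] snd_conv
   by (intro AL_if AL_opt(2) j order_refl LSP_const; intro AL_intro j)
 qed (auto simp: lipton.mainl_def[OF j(1)] AL_const)
qed

text \<open>The parameter \<open>K\<close> is set to 0, because the real one is exponential in the
  length of the word and not a polynomially bounded value. The single transition concerned is
  corrected by \<open>wt_K\<close>.\<close>

lemma AL_tr:
 assumes j: "!!e. lipton (j e)" "LS j" and i: "LS i"
 shows "AL (%e. if i e <= j e then fst (lipton.tr prog R (j e) 0 (i e) u) else [])"
  "AL (%e. if i e <= j e then snd (lipton.tr prog R (j e) 0 (i e) u) else [])"
proof -
 have *: "AL (%e. fst (lipton.tr prog R (j e) 0 (i e) u)) & AL (%e. snd (lipton.tr prog R (j e) 0 (i e) u))"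
  if i: "LS i" "!!e. i e <= j e" for i
  unfolding lipton.tr_def[OF j(1)] if_distrib[of fst] if_distrib[of snd] fst_conv snd_conv
  by (intro conjI AL_if AL_opt AL_mainl LSP_const LSP_conj LSP_less LSP_eq LS_const j i order_refl; intro AL_intro LS_add LS_sub LS_const j i)
 let ?i = "%e. if i e <= j e then i e else 0"
 have i': "LS ?i" "!!e. ?i e <= j e" by (intro LS_intro i j) simp
 note * = *[OF i', THEN conjunct1] *[OF i', THEN conjunct2]
 show "AL (%e. if i e <= j e then fst (lipton.tr prog R (j e) 0 (i e) u) else [])"
  "AL (%e. if i e <= j e then snd (lipton.tr prog R (j e) 0 (i e) u) else [])"
  using AL_if[OF LSP_le[OF i j(2)] *(1) AL_Nil] AL_if[OF LSP_le[OF i j(2)] *(2) AL_Nil] by (simp_all cong: if_cong)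
qed

definition KU :: nat where
 "KU = 16 + 6 * nq"

definition tA :: "nat => nat => nat => arc" where
 "tA j K x = fst (lipton.tr prog R j K (x div KU) (x mod KU))"

definition tB :: "nat => nat => nat => arc" where
 "tB j K x = snd (lipton.tr prog R j K (x div KU) (x mod KU))"

definition np :: "nat => nat" where
 "np j = KP * (j + 1)"

text \<open>There are no abstract transitions and only one cut transition: covering in a Petri net
  is hard enough. All sets are intervals, so that the sorted lists in the encoding are known in
  advance.\<close>

definition net :: "nat => nat => nat rpn" where
 "net j K = (|places = {0..<np j}, elem_trans = {np j..<np j + (j + 1) * KU}, abs_trans = {},
   cut_trans = {np j + (j + 1) * KU..<np j + (j + 1) * KU + 1},
   Wminus = (%t. if t < np j + (j + 1) * KU then wt (tA j K (t - np j)) else wt (lipton.FF qf)),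
   Wplus = (%t. wt (tB j K (t - np j))), Omega = (%t p. 0)|)"

definition rel :: "nat => (pl => nat) => (nat => nat) => bool" where
 "rel j m m' \<longleftrightarrow> (ALL q. vp j q --> m' (pc q) = m q)"

lemma wt_le: assumes "rel j m m'" "ALL x : set a. vp j (fst x)" shows "wt a <= m' \<longleftrightarrow> ms a <= m"
proof
 assume l: "wt a <= m'"
 show "ms a <= m"
 proof (rule le_funI)
  fix q show "ms a q <= m q"
   using le_funD[OF l, of "pc q"] wt_ms[OF assms(2), of q] ms_0[OF assms(2), of q] assms(1) unfolding rel_def
   by (cases "vp j q") auto
 qed
next
 assume l: "ms a <= m"
 show "wt a <= m'"
 proof (rule le_funI)
  fix p show "wt a p <= m' p"
  proof (cases "wt a p = 0")
   case False
   then obtain x where x: "x : set a" "p = pc (fst x)" using wt_nonzero by blast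
   then have v: "vp j (fst x)" using assms(2) by blast
   show ?thesis using le_funD[OF l, of "fst x"] wt_ms[OF assms(2) v] assms(1) v x(2) unfolding rel_def by simp
  qed simp
 qed
qed

lemma rel_fire:
 assumes "rel j m m'" "ALL x : set a Un set b. vp j (fst x)"
 shows "rel j (%p. m p - ms a p + ms b p) (%p. m' p - wt a p + wt b p)"
 using assms wt_ms[of a j] wt_ms[of b j] unfolding rel_def by simp

lemma FF_valid: "ALL x : set (lipton.FF qf). vp j (fst x)"
proof -
 have "0 < R" using wf by (simp add: wfp_def)
 moreover have "lipton.FF qf = [(Qp qf, 1), (Xp 0, 1)]" by (rule lipton.FF_def[OF lipton.intro]) (rule zero_less_one)
 ultimately show ?thesis using qf by simp
qed

lemma clo_net:
 assumes j: "lipton j"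
 shows "rel j m m' ==> clo (net j K) m' \<longleftrightarrow> cov (lipton.TT prog nq R j K) (lipton.FF qf) m"
proof
 have tv: "ALL x : set (tA j K x) Un set (tB j K x). vp j (fst x)" if "x < (j + 1) * KU" for x
 proof -
  have "x div KU < j + 1" using that by (rule less_mult_imp_div_less)
  moreover have "x mod KU < 16 + 6 * nq" by (simp add: KU_def)
  ultimately show ?thesis using tr_valid[OF j, of "x div KU" "x mod KU" K] by (simp add: tA_def tB_def)
 qed
 have inT: "(tA j K x, tB j K x) : lipton.TT prog nq R j K" if "x < (j + 1) * KU" for x
 proof -
  have "x div KU < j + 1" using that by (rule less_mult_imp_div_less)
  moreover have "x mod KU < 16 + 6 * nq" by (simp add: KU_def)
  ultimately show ?thesis unfolding lipton.TT_def[OF j] tA_def tB_def by force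
 qed
 have FF: "ms (lipton.FF qf) <= m \<longleftrightarrow> wt (lipton.FF qf) <= m'" if "rel j m m'" for m m'
  using wt_le[OF that FF_valid] by simp
 show "cov (lipton.TT prog nq R j K) (lipton.FF qf) m" if "clo (net j K) m'" "rel j m m'"
  using that
 proof (induction arbitrary: m rule: clo.induct)
  case (clo_cut t m')
  then have "wt (lipton.FF qf) <= m'" by (simp add: net_def)
  then show ?case using FF[OF clo_cut(3)] by (intro cov.cov_final) simp
 next
  case (clo_elem t m')
  define x where "x = t - np j"
  have t: "x < (j + 1) * KU" "Wminus (net j K) t = wt (tA j K x)" "Wplus (net j K) t = wt (tB j K x)"
   using clo_elem(1) by (auto simp: net_def x_def)
  have "ms (tA j K x) <= m" using clo_elem(2) wt_le[OF clo_elem(5), of "tA j K x"] tv[OF t(1)] t(2) by simp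
  moreover have "cov (lipton.TT prog nq R j K) (lipton.FF qf) (%p. m p - ms (tA j K x) p + ms (tB j K x) p)"
   by (rule clo_elem(4)) (use rel_fire[OF clo_elem(5) tv[OF t(1)]] t in simp)
  ultimately show ?case by (rule cov.cov_step[OF inT[OF t(1)]])
 next
  case (clo_abs t m)
  then show ?case by (simp add: net_def)
 qed
 show "clo (net j K) m'" if "cov (lipton.TT prog nq R j K) (lipton.FF qf) m" "rel j m m'"
  using that
 proof (induction arbitrary: m' rule: cov.induct)
  case (cov_final m)
  have "wt (lipton.FF qf) <= m'" using FF[OF cov_final(2)] cov_final(1) by simp
  then show ?case by (intro clo.clo_cut[of "np j + (j + 1) * KU"]) (simp_all add: net_def)
 next
  case (cov_step a b m)
  obtain i u where iu: "(a, b) = lipton.tr prog R j K i u" "i <= j" "u < KU"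
   using cov_step(1) unfolding lipton.TT_def[OF j] KU_def by auto
  define x where "x = i * KU + u"
  have "i * KU <= j * KU" using iu(2) by (rule mult_right_mono) simp
  moreover have "(j + 1) * KU = j * KU + KU" by simp
  ultimately have x: "x < (j + 1) * KU" using iu(3) unfolding x_def by linarith
  have "x div KU = i" "x mod KU = u" using iu(3) by (simp_all add: x_def)
  then have ab: "a = tA j K x" "b = tB j K x" using iu(1)[symmetric] by (simp_all add: tA_def tB_def)
  have t: "Wminus (net j K) (np j + x) = wt a" "Wplus (net j K) (np j + x) = wt b" using x ab by (simp_all add: net_def)
  show ?case
  proof (rule clo.clo_elem[of "np j + x"])
   show "np j + x : elem_trans (net j K)" using x by (simp add: net_def)
   show "Wminus (net j K) (np j + x) <= m'" unfolding t using wt_le[OF cov_step(5), of a] tv[OF x] ab cov_step(2) by simp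
   show "clo (net j K) (%p. m' p - Wminus (net j K) (np j + x) p + Wplus (net j K) (np j + x) p)"
    unfolding t by (rule cov_step(4)) (rule rel_fire[OF cov_step(5)], use tv[OF x] ab in simp)
  qed
 qed
qed

end

context
 fixes prog :: "nat => ins" and nq R qf :: nat
 assumes wf: "wfp prog nq R" and qf: "qf < nq"
begin

abbreviation (input) "pc' == pc nq R"
abbreviation (input) "wt' == wt nq R"
abbreviation (input) "tA' == tA prog nq R"
abbreviation (input) "tB' == tB prog nq R"
abbreviation (input) "np' == np nq R"
abbreviation (input) "KU' == KU nq"

lemma tr_K:
 assumes "lipton j" shows "u ~= 14 | i ~= j ==> lipton.tr prog R j K i u = lipton.tr prog R j 0 i u"
  "lipton.tr prog R j K j 14 = ([(Pt j 4, 1), (Md j 2, 1), (Xb 0, K)], [(Qp 0, 1), (Xp 0, K)])"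
 unfolding lipton.tr_def[OF assms] by auto

lemma wt_K:
 assumes j: "lipton j"
 shows "wt' (tA' j K x) p = (if x mod KU' = 14 & x div KU' = j & p = pc' (Xb 0) then K else wt' (tA' j 0 x) p)"
  "wt' (tB' j K x) p = (if x mod KU' = 14 & x div KU' = j & p = pc' (Xp 0) then K else wt' (tB' j 0 x) p)"
proof -
 have R: "0 < R" "0 < nq" using wf by (auto simp: wfp_def)
 have i: "pc' q = pc' q' \<longleftrightarrow> q = q'" if "vp nq R j q" "vp nq R j q'" for q q'
  using pc_inj[OF wf qf that] by blast
 have ne: "pc' (Pt j 4) ~= pc' (Xb 0)" "pc' (Md j 2) ~= pc' (Xb 0)" "pc' (Qp 0) ~= pc' (Xp 0)"
  using R by (subst i; simp add: vp.simps[OF wf qf])+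
 let ?c = "x mod KU' = 14 & x div KU' = j"
 have t: "tA' j K x = [(Pt j 4, 1), (Md j 2, 1), (Xb 0, K)]" "tB' j K x = [(Qp 0, 1), (Xp 0, K)]" if ?c for K
  unfolding tA_def[OF wf qf] tB_def[OF wf qf] that[THEN conjunct1] that[THEN conjunct2] tr_K(2)[OF j] by simp_all
 have f: "tA' j K x = tA' j 0 x" "tB' j K x = tB' j 0 x" if "~ ?c"
  unfolding tA_def[OF wf qf] tB_def[OF wf qf] by (subst tr_K(1)[OF j, where K = K], use that in auto)+
 show "wt' (tA' j K x) p = (if x mod KU' = 14 & x div KU' = j & p = pc' (Xb 0) then K else wt' (tA' j 0 x) p)"
  by (cases ?c) (use ne in "simp add: t wt_simps[OF wf qf]", use f in "simp only: conj_assoc[symmetric] simp_thms if_False")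
 show "wt' (tB' j K x) p = (if x mod KU' = 14 & x div KU' = j & p = pc' (Xp 0) then K else wt' (tB' j 0 x) p)"
  by (cases ?c) (use ne in "simp add: t wt_simps[OF wf qf]", use f in "simp only: conj_assoc[symmetric] simp_thms if_False")
qed

lemma LS_np: "LS a ==> LS (%e. np' (a e))"
 unfolding np_def[OF wf qf] by (intro LS_intro)

lemma LS_tAB:
 assumes j: "!!e. lipton (j e)" "LS j" and x: "LS x" and p: "LS p"
 shows "LS (%e. if x e < (j e + 1) * KU' then wt' (tA' (j e) 0 (x e)) (p e) else 0)"
  "LS (%e. if x e < (j e + 1) * KU' then wt' (tB' (j e) 0 (x e)) (p e) else 0)"
proof -
 have e: "(if x < (j + 1) * KU' then f (x div KU') (x mod KU') else 0) =
  (if x < (j + 1) * KU' then SUM u<-[0..<KU']. if x mod KU' = u then if x div KU' <= j then f (x div KU') u else 0 else 0 else 0)" for f :: "nat => nat => nat" and x j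
 proof (cases "x < (j + 1) * KU'")
  case True
  then have "x div KU' < j + 1" by (rule less_mult_imp_div_less)
  moreover have "x mod KU' < KU'" by (simp add: KU_def[OF wf qf])
  ultimately show ?thesis by (simp add: interv_sum_list_conv_sum_set_nat)
 qed simp
 have AL: "LS (%e. if x e div KU' <= j e then wt' (fst (lipton.tr prog R (j e) 0 (x e div KU') u)) (p e) else 0)"
  "LS (%e. if x e div KU' <= j e then wt' (snd (lipton.tr prog R (j e) 0 (x e div KU') u)) (p e) else 0)" for u
 proof -
  have "LS (%e. x e div KU')" by (intro LS_intro x)
  from AL_tr[OF wf qf j this, of u] p show
   "LS (%e. if x e div KU' <= j e then wt' (fst (lipton.tr prog R (j e) 0 (x e div KU') u)) (p e) else 0)"
   "LS (%e. if x e div KU' <= j e then wt' (snd (lipton.tr prog R (j e) 0 (x e div KU') u)) (p e) else 0)"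
   unfolding AL_def[OF wf qf] by (simp_all add: if_distrib[of "%a. wt' a _"] wt_simps[OF wf qf] cong: if_cong)
 qed
 show "LS (%e. if x e < (j e + 1) * KU' then wt' (tA' (j e) 0 (x e)) (p e) else 0)"
  "LS (%e. if x e < (j e + 1) * KU' then wt' (tB' (j e) 0 (x e)) (p e) else 0)"
  unfolding tA_def[OF wf qf] tB_def[OF wf qf]
  by (subst e, intro LS_listsum LS_intro AL j x p)+
qed

lemma enc_set_interval: "enc_set f {a..<b} = enc_nat (b - a) @ concat (map (%i. enc_nat (a + i) @ f (a + i)) [0..<b - a])"
proof -
 have "[a..<b] = map (%i. a + i) [0..<b - a]" by (rule nth_equalityI) auto
 then show ?thesis by (simp add: enc_set_def enc_list_def o_def)
qed

lemma LS_wt_const: "LS p ==> LS (%e. wt' a (p e))"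
 using AL_const[OF wf qf, of a] by (simp add: AL_def[OF wf qf])

lemma lipton_reduction:
 assumes J: "0 < J"
 shows "polytime_computable (%w. enc_marked_rpn (net prog nq R qf (length w ^ k + length w + J) (wn w))
   (|mark = [0 |-> wt' lipton.M0], label = Map.empty|))"
proof -
 define jn where "jn n = n ^ k + n + J" for n
 have lj: "lipton (jn n)" for n using J by (simp add: jn_def lipton_def)
 have Ljn: "LS (%e. jn (a e))" if "LS a" for a unfolding jn_def by (intro LS_intro that)
 \<comment> \<open>The entry with weight \<open>wn w\<close> is produced by copying the word, as in
   \<open>enc_nat_wn\<close>; every other entry is an \<open>LS\<close> number.\<close>
 define eA where "eA w n x p = (if x mod KU' = 14 & x div KU' = jn n & p = pc' (Xb 0)
  then concat (map (%b. [True, b]) w) @ [True, True, False]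
  else enc_nat (if x < (jn n + 1) * KU' then wt' (tA' (jn n) 0 x) p else 0))" for w n x p
 define eB where "eB w n x p = (if x mod KU' = 14 & x div KU' = jn n & p = pc' (Xp 0)
  then concat (map (%b. [True, b]) w) @ [True, True, False]
  else enc_nat (if x < (jn n + 1) * KU' then wt' (tB' (jn n) 0 x) p else 0))" for w n x p
 define F where "F w e = enc_nat (np' (jn (hd e))) @ concat (map (%p. enc_nat p) [0..<np' (jn (hd e))]) @
  enc_nat ((jn (hd e) + 1) * KU') @ concat (map (%x. enc_nat (np' (jn (hd e)) + x) @
    (enc_nat (np' (jn (hd e))) @ concat (map (%p. eA w (hd e) x p) [0..<np' (jn (hd e))])) @
    (enc_nat (np' (jn (hd e))) @ concat (map (%p. eB w (hd e) x p) [0..<np' (jn (hd e))]))) [0..<(jn (hd e) + 1) * KU']) @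
  enc_nat 0 @
  enc_nat 1 @ enc_nat (np' (jn (hd e)) + (jn (hd e) + 1) * KU') @
   (enc_nat (np' (jn (hd e))) @ concat (map (%p. enc_nat (wt' (lipton.FF qf) p)) [0..<np' (jn (hd e))])) @
  enc_nat 1 @ enc_nat 0 @ (enc_nat (np' (jn (hd e))) @ concat (map (%p. enc_nat (wt' lipton.M0 p)) [0..<np' (jn (hd e))])) @ enc_nat 0" for w e
 have LO_eAB: "LO (%w e. eA w (n e) (x e) (p e))" "LO (%w e. eB w (n e) (x e) (p e))" if "LS n" "LS x" "LS p" for n x p
  unfolding eA_def eB_def
  by (rule LO_if, intro LSP_conj LSP_eq LS_div LS_mod LS_const Ljn that, intro LO_append LO_word LO_cons LO_Nil,
    rule LO_enc_nat, rule LS_tAB[OF lj], intro Ljn that, (rule that)+)+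
 have "LO F"
  unfolding F_def
  by (intro LO_eAB LO_intro LS_np Ljn LS_wt_const LS_intro)
 moreover have "enc_marked_rpn (net prog nq R qf (length w ^ k + length w + J) (wn w))
   (|mark = [0 |-> wt' lipton.M0], label = Map.empty|) = F w [length w]" for w
 proof -
  have eA: "enc_nat (wt' (tA' (jn n) (wn w) x) p) = eA w n x p" if "x < (jn n + 1) * KU'" for n x p
   using that by (simp add: eA_def wt_K(1)[OF lj, where K = "wn w"] enc_nat_wn)
  have eB: "enc_nat (wt' (tB' (jn n) (wn w) x) p) = eB w n x p" if "x < (jn n + 1) * KU'" for n x p
   using that by (simp add: eB_def wt_K(2)[OF lj, where K = "wn w"] enc_nat_wn)
  have m: "map (%x. f x @ g x) [0..<n] = map (%x. f x @ h x) [0..<n]" if "!!x. x < n ==> g x = h x" for f g h :: "nat => bool list" and n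
   using that by simp
  have es: "enc_set f {} = enc_nat 0" for f by (simp add: enc_set_def enc_list_def)
  have st: "verts (|mark = [0 |-> wt' lipton.M0], label = Map.empty|) = {0..<1::nat}" "{w. (v, w) : edges (|mark = [0 |-> wt' lipton.M0], label = Map.empty|)} = {0..<0::nat}" for v :: nat
   by (auto simp: verts_def edges_def)
  show ?thesis
   unfolding jn_def[symmetric] enc_marked_rpn_def enc_rpn_def Let_def enc_state_def net_def[OF wf qf] rpn.simps st es
    enc_set_interval concat_enc_vector F_def
   by simp (intro arg_cong[of _ _ concat] map_cong refl, simp add: eA[simplified] eB[simplified] cong: map_cong)
 qed
 ultimately show ?thesis using polytime_I by simp
qed

lemma lipton_instance:
 assumes j: "lipton j"
 shows "enc_marked_rpn (net prog nq R qf j K) (|mark = [0 |-> wt' lipton.M0], label = Map.empty|) : cut_problem \<longleftrightarrow>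
  cov (lipton.TT prog nq R j K) (lipton.FF qf) (ms lipton.M0)"
proof -
 have j1: "1 <= j" using j by (simp add: lipton_def)
 have M0: "ALL x : set lipton.M0. vp nq R j (fst x)"
  using j1 wf by (simp add: lipton.M0_def[OF j] vp.simps[OF wf qf])
 have v: "wt' a : vectors {0..<np' j}" if "ALL x : set a. vp nq R j (fst x)" for a
  unfolding vectors_def np_def[OF wf qf] using that pc_less[OF wf qf] wt_nonzero[OF wf qf] by fastforce
 have tv: "ALL y : set (tA' j K x) Un set (tB' j K x). vp nq R j (fst y)" if "x < (j + 1) * KU'" for x
 proof -
  have "x div KU' < j + 1" using that by (rule less_mult_imp_div_less)
  moreover have "x mod KU' < 16 + 6 * nq" by (simp add: KU_def[OF wf qf])
  ultimately show ?thesis using tr_valid[OF wf qf j, of "x div KU'" "x mod KU'" K] by (simp add: tA_def[OF wf qf] tB_def[OF wf qf])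
 qed
 have t: "t - np' j < (j + 1) * KU'" if "t < np' j + (j + 1) * KU'" "np' j <= t" for t using that by linarith
 have tvec: "wt' (tA' j K (t - np' j)) : vectors {0..<np' j}" "wt' (tB' j K (t - np' j)) : vectors {0..<np' j}"
  if "np' j <= t" "t < np' j + (KU' + j * KU')" for t
  using tv[OF t, of t] that by (auto intro!: v)
 have "is_rpn (net prog nq R qf j K)"
  unfolding is_rpn_def transitions_def net_def[OF wf qf] rpn.simps
  using FF_valid[OF wf qf] tvec by (auto intro!: v)
 moreover have "abs_trans (net prog nq R qf j K) = {}" by (simp add: net_def[OF wf qf])
 moreover have "wt' lipton.M0 : vectors (places (net prog nq R qf j K))" using v[OF M0] by (simp add: net_def[OF wf qf])
 ultimately have "enc_marked_rpn (net prog nq R qf j K) (|mark = [0 |-> wt' lipton.M0], label = Map.empty|) : cut_problem \<longleftrightarrow>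
  clo (net prog nq R qf j K) (wt' lipton.M0)"
  by (rule single_vertex_cut_problem[OF _ _ _ refl])
 also have "... \<longleftrightarrow> cov (lipton.TT prog nq R j K) (lipton.FF qf) (ms lipton.M0)"
  by (rule clo_net[OF wf qf j]) (simp add: rel_def[OF wf qf] wt_ms[OF wf qf M0])
 finally show ?thesis .
qed

end

theorem cut_problem_hard: assumes "L : EXPSPACE" shows "polytime_reducible L cut_problem"
proof -
 obtain prog nq R qf k J where l: "wfp prog nq R" "qf < nq" "0 < J"
  "!!w. cov (lipton.TT prog nq R (length w ^ k + length w + J) (wn w)) (lipton.FF qf) (ms lipton.M0) \<longleftrightarrow> w : L"
  by (rule EXPSPACE_lipton[OF assms]) (rule that; assumption)
 have lj: "lipton (length w ^ k + length w + J)" for w :: "bool list" using l(3) by (simp add: lipton_def)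
 show ?thesis unfolding polytime_reducible_def
  using lipton_reduction[OF l(1,2,3), of k] lipton_instance[OF l(1,2) lj] l(4) by blast
qed

section \<open>Reachability in large graphs\<close>

text \<open>Savitch's algorithm on the graph with nodes below \<open>B\<close>, run by a machine with an explicit stack. A state
  \<open>mk r h x y S\<close> asks (for \<open>r = 0\<close>) whether there is a path of length at most \<open>2 ^ h\<close> from \<open>x\<close> to \<open>y\<close>,
  or gives the answer no (for \<open>r = 1\<close>) or yes (for \<open>r = 2\<close>). The digits of \<open>S\<close> are the pending calls of the higher levels, with
  the midpoint that is being tried and the half of the path that is being examined.\<close>

fun sav :: "(nat => nat => bool) => nat => nat => nat => nat => bool" where
 "sav E B 0 x y \<longleftrightarrow> x = y | E x y"
| "sav E B (Suc h) x y \<longleftrightarrow> (EX z<B. sav E B h x z & sav E B h z y)"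

lemma sav_relpow:
 "x < B ==> y < B ==> sav E B h x y \<longleftrightarrow> (EX n<=2 ^ h. (x, y) : {(u, v). u < B & v < B & E u v} ^^ n)"
proof (induction h arbitrary: x y)
 case 0
 have "(EX n<=2 ^ 0. (x, y) : R ^^ n) \<longleftrightarrow> x = y | (x, y) : R" for R :: "(nat \<times> nat) set"
  by (auto simp: le_Suc_eq)
 then show ?case using 0 by simp
next
 case (Suc h)
 let ?R = "{(u, v). u < B & v < B & E u v}"
 show ?case
 proof
  assume "sav E B (Suc h) x y"
  then obtain z where z: "z < B" "sav E B h x z" "sav E B h z y" by auto
  obtain n m where "n <= 2 ^ h" "(x, z) : ?R ^^ n" "m <= 2 ^ h" "(z, y) : ?R ^^ m"
   using Suc.IH[of x z] Suc.IH[of z y] Suc.prems z by blast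
  then have "(x, y) : ?R ^^ (n + m)" "n + m <= 2 ^ Suc h" by (auto simp: relpow_add)
  then show "EX n<=2 ^ Suc h. (x, y) : ?R ^^ n" by blast
 next
  assume "EX n<=2 ^ Suc h. (x, y) : ?R ^^ n"
  then obtain n where n: "n <= 2 ^ Suc h" "(x, y) : ?R ^^ n" by blast
  define k where "k = min n (2 ^ h)"
  have k: "k <= 2 ^ h" "n - k <= 2 ^ h" "n = k + (n - k)" using n(1) by (auto simp: k_def)
  then have "(x, y) : ?R ^^ k O ?R ^^ (n - k)" using n(2) relpow_add[of k "n - k" ?R] by simp
  then obtain z where z: "(x, z) : ?R ^^ k" "(z, y) : ?R ^^ (n - k)" by blast
  have "z < B"
  using z(1) Suc.prems(1) by (cases k; (auto)?)
  then show "sav E B (Suc h) x y" using Suc.IH[of x z] Suc.IH[of z y] Suc.prems z k(1,2) by auto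
 qed
qed

text \<open>A path in a finite relation can be shortened to at most as many steps as there are
  edges, and here there are at most \<open>B * B\<close> of them.\<close>

lemma sav_rtrancl:
 assumes "x < B" "y < B" "B * B <= 2 ^ h"
 shows "sav E B h x y \<longleftrightarrow> (x, y) : {(u, v). u < B & v < B & E u v}^*"
proof -
 let ?R = "{(u, v). u < B & v < B & E u v}"
 have sub: "?R <= {..<B} \<times> {..<B}" by auto
 have fin: "finite ?R" by (rule finite_subset[OF sub]) simp
 have "card ?R <= card ({..<B} \<times> {..<B})" by (rule card_mono[OF _ sub]) simp
 then have c: "card ?R <= 2 ^ h" using assms(3) by (simp add: card_cartesian_product)
 show ?thesis unfolding sav_relpow[OF assms(1,2)] rtrancl_finite_eq_relpow[OF fin]
 proof
  assume "EX n<=2 ^ h. (x, y) : ?R ^^ n"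
  then have "(x, y) : ?R^*" using relpow_imp_rtrancl by blast
  then show "(x, y) : (\<Union>n\<in>{n. n <= card ?R}. ?R ^^ n)" unfolding rtrancl_finite_eq_relpow[OF fin] .
 next
  assume "(x, y) : (\<Union>n\<in>{n. n <= card ?R}. ?R ^^ n)"
  then show "EX n<=2 ^ h. (x, y) : ?R ^^ n" using c by (auto intro: le_trans)
 qed
qed

declare tcode.simps [simp del]

definition mk :: "nat => nat => nat => nat => nat => nat" where
 "mk r h x y S = tcode [r, h, x, y, S]"

lemma tget_mk [simp]: "tget 0 (mk r h x y S) = r" "tget 1 (mk r h x y S) = h" "tget (Suc 0) (mk r h x y S) = h" "tget 2 (mk r h x y S) = x"
 "tget 3 (mk r h x y S) = y" "tget 4 (mk r h x y S) = S"
 by (simp_all add: mk_def tget_tcode)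

text \<open>A stack frame as one digit in base \<open>qb B\<close>: the endpoints of the pending
  call, the midpoint under trial, and 0 or 1 for the first or second half of the path.\<close>

definition fr3 :: "nat => nat => nat => nat => nat => nat" where
 "fr3 B x y z p = ((x * B + y) * B + z) * 2 + p"

definition qb :: "nat => nat" where
 "qb B = B * B * B * 2"

lemma fr3_less: "x < B ==> y < B ==> z < B ==> p < 2 ==> fr3 B x y z p < qb B"
proof -
 have s: "a * c + d < b * c" if "a < b" "d < c" for a b c d :: nat
 proof -
  have "Suc a * c <= b * c" using that(1) by (intro mult_right_mono) auto
  then show ?thesis using that(2) by simp
 qed
 assume "x < B" "y < B" "z < B" "p < 2"
 then show ?thesis unfolding fr3_def qb_def by (intro s)
qed

lemma fr3_get: assumes "y < B" "z < B" "p < 2" shows "fr3 B x y z p mod 2 = p" "fr3 B x y z p div 2 mod B = z" "fr3 B x y z p div (2 * B) mod B = y"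
 "fr3 B x y z p div (2 * B * B) = x"
proof -
 have B: "0 < B" using assms(1) by simp
 have dm: "(a * b + r) mod b = r" "(a * b + r) div b = a" if "r < b" for a b r :: nat using that by simp_all
 show "fr3 B x y z p mod 2 = p" unfolding fr3_def by (rule dm(1)[OF assms(3)])
 have 2: "fr3 B x y z p div 2 = (x * B + y) * B + z" unfolding fr3_def by (rule dm(2)[OF assms(3)])
 show "fr3 B x y z p div 2 mod B = z" unfolding 2 using assms(2) by simp
 have 3: "fr3 B x y z p div (2 * B) = x * B + y" unfolding div_mult2_eq 2 using assms(2) B by simp
 show "fr3 B x y z p div (2 * B) mod B = y" unfolding 3 using assms(1) by simp
 show "fr3 B x y z p div (2 * B * B) = x" unfolding div_mult2_eq[of _ "2 * B" B] 3 using assms(1) B by simp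
qed

text \<open>An answer consults the top frame and not its own endpoints. A no moves on to the next
  midpoint, or is passed upwards after the last one; a yes moves on to the second half, or is passed
  upwards after it. An answer at level \<open>H\<close> is final and stays fixed for the remaining
  steps.\<close>

definition stp :: "(nat => nat => bool) => nat => nat => nat => nat" where
 "stp E B H s = (let r = tget 0 s; h = tget 1 s; x = tget 2 s; y = tget 3 s; S = tget 4 s;
   f = S mod qb B; S' = S div qb B; fx = f div (2 * B * B); fy = f div (2 * B) mod B; fz = f div 2 mod B in
  if r = 0 then (if h = 0 then mk (if x = y | E x y then 2 else 1) 0 x y S else mk 0 (h - 1) x 0 (fr3 B x y 0 0 + qb B * S))
  else if H <= h then s
  else if r = 1 then (if fz + 1 < B then mk 0 h fx (fz + 1) (fr3 B fx fy (fz + 1) 0 + qb B * S') else mk 1 (h + 1) fx fy S')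
  else if f mod 2 = 0 then mk 0 h fz fy (fr3 B fx fy fz 1 + qb B * S') else mk 2 (h + 1) fx fy S')"

lemma stp_mk:
 "stp E B H (mk 0 0 x y S) = mk (if x = y | E x y then 2 else 1) 0 x y S"
 "stp E B H (mk 0 (Suc h) x y S) = mk 0 h x 0 (fr3 B x y 0 0 + qb B * S)"
 "0 < r ==> H <= h ==> stp E B H (mk r h u v S) = mk r h u v S"
 by (simp_all add: stp_def Let_def)

lemma stp_mk2:
 assumes "x < B" "y < B" "z < B" "p < 2" "h < H"
 shows "stp E B H (mk 1 h u v (fr3 B x y z p + qb B * S)) = (if z + 1 < B then mk 0 h x (z + 1) (fr3 B x y (z + 1) 0 + qb B * S) else mk 1 (Suc h) x y S)"
  "stp E B H (mk 2 h u v (fr3 B x y z 0 + qb B * S)) = mk 0 h z y (fr3 B x y z 1 + qb B * S)"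
  "stp E B H (mk 2 h u v (fr3 B x y z 1 + qb B * S)) = mk 2 (Suc h) x y S"
proof -
 have q: "0 < qb B" using assms(1) by (simp add: qb_def)
 have d: "(fr3 B x y z p + qb B * S) mod qb B = fr3 B x y z p" "(fr3 B x y z p + qb B * S) div qb B = S" if "p < 2" for p
  using fr3_less[OF assms(1-3) that] q by simp_all
 note g = fr3_get[OF assms(2,3)]
 show "stp E B H (mk 1 h u v (fr3 B x y z p + qb B * S)) = (if z + 1 < B then mk 0 h x (z + 1) (fr3 B x y (z + 1) 0 + qb B * S) else mk 1 (Suc h) x y S)"
  using d[OF assms(4)] g[OF assms(4)] assms(5) unfolding stp_def Let_def tget_mk by (simp only:) simp
 show "stp E B H (mk 2 h u v (fr3 B x y z 0 + qb B * S)) = mk 0 h z y (fr3 B x y z 1 + qb B * S)"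
  using d[of 0] g[of 0] assms(5) unfolding stp_def Let_def tget_mk by (simp only:) simp
 show "stp E B H (mk 2 h u v (fr3 B x y z 1 + qb B * S)) = mk 2 (Suc h) x y S"
  using d[of 1] g[of 1] assms(5) unfolding stp_def Let_def tget_mk by (simp only:) simp
qed

fun stime :: "nat => nat => nat" where
 "stime B 0 = 1"
| "stime B (Suc h) = 1 + B * (2 * stime B h + 2)"

lemma stime_bound: "1 <= stime B h & stime B h <= (4 * B + 4) ^ Suc h"
proof (induction h)
 case (Suc h)
 have "stime B (Suc h) <= (4 * B + 4) * stime B h"
 proof -
  have "2 * B * 1 <= 2 * B * stime B h" using Suc by (intro mult_left_mono) auto
  moreover have "B * (2 * stime B h + 2) = 2 * B * stime B h + 2 * B" "(4 * B + 4) * stime B h = 2 * (2 * B * stime B h) + 4 * stime B h"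
   by (simp_all add: algebra_simps)
  ultimately show ?thesis using Suc unfolding stime.simps by linarith
 qed
 also have "... <= (4 * B + 4) * (4 * B + 4) ^ Suc h" using Suc by (intro mult_left_mono) auto
 finally show ?case by simp
qed simp

definition ans :: "bool => nat" where
 "ans b = (if b then 2 else 1)"

text \<open>The call comes back with the stack it was started on. Hence the induction hypothesis,
  used with one more frame on top, describes both recursive calls of each midpoint.\<close>

lemma stp_sav:
 assumes "h <= H" "x < B" "y < B"
 shows "EX t <= stime B h. (stp E B H ^^ t) (mk 0 h x y S) = mk (ans (sav E B h x y)) h x y S"
 using assms
proof (induction h arbitrary: x y S)
 case 0
 then show ?case by (intro exI[of _ 1]) (simp add: stp_mk ans_def)
next
 case (Suc h)
 let ?st = "stp E B H" and ?T = "stime B h"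
 have tr: "EX t <= a + b. (?st ^^ t) s = s''" if A: "EX t <= a. (?st ^^ t) s = s'" and C: "EX t <= b. (?st ^^ t) s' = s''" for a b s s' s''
 proof -
  obtain t where t: "t <= a" "(?st ^^ t) s = s'" using A by (elim exE conjE)
  obtain t' where t': "t' <= b" "(?st ^^ t') s' = s''" using C by (elim exE conjE)
  show ?thesis using t t' by (intro exI[of _ "t' + t"]) (simp add: funpow_add)
 qed
 have one: "EX t <= 1. (?st ^^ t) s = ?st s" for s by (intro exI[of _ 1]) simp
 have h: "h < H" "x < B" "y < B" using Suc.prems by simp_all
 note IH = Suc.IH
 have loop: "EX t <= n * (2 * ?T + 2). (?st ^^ t) (mk 0 h x z (fr3 B x y z 0 + qb B * S)) =
   mk (ans (EX z'<B. z <= z' & sav E B h x z' & sav E B h z' y)) (Suc h) x y S" if "z < B" "n = B - z" for n z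
  using that
 proof (induction n arbitrary: z)
  case (Suc n)
  let ?f = "%z p. fr3 B x y z p + qb B * S"
  have z: "z < B" by fact
  have hx: "h <= H" using h(1) by simp
  note m = stp_mk2[OF h(2,3) z _ h(1)]
  have split: "(EX z'<B. z <= z' & Q z') \<longleftrightarrow> Q z | (EX z'<B. Suc z <= z' & Q z')" for Q
   using z by (metis Suc_leD Suc_leI le_less order_refl)
  have c1: "EX t <= ?T. (?st ^^ t) (mk 0 h x z (?f z 0)) = mk (ans (sav E B h x z)) h x z (?f z 0)"
   by (rule IH[of x z, OF hx h(2) z])
  have nxt: "EX t <= 1 + n * (2 * ?T + 2). (?st ^^ t) (mk 1 h u v (?f z p)) = mk (ans (EX z'<B. Suc z <= z' & sav E B h x z' & sav E B h z' y)) (Suc h) x y S"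
   if "p < 2" for u v p
  proof (cases "z + 1 < B")
   case True
   have e: "?st (mk 1 h u v (?f z p)) = mk 0 h x (Suc z) (?f (Suc z) 0)"
    using m(1)[OF that, where u = u and v = v and S = S] True by simp
   have "Suc z < B" "n = B - Suc z" using True Suc.prems(2) by auto
   from Suc.IH[OF this] show ?thesis by (rule tr[OF one[of "mk 1 h u v (?f z p)", unfolded e]])
  next
   case False
   then have "~ (EX z'<B. Suc z <= z' & sav E B h x z' & sav E B h z' y)" by auto
   then have a: "ans (EX z'<B. Suc z <= z' & sav E B h x z' & sav E B h z' y) = 1" by (simp only: ans_def if_False)
   show ?thesis unfolding a using m(1)[OF that, where u = u and v = v and S = S] False by (intro exI[of _ 1]) simp
  qed
  show ?case
  proof (cases "sav E B h x z")
   case True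
   have c2: "EX t <= 1. (?st ^^ t) (mk 2 h x z (?f z 0)) = mk 0 h z y (?f z 1)"
    using m(2)[where p = 0 and u = x and v = z and S = S] by (intro exI[of _ 1]) simp
   have c3: "EX t <= ?T. (?st ^^ t) (mk 0 h z y (?f z 1)) = mk (ans (sav E B h z y)) h z y (?f z 1)"
    by (rule IH[of z y, OF hx z h(3)])
   show ?thesis
   proof (cases "sav E B h z y")
    case T: True
    have c4: "EX t <= 1. (?st ^^ t) (mk 2 h z y (?f z 1)) = mk 2 (Suc h) x y S"
     using m(3)[where p = 0 and u = z and v = y and S = S] by (intro exI[of _ 1]) simp
    have "EX t <= ?T + (1 + (?T + 1)). (?st ^^ t) (mk 0 h x z (?f z 0)) = mk 2 (Suc h) x y S"
     by (rule tr[OF c1[unfolded ans_def, simplified True if_True] tr[OF c2 tr[OF c3[unfolded ans_def, simplified T if_True] c4]]])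
    then obtain t where t: "t <= ?T + (1 + (?T + 1))" "(?st ^^ t) (mk 0 h x z (?f z 0)) = mk 2 (Suc h) x y S" by (elim exE conjE)
    then have "t <= Suc n * (2 * ?T + 2)" by simp
    moreover have "ans (EX z'<B. z <= z' & sav E B h x z' & sav E B h z' y) = 2" using True T z by (auto simp: ans_def)
    ultimately show ?thesis using t(2) by (intro exI[of _ t]) simp
   next
    case F: False
    have "EX t <= ?T + (1 + (?T + (1 + n * (2 * ?T + 2)))). (?st ^^ t) (mk 0 h x z (?f z 0)) =
      mk (ans (EX z'<B. Suc z <= z' & sav E B h x z' & sav E B h z' y)) (Suc h) x y S"
     by (rule tr[OF c1[unfolded ans_def, simplified True if_True] tr[OF c2 tr[OF c3[unfolded ans_def, simplified F if_False] nxt]]]) simp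
    then show ?thesis unfolding split using F by (simp add: algebra_simps)
   qed
  next
   case False
   have "EX t <= ?T + (1 + n * (2 * ?T + 2)). (?st ^^ t) (mk 0 h x z (?f z 0)) =
     mk (ans (EX z'<B. Suc z <= z' & sav E B h x z' & sav E B h z' y)) (Suc h) x y S"
    by (rule tr[OF c1[unfolded ans_def, simplified False if_False] nxt]) simp
   then obtain t where t: "t <= ?T + (1 + n * (2 * ?T + 2))" "(?st ^^ t) (mk 0 h x z (?f z 0)) =
     mk (ans (EX z'<B. Suc z <= z' & sav E B h x z' & sav E B h z' y)) (Suc h) x y S" by (elim exE conjE)
   then show ?thesis unfolding split using False by (intro exI[of _ t]) simp
  qed
 qed simp
 have "EX t <= 1 + B * (2 * ?T + 2). (?st ^^ t) (mk 0 (Suc h) x y S) = mk (ans (EX z'<B. 0 <= z' & sav E B h x z' & sav E B h z' y)) (Suc h) x y S"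
  by (rule tr[OF one]) (use loop[of 0 B] Suc.prems in "simp add: stp_mk")
 then show ?case by simp
qed

subsection \<open>Bounds on the stack\<close>

definition sinv :: "nat => nat => nat => bool" where
 "sinv B H s \<longleftrightarrow> (EX r h x y S. s = mk r h x y S & r <= 2 & h <= H & x < B & y < B & S < qb B ^ (H - h))"

lemma sinvI: "r <= 2 ==> h <= H ==> x < B ==> y < B ==> S < qb B ^ (H - h) ==> sinv B H (mk r h x y S)"
 unfolding sinv_def by blast

lemma sinv_step: assumes "sinv B H s" shows "sinv B H (stp E B H s)"
proof -
 obtain r h x y S where s: "s = mk r h x y S" "r <= 2" "h <= H" "x < B" "y < B" "S < qb B ^ (H - h)"
  using assms unfolding sinv_def by blast
 have q: "0 < qb B" using s(4) by (simp add: qb_def)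
 have push: "f + qb B * U < qb B ^ Suc n" if "f < qb B" "U < qb B ^ n" for f U n
 proof -
  have "qb B * Suc U <= qb B * qb B ^ n" using that(2) by (intro mult_left_mono) auto
  then show ?thesis using that(1) by simp
 qed
 show ?thesis
 proof (cases "r = 0")
  case True
  show ?thesis
  proof (cases h)
   case 0
   then show ?thesis using s True by (auto simp: stp_mk intro!: sinvI)
  next
   case (Suc k)
   have "fr3 B x y 0 0 + qb B * S < qb B ^ Suc (H - Suc k)"
    by (rule push[OF fr3_less]) (use s Suc in auto)
   moreover have "Suc (H - Suc k) = H - k" using s(3) Suc by simp
   ultimately have "fr3 B x y 0 0 + qb B * S < qb B ^ (H - k)" by (simp only:)
   moreover have "stp E B H s = mk 0 k x 0 (fr3 B x y 0 0 + qb B * S)" using s(1) True Suc by (simp add: stp_mk)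
   ultimately show ?thesis using s Suc by (auto intro!: sinvI)
  qed
 next
  case r: False
  show ?thesis
  proof (cases "H <= h")
   case True
   then show ?thesis using assms s(1) r by (simp add: stp_mk)
  next
   case False
   then obtain n where n: "H - h = Suc n" "H - Suc h = n" by (metis Suc_diff_Suc not_le)
   define f U where "f = S mod qb B" and "U = S div qb B"
   define fx fy fz where "fx = f div (2 * B * B)" and "fy = f div (2 * B) mod B" and "fz = f div 2 mod B"
   have f: "f < qb B" using q by (simp add: f_def)
   have U: "U < qb B ^ n" unfolding U_def by (rule less_mult_imp_div_less) (use s(6) n in "simp add: mult.commute")
   have b: "fx < B" "fy < B" "fz < B"
   proof -
    show "fx < B" unfolding fx_def by (rule less_mult_imp_div_less) (use f in "simp add: qb_def mult_ac")
   qed (use s(4) in "auto simp: fy_def fz_def")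
   have e: "stp E B H s = (if r = 1 then (if fz + 1 < B then mk 0 h fx (fz + 1) (fr3 B fx fy (fz + 1) 0 + qb B * U) else mk 1 (h + 1) fx fy U)
    else if f mod 2 = 0 then mk 0 h fz fy (fr3 B fx fy fz 1 + qb B * U) else mk 2 (h + 1) fx fy U)"
    using r False by (simp add: s(1) stp_def Let_def fx_def fy_def fz_def f_def U_def)
   have i: "sinv B H (mk r' h x' y' (fr3 B fx fy z p + qb B * U))" if "r' <= 2" "x' < B" "y' < B" "z < B" "p < 2" for r' x' y' z p
    by (rule sinvI[OF that(1) s(3) that(2,3)]) (unfold n(1), rule push[OF fr3_less[OF b(1,2) that(4,5)] U])
   have i2: "sinv B H (mk r' (h + 1) fx fy U)" if "r' <= 2" for r'
    using U b that False n by (intro sinvI) auto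
   show ?thesis unfolding e using i i2 b by auto
  qed
 qed
qed

text \<open>The first summand bounds the codes of the machine states, the exponent
  \<open>4 ^ 5\<close> coming from their five fields; the second one bounds the running time. A
  single number can therefore limit both the accumulator and the length of the loop.\<close>

definition sbound :: "nat => nat => nat" where
 "sbound B H = (qb B ^ H + B + H + 4) ^ (4 ^ 5) + (4 * B + 4) ^ Suc H"

lemma sinv_bound: assumes "sinv B H s" shows "s <= sbound B H"
proof -
 obtain r h x y S where s: "s = mk r h x y S" "r <= 2" "h <= H" "x < B" "y < B" "S < qb B ^ (H - h)"
  using assms unfolding sinv_def by blast
 have "1 <= qb B" using s(4) by (simp add: qb_def)
 then have "qb B ^ (H - h) <= qb B ^ H" by (intro power_increasing) auto
 then have "tcode [r, h, x, y, S] <= ((qb B ^ H + B + H + 2) + 2) ^ (4 ^ length [r, h, x, y, S])"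
  using s by (intro tcode_bound) auto
 moreover have "length [r, h, x, y, S] = 5" "qb B ^ H + B + H + 2 + 2 = qb B ^ H + B + H + 4" by simp_all
 ultimately have "tcode [r, h, x, y, S] <= (qb B ^ H + B + H + 4) ^ (4 ^ 5)" by (simp only:)
 then show ?thesis unfolding s(1) mk_def sbound_def by (rule trans_le_add1)
qed

text \<open>States beyond \<open>tget 2 v\<close> are rejected, so that the recursion is bounded for
  all arguments, as \<open>LS_rec\<close> demands. If that number is at least \<open>sbound\<close>,
  no rejection ever happens.\<close>

definition SAV :: "(nat => nat => nat => bool) => nat => bool" where
 "SAV E v \<longleftrightarrow> tget 0 (rec_nat (mk 0 (tget 1 v) (tget 3 v) (tget 4 v) 0)
   (%i s. let s' = stp (%x y. E x y (tget 5 v)) (tget 0 v) (tget 1 v) s in if s' <= tget 2 v then s' else s) (tget 2 v)) = 2"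

theorem SAV_correct:
 assumes "x < B" "y < B" "B * B <= 2 ^ H" "sbound B H <= D"
 shows "SAV E (tcode [B, H, D, x, y, c]) \<longleftrightarrow> (x, y) : {(u, v). u < B & v < B & E u v c}^*"
proof -
 let ?E = "%x y. E x y c"
 let ?st = "stp ?E B H"
 define s0 where "s0 = mk 0 H x y 0"
 have i: "sinv B H ((?st ^^ t) s0)" for t
 proof (induction t)
  case 0
  show ?case unfolding s0_def sinv_def using assms(1,2) by (intro exI[of _ 0] exI[of _ H] exI[of _ x] exI[of _ y]) auto
 qed (use sinv_step in auto)
 have r: "rec_nat s0 (%i s. let s' = ?st s in if s' <= D then s' else s) t = (?st ^^ t) s0" for t
 proof (induction t)
  case (Suc t)
  have "?st ((?st ^^ t) s0) <= D" using sinv_bound[OF i[of "Suc t"]] assms(4) by simp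
  then show ?case using Suc by (simp add: Let_def)
 qed simp
 obtain t where t: "t <= stime B H" "(?st ^^ t) s0 = mk (ans (sav ?E B H x y)) H x y 0"
  using stp_sav[OF order_refl assms(1,2), of H "%x y. E x y c" 0] unfolding s0_def by blast
 have "(4 * B + 4) ^ Suc H <= D" using assms(4) unfolding sbound_def by linarith
 then have tD: "t <= D" using t(1) stime_bound[of B H] by linarith
 have "(?st ^^ (n + t)) s0 = mk (ans (sav ?E B H x y)) H x y 0" for n
 by (induction n; (simp add: stp_mk(3) ans_def t)?)
 from this[of "D - t"] have "(?st ^^ D) s0 = mk (ans (sav ?E B H x y)) H x y 0" using tD by simp
 then have "SAV E (tcode [B, H, D, x, y, c]) \<longleftrightarrow> ans (sav ?E B H x y) = 2"
  unfolding SAV_def using r by (simp add: tget_tcode s0_def)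
 then show ?thesis using sav_rtrancl[OF assms(1-3), of ?E] by (simp add: ans_def)
qed

lemma LSP_subst3:
 assumes "LSP (%e. E (hd (tl (tl e))) (hd (tl e)) (hd e))" "LS a" "LS b" "LS c"
 shows "LSP (%e. E (a e) (b e) (c e))"
 using LS_subst3[of "%x y z. if E x y z then 1 else 0" a b c] assms unfolding LSP_def by simp

lemma LS_mk: "LS r ==> LS h ==> LS x ==> LS y ==> LS S ==> LS (%e. mk (r e) (h e) (x e) (y e) (S e))"
 unfolding mk_def tcode.simps by (intro LS_intro)

lemma LSP_SAV:
 assumes E: "LSP (%e. E (hd (tl (tl e))) (hd (tl e)) (hd e))" and v: "LS v"
 shows "LSP (%e. SAV E (v e))"
proof -
 let ?h = "%s v. let s' = stp (%x y. E x y (tget 5 v)) (tget 0 v) (tget 1 v) s in if s' <= tget 2 v then s' else s"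
 have st: "LS (%e. stp (%x y. E x y (tget 5 (v e))) (tget 0 (v e)) (tget 1 (v e)) (s e))" if "LS v" "LS s" for v s
  unfolding stp_def Let_def qb_def fr3_def
  by (intro LS_mk LSP_subst3[OF E] LS_intro LS_tget that)
 have "LS (%e. rec_nat (mk 0 (tget 1 (hd e)) (tget 3 (hd e)) (tget 4 (hd e)) 0) (%i s. ?h s (hd e)) (tget 2 (hd e)))"
 proof (rule LS_rec[where B = "%e. mk 0 (tget 1 (hd e)) (tget 3 (hd e)) (tget 4 (hd e)) 0 + tget 2 (hd e)"])
  show "LS (%e. ?h (hd e) (hd (tl (tl e))))" unfolding Let_def by (intro LS_intro st LS_tget)
  show "rec_nat (mk 0 (tget 1 (hd e)) (tget 3 (hd e)) (tget 4 (hd e)) 0) (%i s. ?h s (hd e)) i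
    <= mk 0 (tget 1 (hd e)) (tget 3 (hd e)) (tget 4 (hd e)) 0 + tget 2 (hd e)" for e i
   by (induction i) (auto simp: Let_def)
  show "pb (%e. mk 0 (tget 1 (hd e)) (tget 3 (hd e)) (tget 4 (hd e)) 0 + tget 2 (hd e))"
   by (intro pb_add LS_pb LS_mk LS_tget LS_intro)
 qed (intro LS_mk LS_tget LS_intro)+
 then have "LSP (%e. SAV E (hd e))" unfolding SAV_def by (intro LSP_eq LS_tget LS_const)
 then show ?thesis using LS_subst1[of "%v. if SAV E v then 1 else 0" v] v unfolding LSP_def by simp
qed

section \<open>Membership\<close>

subsection \<open>Derivations of closability\<close>

definition sub :: "'a rpn => 'a set => 'a rpn" where
 "sub N A = N(|elem_trans := elem_trans N Un A, abs_trans := {}|)"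

lemma sub_simps [simp]: "elem_trans (sub N A) = elem_trans N Un A" "abs_trans (sub N A) = {}" "cut_trans (sub N A) = cut_trans N"
 "Wminus (sub N A) = Wminus N" "Wplus (sub N A) = Wplus N" "places (sub N A) = places N"
 by (simp_all add: sub_def)

lemma clo_sub_sound:
 assumes "!!t. t : A ==> t : abs_trans N & clo N (Omega N t)" "clo (sub N A) m" shows "clo N m"
 using assms(2)
proof (induction rule: clo.induct)
 case (clo_cut t m)
 then show ?case by (auto intro: clo.clo_cut)
next
 case (clo_elem t m)
 show ?case
 proof (cases "t : A")
  case True
  then show ?thesis using clo.clo_abs[of t N m] assms(1)[of t] clo_elem by simp
 next
  case False
  then show ?thesis using clo.clo_elem[of t N m] clo_elem by simp
 qed
qed simp

lemma clo_sub_complete: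
 assumes "!!t. t : abs_trans N ==> clo (sub N A) (Omega N t) ==> t : A" "clo N m" shows "clo (sub N A) m"
 using assms(2)
proof (induction rule: clo.induct)
 case (clo_cut t m)
 then show ?case using clo.clo_cut[of t "sub N A" m] by simp
next
 case (clo_elem t m)
 then show ?case using clo.clo_elem[of t "sub N A" m] by simp
next
 case (clo_abs t m)
 then show ?case using clo.clo_elem[of t "sub N A" m] assms(1)[of t] by simp
qed

definition items :: "'a rpn => ('a, 'v) state => ('a + 'v) set" where
 "items N s = Inl ` abs_trans N Un Inr ` verts s"

fun just :: "'a rpn => ('a, 'v) state => ('a + 'v) set => 'a + 'v => bool" where
 "just N s A (Inl t) = clo (sub N {t : abs_trans N. Inl t : A}) (Omega N t)"
| "just N s A (Inr v) = clo (sub N {t : abs_trans N. Inl t : A})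
   (%p. the (mark s v) p + (SUM w : {w. (v, w) : edges s & Inr w : A}. the (label s (v, w)) p))"

text \<open>A certificate that can be checked item by item: everything of rank below
  \<open>n\<close> is justified by items of smaller rank, which excludes circular
  justifications.\<close>

definition ranked :: "'a rpn => ('a, 'v) state => ('a + 'v => nat) => nat => bool" where
 "ranked N s r n \<longleftrightarrow> (ALL x : items N s. r x < n --> just N s {y. r y < r x} x)"

lemma finite_kids: "wfs s ==> finite {w. (v, w) : edges s & Q w}"
 by (rule finite_subset[of _ "verts s"]) (auto dest: wfs_edges simp: wfs_finite)

lemma ranked_sound:
 assumes s: "wfs s" and r: "ranked N s r n" and x: "x : items N s" "r x < n"
 shows "case x of Inl t => clo N (Omega N t) | Inr v => cl N s v"
 using x
proof (induction "r x" arbitrary: x rule: less_induct)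
 case less
 let ?A = "{t : abs_trans N. Inl t : {y. r y < r x}}"
 have A: "t : abs_trans N & clo N (Omega N t)" if "t : ?A" for t
  using less.hyps[of "Inl t"] that less.prems(2) by (auto simp: items_def)
 have j: "just N s {y. r y < r x} x" using r less.prems unfolding ranked_def by blast
 show ?case
 proof (cases x)
  case (Inl t)
  have "clo N (Omega N t)" by (rule clo_sub_sound[OF A]) (use j Inl in simp_all)
  then show ?thesis using Inl by simp
 next
  case (Inr v)
  let ?X = "{w. (v, w) : edges s & Inr w : {y. r y < r x}}"
  have v: "v : verts s" using less.prems(1) Inr by (auto simp: items_def)
  then obtain m where m: "mark s v = Some m" unfolding verts_def by blast
  have X: "(v, w) : edges s & cl N s w" if "w : ?X" for w
   using less.hyps[of "Inr w"] that less.prems(2) wfs_edges[OF s] by (auto simp: items_def)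
  have "clo N (%p. m p + (SUM w:?X. the (label s (v, w)) p))"
   by (rule clo_sub_sound[OF A]) (use j Inr m in simp_all)
  then have "cl N s v" by (intro cl.intros[OF m finite_kids[OF s] X])
  then show ?thesis using Inr by simp
 qed
qed

text \<open>A set that is closed under justification contains all closable threads, by induction on
  their derivations; additional children in the set only add tokens.\<close>

lemma just_complete:
 assumes s: "wfs s" and A: "!!x. x : items N s ==> just N s A x ==> x : A"
 shows "cl N s v ==> Inr v : A"
proof (induction rule: cl.induct)
 case (1 v m X)
 have v: "v : verts s" using 1(1) by (auto simp: verts_def)
 let ?A = "{t : abs_trans N. Inl t : A}"
 have "clo (sub N ?A) (%p. m p + (SUM w:X. the (label s (v, w)) p))"
 proof (rule clo_sub_complete[OF _ 1(3)])
  fix t assume "t : abs_trans N" "clo (sub N ?A) (Omega N t)"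
  then show "t : ?A" using A[of "Inl t"] by (simp add: items_def)
 qed
 moreover have "(SUM w:X. the (label s (v, w)) p) <= (SUM w : {w. (v, w) : edges s & Inr w : A}. the (label s (v, w)) p)" for p
  by (rule sum_mono2[OF finite_kids[OF s]]) (use 1(4) in auto)
 then have "(%p. m p + (SUM w:X. the (label s (v, w)) p)) <=
   (%p. the (mark s v) p + (SUM w : {w. (v, w) : edges s & Inr w : A}. the (label s (v, w)) p))"
  using 1(1) by (simp add: le_fun_def)
 ultimately have "just N s A (Inr v)" by (simp add: clo_mono)
 then show ?case using A v by (simp add: items_def)
qed

text \<open>Ranks are positions in a longest repetition-free list in which each item is justified by
  its predecessors. By maximality the set of its members is closed under \<open>just\<close>, so it
  contains \<open>Inr v\<close>.\<close>

lemma ranked_complete: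
 assumes s: "wfs s" and fin: "finite (items N s)" and v: "cl N s v"
 obtains r where "ranked N s r (card (items N s))" "!!x. r x <= card (items N s)" "r (Inr v) < card (items N s)"
proof -
 define ok where "ok ts \<longleftrightarrow> distinct ts & set ts <= items N s & (ALL i<length ts. just N s (set (take i ts)) (ts ! i))" for ts
 have len: "length ts <= card (items N s)" if "ok ts" for ts
  using that card_mono[OF fin, of "set ts"] unfolding ok_def by (metis distinct_card)
 have "ok []" by (simp add: ok_def)
 then obtain ts where ts: "ok ts" "!!ts'. ok ts' ==> length ts' <= length ts"
  using ex_has_greatest_nat[of ok "[]" length "card (items N s) + 1"] len by (metis le_imp_less_Suc Suc_eq_plus1)
 have cls: "x : set ts" if "x : items N s" "just N s (set ts) x" for x
 using ts(1) ts(2)[of "ts @ [x]"] that by (auto simp: ok_def nth_append less_Suc_eq)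
 define n where "n = card (items N s)"
 have n: "length ts <= n" using len[OF ts(1)] by (simp add: n_def)
 \<comment> \<open>The value \<open>n\<close>, the number of all items, is left for the items that
   are never justified.\<close>
 define r where "r x = (if x : set ts then (LEAST i. i < length ts & ts ! i = x) else n)" for x
 have r: "r x < length ts & ts ! r x = x" if "x : set ts" for x
 using that by (smt (verit)  r_def in_set_conv_nth LeastI_ex)
 have rn: "r x = n" if "x ~: set ts" for x using that by (simp add: r_def)
 have "set (take (r x) ts) = {y. r y < r x}" if "x : set ts" for x
 proof
  show "set (take (r x) ts) <= {y. r y < r x}"
  proof
   fix y assume "y : set (take (r x) ts)"
   then obtain i where i: "i < r x" "i < length ts" "y = ts ! i" by (auto simp: in_set_conv_nth)
   then have "ts ! r y = ts ! i" "r y < length ts" using r[of y] nth_mem by auto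
   then have "r y = i" using ts(1) i(2) by (simp add: ok_def nth_eq_iff_index_eq)
   then show "y : {y. r y < r x}" using i(1) by simp
  qed
  show "{y. r y < r x} <= set (take (r x) ts)"
  proof
   fix y assume "y : {y. r y < r x}"
   then have y: "r y < r x" by simp
   then have "y : set ts" using rn[of y] r[OF that] n by fastforce
   then have "ts ! r y = y" "r y < length ts" using r by auto
   then show "y : set (take (r x) ts)" using y r[OF that] by (metis in_set_conv_nth length_take min_less_iff_conj nth_take)
  qed
 qed
 then have rk: "ranked N s r n" unfolding ranked_def
 proof (intro ballI impI)
  fix x assume eq: "!!x. x : set ts ==> set (take (r x) ts) = {y. r y < r x}" and x: "x : items N s" "r x < n"
  then have "x : set ts" using rn by fastforce
  then show "just N s {y. r y < r x} x" using eq[of x] r[of x] ts(1) unfolding ok_def by metis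
 qed
 have "Inr v : set ts" by (rule just_complete[OF s _ v]) (rule cls)
 then have "r (Inr v) < n" using r n by fastforce
 moreover have "r x <= n" for x using r[of x] rn[of x] n by (cases "x : set ts") auto
 ultimately show thesis using that rk unfolding n_def by blast
qed

subsection \<open>Instances as arrays\<close>

text \<open>Sizes of the five sets, names in increasing order, weights by positions, and for a thread the position of its parent,
  the position of the abstract transition labelling the edge from its parent, and a depth.\<close>

record inst =
 ip :: nat  ie :: nat  ia :: nat  ic :: nat  iv :: nat
 nP :: "nat => nat"  nE :: "nat => nat"  nA :: "nat => nat"  nC :: "nat => nat"  nV :: "nat => nat"
 wme :: "nat => nat => nat"  wpe :: "nat => nat => nat"
 wma :: "nat => nat => nat"  wpa :: "nat => nat => nat"  oma :: "nat => nat => nat"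
 wmc :: "nat => nat => nat"  mkr :: "nat => nat => nat"
 par :: "nat => nat"  la :: "nat => nat"  dep :: "nat => nat"

definition rows :: "nat => (nat => bool list) => bool list" where
 "rows k f = enc_nat k @ concat (map f [0..<k])"

definition vecI :: "nat => (nat => nat) => bool list" where
 "vecI k f = rows k (%j. enc_nat (f j))"

definition encE :: "inst => nat => bool list" where
 "encE I i = enc_nat (nE I i) @ vecI (ip I) (wme I i) @ vecI (ip I) (wpe I i)"

definition encA :: "inst => nat => bool list" where
 "encA I i = enc_nat (nA I i) @ vecI (ip I) (wma I i) @ vecI (ip I) (wpa I i) @ vecI (ip I) (oma I i)"

definition encC :: "inst => nat => bool list" where
 "encC I i = enc_nat (nC I i) @ vecI (ip I) (wmc I i)"

definition encV :: "inst => nat => bool list" where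
 "encV I v = enc_nat (nV I v) @ vecI (ip I) (mkr I v) @ enc_nat (SUM u<iv I. if par I u = v then 1 else 0) @
   concat (map (%u. if par I u = v then enc_nat (nV I u) @ vecI (ip I) (wpa I (la I u)) else []) [0..<iv I])"

definition encI :: "inst => bool list" where
 "encI I = rows (ip I) (%j. enc_nat (nP I j)) @ rows (ie I) (encE I) @ rows (ia I) (encA I) @ rows (ic I) (encC I) @ rows (iv I) (encV I)"

definition enum :: "nat set => (nat => nat) => nat => bool" where
 "enum A f k \<longleftrightarrow> A = f ` {..<k} & (ALL i<k. ALL j<k. i < j --> f i < f j)"

lemma enumD: assumes "enum A f k" shows "inj_on f {..<k}" "i < k ==> f i : A" "finite A" "x : A ==> EX i<k. x = f i"
proof -
 show "inj_on f {..<k}"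
 proof (rule inj_onI)
  fix x y assume "x : {..<k}" "y : {..<k}" "f x = f y"
  then show "x = y" using assms unfolding enum_def by (metis lessThan_iff less_irrefl linorder_neqE_nat)
 qed
qed (use assms in "auto simp: enum_def")

lemma enum_inj: "enum A f k ==> i < k ==> j < k ==> f i = f j \<longleftrightarrow> i = j"
 using enumD(1)[of A f k] by (auto dest: inj_onD)

lemma sorted_list_filter:
 assumes "enum A f k" shows "sorted_list_of_set (f ` {i. i < k & P i}) = map f (filter P [0..<k])"
proof (rule sorted_list_of_set_unique[THEN iffD1])
 have e: "f ` {i. i < k & P i} = set (map f (filter P [0..<k]))" by auto
 have s: "sorted_wrt (<) (map f (filter P [0..<k]))"
  unfolding sorted_wrt_map
 proof (rule sorted_wrt_mono_rel[OF _ sorted_wrt_filter[OF sorted_wrt_upt]])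
  fix x y assume "x : set (filter P [0..<k])" "y : set (filter P [0..<k])" "x < y"
  then show "f x < f y" using assms by (simp add: enum_def)
 qed
 have "distinct (map f (filter P [0..<k]))" using s strict_sorted_iff by blast
 then have len: "length (map f (filter P [0..<k])) = card (f ` {i. i < k & P i})" unfolding e by (simp only: distinct_card)
 show "sorted_wrt (<) (map f (filter P [0..<k])) & set (map f (filter P [0..<k])) = f ` {i. i < k & P i} &
   length (map f (filter P [0..<k])) = card (f ` {i. i < k & P i})" by (intro conjI s len e[symmetric])
qed (rule finite_imageI, simp)

lemma sorted_list_enum: "enum A f k ==> sorted_list_of_set A = map f [0..<k]"
 using sorted_list_filter[of A f k "%_. True"] by (simp add: enum_def lessThan_def)

lemma enum_ex: assumes "finite A" obtains f where "enum A f (card A)" "!!i. card A <= i ==> f i = 0"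
proof
 let ?xs = "sorted_list_of_set A"
 have s: "sorted_wrt (<) ?xs" by simp
 have l: "length ?xs = card A" by simp
 have "A = set ?xs" using assms by simp
 also have "... = (%i. ?xs ! i) ` {..<card A}" by (auto simp: set_conv_nth l)
 also have "... = (%i. if i < card A then ?xs ! i else 0) ` {..<card A}" by (intro image_cong) auto
 finally have a: "A = (%i. if i < card A then ?xs ! i else 0) ` {..<card A}" .
 show "enum A (%i. if i < card A then ?xs ! i else 0) (card A)"
  unfolding enum_def using a sorted_wrt_nth_less[OF s] l by simp
qed simp

definition repr :: "inst => nat rpn => (nat, nat) state => bool" where
 "repr I N s \<longleftrightarrow> enum (places N) (nP I) (ip I) & enum (elem_trans N) (nE I) (ie I) & enum (abs_trans N) (nA I) (ia I) &
  enum (cut_trans N) (nC I) (ic I) & enum (verts s) (nV I) (iv I) &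
  (ALL i<ie I. ALL j<ip I. Wminus N (nE I i) (nP I j) = wme I i j & Wplus N (nE I i) (nP I j) = wpe I i j) &
  (ALL i<ia I. ALL j<ip I. Wminus N (nA I i) (nP I j) = wma I i j & Wplus N (nA I i) (nP I j) = wpa I i j & Omega N (nA I i) (nP I j) = oma I i j) &
  (ALL i<ic I. ALL j<ip I. Wminus N (nC I i) (nP I j) = wmc I i j) &
  (ALL v<iv I. ALL j<ip I. the (mark s (nV I v)) (nP I j) = mkr I v j) &
  (ALL u<iv I. ALL v<iv I. (nV I v, nV I u) : edges s \<longleftrightarrow> par I u = v) &
  (ALL u<iv I. par I u < iv I --> la I u < ia I & label s (nV I (par I u), nV I u) = Some (Wplus N (nA I (la I u))))"

lemma state_edges: "is_state N s ==> edges s <= verts s \<times> verts s"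
 by (auto simp: is_state_def rooted_tree_def)

lemma enc_repr: assumes r: "repr I N s" and s: "is_state N s" shows "enc_marked_rpn N s = encI I"
proof -
 have e: "enum (places N) (nP I) (ip I)" "enum (elem_trans N) (nE I) (ie I)" "enum (abs_trans N) (nA I) (ia I)"
  "enum (cut_trans N) (nC I) (ic I)" "enum (verts s) (nV I) (iv I)"
  using r unfolding repr_def by simp_all
 note l = e[THEN sorted_list_enum]
 have vec: "enc_vector (places N) m = vecI (ip I) g" if "!!j. j < ip I ==> m (nP I j) = g j" for m g
 proof -
  have "map (%x. enc_nat (m (nP I x))) [0..<ip I] = map (%j. enc_nat (g j)) [0..<ip I]" using that by simp
  then show ?thesis unfolding enc_vector_def enc_list_def vecI_def rows_def l map_map o_def by (simp only: length_map length_upt minus_nat.diff_0)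
 qed
 have cc: "concat (map f xs) = concat (map g xs)" if "!!x. x : set xs ==> f x = g x" for f g :: "nat => bool list" and xs
  using that by (simp cong: map_cong)
 have es: "enc_set f A = rows k g"
  if "enum A h k" "!!i. i < k ==> enc_nat (h i) @ f (h i) = g i" for f g A h k
 proof -
  have "map (%i. enc_nat (h i) @ f (h i)) [0..<k] = map g [0..<k]" using that(2) by simp
  then show ?thesis unfolding rows_def enc_set_def enc_list_def sorted_list_enum[OF that(1)] map_map o_def by (simp only: length_map length_upt minus_nat.diff_0)
 qed
 have v1: "enc_vector (places N) (Wminus N (nE I i)) = vecI (ip I) (wme I i)" "enc_vector (places N) (Wplus N (nE I i)) = vecI (ip I) (wpe I i)" if "i < ie I" for i
  using that r by (intro vec; simp add: repr_def)+
 have v2: "enc_vector (places N) (Wminus N (nA I i)) = vecI (ip I) (wma I i)" "enc_vector (places N) (Wplus N (nA I i)) = vecI (ip I) (wpa I i)"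
  "enc_vector (places N) (Omega N (nA I i)) = vecI (ip I) (oma I i)" if "i < ia I" for i
  using that r by (intro vec; simp add: repr_def)+
 have v3: "enc_vector (places N) (Wminus N (nC I i)) = vecI (ip I) (wmc I i)" if "i < ic I" for i
  using that r by (intro vec; simp add: repr_def)
 have v4: "enc_vector (places N) (the (mark s (nV I v))) = vecI (ip I) (mkr I v)" if "v < iv I" for v
  using that r by (intro vec; simp add: repr_def)
 have kids: "enc_set (%w. enc_vector (places N) (the (label s (nV I v, w)))) {w. (nV I v, w) : edges s} =
   enc_nat (SUM u<iv I. if par I u = v then 1 else 0) @
   concat (map (%u. if par I u = v then enc_nat (nV I u) @ vecI (ip I) (wpa I (la I u)) else []) [0..<iv I])" if v: "v < iv I" for v
 proof -
  have "{w. (nV I v, w) : edges s} = nV I ` {u. u < iv I & par I u = v}"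
  proof
   show "{w. (nV I v, w) : edges s} <= nV I ` {u. u < iv I & par I u = v}"
   proof
    fix w assume w: "w : {w. (nV I v, w) : edges s}"
    then have "w : verts s" using state_edges[OF s] by auto
    then obtain u where "u < iv I" "w = nV I u" using enumD(4)[OF e(5)] by blast
    then show "w : nV I ` {u. u < iv I & par I u = v}" using w r v by (auto simp: repr_def)
   qed
   show "nV I ` {u. u < iv I & par I u = v} <= {w. (nV I v, w) : edges s}" using r v by (auto simp: repr_def)
  qed
  then have sl: "sorted_list_of_set {w. (nV I v, w) : edges s} = map (nV I) (filter (%u. par I u = v) [0..<iv I])"
   by (simp only: sorted_list_filter[OF e(5)])
  have len: "length (filter P [0..<k]) = (SUM u<k. if P u then 1 else 0)" for P k by (induction k) auto
  have cf: "concat (map f (filter P xs)) = concat (map (%x. if P x then f x else []) xs)" for f P and xs :: "nat list" by (induction xs) auto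
  have lab: "enc_vector (places N) (the (label s (nV I v, nV I u))) = vecI (ip I) (wpa I (la I u))" if "u < iv I" "par I u = v" for u
  using v that v2(2) assms by (auto simp: repr_def)
  show ?thesis unfolding enc_set_def enc_list_def sl map_map length_map len cf
   by (intro arg_cong2[of _ _ _ _ append] cc refl) (use lab in auto)
 qed
 show ?thesis unfolding enc_marked_rpn_def enc_rpn_def Let_def enc_state_def encI_def append_assoc
  by (intro arg_cong2[of _ _ _ _ append] es[OF e(1)] es[OF e(2)] es[OF e(3)] es[OF e(4)] es[OF e(5)])
   (simp_all add: v1 v2 v3 v4 kids encE_def encA_def encC_def encV_def)
qed

definition incr :: "(nat => nat) => nat => bool" where
 "incr f k \<longleftrightarrow> (ALL i<k. ALL j<k. i < j --> f i < f j)"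

definition disj :: "(nat => nat) => nat => (nat => nat) => nat => bool" where
 "disj f k g l \<longleftrightarrow> (ALL i<k. ALL j<l. f i ~= g j)"

text \<open>The table \<open>dep\<close> increases strictly from parent to child, a locally
  checkable certificate that the parent table describes a tree. The root is recognized by a parent
  entry outside the table.\<close>

definition valid :: "inst => bool" where
 "valid I \<longleftrightarrow> incr (nP I) (ip I) & incr (nE I) (ie I) & incr (nA I) (ia I) & incr (nC I) (ic I) & incr (nV I) (iv I) &
  disj (nP I) (ip I) (nE I) (ie I) & disj (nP I) (ip I) (nA I) (ia I) & disj (nP I) (ip I) (nC I) (ic I) &
  disj (nE I) (ie I) (nA I) (ia I) & disj (nE I) (ie I) (nC I) (ic I) & disj (nA I) (ia I) (nC I) (ic I) &
  (0 < iv I --> (EX r<iv I. iv I <= par I r & (ALL v<iv I. v ~= r --> par I v < iv I & dep I (par I v) < dep I v & la I v < ia I)))"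

lemma valid_repr: assumes "valid I" obtains N s where "is_rpn N" "is_state N s" "repr I N s"
proof -
 define P where "P = nP I ` {..<ip I}"
 define E where "E = nE I ` {..<ie I}"
 define A where "A = nA I ` {..<ia I}"
 define C where "C = nC I ` {..<ic I}"
 define V where "V = nV I ` {..<iv I}"
 have e: "enum P (nP I) (ip I)" "enum E (nE I) (ie I)" "enum A (nA I) (ia I)" "enum C (nC I) (ic I)" "enum V (nV I) (iv I)"
  using assms unfolding valid_def incr_def enum_def P_def E_def A_def C_def V_def by simp_all
 have d: "P Int (E Un A Un C) = {}" "E Int A = {}" "E Int C = {}" "A Int C = {}"
  using assms unfolding valid_def disj_def P_def E_def A_def C_def by fastforce+
 define jx where "jx f k y = inv_into {..<k} f y" for f :: "nat => nat" and k y
 have jx: "jx f k (f i) = i" if "enum B f k" "i < k" for f k i B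
  unfolding jx_def using inv_into_f_f[OF enumD(1)[OF that(1)]] that(2) by simp
 define vec where "vec g p = (if p : P then g (jx (nP I) (ip I) p) else 0)" for g :: "nat => nat" and p
 have vecP: "vec g : vectors P" for g by (simp add: vec_def vectors_def)
 have vec: "vec g (nP I j) = g j" if "j < ip I" for g j using jx[OF e(1) that] enumD(2)[OF e(1) that] by (simp add: vec_def)
 define Wm where "Wm t = vec (if t : E then wme I (jx (nE I) (ie I) t) else if t : A then wma I (jx (nA I) (ia I) t) else wmc I (jx (nC I) (ic I) t))" for t
 define Wp where "Wp t = vec (if t : E then wpe I (jx (nE I) (ie I) t) else wpa I (jx (nA I) (ia I) t))" for t
 define Om where "Om t = vec (oma I (jx (nA I) (ia I) t))" for t
 define N where "N = (|places = P, elem_trans = E, abs_trans = A, cut_trans = C, Wminus = Wm, Wplus = Wp, Omega = Om|)"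
 have N: "is_rpn N" unfolding is_rpn_def N_def transitions_def
  using d vecP e[THEN enumD(3)] by (auto simp: Wm_def Wp_def Om_def)
 define s where "s = (|mark = (%x. if x : V then Some (vec (mkr I (jx (nV I) (iv I) x))) else None),
   label = (%(x, y). if EX u<iv I. y = nV I u & par I u < iv I & x = nV I (par I u) then Some (Wp (nA I (la I (jx (nV I) (iv I) y)))) else None)|)"
 have vs: "verts s = V" by (auto simp: verts_def s_def split: if_splits)
 have es: "edges s = {(x, y). EX u<iv I. y = nV I u & par I u < iv I & x = nV I (par I u)}"
  by (auto simp: edges_def s_def split: if_splits)
 have ed: "(nV I v, nV I u) : edges s \<longleftrightarrow> par I u = v" if "u < iv I" "v < iv I" for u v
  using enum_inj[OF e(5)] that unfolding es by auto
 have st: "is_state N s"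
 proof (cases "iv I = 0")
  case True
  then have "s = empty_state" by (auto simp: s_def empty_state_def V_def)
  then show ?thesis by (simp add: is_state_def)
 next
  case False
  then obtain r where r: "r < iv I" "iv I <= par I r" "!!v. v < iv I ==> v ~= r ==> par I v < iv I & dep I (par I v) < dep I v & la I v < ia I"
   using assms unfolding valid_def by auto
  have reach: "(nV I r, nV I v) : (edges s)^*" if "v < iv I" for v
   using that
  proof (induction "dep I v" arbitrary: v rule: less_induct)
   case less
   show ?case
   proof (cases "v = r")
    case False
    then have p: "par I v < iv I" "dep I (par I v) < dep I v" using r(3)[OF less.prems] by auto
    then have "(nV I r, nV I (par I v)) : (edges s)^*" using less.hyps by blast
    moreover have "(nV I (par I v), nV I v) : edges s" using ed[OF less.prems p(1)] by simp
    ultimately show ?thesis by (rule rtrancl_into_rtrancl)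
   qed simp
  qed
  have "rooted_tree V (edges s) (nV I r)"
   unfolding rooted_tree_def
  proof (intro conjI ballI allI)
   show "nV I r : V" using enumD(2)[OF e(5) r(1)] .
   show "edges s <= V \<times> V" unfolding es V_def by auto
   show "(u, nV I r) ~: edges s" for u using r(1,2) enum_inj[OF e(5)] unfolding es by fastforce
   show "(nV I r, v) : (edges s)^*" if "v : V" for v using reach that unfolding V_def by auto
   fix v assume v: "v : V - {nV I r}"
   then obtain u where u: "u < iv I" "v = nV I u" "u ~= r" unfolding V_def by blast
   then have p: "par I u < iv I" using r(3) by blast
   show "EX! x. (x, v) : edges s"
   using enum_inj[OF e(5)] u(1) p u(2) by (auto simp: es)
  qed
  moreover have "ran (mark s) <= vectors P" using vecP by (auto simp: ran_def s_def split: if_splits)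
  moreover have "ran (label s) <= Wp ` A"
  proof
   fix l assume "l : ran (label s)"
   then obtain x y where xy: "label s (x, y) = Some l" unfolding ran_def by auto
   then obtain u where u: "u < iv I" "y = nV I u" "par I u < iv I" "l = Wp (nA I (la I (jx (nV I) (iv I) y)))"
    by (auto simp: s_def split: if_splits)
   have "u ~= r" using u(3) r(2) by auto
   then have "la I u < ia I" using r(3)[OF u(1)] by blast
   then show "l : Wp ` A" using u(4) jx[OF e(5) u(1)] enumD(2)[OF e(3)] u(2) by simp
  qed
  ultimately show ?thesis unfolding is_state_def vs using e(5)[THEN enumD(3)] by (auto simp: N_def)
 qed
 have "repr I N s"
 proof -
  have w1: "Wm (nE I i) (nP I j) = wme I i j" "Wp (nE I i) (nP I j) = wpe I i j" if "i < ie I" "j < ip I" for i j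
   using vec[OF that(2)] jx[OF e(2) that(1)] enumD(2)[OF e(2) that(1)] by (simp_all add: Wm_def Wp_def)
  have w2: "Wm (nA I i) (nP I j) = wma I i j" "Wp (nA I i) (nP I j) = wpa I i j" "Om (nA I i) (nP I j) = oma I i j" if "i < ia I" "j < ip I" for i j
  using enumD(2)[OF e(3) that(1)] vec[OF that(2)] d(2) jx[OF e(3) that(1)] by (auto simp: Wm_def Wp_def Om_def)
  have w3: "Wm (nC I i) (nP I j) = wmc I i j" if "i < ic I" "j < ip I" for i j
  using enumD(2)[OF e(4) that(1)] vec[OF that(2)] d(3,4) jx[OF e(4) that(1)] by (auto simp: Wm_def)
  have w4: "the (mark s (nV I v)) (nP I j) = mkr I v j" if "v < iv I" "j < ip I" for v j
   using vec[OF that(2)] jx[OF e(5) that(1)] enumD(2)[OF e(5) that(1)] by (simp add: s_def)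
  have w5: "la I u < ia I & label s (nV I (par I u), nV I u) = Some (Wp (nA I (la I u)))" if "u < iv I" "par I u < iv I" for u
  using assms that jx[OF e(5) that(1)] leD by (auto simp: valid_def s_def)
  show ?thesis unfolding repr_def vs using e w1 w2 w3 w4 w5 ed by (simp add: N_def)
 qed
 then show thesis using that N st by blast
qed

lemma enc_nat_length: "x < 2 ^ length (enc_nat x)" "1 <= length (enc_nat x)"
proof -
 have "length (concat (map (%b. [True, b]) u)) = 2 * length u" for u by (induction u) auto
 then have l: "length (enc_nat x) = 2 * length (bits x) + 1" by (simp add: enc_nat_def)
 have "x < 2 ^ length (bits x)" for x
 proof (induction x rule: less_induct)
  case (less x)
  show ?case
  proof (cases "x = 0")
   case False
   then have "x div 2 < 2 ^ length (bits (x div 2))" by (intro less) auto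
   then show ?thesis using False by (subst bits.simps) auto
  qed (simp add: bits.simps)
 qed
 also have "(2::nat) ^ length (bits x) <= 2 ^ length (enc_nat x)" unfolding l by (rule power_increasing) auto
 finally show "x < 2 ^ length (enc_nat x)" .
 show "1 <= length (enc_nat x)" unfolding l by simp
qed

lemma rows_length: "i < k ==> length (f i) <= length (rows k f)" "(!!i. i < k ==> 1 <= length (f i)) ==> k < length (rows k f)"
proof -
 show "length (f i) <= length (rows k f)" if "i < k" using that by (auto simp: rows_def length_concat intro!: trans_le_add2 member_le_sum_list)
 have c: "k <= length (concat (map f [0..<k]))" if "!!i. i < k ==> 1 <= length (f i)" for k
  using that
 proof (induction k)
  case (Suc k)
  have "k <= length (concat (map f [0..<k]))" using Suc by simp
  then show ?case using Suc.prems[of k] by simp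
 qed simp
 show "k < length (rows k f)" if "!!i. i < k ==> 1 <= length (f i)"
 proof -
  have "k <= length (concat (map f [0..<k]))" by (rule c) (rule that)
  then show ?thesis using enc_nat_length(2)[of k] by (simp add: rows_def)
 qed
qed

text \<open>Each number occurs in binary inside the word, and each row as well as each of the five
  row counts takes at least one letter.\<close>

lemma encI_bounds:
 assumes w: "n = length (encI I)"
 shows "ip I + ie I + ia I + ic I + iv I + 5 <= n"
  "i < ip I ==> nP I i < 2 ^ n" "i < ie I ==> nE I i < 2 ^ n" "i < ia I ==> nA I i < 2 ^ n" "i < ic I ==> nC I i < 2 ^ n" "i < iv I ==> nV I i < 2 ^ n"
  "i < ie I ==> j < ip I ==> wme I i j < 2 ^ n & wpe I i j < 2 ^ n"
  "i < ia I ==> j < ip I ==> wma I i j < 2 ^ n & wpa I i j < 2 ^ n & oma I i j < 2 ^ n"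
  "i < ic I ==> j < ip I ==> wmc I i j < 2 ^ n" "i < iv I ==> j < ip I ==> mkr I i j < 2 ^ n"
proof -
 have x: "a < 2 ^ n" if "length (enc_nat a) <= n" for a
  using enc_nat_length(1)[of a] power_increasing[OF that, of "2 :: nat"] by linarith
 have n: "length (rows (ip I) (%j. enc_nat (nP I j))) + length (rows (ie I) (encE I)) + length (rows (ia I) (encA I)) +
   length (rows (ic I) (encC I)) + length (rows (iv I) (encV I)) = n"
  unfolding w encI_def by (simp only: length_append add.assoc)
 have e: "1 <= length (encE I i)" "1 <= length (encA I i)" "1 <= length (encC I i)" "1 <= length (encV I i)" for i
  using enc_nat_length(2) by (simp_all add: encE_def encA_def encC_def encV_def trans_le_add1)
 show "ip I + ie I + ia I + ic I + iv I + 5 <= n"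
  using n rows_length(2)[of "ip I" "%j. enc_nat (nP I j)"] rows_length(2)[of "ie I" "encE I", OF e(1)] rows_length(2)[of "ia I" "encA I", OF e(2)]
   rows_length(2)[of "ic I" "encC I", OF e(3)] rows_length(2)[of "iv I" "encV I", OF e(4)] enc_nat_length(2) by fastforce
 have r: "length (enc_nat (nP I j)) <= n" if "j < ip I" for j using rows_length(1)[OF that, of "%j. enc_nat (nP I j)"] n by linarith
 have E: "length (encE I i) <= n" if "i < ie I" for i using rows_length(1)[OF that, of "encE I"] n by linarith
 have A: "length (encA I i) <= n" if "i < ia I" for i using rows_length(1)[OF that, of "encA I"] n by linarith
 have C: "length (encC I i) <= n" if "i < ic I" for i using rows_length(1)[OF that, of "encC I"] n by linarith
 have V: "length (encV I i) <= n" if "i < iv I" for i using rows_length(1)[OF that, of "encV I"] n by linarith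
 note d = encE_def encA_def encC_def encV_def
 show "i < ip I ==> nP I i < 2 ^ n" "i < ie I ==> nE I i < 2 ^ n" "i < ia I ==> nA I i < 2 ^ n" "i < ic I ==> nC I i < 2 ^ n" "i < iv I ==> nV I i < 2 ^ n"
  using r[of i] E[of i] A[of i] C[of i] V[of i] by (auto simp: d intro!: x)
 have y: "f j < 2 ^ n" if "j < ip I" "length (vecI (ip I) f) <= n" for f j
  by (rule x) (use rows_length(1)[OF that(1), of "%j. enc_nat (f j)"] that(2) in "simp add: vecI_def")
 show "wme I i j < 2 ^ n & wpe I i j < 2 ^ n" if "i < ie I" "j < ip I"
  using E[OF that(1)] by (intro conjI y that(2)) (simp_all add: d)
 show "wma I i j < 2 ^ n & wpa I i j < 2 ^ n & oma I i j < 2 ^ n" if "i < ia I" "j < ip I"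
  using A[OF that(1)] by (intro conjI y that(2)) (simp_all add: d)
 show "wmc I i j < 2 ^ n" if "i < ic I" "j < ip I" using C[OF that(1)] by (intro y that(2)) (simp add: d)
 show "mkr I i j < 2 ^ n" if "i < iv I" "j < ip I" using V[OF that(1)] by (intro y that(2)) (simp add: d)
qed

section \<open>All tables of an instance as the digits of one number\<close>

definition instF :: "(nat => nat => nat => nat) => inst" where
 "instF F = (|ip = F 0 0 0, ie = F 1 0 0, ia = F 2 0 0, ic = F 3 0 0, iv = F 4 0 0,
  nP = %i. F 5 i 0, nE = %i. F 6 i 0, nA = %i. F 7 i 0, nC = %i. F 8 i 0, nV = %i. F 9 i 0,
  wme = F 10, wpe = F 11, wma = F 12, wpa = F 13, oma = F 14, wmc = F 15, mkr = F 16,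
  par = %i. F 17 i 0, la = %i. F 18 i 0, dep = %i. F 19 i 0|)"

text \<open>Indices out of range yield 0, just as the tables of a \<open>tight\<close> instance do
  beyond their sizes. A suitable number therefore decodes to exactly that record, functions
  included.\<close>

definition ar :: "nat => nat => nat => nat => nat => nat" where
 "ar b Z k i j = (if i < b & j < b then dg b Z ((k * b + i) * b + j) else 0)"

lemma digits_ex: "0 < b ==> (!!i. i < L ==> g i < b) ==> EX Z < b ^ L. ALL i<L. dg b Z i = g i"
proof (induction L arbitrary: g)
 case (Suc L)
 obtain Z where Z: "Z < b ^ L" "!!i. i < L ==> dg b Z i = g (Suc i)" using Suc.IH[of "%i. g (Suc i)"] Suc.prems by auto
 have g: "g 0 < b" using Suc.prems by simp
 have "Suc Z * b <= b ^ L * b" using Z(1) by (intro mult_right_mono) auto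
 then have "Z * b + g 0 < b ^ Suc L" using g by (simp add: mult.commute)
 moreover have "dg b (Z * b + g 0) i = g i" if "i < Suc L" for i using that g Z(2) by (cases i) simp_all
 ultimately show ?case by blast
qed simp

lemma ar_ex:
 assumes "!!k i j. k < K ==> F k i j < b" "!!k i j. k < K ==> b <= i | b <= j ==> F k i j = 0"
 shows "EX Z < b ^ (K * b * b). ALL k<K. ar b Z k = F k"
proof (cases "K = 0")
 case False
 then have b: "0 < b" using assms(1)[of 0 0 0] by simp
 obtain Z where Z: "Z < b ^ (K * b * b)" "!!i. i < K * b * b ==> dg b Z i = F (i div b div b) (i div b mod b) (i mod b)"
  using digits_ex[OF b, of "K * b * b" "%i. F (i div b div b) (i div b mod b) (i mod b)"] assms(1) by (auto simp: less_mult_imp_div_less)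
 have "ar b Z k i j = F k i j" if "k < K" for k i j
 proof (cases "i < b & j < b")
  case True
  have s: "a * b + d < c * b" if "a < c" "d < b" for a c d
  proof -
   have "Suc a * b <= c * b" using that(1) by (intro mult_right_mono) auto
   then show ?thesis using that(2) by simp
  qed
  have "(k * b + i) * b + j < K * b * b" using True that by (intro s) auto
  from Z(2)[OF this] show ?thesis using True by (simp add: ar_def)
 next
  case False
  then show ?thesis using assms(2)[OF that, of i j] by (auto simp: ar_def not_less)
 qed
 then show ?thesis using Z(1) by (intro exI[of _ Z] conjI allI impI ext)
qed simp

definition tight :: "inst => bool" where
 "tight I \<longleftrightarrow> (ALL i j. (ip I <= j | ie I <= i --> wme I i j = 0 & wpe I i j = 0) &
   (ip I <= j | ia I <= i --> wma I i j = 0 & wpa I i j = 0 & oma I i j = 0) &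
   (ip I <= j | ic I <= i --> wmc I i j = 0) & (ip I <= j | iv I <= i --> mkr I i j = 0)) &
  (ALL i. (ip I <= i --> nP I i = 0) & (ie I <= i --> nE I i = 0) & (ia I <= i --> nA I i = 0) & (ic I <= i --> nC I i = 0) &
   (iv I <= i --> nV I i = 0 & par I i = 0 & la I i = 0 & dep I i = 0) & par I i <= iv I & dep I i <= iv I & la I i <= ia I)"

theorem repr_ex:
 assumes N: "is_rpn N" and s: "is_state N s"
 obtains I where "repr I N s" "valid I" "tight I"
proof -
 let ?P = "places N" and ?E = "elem_trans N" and ?A = "abs_trans N" and ?C = "cut_trans N" and ?V = "verts s"
 have w: "wfs s" using s by (auto simp: is_state_def wfs_def)
 have fin: "finite ?P" "finite ?E" "finite ?A" "finite ?C" "finite ?V"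
  using N wfs_finite[OF w] by (auto simp: is_rpn_def transitions_def)
 obtain fP where P: "enum ?P fP (card ?P)" "!!i. card ?P <= i ==> fP i = 0" using enum_ex[OF fin(1)] by blast
 obtain fE where E: "enum ?E fE (card ?E)" "!!i. card ?E <= i ==> fE i = 0" using enum_ex[OF fin(2)] by blast
 obtain fA where A: "enum ?A fA (card ?A)" "!!i. card ?A <= i ==> fA i = 0" using enum_ex[OF fin(3)] by blast
 obtain fC where C: "enum ?C fC (card ?C)" "!!i. card ?C <= i ==> fC i = 0" using enum_ex[OF fin(4)] by blast
 obtain fV where V: "enum ?V fV (card ?V)" "!!i. card ?V <= i ==> fV i = 0" using enum_ex[OF fin(5)] by blast
 define nv where "nv = card ?V"
 \<comment> \<open>The value \<open>nv\<close> marks the root; the value 0 beyond the table keeps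
   the instance tight.\<close>
 define pv where "pv u = (if u < nv then (if EX v<nv. (fV v, fV u) : edges s then SOME v. v < nv & (fV v, fV u) : edges s else nv) else 0)" for u
 define lv where "lv u = (if u < nv & pv u < nv then SOME t. t < card ?A & label s (fV (pv u), fV u) = Some (Wplus N (fA t)) else 0)" for u
 \<comment> \<open>The depth of a vertex is the number of its proper ancestors.\<close>
 define dv where "dv u = (if u < nv then card {x. (x, fV u) : (edges s)^+} else 0)" for u
 have es: "edges s <= ?V \<times> ?V" by (rule state_edges[OF s])
 have par1: "pv u < nv & (fV (pv u), fV u) : edges s" if u: "u < nv" "(x, fV u) : edges s" for u x
 proof -
  obtain v where "v < nv" "x = fV v" using u(2) es enumD(4)[OF V(1)] unfolding nv_def by blast
  then have ex: "EX v<nv. (fV v, fV u) : edges s" using u(2) by blast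
  then have "(SOME v. v < nv & (fV v, fV u) : edges s) < nv & (fV (SOME v. v < nv & (fV v, fV u) : edges s), fV u) : edges s" by (rule someI_ex)
  then show ?thesis unfolding pv_def using ex u(1) by simp
 qed
 have par2: "(fV (pv u), fV u) : edges s" if "u < nv" "pv u < nv" for u
  using par1[OF that(1)] that unfolding pv_def by (metis (mono_tags, lifting) less_irrefl)
 have lab: "lv u < card ?A & label s (fV (pv u), fV u) = Some (Wplus N (fA (lv u)))" if u: "u < nv" "pv u < nv" for u
 proof -
  obtain l where l: "label s (fV (pv u), fV u) = Some l" using par2[OF u] unfolding edges_def by auto
  then have "s ~= empty_state" by (auto simp: empty_state_def)
  then have "ran (label s) <= Wplus N ` ?A" using s by (simp add: is_state_def)
  then have "l : Wplus N ` ?A" using l by (meson ranI subsetD)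
  then have "EX t. t < card ?A & label s (fV (pv u), fV u) = Some (Wplus N (fA t))" using l enumD(4)[OF A(1)] by fastforce
  then have "(SOME t. t < card ?A & label s (fV (pv u), fV u) = Some (Wplus N (fA t))) < card ?A &
   label s (fV (pv u), fV u) = Some (Wplus N (fA (SOME t. t < card ?A & label s (fV (pv u), fV u) = Some (Wplus N (fA t)))))" by (rule someI_ex)
  then show ?thesis unfolding lv_def using u by simp
 qed
 have sub: "{x. (x, y) : (edges s)^+} <= ?V" for y using es by (auto dest: tranclD)
 define I where "I = (|ip = card ?P, ie = card ?E, ia = card ?A, ic = card ?C, iv = nv, nP = fP, nE = fE, nA = fA, nC = fC, nV = fV,
  wme = (%i j. if i < card ?E & j < card ?P then Wminus N (fE i) (fP j) else 0),
  wpe = (%i j. if i < card ?E & j < card ?P then Wplus N (fE i) (fP j) else 0),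
  wma = (%i j. if i < card ?A & j < card ?P then Wminus N (fA i) (fP j) else 0),
  wpa = (%i j. if i < card ?A & j < card ?P then Wplus N (fA i) (fP j) else 0),
  oma = (%i j. if i < card ?A & j < card ?P then Omega N (fA i) (fP j) else 0),
  wmc = (%i j. if i < card ?C & j < card ?P then Wminus N (fC i) (fP j) else 0),
  mkr = (%i j. if i < nv & j < card ?P then the (mark s (fV i)) (fP j) else 0),
  par = pv, la = lv, dep = dv|)"
 have one: "fV v = fV (pv u)" if "u < nv" "(fV v, fV u) : edges s" for u v
  using the_parent[OF w] par1[OF that] that(2) by metis
 have "(fV v, fV u) : edges s \<longleftrightarrow> pv u = v" if "u < nv" "v < nv" for u v
  using one[OF that(1)] par1[OF that(1)] par2[OF that(1)] that(2) enum_inj[OF V(1), folded nv_def] by metis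
 then have r: "repr I N s"
  unfolding repr_def I_def using P(1) E(1) A(1) C(1) V(1) lab by (simp add: nv_def)
 have d: "dv (pv u) < dv u" if u: "u < nv" "pv u < nv" for u
 proof -
  note p = par2[OF u]
  have "(fV (pv u), fV (pv u)) ~: (edges s)^+"
   using w rooted_tree_acyclic[of ?V "edges s"] enumD(2)[OF V(1)] u(2) p
   unfolding wfs_def nv_def by (auto simp: empty_state_def edges_def)
  moreover have "{x. (x, fV (pv u)) : (edges s)^+} <= {x. (x, fV u) : (edges s)^+}"
   using p by (auto intro: trancl_into_trancl)
  ultimately have "{x. (x, fV (pv u)) : (edges s)^+} \<subset> {x. (x, fV u) : (edges s)^+}" using p by blast
  then show ?thesis unfolding dv_def using u finite_subset[OF sub fin(5)] by (simp add: psubset_card_mono)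
 qed
 have v: "valid I"
 proof -
  have i: "incr f k" if "enum B f k" for B f k using that by (simp add: enum_def incr_def)
  have dj: "disj f k g l" if "enum B f k" "enum D g l" "B Int D = {}" for B D f g k l
   using that enumD(2)[OF that(1)] enumD(2)[OF that(2)] unfolding disj_def by (metis disjoint_iff)
  have "EX r<nv. nv <= pv r & (ALL v<nv. v ~= r --> pv v < nv & dv (pv v) < dv v & lv v < card ?A)" if nv: "0 < nv"
  proof -
   have "?V ~= {}" using nv by (auto simp: nv_def)
   then obtain r where r: "rooted_tree ?V (edges s) r" using w by (auto simp: wfs_def empty_state_def verts_def)
   then have "r : ?V" by (simp add: rooted_tree_def)
   then obtain k where k: "k < nv" "r = fV k" using enumD(4)[OF V(1)] unfolding nv_def by blast
   have "nv <= pv k" using par2[OF k(1)] r k(2) unfolding rooted_tree_def by (metis not_le)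
   moreover have "pv v < nv & dv (pv v) < dv v & lv v < card ?A" if "v < nv" "v ~= k" for v
   proof -
    have "fV v : ?V - {r}" using enumD(2)[OF V(1)] enum_inj[OF V(1)] that k unfolding nv_def by blast
    then obtain u where "(u, fV v) : edges s" using r unfolding rooted_tree_def by blast
    then show ?thesis using par1[OF that(1)] d lab that(1) by blast
   qed
   ultimately show ?thesis using k(1) by blast
  qed
  moreover have "?P Int ?E = {}" "?P Int ?A = {}" "?P Int ?C = {}" "?E Int ?A = {}" "?E Int ?C = {}" "?A Int ?C = {}"
   using N by (auto simp: is_rpn_def transitions_def)
  ultimately show ?thesis unfolding valid_def I_def
   using P(1) E(1) A(1) C(1) V(1) by (auto simp: nv_def intro: i dj)
 qed
 have "pv u <= nv" for u using par1[of u] by (cases "u < nv & (EX v<nv. (fV v, fV u) : edges s)") (auto simp: pv_def less_imp_le)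
 moreover have "dv u <= nv" for u unfolding dv_def nv_def using card_mono[OF fin(5) sub] by simp
 moreover have "lv u <= card ?A" for u using lab[of u] by (cases "u < nv & pv u < nv") (auto simp: lv_def)
 ultimately show thesis using P(2) E(2) A(2) C(2) V(2)
  by (intro that[OF r v]) (auto simp: tight_def I_def nv_def pv_def lv_def dv_def)
qed

section \<open>Covering as reachability between numbers\<close>

definition edge :: "inst => (nat => nat) => nat => nat => nat => nat => bool" where
 "edge I rA c rg x y \<longleftrightarrow>
  (EX i<ie I. ALL j<ip I. wme I i j <= dg c x j & dg c y j = dg c x j - wme I i j + wpe I i j) |
  (EX i<ia I. rA i < rg & (ALL j<ip I. wma I i j <= dg c x j & dg c y j = dg c x j - wma I i j + wpa I i j))"

definition stops :: "inst => nat => nat => bool" where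
 "stops I c y \<longleftrightarrow> (EX i<ic I. ALL j<ip I. wmc I i j <= dg c y j)"

definition covers :: "inst => (nat => nat) => nat => nat => nat => (nat => nat) => bool" where
 "covers I rA c B rg f \<longleftrightarrow> (EX x<B. (ALL j<ip I. dg c x j = f j) &
  (EX y<B. stops I c y & (x, y) : {(u, v). u < B & v < B & edge I rA c rg u v}^*))"

context
 fixes I :: inst and N :: "nat rpn" and s :: "(nat, nat) state" and rA :: "nat => nat" and rg :: nat and A :: "nat set"
 assumes r: "repr I N s" and N: "is_rpn N" and A: "A = nA I ` {i. i < ia I & rA i < rg}"
begin

lemma enums: "enum (places N) (nP I) (ip I)" "enum (elem_trans N) (nE I) (ie I)" "enum (abs_trans N) (nA I) (ia I)"
  "enum (cut_trans N) (nC I) (ic I)"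
 using r by (simp_all add: repr_def)

lemma weights:
 "i < ie I ==> j < ip I ==> Wminus N (nE I i) (nP I j) = wme I i j & Wplus N (nE I i) (nP I j) = wpe I i j"
 "i < ia I ==> j < ip I ==> Wminus N (nA I i) (nP I j) = wma I i j & Wplus N (nA I i) (nP I j) = wpa I i j"
 "i < ic I ==> j < ip I ==> Wminus N (nC I i) (nP I j) = wmc I i j"
 using r by (simp_all add: repr_def)

lemma A_abs: "A <= abs_trans N"
 using enumD(2)[OF enums(3)] unfolding A by blast

lemma le_iff: assumes "t : transitions N"
 shows "Wminus N t <= m \<longleftrightarrow> (ALL j<ip I. Wminus N t (nP I j) <= m (nP I j))"
proof
 assume a: "ALL j<ip I. Wminus N t (nP I j) <= m (nP I j)"
 have "Wminus N t p <= m p" for p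
 using a enumD(4)[OF enums(1)] N assms by (cases "p : places N"; (force simp: is_rpn_def vectors_def)?)
 then show "Wminus N t <= m" by (simp add: le_fun_def)
qed (simp add: le_fun_def)

lemma covers_sound:
 assumes c: "covers I rA c B rg f" and m: "!!j. j < ip I ==> m (nP I j) = f j"
 shows "clo (sub N A) m"
proof -
 obtain x y where x: "!!j. j < ip I ==> dg c x j = f j" and y: "stops I c y"
  and xy: "(x, y) : {(u, v). u < B & v < B & edge I rA c rg u v}^*" using c unfolding covers_def by blast
 have fire: "clo (sub N A) m" if t: "t : elem_trans N Un A" "!!j. j < ip I ==> Wminus N t (nP I j) <= m (nP I j)"
  "clo (sub N A) (%p. m p - Wminus N t p + Wplus N t p)" for t m
 proof -
  have "t : transitions N" using t(1) A_abs by (auto simp: transitions_def)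
  then show ?thesis using clo.clo_elem[of t "sub N A" m] t le_iff by simp
 qed
 have "clo (sub N A) m" if "!!j. j < ip I ==> m (nP I j) = dg c x j" for m
  using xy that
 proof (induction arbitrary: m rule: converse_rtrancl_induct)
  case base
  then obtain i where i: "i < ic I" "ALL j<ip I. wmc I i j <= dg c y j" using y unfolding stops_def by blast
  have "nC I i : cut_trans N" by (rule enumD(2)[OF enums(4) i(1)])
  then show ?case using i base weights(3) by (intro clo.clo_cut[of "nC I i"]) (simp_all add: le_iff transitions_def)
 next
  case (step x x')
  have "edge I rA c rg x x'" using step(1) by simp
  then consider i where "i < ie I" "!!j. j < ip I ==> wme I i j <= dg c x j & dg c x' j = dg c x j - wme I i j + wpe I i j"
   | i where "i < ia I" "rA i < rg" "!!j. j < ip I ==> wma I i j <= dg c x j & dg c x' j = dg c x j - wma I i j + wpa I i j"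
   unfolding edge_def by blast
  then show ?case
  proof cases
   case (1 i)
   show ?thesis
    by (rule fire[of "nE I i"]) (use 1 step weights(1) enumD(2)[OF enums(2)] in simp_all)
  next
   case (2 i)
   have "nA I i : A" using 2 A by auto
   then show ?thesis by - (rule fire[of "nA I i"], use 2 step weights(2) in simp_all)
  qed
 qed
 then show ?thesis using m x by simp
qed

text \<open>By \<open>rackoff_bound\<close> some covering path has at most
  \<open>rackoff w (ip I)\<close> steps, each adding at most \<open>w\<close> to a place. All its
  markings thus have entries below \<open>c\<close> and are coded by numbers below
  \<open>c ^ ip I\<close>.\<close>

lemma covers_complete:
 assumes clo: "clo (sub N A) m" and m: "!!j. j < ip I ==> m (nP I j) = f j"
  and w: "!!i j. i < ie I ==> j < ip I ==> wme I i j <= w & wpe I i j <= w"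
   "!!i j. i < ia I ==> j < ip I ==> wma I i j <= w & wpa I i j <= w" "!!i j. i < ic I ==> j < ip I ==> wmc I i j <= w"
  and c: "!!j. j < ip I ==> f j + rackoff w (ip I) * w < c" "0 < c" and B: "c ^ ip I <= B"
 shows "covers I rA c B rg f"
proof -
 let ?R = "{(u, v). u < B & v < B & edge I rA c rg u v}"
 have trans: "EX i<ie I. t = nE I i" if "t : elem_trans N" for t using enumD(4)[OF enums(2) that] .
 have act: "actives (sub N A) = elem_trans N Un A" by (auto simp: actives_def)
 have z: "W p <= w" if "!!j. j < ip I ==> W (nP I j) <= w" "W : vectors (places N)" for W p
  using that enumD(4)[OF enums(1), of p] by (cases "p : places N") (auto simp: vectors_def)
 have Am: "EX i<ia I. t = nA I i & rA i < rg" if "t : A" for t using that unfolding A by blast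
 have vec: "Wminus N t : vectors (places N)" if "t : transitions N" for t using N that by (simp add: is_rpn_def)
 have wm: "Wminus (sub N A) t p <= w" if "t : cut_trans (sub N A) Un actives (sub N A)" for t p
  unfolding sub_simps
 proof (rule z[where W = "Wminus N t", OF _ vec])
  show "t : transitions N" using that A_abs by (auto simp: act transitions_def)
  show "Wminus N t (nP I j) <= w" if "j < ip I" for j
   using \<open>t : cut_trans (sub N A) Un actives (sub N A)\<close> trans[of t] Am[of t] enumD(4)[OF enums(4), of t] weights w that by (auto simp: act)
 qed
 have wp: "Wplus (sub N A) t p <= w" if "t : actives (sub N A)" for t p
  unfolding sub_simps
 proof (rule z[where W = "Wplus N t"])
  show "Wplus N t : vectors (places N)" using N that A_abs by (auto simp: act is_rpn_def)
  show "Wplus N t (nP I j) <= w" if "j < ip I" for j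
   using \<open>t : actives (sub N A)\<close> trans[of t] Am[of t] weights w that by (auto simp: act)
 qed
 have P: "card (places N) = ip I"
  using card_image[OF enumD(1)[OF enums(1)]] enums(1) by (simp add: enum_def)
 obtain k where "covn (sub N A) k UNIV m" using clo_covn[OF clo] by blast
 then have "covn (sub N A) k (places N) m" by (rule covn_subset[rotated]) simp
 from rackoff_bound[OF wm wp enumD(3)[OF enums(1)] this]
 have cov: "covn (sub N A) (rackoff w (ip I)) (places N) m" by (simp add: P)
 have path: "EX y<B. stops I c y & (x, y) : ?R^*"
  if "covn (sub N A) k (places N) m" "x < B" "!!j. j < ip I ==> dg c x j = m (nP I j)" "!!j. j < ip I ==> m (nP I j) + k * w < c" for k x m
  using that
 proof (induction k arbitrary: x m)
  case 0
  then obtain t where t: "t : cut_trans N" "ALL p:places N. Wminus N t p <= m p" by auto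
  then obtain i where i: "i < ic I" "t = nC I i" using enumD(4)[OF enums(4)] by blast
  then have "stops I c x" using t(2) 0(3) weights(3) enumD(2)[OF enums(1)] unfolding stops_def by metis
  then show ?case using 0(2) by blast
 next
  case (Suc k)
  show ?case
  proof (cases "covn (sub N A) 0 (places N) m")
   case True
   then show ?thesis using covn_0[OF True] Suc.prems Suc.IH[OF covn_0[OF True] Suc.prems(2,3)] by fastforce
  next
   case False
   then obtain t where t: "t : elem_trans N Un A" "ALL p:places N. Wminus N t p <= m p" "covn (sub N A) k (places N) (shift (sub N A) t m)"
    using Suc.prems(1) unfolding covn.simps(2) act by auto
   have sh: "shift (sub N A) t m p = m p - Wminus N t p + Wplus N t p" for p by (simp add: shift_def)
   have l: "shift (sub N A) t m (nP I j) + k * w < c" if "j < ip I" for j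
    using Suc.prems(4)[OF that] wp[of t "nP I j"] t(1) unfolding sh by (simp add: act)
   obtain x' where x': "x' < c ^ ip I" "!!j. j < ip I ==> dg c x' j = shift (sub N A) t m (nP I j)"
    using digits_ex[OF c(2), of "ip I" "%j. shift (sub N A) t m (nP I j)"] l by (meson add_lessD1)
   have "edge I rA c rg x x'"
   proof (cases "t : elem_trans N")
    case True
    then obtain i where "i < ie I" "t = nE I i" using trans by blast
    then show ?thesis using t(2) enumD(2)[OF enums(1)] x'(2) Suc.prems(3) weights(1) unfolding edge_def sh by metis
   next
    case False
    then obtain i where "i < ia I" "t = nA I i" "rA i < rg" using Am t(1) by blast
    then show ?thesis using t(2) enumD(2)[OF enums(1)] x'(2) Suc.prems(3) weights(2) unfolding edge_def sh by metis
   qed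
   moreover have xB: "x' < B" using x'(1) B by simp
   moreover obtain y where "y < B" "stops I c y" "(x', y) : ?R^*" using Suc.IH[OF t(3) xB x'(2) l] by blast
   ultimately show ?thesis using Suc.prems(2) by (auto intro!: exI[of _ y] intro: converse_rtrancl_into_rtrancl)
  qed
 qed
 obtain x where x: "x < c ^ ip I" "!!j. j < ip I ==> dg c x j = f j"
  using digits_ex[OF c(2), of "ip I" f] c(1) by (meson add_lessD1)
 have "EX y<B. stops I c y & (x, y) : ?R^*" by (rule path[OF cov]) (use x m c B in simp_all)
 then show ?thesis using x B unfolding covers_def by (meson order_less_le_trans)
qed

end

definition init_mark :: "inst => (nat => nat) => nat => nat => nat" where
 "init_mark I rV v j = mkr I v j + (SUM u<iv I. if par I u = v & rV u < rV v then wpa I (la I u) j else 0)"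

definition goodc :: "inst => (nat => nat) => (nat => nat) => nat => nat => bool" where
 "goodc I rA rV c B \<longleftrightarrow> iv I = 0 |
  (EX v<iv I. iv I <= par I v & rV v < ia I + iv I) &
  (ALL i<ia I. rA i < ia I + iv I --> covers I rA c B (rA i) (oma I i)) &
  (ALL v<iv I. rV v < ia I + iv I --> covers I rA c B (rV v) (init_mark I rV v))"

text \<open>\<open>just\<close> evaluates a marking on all names, while \<open>init_mark\<close>
  knows only table positions. The marking \<open>m\<close> mediates between them and is determined
  on the listed places only.\<close>

lemma just_repr:
 assumes r: "repr I N s" and s: "is_state N s"
  and rA: "ALL i<ia I. R (Inl (nA I i)) = rA i" and rV: "ALL v<iv I. R (Inr (nV I v)) = rV v"
 shows "i < ia I ==> just N s {y. R y < R (Inl (nA I i))} (Inl (nA I i)) \<longleftrightarrow> clo (sub N (nA I ` {k. k < ia I & rA k < rA i})) (Omega N (nA I i))"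
  "v < iv I ==> EX m. (just N s {y. R y < R (Inr (nV I v))} (Inr (nV I v)) \<longleftrightarrow> clo (sub N (nA I ` {k. k < ia I & rA k < rV v})) m) & (ALL j<ip I. m (nP I j) = init_mark I rV v j)"
proof -
 have e: "enum (abs_trans N) (nA I) (ia I)" "enum (verts s) (nV I) (iv I)" using r by (simp_all add: repr_def)
 have a: "{t : abs_trans N. R (Inl t) < b} = nA I ` {k. k < ia I & rA k < b}" for b
  using rA e(1) unfolding enum_def by auto
 show "just N s {y. R y < R (Inl (nA I i))} (Inl (nA I i)) \<longleftrightarrow> clo (sub N (nA I ` {k. k < ia I & rA k < rA i})) (Omega N (nA I i))" if "i < ia I"
  using rA that by (simp add: a)
 show "EX m. (just N s {y. R y < R (Inr (nV I v))} (Inr (nV I v)) \<longleftrightarrow> clo (sub N (nA I ` {k. k < ia I & rA k < rV v})) m) & (ALL j<ip I. m (nP I j) = init_mark I rV v j)" if v: "v < iv I"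
 proof (intro exI conjI allI impI)
  let ?X = "{w. (nV I v, w) : edges s & R (Inr w) < rV v}"
  show "just N s {y. R y < R (Inr (nV I v))} (Inr (nV I v)) \<longleftrightarrow> clo (sub N (nA I ` {k. k < ia I & rA k < rV v}))
   (%p. the (mark s (nV I v)) p + (SUM w:?X. the (label s (nV I v, w)) p))" using rV v by (simp add: a)
  fix j assume j: "j < ip I"
  have "?X = nV I ` {u. u < iv I & par I u = v & rV u < rV v}"
  proof (intro equalityI subsetI)
   have ed: "(nV I v, nV I u) : edges s \<longleftrightarrow> par I u = v" if "u < iv I" for u using r v that by (simp add: repr_def)
   show "w : nV I ` {u. u < iv I & par I u = v & rV u < rV v}" if w: "w : ?X" for w
   proof -
    have "w : verts s" using w state_edges[OF s] by auto
    then obtain u where "u < iv I" "w = nV I u" using enumD(4)[OF e(2)] by blast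
    then show ?thesis using w ed rV by auto
   qed
   show "w : ?X" if "w : nV I ` {u. u < iv I & par I u = v & rV u < rV v}" for w using that ed rV by auto
  qed
  moreover have "inj_on (nV I) {u. u < iv I & par I u = v & rV u < rV v}" by (rule inj_on_subset[OF enumD(1)[OF e(2)]]) auto
  ultimately have "(SUM w:?X. the (label s (nV I v, w)) (nP I j)) = (SUM u | u < iv I & par I u = v & rV u < rV v. the (label s (nV I v, nV I u)) (nP I j))"
   by (simp add: sum.reindex)
  also have "... = (SUM u | u < iv I & par I u = v & rV u < rV v. wpa I (la I u) j)"
   using r v j unfolding repr_def by (intro sum.cong refl) (force simp: split: option.splits)
  also have "... = (SUM u<iv I. if par I u = v & rV u < rV v then wpa I (la I u) j else 0)"
   by (simp add: sum.inter_filter[symmetric] lessThan_def conj_ac)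
  finally show "the (mark s (nV I v)) (nP I j) + (SUM w:?X. the (label s (nV I v, w)) (nP I j)) = init_mark I rV v j"
   using r v j by (simp add: init_mark_def repr_def)
 qed
qed

text \<open>The condition on \<open>c\<close>: a thread starts with its own entry of at most
  \<open>w\<close> plus at most \<open>iv I\<close> labels from its children, and a covering path of
  Rackoff's length adds at most \<open>w\<close> per step.\<close>

theorem goodc_iff:
 assumes r: "repr I N s" and N: "is_rpn N" and s: "is_state N s" and B: "c ^ ip I <= B"
  and w: "!!i j. i < ie I ==> j < ip I ==> wme I i j <= w & wpe I i j <= w"
   "!!i j. i < ia I ==> j < ip I ==> wma I i j <= w & wpa I i j <= w & oma I i j <= w" "!!i j. i < ic I ==> j < ip I ==> wmc I i j <= w"
   "!!v j. v < iv I ==> j < ip I ==> mkr I v j <= w"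
  and c: "(iv I + 1) * w + rackoff w (ip I) * w < c"
 shows "goodc I rA rV c B ==> good N s"
  "good N s ==> EX rA rV. (ALL i. rA i <= ia I + iv I & rV i <= ia I + iv I) & (ALL i>=ia I. rA i = 0) & (ALL i>=iv I. rV i = 0) & goodc I rA rV c B"
proof -
 have e: "enum (abs_trans N) (nA I) (ia I)" "enum (verts s) (nV I) (iv I)" using r by (simp_all add: repr_def)
 have ed: "(nV I v, nV I u) : edges s \<longleftrightarrow> par I u = v" if "u < iv I" "v < iv I" for u v using r that by (simp add: repr_def)
 have ws: "wfs s" using s by (auto simp: is_state_def wfs_def)
 have root: "is_root s (nV I v) \<longleftrightarrow> iv I <= par I v" if "v < iv I" for v
 proof -
  have "is_root s (nV I v) \<longleftrightarrow> (ALL u<iv I. (nV I u, nV I v) ~: edges s)"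
   using state_edges[OF s] enumD(2)[OF e(2) that] enumD(4)[OF e(2)] unfolding is_root_def by blast
  then show ?thesis using ed[OF that] by (metis not_le order_less_irrefl)
 qed
 have empty: "s = empty_state \<longleftrightarrow> iv I = 0"
 using e(2) ws by (auto simp: enum_def wfs_def rooted_tree_def)
 have card: "card (items N s) = ia I + iv I"
 proof -
  have "card (abs_trans N) = ia I" "card (verts s) = iv I"
   using e card_image[OF enumD(1)[OF e(1)]] card_image[OF enumD(1)[OF e(2)]] by (simp_all add: enum_def)
  moreover have "card (items N s) = card (Inl ` abs_trans N :: (nat + nat) set) + card (Inr ` verts s :: (nat + nat) set)"
   unfolding items_def using e[THEN enumD(3)] by (intro card_Un_disjoint) auto
  ultimately show ?thesis by (simp add: card_image)
 qed
 have fin: "finite (items N s)" using e[THEN enumD(3)] by (simp add: items_def)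
 have items: "x : items N s \<longleftrightarrow> (EX i<ia I. x = Inl (nA I i)) | (EX v<iv I. x = Inr (nV I v))" for x
 using e by (auto simp: items_def enum_def)
 have om: "Omega N (nA I i) (nP I j) = oma I i j" if "i < ia I" "j < ip I" for i j using r that by (simp add: repr_def)
 have im: "init_mark I rV v j <= (iv I + 1) * w" if "v < iv I" "j < ip I" for rV v j
 proof -
  have "la I u < ia I" if "u < iv I" "par I u = v" for u using r that \<open>v < iv I\<close> by (auto simp: repr_def)
  then have "(SUM u<iv I. if par I u = v & rV u < rV v then wpa I (la I u) j else 0) <= of_nat (card {..<iv I}) * w"
   using w(2)[OF _ that(2)] by (intro sum_bounded_above) auto
  then show ?thesis using w(4)[OF that] by (simp add: init_mark_def)
 qed
 note cs = covers_sound[OF r N refl]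
 have cc: "covers I rA c B b f" if clo: "clo (sub N (nA I ` {k. k < ia I & rA k < b})) m" and m: "!!j. j < ip I ==> m (nP I j) = f j"
  and f: "!!j. j < ip I ==> f j <= (iv I + 1) * w" for rA b m f
 proof (rule covers_complete[OF r N refl clo m w(1) _ w(3) _ _ B])
  show "f j + rackoff w (ip I) * w < c" if "j < ip I" for j using f[OF that] c by linarith
 qed (use w(2) c in simp_all)
 show "good N s" if g: "goodc I rA rV c B"
 proof (cases "iv I = 0")
  case False
  define R where "R x = (case x of Inl t => rA (inv_into {..<ia I} (nA I) t) | Inr v => rV (inv_into {..<iv I} (nV I) v))" for x
  have R: "ALL i<ia I. R (Inl (nA I i)) = rA i" using inv_into_f_f[OF enumD(1)[OF e(1)]] by (simp add: R_def)
  have R': "ALL v<iv I. R (Inr (nV I v)) = rV v" using inv_into_f_f[OF enumD(1)[OF e(2)]] by (simp add: R_def)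
  note j = just_repr[OF r s, of R rA rV, OF R R']
  obtain v where v: "v < iv I" "iv I <= par I v" "rV v < ia I + iv I" using g False unfolding goodc_def by blast
  have "ranked N s R (ia I + iv I)"
   unfolding ranked_def
  proof (intro ballI impI)
   fix x assume x: "x : items N s" "R x < ia I + iv I"
   then consider i where "i < ia I" "x = Inl (nA I i)" | u where "u < iv I" "x = Inr (nV I u)" unfolding items by blast
   then show "just N s {y. R y < R x} x"
   proof cases
    case (1 i)
    then have "covers I rA c B (rA i) (oma I i)" using g False x(2) R by (simp add: goodc_def)
    from cs[OF this, of "Omega N (nA I i)"] show ?thesis using j(1)[OF 1(1)] om 1 by simp
   next
    case (2 u)
    then have "covers I rA c B (rV u) (init_mark I rV u)" using g False x(2) R' by (simp add: goodc_def)
    from cs[OF this] show ?thesis using j(2)[OF 2(1)] 2(2) by blast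
   qed
  qed
  from ranked_sound[OF ws this, of "Inr (nV I v)"] have "cl N s (nV I v)" using v items R' by auto
  then show ?thesis using root[OF v(1)] v(2) unfolding good_def by blast
 qed (simp add: empty good_def)
 assume "good N s"
 show "EX rA rV. (ALL i. rA i <= ia I + iv I & rV i <= ia I + iv I) & (ALL i>=ia I. rA i = 0) & (ALL i>=iv I. rV i = 0) & goodc I rA rV c B"
 proof (cases "iv I = 0")
  case True
  then show ?thesis by (intro exI[of _ "%_. 0"]) (simp add: goodc_def)
 next
  case False
  then obtain x where x: "is_root s x" "cl N s x" using \<open>good N s\<close> empty by (auto simp: good_def)
  then obtain v where v: "v < iv I" "x = nV I v" using enumD(4)[OF e(2)] by (auto simp: is_root_def)
  obtain R where R: "ranked N s R (ia I + iv I)" "!!x. R x <= ia I + iv I" "R (Inr x) < ia I + iv I"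
   using ranked_complete[OF ws fin x(2), unfolded card] by blast
  define rA where "rA i = (if i < ia I then R (Inl (nA I i)) else 0)" for i
  define rV where "rV i = (if i < iv I then R (Inr (nV I i)) else 0)" for i
  have RA: "ALL i<ia I. R (Inl (nA I i)) = rA i" and RV: "ALL v<iv I. R (Inr (nV I v)) = rV v" by (simp_all add: rA_def rV_def)
  note j = just_repr[OF r s RA RV]
  have "goodc I rA rV c B"
   unfolding goodc_def
  proof (intro disjI2 conjI allI impI)
   show "EX v<iv I. iv I <= par I v & rV v < ia I + iv I" using v R(3) x(1) root by (auto simp: rV_def)
   fix i
   show "covers I rA c B (rA i) (oma I i)" if "i < ia I" "rA i < ia I + iv I"
   proof -
    have "Inl (nA I i) : items N s" using items that(1) by blast
    then have "just N s {y. R y < R (Inl (nA I i))} (Inl (nA I i))" using R(1) that \<open>Inl (nA I i) : items N s\<close> by (simp add: ranked_def rA_def del: just.simps)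
    then have "clo (sub N (nA I ` {k. k < ia I & rA k < rA i})) (Omega N (nA I i))" using j(1)[OF that(1)] by simp
    from cc[OF this] show ?thesis using om w(2) that(1) by (simp add: trans_le_add1)
   qed
   show "covers I rA c B (rV i) (init_mark I rV i)" if "i < iv I" "rV i < ia I + iv I"
   proof -
    have "Inr (nV I i) : items N s" using items that(1) by blast
    then have "just N s {y. R y < R (Inr (nV I i))} (Inr (nV I i))" using R(1) that \<open>Inr (nV I i) : items N s\<close> by (simp add: ranked_def rV_def del: just.simps)
    then obtain m where m: "clo (sub N (nA I ` {k. k < ia I & rA k < rV i})) m" "ALL j<ip I. m (nP I j) = init_mark I rV i j"
     using j(2)[OF \<open>i < iv I\<close>] by blast
    from cc[OF m(1), of "init_mark I rV i"] show ?thesis using m(2) im that(1) by simp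
   qed
  qed
  then show ?thesis using R(2) by (intro exI[of _ rA] exI[of _ rV]) (simp add: rA_def rV_def)
 qed
qed

subsection \<open>Checking an instance\<close>

text \<open>The code of the word with code \<open>p\<close> extended by \<open>u\<close>, where 0
  means failure: the computation gives up once the code exceeds \<open>W\<close>. Words can thus be
  compared with the input while the accumulator stays bounded.\<close>

definition mt :: "nat => bool list => nat => nat" where
 "mt W u p = foldl (%p b. if p ~= 0 & 2 * p + of_bool b <= W then 2 * p + of_bool b else 0) p u"

lemma mt_simps [simp]: "mt W [] p = p" "mt W (u @ v) p = mt W v (mt W u p)"
 "mt W [b] p = (if p ~= 0 & 2 * p + of_bool b <= W then 2 * p + of_bool b else 0)"
 by (simp_all add: mt_def)

lemma wcode_simps: "wcode [] = 1" "0 < wcode u"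
using wcode_bounds[of u] by (auto simp: wcode_def)

lemma mt_wcode: "0 < W ==> mt W u 1 = (if wcode u <= W then wcode u else 0)"
by (induction u rule: rev_induct; (simp add: wcode_snoc wcode_simps)?)

lemma wcode_inject: "wcode u = wcode v \<longleftrightarrow> u = v"
proof (induction u arbitrary: v rule: rev_induct)
 have nz: "wcode (u @ [b]) ~= 1" for u b using wcode_simps(2)[of u] by (cases b) (simp_all add: wcode_snoc)
 case Nil
 show ?case using nz by (cases v rule: rev_exhaust) (simp_all add: wcode_simps(1), metis)
next
 case (snoc a u)
 have nz: "wcode (u @ [b]) ~= 1" for u b using wcode_simps(2)[of u] by (cases b) (simp_all add: wcode_snoc)
 have "2 * x + of_bool a = 2 * y + of_bool b \<longleftrightarrow> x = y & (a \<longleftrightarrow> b)" for x y :: nat and b by (cases a; cases b) (simp_all; presburger)+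
 then show ?case using snoc nz[of u a]
  by (cases v rule: rev_exhaust) (simp_all add: wcode_snoc wcode_simps(1))
qed

text \<open>The analogue of \<open>LO\<close> for recognition instead of output: a described word is
  accessible only by running it through the bounded matcher.\<close>

definition LM :: "(nat list => bool list) => bool" where
 "LM F \<longleftrightarrow> (ALL W p. LS W --> LS p --> LS (%e. mt (W e) (F e) (p e)))"

named_theorems LM_intro

lemma LS_mt: "LS W ==> LM F ==> LS p ==> LS (%e. mt (W e) (F e) (p e))"
 by (simp add: LM_def)

lemma LM_Nil [LM_intro]: "LM (%e. [])"
 by (simp add: LM_def)

lemma LM_single [LM_intro]: "LM (%e. [b])"
 unfolding LM_def mt_simps by (intro allI impI LS_intro)

lemma LM_append [LM_intro]: "LM F ==> LM G ==> LM (%e. F e @ G e)"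
 unfolding LM_def mt_simps by blast

lemma LM_Cons [LM_intro]: "LM F ==> LM (%e. b # F e)"
 using LM_append[OF LM_single, of F b] by simp

lemma LM_if [LM_intro]: "LSP P ==> LM F ==> LM G ==> LM (%e. if P e then F e else G e)"
 unfolding LM_def by (simp add: if_distrib[of "%u. mt _ u _"] LS_If)

text \<open>The environment of the body has two more entries in front, the accumulator and the loop variable.\<close>

lemma LM_for [LM_intro]:
 assumes n: "LS n" and F: "LM (%e. F (hd (tl e)) (tl (tl e)))"
 shows "LM (%e. concat (map (%i. F i e) [0..<n e]))"
 unfolding LM_def
proof (intro allI impI)
 fix W p assume W: "LS W" and p: "LS p"
 have r: "rec_nat q (%i r. mt w (F i e) r) m = mt w (concat (map (%i. F i e) [0..<m])) q" for w q m e
  by (induction m) simp_all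
 have le: "mt w u q <= w + q" for w u q by (induction u rule: rev_induct) simp_all
 have "LS (%e. mt (W (tl (tl e))) (F (hd (tl e)) (tl (tl e))) (hd e))"
  using F LS_tl2[OF W] LS_hd unfolding LM_def by blast
 then have "LS (%e. rec_nat (p e) (%i r. mt (W e) (F i e) r) (n e))"
  by (intro LS_rec[where h = "%r i e. mt (W e) (F i e) r" and B = "%e. W e + p e"] n p)
   (simp_all add: r le pb_add LS_pb W p)
 then show "LS (%e. mt (W e) (concat (map (%i. F i e) [0..<n e])) (p e))" by (simp only: r)
qed

lemma LM_enc_nat [LM_intro]: assumes "LS f" shows "LM (%e. enc_nat (f e))"
 unfolding enc_nat_for by (intro LM_intro LS_intro assms LS_tl[OF assms] LS_tl2[OF assms])

lemma LM_rows [LM_intro]: "LS k ==> LM (%e. F (hd (tl e)) (tl (tl e))) ==> LM (%e. rows (k e) (%j. F j e))"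
 unfolding rows_def by (intro LM_intro)

lemma LS_ar [LS_intro]: "LS b ==> LS Z ==> LS i ==> LS j ==> LS (%e. ar (b e) (Z e) k (i e) (j e))"
 unfolding ar_def by (intro LS_intro)

definition inst_of :: "nat => nat => inst" where
 "inst_of b Z = instF (ar b Z)"

lemma inst_of_simps: "ip (inst_of b Z) = ar b Z 0 0 0" "ie (inst_of b Z) = ar b Z 1 0 0" "ia (inst_of b Z) = ar b Z 2 0 0"
 "ic (inst_of b Z) = ar b Z 3 0 0" "iv (inst_of b Z) = ar b Z 4 0 0"
 "nP (inst_of b Z) = (%i. ar b Z 5 i 0)" "nE (inst_of b Z) = (%i. ar b Z 6 i 0)" "nA (inst_of b Z) = (%i. ar b Z 7 i 0)"
 "nC (inst_of b Z) = (%i. ar b Z 8 i 0)" "nV (inst_of b Z) = (%i. ar b Z 9 i 0)"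
 "wme (inst_of b Z) = (%i j. ar b Z 10 i j)" "wpe (inst_of b Z) = (%i j. ar b Z 11 i j)" "wma (inst_of b Z) = (%i j. ar b Z 12 i j)"
 "wpa (inst_of b Z) = (%i j. ar b Z 13 i j)" "oma (inst_of b Z) = (%i j. ar b Z 14 i j)" "wmc (inst_of b Z) = (%i j. ar b Z 15 i j)"
 "mkr (inst_of b Z) = (%i j. ar b Z 16 i j)" "par (inst_of b Z) = (%i. ar b Z 17 i 0)" "la (inst_of b Z) = (%i. ar b Z 18 i 0)"
 "dep (inst_of b Z) = (%i. ar b Z 19 i 0)"
 by (simp_all add: inst_of_def instF_def)

text \<open>\<open>SAV\<close> hands a single number to its edge relation, so the array base, the
  tables, the digit base of markings and the rank bound are packed into \<open>v\<close>.\<close>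

definition tedge :: "nat => nat => nat => bool" where
 "tedge x y v \<longleftrightarrow> edge (inst_of (tget 0 v) (tget 1 v)) (%i. ar (tget 0 v) (tget 1 v) 20 i 0) (tget 2 v) (tget 3 v) x y"

lemma LSP_tedge: "LSP (%e. tedge (hd (tl (tl e))) (hd (tl e)) (hd e))"
 unfolding tedge_def edge_def inst_of_simps by (intro LS_intro LS_tget)

definition lg :: "nat => nat" where
 "lg c = (SUM x<c. if c div 2 ^ x = 0 then 0 else 1)"

text \<open>A power is not polynomially bounded in its base and exponent, so the recursion stops
  growing at \<open>D\<close>; powers up to \<open>D\<close> come out exactly.\<close>

definition cpow :: "nat => nat => nat => nat" where
 "cpow D c n = rec_nat 1 (%i r. if r * c <= D then r * c else r) n"

lemma cpow: "1 <= c ==> c ^ n <= D ==> cpow D c n = c ^ n"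
proof (induction n)
 case (Suc n)
 have "c ^ n * 1 <= c ^ n * c" using Suc.prems by (intro mult_left_mono) auto
 then have "c ^ n <= D" using Suc.prems(2) by (simp only: mult_1_right power_Suc2)
 then have "cpow D c n = c ^ n" using Suc by simp
 then show ?case using Suc.prems(2) by (simp add: cpow_def mult.commute)
qed (simp add: cpow_def)

lemma LS_cpow: assumes "LS D" "LS c" "LS n" shows "LS (%e. cpow (D e) (c e) (n e))"
proof -
 have "cpow d a i <= d + 1" for d a i by (induction i) (auto simp: cpow_def)
 then show ?thesis unfolding cpow_def
  by (intro LS_rec[where h = "%r i e. if r * c e <= D e then r * c e else r" and B = "%e. D e + 1"])
   (use assms in "auto intro!: LS_intro LS_tl2 pb_add pb_const LS_pb simp del: add_0_right add_Suc_right")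
qed

definition covS :: "nat => nat => nat => nat => nat => nat => nat => (nat => nat) => bool" where
 "covS D H B b Z c rg f \<longleftrightarrow> (EX x<B. (ALL j<ip (inst_of b Z). dg c x j = f j) &
  (EX y<B. stops (inst_of b Z) c y & SAV tedge (tcode [B, H, D, x, y, tcode [b, Z, c, rg]])))"

lemma covS_iff: "B * B <= 2 ^ H ==> sbound B H <= D ==> covS D H B b Z c rg f \<longleftrightarrow> covers (inst_of b Z) (%i. ar b Z 20 i 0) c B rg f"
 using SAV_correct[of _ B _ H D tedge "tcode [b, Z, c, rg]"] unfolding covS_def covers_def
 by (simp add: tedge_def tget_tcode cong: conj_cong)

definition goodS :: "nat => nat => nat => nat => nat => nat => bool" where
 "goodS D H B b Z c \<longleftrightarrow> (let I = inst_of b Z; rA = %i. ar b Z 20 i 0; rV = %i. ar b Z 21 i 0 in iv I = 0 |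
  (EX v<iv I. iv I <= par I v & rV v < ia I + iv I) &
  (ALL i<ia I. rA i < ia I + iv I --> covS D H B b Z c (rA i) (oma I i)) &
  (ALL v<iv I. rV v < ia I + iv I --> covS D H B b Z c (rV v) (init_mark I rV v)))"

lemma goodS_iff: "B * B <= 2 ^ H ==> sbound B H <= D ==>
  goodS D H B b Z c \<longleftrightarrow> goodc (inst_of b Z) (%i. ar b Z 20 i 0) (%i. ar b Z 21 i 0) c B"
 by (simp add: goodS_def goodc_def covS_iff Let_def)



text \<open>\<open>W\<close> is the code of the word and also the base of the arrays, since all
  entries are smaller than it. Markings of at most \<open>n\<close> places with entries below
  \<open>c\<close> are numbers below \<open>c ^ n\<close>; as \<open>lg c\<close> is the binary
  length of \<open>c\<close>, \<open>2 ^ (2 * n * lg c)\<close> exceeds the number of their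
  pairs.\<close>

definition decide :: "nat => nat => nat => nat => bool" where
 "decide D c n W \<longleftrightarrow> (EX Z<D. valid (inst_of W Z) & mt W (encI (inst_of W Z)) 1 = W & goodS D (2 * n * lg c) (cpow D c n) W Z c)"

lemma LSP_decide: "LSP (%e. decide (hd e) (hd (tl e)) (hd (tl (tl e))) (hd (tl (tl (tl e)))))"
 unfolding decide_def valid_def incr_def disj_def encI_def encE_def[abs_def] encA_def[abs_def] encC_def[abs_def] encV_def[abs_def] vecI_def goodS_def covS_def stops_def init_mark_def inst_of_simps Let_def tcode.simps lg_def
 by (intro LS_intro LM_intro LS_mt LS_cpow LSP_SAV[OF LSP_tedge])

lemma lg_two_power: "lg (2 ^ k) = k + 1"
proof -
 have "(2::nat) ^ k div 2 ^ x = 0 \<longleftrightarrow> ~ x <= k" for x by (simp add: div_eq_0_iff not_le)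
 then have "lg (2 ^ k) = (SUM x<2 ^ k. if x <= k then 1 else 0)" unfolding lg_def by (intro sum.cong) auto
 moreover have "(SUM x<m. if x <= k then 1 else 0) = min m (k + 1)" for m by (induction m) auto
 ultimately show ?thesis using less_two_power[of k] by simp
qed

text \<open>With a = n * 2^(n^3 + 64) the graph has 2^a nodes and the recursion depth is at most 4 *
  a, so states and running time are 2 to a constant times a^2. The exponent of a^2 is about 2 * n^3,
  which \<open>n ^ 4 + 160\<close> dominates for \<open>n\<close> at least 5.\<close>

lemma sbound_double_exp:
 assumes n: "5 <= n"
 shows "sbound ((2 ^ 2 ^ (n ^ 3 + 64)) ^ n) (2 * n * (2 ^ (n ^ 3 + 64) + 1)) <= 2 ^ 2 ^ (n ^ 4 + 160)"
proof -
 define a where "a = n * 2 ^ (n ^ 3 + 64)"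
 define H where "H = 2 * n * (2 ^ (n ^ 3 + 64) + 1)"
 have B: "((2::nat) ^ 2 ^ (n ^ 3 + 64)) ^ n = 2 ^ a" by (simp add: a_def power_mult[symmetric] mult.commute)
 have na: "n <= a" by (simp add: a_def)
 have H: "H = 2 * a + 2 * n" by (simp add: H_def a_def algebra_simps)
 have H4: "H <= 4 * a" using na unfolding H by simp
 have a1: "1 <= a" using na n by simp
 define x where "x = (3 * a + 1) * H + a + H + 2"
 have "qb (2 ^ a) = 2 ^ (a + a + a + 1)" by (simp add: qb_def power_add)
 also have "a + a + a + 1 = 3 * a + 1" by simp
 finally have "qb (2 ^ a) ^ H = 2 ^ ((3 * a + 1) * H)" by (simp only: power_mult)
 moreover have "(2::nat) ^ ((3 * a + 1) * H) <= 2 ^ x" "(2::nat) ^ a <= 2 ^ x" "(2::nat) ^ H <= 2 ^ x" "(2::nat) ^ 2 <= 2 ^ x"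
  unfolding x_def by (intro power_increasing; simp)+
 moreover have "H < 2 ^ H" by (rule less_two_power)
 moreover have "(4::nat) = 2 ^ 2" by simp
 ultimately have "qb (2 ^ a) ^ H + 2 ^ a + H + 4 <= 4 * 2 ^ x" by linarith
 then have "(qb (2 ^ a) ^ H + 2 ^ a + H + 4) ^ (4 ^ 5) <= (4 * 2 ^ x) ^ (4 ^ 5)" by (rule power_mono) simp
 also have "... = 2 ^ ((x + 2) * 1024)" by (simp add: power_mult power_add)
 finally have 1: "(qb (2 ^ a) ^ H + 2 ^ a + H + 4) ^ (4 ^ 5) <= 2 ^ ((x + 2) * 1024)" .
 have "(4 * 2 ^ a + 4 :: nat) <= 2 ^ (a + 3)" by (simp add: power_add)
 then have "(4 * 2 ^ a + 4 :: nat) ^ Suc H <= (2 ^ (a + 3)) ^ Suc H" by (rule power_mono) simp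
 then have 2: "(4 * 2 ^ a + 4 :: nat) ^ Suc H <= 2 ^ ((a + 3) * Suc H)" by (simp only: power_mult)
 have sum: "(2::nat) ^ u + 2 ^ v <= 2 ^ (u + v + 1)" for u v
 proof -
  have "(2::nat) ^ u <= 2 ^ (u + v)" "(2::nat) ^ v <= 2 ^ (u + v)" by (intro power_increasing; simp)+
  moreover have "(2::nat) ^ (u + v + 1) = 2 * 2 ^ (u + v)" by simp
  ultimately show ?thesis by linarith
 qed
 have "sbound (2 ^ a) H <= 2 ^ ((x + 2) * 1024) + 2 ^ ((a + 3) * Suc H)" unfolding sbound_def using 1 2 by (rule add_mono)
 also have "... <= 2 ^ ((x + 2) * 1024 + (a + 3) * Suc H + 1)" by (rule sum)
 also have "... <= 2 ^ 2 ^ (n ^ 4 + 160)"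
 proof (rule power_increasing)
  have aa: "a <= a * a" "1 <= a * a" using a1 by simp_all
  have "(3 * a + 1) * H <= (4 * a) * (4 * a)" using H4 a1 by (intro mult_mono) auto
  moreover have "(4 * a) * (4 * a) = 16 * (a * a)" "(4 * a) * (5 * a) = 20 * (a * a)" by simp_all
  ultimately have "x + 2 <= 25 * (a * a)" unfolding x_def using H4 aa by linarith
  moreover have "(a + 3) * Suc H <= (4 * a) * (5 * a)" using H4 a1 by (intro mult_mono) auto
  ultimately have "(x + 2) * 1024 + (a + 3) * Suc H + 1 <= 32768 * (a * a)"
  by (simp)
  also have "(32768 :: nat) = 2 ^ 15" by simp
  also have "a * a <= (2 ^ n * 2 ^ (n ^ 3 + 64)) * (2 ^ n * 2 ^ (n ^ 3 + 64))"
   unfolding a_def using less_two_power[of n] by (intro mult_mono) auto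
  also have "... = 2 ^ (2 * n ^ 3 + 2 * n + 128)" by (simp add: power_add[symmetric] del: power_Suc)
  also have "(2::nat) ^ 15 * 2 ^ (2 * n ^ 3 + 2 * n + 128) = 2 ^ (2 * n ^ 3 + 2 * n + 143)" by (simp only: power_add[symmetric]) simp
  also have "... <= 2 ^ (n ^ 4 + 160)"
  proof (rule power_increasing)
   have "5 * n ^ 3 <= n * n ^ 3" using n by (rule mult_right_mono) simp
   moreover have "n ^ 4 = n * n ^ 3" by (simp add: eval_nat_numeral)
   moreover have "n <= n ^ 3" using n by (intro self_le_power) auto
   ultimately show "2 * n ^ 3 + 2 * n + 143 <= n ^ 4 + 160" by linarith
  qed simp
  finally show "(x + 2) * 1024 + (a + 3) * Suc H + 1 <= 2 ^ (n ^ 4 + 160)" by simp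
 qed simp
 finally show ?thesis unfolding B H_def .
qed

lemma inst_digits:
 assumes I: "ip I < b" "ie I < b" "ia I < b" "ic I < b" "iv I < b"
  and "ALL f : {nP I, nE I, nA I, nC I, nV I, par I, la I, dep I, rA, rV}. ALL i. f i < b & (b <= i --> f i = 0)"
  and "ALL g : {wme I, wpe I, wma I, wpa I, oma I, wmc I, mkr I}. ALL i j. g i j < b & (b <= i | b <= j --> g i j = 0)"
 obtains Z where "Z < b ^ (22 * b * b)" "inst_of b Z = I" "(%i. ar b Z 20 i 0) = rA" "(%i. ar b Z 21 i 0) = rV"
proof -
 define c0 where "c0 x i j = (if i = 0 & j = 0 then x else 0)" for x i j :: nat
 define c1 where "c1 f i j = (if j = 0 then f i else 0)" for f :: "nat => nat" and i j :: nat
 define fs where "fs = [c0 (ip I), c0 (ie I), c0 (ia I), c0 (ic I), c0 (iv I), c1 (nP I), c1 (nE I), c1 (nA I), c1 (nC I), c1 (nV I),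
  wme I, wpe I, wma I, wpa I, oma I, wmc I, mkr I, c1 (par I), c1 (la I), c1 (dep I), c1 rA, c1 rV]"
 have "ALL f : set fs. ALL i j. f i j < b & (b <= i | b <= j --> f i j = 0)"
  using assms by (simp add: fs_def c0_def c1_def)
 moreover have "fs ! k : set fs" if "k < 22" for k by (rule nth_mem) (use that in "simp add: fs_def")
 ultimately obtain Z where Z: "Z < b ^ (22 * b * b)" "!!k. k < 22 ==> ar b Z k = fs ! k"
  using ar_ex[of 22 "%k. fs ! k" b] by blast
 have "inst_of b Z = I" unfolding inst_of_def instF_def by (cases I) (simp add: Z(2) fs_def c0_def c1_def)
 moreover have "(%i. ar b Z 20 i 0) = rA" "(%i. ar b Z 21 i 0) = rV" by (simp_all add: Z(2) fs_def c1_def)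
 ultimately show thesis using that Z(1) by blast
qed

text \<open>The exponent \<open>n ^ 3 + 64\<close> exceeds the one in Rackoff's bound, which is
  about (n + 3)^2, and \<open>n ^ 4 + 160\<close> provides for Savitch's machine and for the search
  over \<open>Z\<close>. Estimates that need \<open>n\<close> to be at least 5 are made only for
  words that encode an instance, and these have at least 5 letters.\<close>

lemma cut_problem_decide:
 "w : cut_problem \<longleftrightarrow> decide (2 ^ 2 ^ (length w ^ 4 + 160)) (2 ^ 2 ^ (length w ^ 3 + 64)) (length w) (wcode w)"
proof -
 define n where "n = length w"
 define W where "W = wcode w"
 define D c :: nat where "D = 2 ^ 2 ^ (n ^ 4 + 160)" and "c = 2 ^ 2 ^ (n ^ 3 + 64)"
 \<comment> \<open>A common bound for all weights and markings that can be written within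
   \<open>n\<close> letters.\<close>
 define u :: nat where "u = 2 ^ n - 1"
 have W: "2 ^ n <= W" "W < 2 ^ Suc n" using wcode_bounds[of w] by (simp_all add: W_def n_def)
 have W0: "0 < W" using wcode_simps(2) by (simp add: W_def)
 have enc: "mt W v 1 = W \<longleftrightarrow> v = w" for v using mt_wcode[OF W0, of v] wcode_inject[of v w] W0 by (auto simp: W_def)
 \<comment> \<open>The parameter \<open>D\<close> has to exceed the code of every possible guess: 22
   arrays with \<open>W\<close> rows and columns and digits below \<open>W\<close>.\<close>
 have Zb: "W ^ (22 * W * W) <= D"
 proof -
  have "W ^ (22 * W * W) <= (2 ^ Suc n) ^ (22 * W * W)" using W(2) by (intro power_mono) auto
  also have "... = 2 ^ (Suc n * (22 * W * W))" by (simp only: power_mult)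
  also have "... <= 2 ^ 2 ^ (n ^ 4 + 160)"
  proof (rule power_increasing)
   have "Suc n * (22 * W * W) <= 2 ^ n * (2 ^ 5 * 2 ^ Suc n * 2 ^ Suc n)"
    using W(2) by (intro mult_mono Suc_leI less_two_power) auto
   also have "... = 2 ^ (3 * n + 7)" by (simp only: power_add[symmetric]) (simp add: algebra_simps)
   also have "... <= 2 ^ (n ^ 4 + 160)"
   proof (rule power_increasing)
    have "3 * n <= n ^ 4 + 150"
    proof (cases "n <= 50")
     case False
     then have "3 * n <= n ^ 3 * n" by (intro mult_right_mono order_trans[OF _ self_le_power]) auto
     then show ?thesis by (simp add: eval_nat_numeral mult_ac)
    qed simp
    then show "3 * n + 7 <= n ^ 4 + 160" by simp
   qed simp
   finally show "Suc n * (22 * W * W) <= 2 ^ (n ^ 4 + 160)" .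
  qed simp
  finally show ?thesis by (simp add: D_def)
 qed
 have key: "cpow D c n = c ^ n" "goodS D (2 * n * lg c) (c ^ n) W Z c = goodc (inst_of W Z) (%i. ar W Z 20 i 0) (%i. ar W Z 21 i 0) c (c ^ n)"
  "c ^ ip I <= c ^ n" "(iv I + 1) * u + rackoff u (ip I) * u < c" if n: "n = length (encI I)" for I Z
 proof -
  have n5: "5 <= n" "ip I <= n" "iv I + 1 <= n" using encI_bounds(1)[OF n] by linarith+
  have sb: "sbound (c ^ n) (2 * n * lg c) <= D" using sbound_double_exp[OF n5(1)] by (simp add: c_def D_def lg_two_power)
  have "4 * c ^ n + 4 <= (4 * c ^ n + 4) ^ Suc (2 * n * lg c)" by (rule self_le_power) simp_all
  then have "c ^ n <= D" using sb unfolding sbound_def by linarith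
  then show "cpow D c n = c ^ n" by (intro cpow) (simp_all add: c_def)
  have "c ^ n * c ^ n = 2 ^ (2 * n * 2 ^ (n ^ 3 + 64))" by (simp add: c_def power_mult[symmetric] power_add[symmetric] mult_ac)
  also have "... <= 2 ^ (2 * n * lg c)" by (rule power_increasing) (simp_all add: c_def lg_two_power)
  finally show "goodS D (2 * n * lg c) (c ^ n) W Z c = goodc (inst_of W Z) (%i. ar W Z 20 i 0) (%i. ar W Z 21 i 0) c (c ^ n)"
   using sb by (rule goodS_iff)
  show "c ^ ip I <= c ^ n" using n5(2) by (intro power_increasing) (simp_all add: c_def)
  have u: "u < 2 ^ n" by (simp add: u_def)
  let ?q = "(n + 3) * (n + 3)"
  have "(iv I + 1) * u + rackoff u (ip I) * u <= 2 ^ n * 2 ^ n + 2 ^ 2 ^ ?q * 2 ^ n"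
   using rackoff_double_exp[OF n5(2) u] u order_trans[OF n5(3) less_imp_le[OF less_two_power]] by (intro add_mono mult_mono) auto
  also have "... < 2 ^ 2 ^ (n ^ 3 + 64)"
  proof -
   have "n <= ?q" by (simp add: algebra_simps)
   then have nq: "n < 2 ^ ?q" by (rule le_less_trans[OF _ less_two_power])
   have "2 ^ n * 2 ^ n + 2 ^ 2 ^ ?q * 2 ^ n < (2 ^ (2 * 2 ^ ?q) + 2 ^ (2 * 2 ^ ?q) :: nat)"
    unfolding power_add[symmetric] using nq by (intro add_less_le_mono power_strict_increasing power_increasing) auto
   also have "... = 2 ^ (2 * 2 ^ ?q + 1)" by simp
   also have "... <= 2 ^ 2 ^ (n ^ 3 + 64)"
   proof (rule power_increasing)
    have "5 * n <= n * n" "5 * (n * n) <= n * (n * n)" using n5(1) by (intro mult_right_mono; simp)+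
    moreover have "n ^ 3 = n * (n * n)" "?q = n * n + 6 * n + 9" by (simp_all add: eval_nat_numeral algebra_simps)
    ultimately have "?q + 2 <= n ^ 3 + 64" by linarith
    then have "(2::nat) ^ (?q + 2) <= 2 ^ (n ^ 3 + 64)" by (rule power_increasing) simp
    moreover have "(2::nat) ^ (?q + 2) = 4 * 2 ^ ?q" "1 <= (2::nat) ^ ?q" by simp_all
    ultimately show "2 * 2 ^ ?q + 1 <= (2::nat) ^ (n ^ 3 + 64)" by linarith
   qed simp
   finally show ?thesis .
  qed
  finally show "(iv I + 1) * u + rackoff u (ip I) * u < c" by (simp add: c_def)
 qed
 have le_u: "x <= u" if "x < 2 ^ n" for x using that by (simp add: u_def)
 have wu: "i < ie I ==> j < ip I ==> wme I i j <= u & wpe I i j <= u"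
   "i < ia I ==> j < ip I ==> wma I i j <= u & wpa I i j <= u & oma I i j <= u"
   "i < ic I ==> j < ip I ==> wmc I i j <= u" "i < iv I ==> j < ip I ==> mkr I i j <= u" if n: "n = length (encI I)" for I i j
  using encI_bounds(7-10)[OF n] by (simp_all add: le_u)
 note good = goodc_iff[where c = c and B = "c ^ n" and w = u]
 show ?thesis unfolding n_def[symmetric] W_def[symmetric] D_def[symmetric] c_def[symmetric]
 proof
  assume "decide D c n W"
  then obtain Z where Z: "valid (inst_of W Z)" "encI (inst_of W Z) = w" "goodS D (2 * n * lg c) (cpow D c n) W Z c"
   unfolding decide_def enc by blast
  obtain N s where N: "is_rpn N" "is_state N s" "repr (inst_of W Z) N s" using valid_repr[OF Z(1)] by blast
  have n: "n = length (encI (inst_of W Z))" using Z(2) by (simp add: n_def)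
  have "goodc (inst_of W Z) (%i. ar W Z 20 i 0) (%i. ar W Z 21 i 0) c (c ^ n)" using Z(3) by (simp only: key(1,2)[OF n])
  then have "good N s"
   by (rule good(1)[OF N(3,1,2) key(3)[OF n] _ _ _ _ key(4)[OF n], rotated 4]) (use wu[OF n] in simp_all)
  then have "EX sg. firing_sequence N s sg empty_state" using cut_iff_good[OF infinite_UNIV_nat N(2)] by simp
  moreover have "w = enc_marked_rpn N s" using enc_repr[OF N(3,2)] Z(2) by simp
  ultimately show "w : cut_problem" using N unfolding cut_problem_def by blast
 next
  assume "w : cut_problem"
  then obtain N s where N: "w = enc_marked_rpn N s" "is_rpn N" "is_state N s" "EX sg. firing_sequence N s sg empty_state"
   unfolding cut_problem_def by blast
  from N(4) have g: "good N s" using cut_iff_good[OF infinite_UNIV_nat N(3)] by simp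
  obtain I where r: "repr I N s" "valid I" "tight I" by (rule repr_ex[OF N(2,3)])
  note z = r(3)[unfolded tight_def]
  have wI: "encI I = w" using enc_repr[OF r(1) N(3)] N(1) by simp
  then have n: "n = length (encI I)" by (simp add: n_def)
  note b = encI_bounds[OF n]
  from g have "EX rA rV. (ALL i. rA i <= ia I + iv I & rV i <= ia I + iv I) & (ALL i>=ia I. rA i = 0) & (ALL i>=iv I. rV i = 0) & goodc I rA rV c (c ^ n)"
   by (rule good(2)[OF r(1) N(2,3) key(3)[OF n] _ _ _ _ key(4)[OF n], rotated 4]) (use wu[OF n] in simp_all)
  then obtain rA rV where
   R: "!!i. rA i <= ia I + iv I & rV i <= ia I + iv I" "!!i. ia I <= i ==> rA i = 0" "!!i. iv I <= i ==> rV i = 0" "goodc I rA rV c (c ^ n)"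
   by blast
  have nW: "n < W" using less_two_power[of n] W(1) by linarith
  have lt: "x < W" if "x < 2 ^ n" for x using that W(1) by linarith
  have i: "W <= i ==> ip I <= i & ie I <= i & ia I <= i & ic I <= i & iv I <= i" for i using b(1) nW by linarith
  have "nP I i < W" "nE I i < W" "nA I i < W" "nC I i < W" "nV I i < W" for i
   using lt[OF b(2)] lt[OF b(3)] lt[OF b(4)] lt[OF b(5)] lt[OF b(6)] z W0 by (metis not_le)+
  moreover have "par I i < W" "la I i < W" "dep I i < W" "rA i < W" "rV i < W" for i
  proof -
   have "par I i <= iv I & dep I i <= iv I & la I i <= ia I" using z[THEN conjunct2] by blast
   then show "par I i < W" "la I i < W" "dep I i < W" "rA i < W" "rV i < W" using R(1)[of i] b(1) nW by linarith+
  qed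
  moreover have "wme I i j < W & wpe I i j < W" for i j
   using b(7)[of i j] z lt W0 by (cases "i < ie I & j < ip I") (auto simp: not_less)
  moreover have "wma I i j < W & wpa I i j < W & oma I i j < W" for i j
   using b(8)[of i j] z lt W0 by (cases "i < ia I & j < ip I") (auto simp: not_less)
  moreover have "wmc I i j < W" for i j
   using b(9)[of i j] z lt W0 by (cases "i < ic I & j < ip I") (auto simp: not_less)
  moreover have "mkr I i j < W" for i j
   using b(10)[of i j] z lt W0 by (cases "i < iv I & j < ip I") (auto simp: not_less)
  ultimately obtain Z where Z: "Z < W ^ (22 * W * W)" "inst_of W Z = I" "(%i. ar W Z 20 i 0) = rA" "(%i. ar W Z 21 i 0) = rV"
   using b(1) nW by - (rule inst_digits[of I W rA rV]; (linarith | simp add: z R(2,3) i))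
  have "goodS D (2 * n * lg c) (cpow D c n) W Z c" using R(4) by (simp only: key(1,2)[OF n] Z(2-4))
  then show "decide D c n W" unfolding decide_def enc using Z(1,2) Zb r(2) wI by (intro exI[of _ Z]) simp
 qed
qed

theorem cut_problem_EXPSPACE: "cut_problem : EXPSPACE"
proof (rule EXPSPACE_I[OF LSP_decide])
 show "w : cut_problem \<longleftrightarrow> decide (hd [2 ^ 2 ^ (length w ^ 4 + 160), 2 ^ 2 ^ (length w ^ 3 + 64), length w, wcode w])
  (hd (tl [2 ^ 2 ^ (length w ^ 4 + 160), 2 ^ 2 ^ (length w ^ 3 + 64), length w, wcode w]))
  (hd (tl (tl [2 ^ 2 ^ (length w ^ 4 + 160), 2 ^ 2 ^ (length w ^ 3 + 64), length w, wcode w])))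
  (hd (tl (tl (tl [2 ^ 2 ^ (length w ^ 4 + 160), 2 ^ 2 ^ (length w ^ 3 + 64), length w, wcode w]))))" for w
  unfolding list.sel by (rule cut_problem_decide)
qed

theorem theorem5:
 shows "EXPSPACE_complete cut_problem"
 unfolding EXPSPACE_complete_def using cut_problem_EXPSPACE cut_problem_hard by blast

end
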